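(* Let $R$ be a ring, $M$ an $R$-bimodule, $n\ge1$, and let $[Y,g]$ be a left $R\ltimes_n M$-module. The following conditions are equivalent: (1) $\mathrm{Ext}^i_{R\ltimes_n M}(\mathbf{Z}(R),[Y,g])=0$ for any $i\ge1$. (2) $\mathrm{Ext}^i_{R\ltimes_n M}(\mathbf{Z}(Q),[Y,g])\cong\mathrm{Ext}^i_R(Q,\ker(g))$ for any left $R$-module $Q$ and $i\ge1$.
   Context: All rings are nonzero, associative, with identity; all modules are unitary. $M^{\otimes_R 0}=R$, $M^{\otimes_R 1}=M$, $M^{\otimes_R (i+1)}=M\otimes_R M^{\otimes_R i}$. The $n$-trivial extension $R\ltimes_n M$ is the abelian group $\coprod_{i=0}^n M^{\otimes_R i}$ with multiplication $(m_0,\dots,m_n)(m_0',\dots,m_n')=\big(\sum_{i+j=k}m_i\otimes m_j'\big)_{0\le k\le n}$ (using the canonical identifications $R\otimes_R N=N=N\otimes_R R$). For a left $R$-module $Y$, $\mathrm{Hom}_R(M,Y)$ denotes left $R$-homomorphisms, a left $R$-module via $(r\varphi)(m)=\varphi(mr)$; $\mathrm{Hom}_R^0(M,Y)=Y$ and $\mathrm{Hom}_R^{i}(M,Y)=\mathrm{Hom}_R(M,\mathrm{Hom}_R^{i-1}(M,Y))$. Left $R\ltimes_n M$-modules are identified with pairs $[Y,g]$, where $Y$ is a left $R$-module and $g:Y\to\mathrm{Hom}_R(M,Y)$ is a left $R$-homomorphism such that the composite $\mathrm{Hom}_R^n(M,g)\cdots\mathrm{Hom}_R(M,g)\,g:Y\to\mathrm{Hom}_R^{n+1}(M,Y)$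 is zero; explicitly $g(y)(m)=(0,m,0,\dots,0)y$. For a left $R$-module $Q$, $\mathbf{Z}(Q)$ is the left $R\ltimes_n M$-module with underlying $R$-module $Q$ on which $(m_0,\dots,m_n)$ acts as $m_0$, i.e. $[Q,0]$. *)

theory Defs
  imports "HOL-Algebra.Module" "HOL-Algebra.AbelCoset" "HOL-Algebra.Free_Abelian_Groups"
begin

section \<open>Modules over noncommutative rings\<close>

text \<open>
  The library locale \<^locale>\<open>module\<close> demands a commutative ring of scalars, so left modules
  over arbitrary rings are introduced here, on the library record type. As usual for that record,
  the fields \<^const>\<open>monoid.mult\<close> and \<^const>\<open>monoid.one\<close> carry no meaning.
\<close>

locale left_module = R?: ring R + M?: abelian_group M
  for R :: "('r, 'e) ring_scheme" (structure) and M :: "('r, 'm, 'f) module_scheme" (structure) +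
  assumes smult_closed:
      "\<lbrakk>r \<in> carrier R; x \<in> carrier M\<rbrakk> \<Longrightarrow> r \<odot>\<^bsub>M\<^esub> x \<in> carrier M"
    and smult_l_distr:
      "\<lbrakk>r \<in> carrier R; s \<in> carrier R; x \<in> carrier M\<rbrakk> \<Longrightarrow>
        (r \<oplus>\<^bsub>R\<^esub> s) \<odot>\<^bsub>M\<^esub> x = r \<odot>\<^bsub>M\<^esub> x \<oplus>\<^bsub>M\<^esub> s \<odot>\<^bsub>M\<^esub> x"
    and smult_r_distr:
      "\<lbrakk>r \<in> carrier R; x \<in> carrier M; y \<in> carrier M\<rbrakk> \<Longrightarrow>
        r \<odot>\<^bsub>M\<^esub> (x \<oplus>\<^bsub>M\<^esub> y) = r \<odot>\<^bsub>M\<^esub> x \<oplus>\<^bsub>M\<^esub> r \<odot>\<^bsub>M\<^esub> y"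
    and smult_assoc:
      "\<lbrakk>r \<in> carrier R; s \<in> carrier R; x \<in> carrier M\<rbrakk> \<Longrightarrow>
        (r \<otimes>\<^bsub>R\<^esub> s) \<odot>\<^bsub>M\<^esub> x = r \<odot>\<^bsub>M\<^esub> (s \<odot>\<^bsub>M\<^esub> x)"
    and smult_one:
      "x \<in> carrier M \<Longrightarrow> \<one>\<^bsub>R\<^esub> \<odot>\<^bsub>M\<^esub> x = x"

record ('r, 'm) bimodule = "('r, 'm) module" +
  rsmult :: "'m \<Rightarrow> 'r \<Rightarrow> 'm" (infixl \<open>\<bullet>\<index>\<close> 70)

locale bimodule = left_module R M
  for R :: "('r, 'e) ring_scheme" (structure) and M :: "('r, 'm, 'f) bimodule_scheme" (structure) +
  assumes rsmult_closed:
      "\<lbrakk>x \<in> carrier M; r \<in> carrier R\<rbrakk> \<Longrightarrow> x \<bullet>\<^bsub>M\<^esub> r \<in> carrier M"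
    and rsmult_r_distr:
      "\<lbrakk>x \<in> carrier M; r \<in> carrier R; s \<in> carrier R\<rbrakk> \<Longrightarrow>
        x \<bullet>\<^bsub>M\<^esub> (r \<oplus>\<^bsub>R\<^esub> s) = x \<bullet>\<^bsub>M\<^esub> r \<oplus>\<^bsub>M\<^esub> x \<bullet>\<^bsub>M\<^esub> s"
    and rsmult_l_distr:
      "\<lbrakk>x \<in> carrier M; y \<in> carrier M; r \<in> carrier R\<rbrakk> \<Longrightarrow>
        (x \<oplus>\<^bsub>M\<^esub> y) \<bullet>\<^bsub>M\<^esub> r = x \<bullet>\<^bsub>M\<^esub> r \<oplus>\<^bsub>M\<^esub> y \<bullet>\<^bsub>M\<^esub> r"
    and rsmult_assoc:
      "\<lbrakk>x \<in> carrier M; r \<in> carrier R; s \<in> carrier R\<rbrakk> \<Longrightarrow>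
        x \<bullet>\<^bsub>M\<^esub> (r \<otimes>\<^bsub>R\<^esub> s) = (x \<bullet>\<^bsub>M\<^esub> r) \<bullet>\<^bsub>M\<^esub> s"
    and rsmult_one:
      "x \<in> carrier M \<Longrightarrow> x \<bullet>\<^bsub>M\<^esub> \<one>\<^bsub>R\<^esub> = x"
    and smult_rsmult:
      "\<lbrakk>r \<in> carrier R; x \<in> carrier M; s \<in> carrier R\<rbrakk> \<Longrightarrow>
        (r \<odot>\<^bsub>M\<^esub> x) \<bullet>\<^bsub>M\<^esub> s = r \<odot>\<^bsub>M\<^esub> (x \<bullet>\<^bsub>M\<^esub> s)"

definition regular_module :: "('r, 'e) ring_scheme \<Rightarrow> ('r, 'r) module" where
  "regular_module R =
    \<lparr>carrier = carrier R, mult = undefined, one = undefined, ring.zero = \<zero>\<^bsub>R\<^esub>,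
     ring.add = (\<oplus>\<^bsub>R\<^esub>), smult = (\<otimes>\<^bsub>R\<^esub>)\<rparr>"

text \<open>
  Homomorphisms are taken to be extensional (\<^const>\<open>undefined\<close> outside the carrier), so that
  equal maps are equal as HOL functions and Hom sets are groups on the nose.
\<close>

definition lmod_hom ::
  "('r, 'e) ring_scheme \<Rightarrow> ('r, 'x, 'f) module_scheme \<Rightarrow> ('r, 'y, 'g) module_scheme \<Rightarrow> ('x \<Rightarrow> 'y) set"
  where "lmod_hom R X Y =
    {f \<in> carrier X \<rightarrow>\<^sub>E carrier Y.
      (\<forall>x\<in>carrier X. \<forall>x'\<in>carrier X. f (x \<oplus>\<^bsub>X\<^esub> x') = f x \<oplus>\<^bsub>Y\<^esub> f x') \<and>
      (\<forall>r\<in>carrier R. \<forall>x\<in>carrier X. f (r \<odot>\<^bsub>X\<^esub> x) = r \<odot>\<^bsub>Y\<^esub> f x)}"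

definition hom_group ::
  "('r, 'e) ring_scheme \<Rightarrow> ('r, 'x, 'f) module_scheme \<Rightarrow> ('r, 'y, 'g) module_scheme \<Rightarrow> ('x \<Rightarrow> 'y) monoid"
  where "hom_group R X Y =
    \<lparr>carrier = lmod_hom R X Y,
     mult = (\<lambda>f f'. \<lambda>x\<in>carrier X. f x \<oplus>\<^bsub>Y\<^esub> f' x),
     one = (\<lambda>x\<in>carrier X. \<zero>\<^bsub>Y\<^esub>)\<rparr>"

text \<open>For a bimodule \<open>M\<close>, the right action on \<open>M\<close> makes \<open>Hom\<^sub>R(M, Y)\<close> a left \<open>R\<close>-module.\<close>

definition hom_module ::
  "('r, 'e) ring_scheme \<Rightarrow> ('r, 'm, 'f) bimodule_scheme \<Rightarrow> ('r, 'y, 'g) module_scheme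
    \<Rightarrow> ('r, 'm \<Rightarrow> 'y) module"
  where "hom_module R M Y =
    \<lparr>carrier = lmod_hom R M Y, mult = undefined, one = undefined,
     ring.zero = (\<lambda>m\<in>carrier M. \<zero>\<^bsub>Y\<^esub>),
     ring.add = (\<lambda>f f'. \<lambda>m\<in>carrier M. f m \<oplus>\<^bsub>Y\<^esub> f' m),
     smult = (\<lambda>r f. \<lambda>m\<in>carrier M. f (m \<bullet>\<^bsub>M\<^esub> r))\<rparr>"


section \<open>Tensor products and tensor powers\<close>

text \<open>
  \<open>M \<otimes>\<^sub>R N\<close> is the free abelian group on \<open>M \<times> N\<close> modulo the subgroup generated by the
  biadditivity and balancing relations; the left action of \<open>R\<close> on \<open>M\<close> makes it a left module.
\<close>

definition tensor_relations ::
  "('r, 'e) ring_scheme \<Rightarrow> ('r, 'm, 'f) bimodule_scheme \<Rightarrow> ('r, 'x, 'g) module_scheme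
    \<Rightarrow> ('m \<times> 'x \<Rightarrow>\<^sub>0 int) set"
  where "tensor_relations R M N =
    {frag_of (m \<oplus>\<^bsub>M\<^esub> m', x) - frag_of (m, x) - frag_of (m', x) | m m' x.
       m \<in> carrier M \<and> m' \<in> carrier M \<and> x \<in> carrier N} \<union>
    {frag_of (m, x \<oplus>\<^bsub>N\<^esub> x') - frag_of (m, x) - frag_of (m, x') | m x x'.
       m \<in> carrier M \<and> x \<in> carrier N \<and> x' \<in> carrier N} \<union>
    {frag_of (m \<bullet>\<^bsub>M\<^esub> r, x) - frag_of (m, r \<odot>\<^bsub>N\<^esub> x) | m r x.
       m \<in> carrier M \<and> r \<in> carrier R \<and> x \<in> carrier N}"

definition tensor_null ::
  "('r, 'e) ring_scheme \<Rightarrow> ('r, 'm, 'f) bimodule_scheme \<Rightarrow> ('r, 'x, 'g) module_scheme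
    \<Rightarrow> ('m \<times> 'x \<Rightarrow>\<^sub>0 int) set"
  where "tensor_null R M N =
    generate (free_Abelian_group (carrier M \<times> carrier N)) (tensor_relations R M N)"

definition tensor_class ::
  "('r, 'e) ring_scheme \<Rightarrow> ('r, 'm, 'f) bimodule_scheme \<Rightarrow> ('r, 'x, 'g) module_scheme
    \<Rightarrow> ('m \<times> 'x \<Rightarrow>\<^sub>0 int) \<Rightarrow> ('m \<times> 'x \<Rightarrow>\<^sub>0 int) set"
  where "tensor_class R M N p =
    tensor_null R M N #>\<^bsub>free_Abelian_group (carrier M \<times> carrier N)\<^esub> p"

definition tensor_product ::
  "('r, 'e) ring_scheme \<Rightarrow> ('r, 'm, 'f) bimodule_scheme \<Rightarrow> ('r, 'x, 'g) module_scheme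
    \<Rightarrow> ('r, ('m \<times> 'x \<Rightarrow>\<^sub>0 int) set) module"
  where "tensor_product R M N =
    (let T = free_Abelian_group (carrier M \<times> carrier N) Mod tensor_null R M N in
     \<lparr>carrier = carrier T, mult = undefined, one = undefined,
      ring.zero = \<one>\<^bsub>T\<^esub>, ring.add = (\<otimes>\<^bsub>T\<^esub>),
      smult = (\<lambda>r c. tensor_class R M N
        (frag_extend (\<lambda>(m, x). frag_of (r \<odot>\<^bsub>M\<^esub> m, x)) (SOME p. p \<in> c)))\<rparr>)"

text \<open>
  The type of \<^const>\<open>tensor_product\<close> depends on the type of its factors, so iterating it would
  need a new HOL type for every power. All tensor powers are therefore carried into one type by
  transport of structure: \<open>Scal\<close> labels the elements of \<open>M\<^sup>0 = R\<close>, \<open>Vec\<close> those of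
  \<open>M\<^sup>1 = M\<close>, and an element \<open>c\<close> of \<open>M \<otimes>\<^sub>R M\<^sup>i\<close> (\<open>i \<ge> 1\<close>) is stored as
  \<open>Tens l\<close>, where \<open>l\<close> is one chosen list of pairs with \<open>c = (\<Sum>(m, x)\<leftarrow>l. m \<otimes> x)\<close>; such
  a list exists as \<open>-(m \<otimes> x) = (-m) \<otimes> x\<close>.
\<close>

datatype ('r, 'm) tensor =
  Scal (the_scal: 'r)
| Vec (the_vec: 'm)
| Tens (the_tens: "('m \<times> ('r, 'm) tensor) list")

definition tensor_code ::
  "('r, 'e) ring_scheme \<Rightarrow> ('r, 'm, 'f) bimodule_scheme \<Rightarrow> ('r, ('r, 'm) tensor, 'g) module_scheme
    \<Rightarrow> ('m \<times> ('r, 'm) tensor \<Rightarrow>\<^sub>0 int) set \<Rightarrow> ('r, 'm) tensor"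
  where "tensor_code R M N c =
    Tens (SOME l. set l \<subseteq> carrier M \<times> carrier N \<and> tensor_class R M N (\<Sum>p\<leftarrow>l. frag_of p) = c)"

definition transport :: "('x \<Rightarrow> 'z) \<Rightarrow> ('r, 'x, 'e) module_scheme \<Rightarrow> ('r, 'z) module" where
  "transport h N =
    (let h' = inv_into (carrier N) h in
     \<lparr>carrier = h ` carrier N, mult = undefined, one = undefined,
      ring.zero = h \<zero>\<^bsub>N\<^esub>, ring.add = (\<lambda>a b. h (h' a \<oplus>\<^bsub>N\<^esub> h' b)), smult = (\<lambda>r a. h (r \<odot>\<^bsub>N\<^esub> h' a))\<rparr>)"

fun tensor_power ::
  "('r, 'e) ring_scheme \<Rightarrow> ('r, 'm, 'f) bimodule_scheme \<Rightarrow> nat \<Rightarrow> ('r, ('r, 'm) tensor) module"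
  where
  "tensor_power R M 0 = transport Scal (regular_module R)"
| "tensor_power R M (Suc 0) = transport Vec M"
| "tensor_power R M (Suc (Suc i)) =
    transport (tensor_code R M (tensor_power R M (Suc i)))
      (tensor_product R M (tensor_power R M (Suc i)))"

text \<open>
  \<open>tensor_cons R M i m x\<close> is \<open>m \<otimes> x\<close> in the \<open>(i+1)\<close>-st power, for \<open>x\<close> in the
  \<open>i\<close>-th; for \<open>i = 0\<close> it is \<open>m\<cdot>x\<close>, by the identification of \<open>M \<otimes>\<^sub>R R\<close> with \<open>M\<close>.
\<close>

definition tensor_cons ::
  "('r, 'e) ring_scheme \<Rightarrow> ('r, 'm, 'f) bimodule_scheme \<Rightarrow> nat \<Rightarrow> 'm \<Rightarrow> ('r, 'm) tensor \<Rightarrow> ('r, 'm) tensor"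
  where "tensor_cons R M i m x =
    (if i = 0 then Vec (m \<bullet>\<^bsub>M\<^esub> the_scal x)
     else tensor_code R M (tensor_power R M i)
       (tensor_class R M (tensor_power R M i) (frag_of (m, x))))"

definition list_sum :: "('a, 'e) ring_scheme \<Rightarrow> 'a list \<Rightarrow> 'a" where
  "list_sum G xs = foldr (\<oplus>\<^bsub>G\<^esub>) xs \<zero>\<^bsub>G\<^esub>"

text \<open>
  \<open>tensor_mult R M i j a b\<close> is \<open>a \<otimes> b\<close> in the \<open>(i+j)\<close>-th power, for \<open>a\<close> in the
  \<open>i\<close>-th and \<open>b\<close> in the \<open>j\<close>-th power, by the rules \<open>r \<otimes> b = r\<cdot>b\<close> and
  \<open>(\<Sum> m \<otimes> x) \<otimes> b = (\<Sum> m \<otimes> (x \<otimes> b))\<close>.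
\<close>

primrec tensor_mult ::
  "('r, 'e) ring_scheme \<Rightarrow> ('r, 'm, 'f) bimodule_scheme \<Rightarrow> nat \<Rightarrow> nat
    \<Rightarrow> ('r, 'm) tensor \<Rightarrow> ('r, 'm) tensor \<Rightarrow> ('r, 'm) tensor"
  where
  "tensor_mult R M 0 j a b = the_scal a \<odot>\<^bsub>tensor_power R M j\<^esub> b"
| "tensor_mult R M (Suc i) j a b =
    (if i = 0 then tensor_cons R M j (the_vec a) b
     else list_sum (tensor_power R M (Suc i + j))
       (map (\<lambda>(m, x). tensor_cons R M (i + j) m (tensor_mult R M i j x b)) (the_tens a)))"


section \<open>The trivial extension and its modules\<close>

definition trivial_extension ::
  "nat \<Rightarrow> ('r, 'e) ring_scheme \<Rightarrow> ('r, 'm, 'f) bimodule_scheme \<Rightarrow> (nat \<Rightarrow> ('r, 'm) tensor) ring"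
  where "trivial_extension n R M =
    \<lparr>carrier = (\<Pi>\<^sub>E k\<in>{..n}. carrier (tensor_power R M k)),
     mult = (\<lambda>a b. \<lambda>k\<in>{..n}. \<Oplus>\<^bsub>tensor_power R M k\<^esub>i\<in>{..k}. tensor_mult R M i (k - i) (a i) (b (k - i))),
     one = (\<lambda>k\<in>{..n}. if k = 0 then Scal \<one>\<^bsub>R\<^esub> else \<zero>\<^bsub>tensor_power R M k\<^esub>),
     ring.zero = (\<lambda>k\<in>{..n}. \<zero>\<^bsub>tensor_power R M k\<^esub>),
     ring.add = (\<lambda>a b. \<lambda>k\<in>{..n}. a k \<oplus>\<^bsub>tensor_power R M k\<^esub> b k)\<rparr>"

text \<open>
  The data \<open>[Y, g]\<close>. Evaluated at \<open>y\<close> and then at \<open>m\<^sub>0, \<dots>, m\<^sub>n\<close>, the composite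
  \<open>Hom\<^sup>n(M, g) \<cdots> Hom(M, g) g\<close> gives \<open>g (\<cdots> (g (g y m\<^sub>0) m\<^sub>1) \<cdots>) m\<^sub>n\<close>, because
  \<open>Hom(M, g)\<close> is composition with \<open>g\<close>.
\<close>

definition module_pair ::
  "nat \<Rightarrow> ('r, 'e) ring_scheme \<Rightarrow> ('r, 'm, 'f) bimodule_scheme \<Rightarrow> ('r, 'y, 'g) module_scheme
    \<Rightarrow> ('y \<Rightarrow> 'm \<Rightarrow> 'y) \<Rightarrow> bool"
  where "module_pair n R M Y g \<longleftrightarrow>
    left_module R Y \<and> g \<in> lmod_hom R Y (hom_module R M Y) \<and>
    (\<forall>y\<in>carrier Y. \<forall>ms. length ms = n + 1 \<and> set ms \<subseteq> carrier M \<longrightarrow> foldl g y ms = \<zero>\<^bsub>Y\<^esub>)"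

text \<open>
  In the module \<open>[Y, g]\<close> the element \<open>(0, m, 0, \<dots>, 0)\<close> sends \<open>y\<close> to \<open>g y m\<close>, hence
  \<open>m \<otimes> x\<close> sends \<open>y\<close> to \<open>g (x y) m\<close>.
\<close>

primrec tensor_act ::
  "('r, 'y, 'g) module_scheme \<Rightarrow> ('y \<Rightarrow> 'm \<Rightarrow> 'y) \<Rightarrow> nat \<Rightarrow> ('r, 'm) tensor \<Rightarrow> 'y \<Rightarrow> 'y"
  where
  "tensor_act Y g 0 a y = the_scal a \<odot>\<^bsub>Y\<^esub> y"
| "tensor_act Y g (Suc i) a y =
    (if i = 0 then g y (the_vec a)
     else list_sum Y (map (\<lambda>(m, x). g (tensor_act Y g i x y) m) (the_tens a)))"

definition pair_module ::
  "nat \<Rightarrow> ('r, 'y, 'g) module_scheme \<Rightarrow> ('y \<Rightarrow> 'm \<Rightarrow> 'y) \<Rightarrow> (nat \<Rightarrow> ('r, 'm) tensor, 'y) module"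
  where "pair_module n Y g =
    \<lparr>carrier = carrier Y, mult = undefined, one = undefined, ring.zero = \<zero>\<^bsub>Y\<^esub>, ring.add = (\<oplus>\<^bsub>Y\<^esub>),
     smult = (\<lambda>a y. \<Oplus>\<^bsub>Y\<^esub>i\<in>{..n}. tensor_act Y g i (a i) y)\<rparr>"

definition Z_module :: "('r, 'q, 'g) module_scheme \<Rightarrow> (nat \<Rightarrow> ('r, 'm) tensor, 'q) module" where
  "Z_module Q =
    \<lparr>carrier = carrier Q, mult = undefined, one = undefined, ring.zero = \<zero>\<^bsub>Q\<^esub>, ring.add = (\<oplus>\<^bsub>Q\<^esub>),
     smult = (\<lambda>a q. the_scal (a 0) \<odot>\<^bsub>Q\<^esub> q)\<rparr>"

definition kernel_module ::
  "('r, 'e) ring_scheme \<Rightarrow> ('r, 'm, 'f) bimodule_scheme \<Rightarrow> ('r, 'y) module \<Rightarrow> ('y \<Rightarrow> 'm \<Rightarrow> 'y)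
    \<Rightarrow> ('r, 'y) module"
  where "kernel_module R M Y g = Y\<lparr>carrier := a_kernel Y (hom_module R M Y) g\<rparr>"


section \<open>Ext groups\<close>

text \<open>
  \<open>Ext\<^sup>k(X, Y)\<close> is the \<open>k\<close>-th cohomology of \<open>Hom(F\<^sub>\<bullet>, Y)\<close> for one explicit free resolution
  \<open>F\<^sub>\<bullet> \<rightarrow> X\<close>. First, the free module on a set \<open>B\<close> and the linear extension of a map on its basis.
\<close>

definition free_module :: "('s, 'e) ring_scheme \<Rightarrow> 'b set \<Rightarrow> ('s, 'b \<Rightarrow> 's) module" where
  "free_module S B =
    \<lparr>carrier = {f. (\<forall>b. f b \<in> carrier S) \<and> (\<forall>b. b \<notin> B \<longrightarrow> f b = \<zero>\<^bsub>S\<^esub>) \<and> finite {b. f b \<noteq> \<zero>\<^bsub>S\<^esub>}},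
     mult = undefined, one = undefined,
     ring.zero = (\<lambda>_. \<zero>\<^bsub>S\<^esub>), ring.add = (\<lambda>f f' b. f b \<oplus>\<^bsub>S\<^esub> f' b), smult = (\<lambda>s f b. s \<otimes>\<^bsub>S\<^esub> f b)\<rparr>"

definition linear_extension ::
  "('s, 'e) ring_scheme \<Rightarrow> ('s, 'x, 'f) module_scheme \<Rightarrow> ('b \<Rightarrow> 'x) \<Rightarrow> ('b \<Rightarrow> 's) \<Rightarrow> 'x" where
  "linear_extension S N h f = (\<Oplus>\<^bsub>N\<^esub>b\<in>{b. f b \<noteq> \<zero>\<^bsub>S\<^esub>}. f b \<odot>\<^bsub>N\<^esub> h b)"

text \<open>
  A free resolution has to live in a single type. Its bases consist of trees: \<open>F\<^sub>0\<close> is free on the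
  elements of \<open>X\<close>, labelled \<open>Gen\<close>; and \<open>F\<^sub>k\<^sub>+\<^sub>1\<close> has one basis element \<open>Rel l\<close> for
  every formal expression \<open>l = [(s\<^sub>1, b\<^sub>1), \<dots>]\<close> whose value \<open>\<Sum> s\<^sub>i b\<^sub>i\<close> in \<open>F\<^sub>k\<close> lies in
  the kernel of \<open>F\<^sub>k \<rightarrow> F\<^sub>k\<^sub>-\<^sub>1\<close> (of \<open>F\<^sub>0 \<rightarrow> X\<close> if \<open>k = 0\<close>), and the differential sends
  \<open>Rel l\<close> to that value. Exactness is immediate, since every kernel element is such a value.
\<close>

datatype ('s, 'x) syzygy =
  Gen (the_gen: 'x)
| Rel (the_rel: "('s \<times> ('s, 'x) syzygy) list")

definition formal_sum :: "('s, 'e) ring_scheme \<Rightarrow> ('s \<times> 'b) list \<Rightarrow> 'b \<Rightarrow> 's" where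
  "formal_sum S l b = list_sum S (map fst (filter (\<lambda>p. snd p = b) l))"

definition syzygy_boundary :: "('s, 'e) ring_scheme \<Rightarrow> ('s, 'x) syzygy \<Rightarrow> ('s, 'x) syzygy \<Rightarrow> 's" where
  "syzygy_boundary S b = formal_sum S (the_rel b)"

fun syzygy_basis ::
  "('s, 'e) ring_scheme \<Rightarrow> ('s, 'x, 'f) module_scheme \<Rightarrow> nat \<Rightarrow> ('s, 'x) syzygy set" where
  "syzygy_basis S X 0 = Gen ` carrier X"
| "syzygy_basis S X (Suc 0) =
    {Rel l | l. set l \<subseteq> carrier S \<times> syzygy_basis S X 0 \<and>
       linear_extension S X the_gen (formal_sum S l) = \<zero>\<^bsub>X\<^esub>}"
| "syzygy_basis S X (Suc (Suc k)) =
    (let F = free_module S (syzygy_basis S X k) in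
     {Rel l | l. set l \<subseteq> carrier S \<times> syzygy_basis S X (Suc k) \<and>
        linear_extension S F (syzygy_boundary S) (formal_sum S l) = \<zero>\<^bsub>F\<^esub>})"

definition resolution ::
  "('s, 'e) ring_scheme \<Rightarrow> ('s, 'x, 'f) module_scheme \<Rightarrow> nat \<Rightarrow> ('s, ('s, 'x) syzygy \<Rightarrow> 's) module"
  where "resolution S X k = free_module S (syzygy_basis S X k)"

definition differential ::
  "('s, 'e) ring_scheme \<Rightarrow> ('s, 'x, 'f) module_scheme \<Rightarrow> nat
    \<Rightarrow> (('s, 'x) syzygy \<Rightarrow> 's) \<Rightarrow> (('s, 'x) syzygy \<Rightarrow> 's)"
    \<comment> \<open>\<open>differential S X k\<close> goes from degree \<open>k+1\<close> to degree \<open>k\<close>\<close>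
  where "differential S X k =
    (\<lambda>f\<in>carrier (resolution S X (Suc k)). linear_extension S (resolution S X k) (syzygy_boundary S) f)"

definition cocycles ::
  "('s, 'e) ring_scheme \<Rightarrow> ('s, 'x, 'f) module_scheme \<Rightarrow> ('s, 'y, 'g) module_scheme \<Rightarrow> nat
    \<Rightarrow> ((('s, 'x) syzygy \<Rightarrow> 's) \<Rightarrow> 'y) set"
  where "cocycles S X Y k =
    {c \<in> lmod_hom S (resolution S X k) Y.
      compose (carrier (resolution S X (Suc k))) c (differential S X k)
        = \<one>\<^bsub>hom_group S (resolution S X (Suc k)) Y\<^esub>}"

fun coboundaries ::
  "('s, 'e) ring_scheme \<Rightarrow> ('s, 'x, 'f) module_scheme \<Rightarrow> ('s, 'y, 'g) module_scheme \<Rightarrow> nat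
    \<Rightarrow> ((('s, 'x) syzygy \<Rightarrow> 's) \<Rightarrow> 'y) set"
  where
  "coboundaries S X Y 0 = {\<one>\<^bsub>hom_group S (resolution S X 0) Y\<^esub>}"
| "coboundaries S X Y (Suc k) =
    (\<lambda>c. compose (carrier (resolution S X (Suc k))) c (differential S X k))
      ` lmod_hom S (resolution S X k) Y"

definition Ext ::
  "('s, 'e) ring_scheme \<Rightarrow> nat \<Rightarrow> ('s, 'x, 'f) module_scheme \<Rightarrow> ('s, 'y, 'g) module_scheme
    \<Rightarrow> ((('s, 'x) syzygy \<Rightarrow> 's) \<Rightarrow> 'y) set monoid"
  where "Ext S k X Y =
    (hom_group S (resolution S X k) Y)\<lparr>carrier := cocycles S X Y k\<rparr> Mod coboundaries S X Y k"

end

(*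
  For R-modules Q there is Hom_S(Z(Q), [Y,g]) = Hom_R(Q, ker g), where S is the n-trivial extension.
  If Ext_S(Z(R), [Y,g]) vanishes in positive degrees, then so does Ext_S(Z(F), [Y,g]) for every free
  R-module F: a direct sum of free S-resolutions of Z(R) is one of Z(F), and vanishing does not depend
  on the free resolution.  Hence Z(F_.) -> Z(Q) is a resolution by Hom_S(-, [Y,g])-acyclic modules for
  a free R-resolution F_. of Q, and dimension shifting along its syzygies (through the horseshoe
  resolution of the middle term of a short exact sequence) gives the isomorphism with Ext_R(Q, ker g).
  Conversely, take for Q a free module of rank one.
*)
theory Submission
  imports Defs
begin

section \<open>Linear maps and free modules\<close>

text \<open>The two Ext groups belong to different rings and to different resolutions, and the
  passage between them rests on lifts that are chosen, not canonical. No connecting homomorphism is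
  therefore defined as a map: the isomorphisms come from relations between cochains that are closed
  under differences, total and onto, and that match coboundaries with coboundaries. No long exact
  sequence is set up either; vanishing for the middle term enters as acyclicity of its horseshoe
  resolution. The kernel of \<open>g\<close> appears because \<open>(0, m, 0, \<dots>, 0)\<close> is
  zero on \<open>Z(Q)\<close>, so that an S-linear map out of \<open>Z(Q)\<close> has its values
  where every \<open>g y m\<close> vanishes. Types shape the rest. The resolution in the definition
  of Ext has bases in a tree type, while sums of resolutions have bases in product and sum types;
  resolutions are thus families \<open>B\<close>, \<open>d\<close>, \<open>e\<close> over any basis
  type, and cochains are functions on the basis. The tensor powers are stored through chosen lists
  of pairs, so each operation on them must first be shown to be independent of that choice.\<close>

context abelian_group
begin

lemma diff_eq_zero_iff:
  assumes "x \<in> carrier G" "y \<in> carrier G" shows "x \<ominus> y = \<zero> \<longleftrightarrow> x = y"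
proof
  assume "x \<ominus> y = \<zero>"
  then have "\<ominus> (\<ominus> y) = x" by (intro minus_equality) (use assms in \<open>simp_all add: a_minus_def\<close>)
  then show "x = y" using assms by simp
next
  assume "x = y"
  then show "x \<ominus> y = \<zero>" using assms by (simp add: a_minus_def r_neg)
qed

lemma a_inv_zero: "\<ominus> \<zero> = \<zero>"
  by (rule minus_equality) simp_all

lemma diff_add_cancel:
  assumes "x \<in> carrier G" "y \<in> carrier G" shows "x \<ominus> y \<oplus> y = x"
  using assms by (simp add: a_minus_def a_assoc l_neg)

text \<open>Solves the homotopy equation, in which two terms are subtracted from a basis vector, for
  that basis vector.\<close>

lemma diff_diff_add_cancel:
  assumes "x \<in> carrier G" "y \<in> carrier G" "z \<in> carrier G"
  shows "x \<ominus> y \<ominus> z \<oplus> y \<oplus> z = x"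
proof -
  have "x \<ominus> y \<ominus> z \<oplus> y \<oplus> z = (x \<ominus> y \<ominus> z \<oplus> z) \<oplus> y"
    using assms by (simp add: a_ac)
  then show ?thesis using assms by (simp add: diff_add_cancel)
qed

end

context left_module
begin

lemma smult_l_null: "x \<in> carrier M \<Longrightarrow> \<zero>\<^bsub>R\<^esub> \<odot>\<^bsub>M\<^esub> x = \<zero>\<^bsub>M\<^esub>"
  by (metis R.l_zero R.zero_closed M.add.l_cancel_one smult_closed smult_l_distr)

lemma smult_r_null: "r \<in> carrier R \<Longrightarrow> r \<odot>\<^bsub>M\<^esub> \<zero>\<^bsub>M\<^esub> = \<zero>\<^bsub>M\<^esub>"
  by (metis M.l_zero M.zero_closed M.add.l_cancel_one smult_closed smult_r_distr)

lemma minus_one_smult: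
  assumes "x \<in> carrier M" shows "(\<ominus>\<^bsub>R\<^esub> \<one>\<^bsub>R\<^esub>) \<odot>\<^bsub>M\<^esub> x = \<ominus>\<^bsub>M\<^esub> x"
proof -
  have "(\<ominus>\<^bsub>R\<^esub> \<one>\<^bsub>R\<^esub>) \<odot>\<^bsub>M\<^esub> x \<oplus>\<^bsub>M\<^esub> x = (\<ominus>\<^bsub>R\<^esub> \<one>\<^bsub>R\<^esub> \<oplus>\<^bsub>R\<^esub> \<one>\<^bsub>R\<^esub>) \<odot>\<^bsub>M\<^esub> x"
    by (simp add: smult_l_distr smult_one assms)
  also have "\<dots> = \<zero>\<^bsub>M\<^esub>" by (simp add: R.l_neg smult_l_null assms)
  finally show ?thesis using assms by (simp add: M.minus_equality smult_closed)
qed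

end

section \<open>Additive and linear maps\<close>

text \<open>Only addition is respected, so that the locale also covers multiplication by a fixed
  tensor, the action of a fixed tensor, and lifts of balanced maps to an arbitrary abelian
  group.\<close>

locale additive_map = dom: abelian_group G + cod: abelian_group H
  for G (structure) and H (structure) and \<phi> +
  assumes closed: "x \<in> carrier G \<Longrightarrow> \<phi> x \<in> carrier H"
    and add: "\<lbrakk>x \<in> carrier G; y \<in> carrier G\<rbrakk> \<Longrightarrow> \<phi> (x \<oplus>\<^bsub>G\<^esub> y) = \<phi> x \<oplus>\<^bsub>H\<^esub> \<phi> y"
begin

lemma zero: "\<phi> \<zero>\<^bsub>G\<^esub> = \<zero>\<^bsub>H\<^esub>"
  by (metis add closed cod.add.l_cancel_one dom.l_zero dom.zero_closed)

lemma minus: "x \<in> carrier G \<Longrightarrow> \<phi> (\<ominus>\<^bsub>G\<^esub> x) = \<ominus>\<^bsub>H\<^esub> \<phi> x"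
  by (metis add closed cod.minus_equality dom.a_inv_closed dom.l_neg zero)

lemma diff: "\<lbrakk>x \<in> carrier G; y \<in> carrier G\<rbrakk> \<Longrightarrow> \<phi> (x \<ominus>\<^bsub>G\<^esub> y) = \<phi> x \<ominus>\<^bsub>H\<^esub> \<phi> y"
  by (simp add: a_minus_def add minus)

lemma finsum:
  assumes "f \<in> A \<rightarrow> carrier G"
  shows "\<phi> (finsum G f A) = finsum H (\<lambda>a. \<phi> (f a)) A"
proof (cases "finite A")
  case True
  then show ?thesis using assms
  proof (induction A rule: finite_induct)
    case (insert a A)
    then have "f \<in> A \<rightarrow> carrier G" "f a \<in> carrier G" by auto
    moreover from this have "(\<lambda>a. \<phi> (f a)) \<in> A \<rightarrow> carrier H" "\<phi> (f a) \<in> carrier H"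
      using closed by auto
    ultimately show ?case using insert by (simp add: add dom.finsum_closed)
  qed (simp add: zero)
qed (simp add: zero)

lemma list_sum:
  assumes "set xs \<subseteq> carrier G"
  shows "\<phi> (list_sum G xs) = list_sum H (map \<phi> xs) \<and> list_sum G xs \<in> carrier G"
  using assms by (induction xs) (auto simp: list_sum_def zero add)

end

text \<open>Unlike \<open>lmod_hom\<close>, nothing is asked outside the carrier. Composites, sums
  and negatives can then be written as plain lambda terms; restriction to the carrier is left to the
  translation into Ext groups.\<close>

locale linear_map = dom: left_module R X + cod: left_module R Y
  for R (structure) and X (structure) and Y (structure) and \<phi> +
  assumes closed: "x \<in> carrier X \<Longrightarrow> \<phi> x \<in> carrier Y"
    and add: "\<lbrakk>x \<in> carrier X; y \<in> carrier X\<rbrakk> \<Longrightarrow> \<phi> (x \<oplus>\<^bsub>X\<^esub> y) = \<phi> x \<oplus>\<^bsub>Y\<^esub> \<phi> y"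
    and smult: "\<lbrakk>r \<in> carrier R; x \<in> carrier X\<rbrakk> \<Longrightarrow> \<phi> (r \<odot>\<^bsub>X\<^esub> x) = r \<odot>\<^bsub>Y\<^esub> \<phi> x"
begin

sublocale additive: additive_map X Y \<phi>
  by unfold_locales (auto simp: closed add)

lemmas zero = additive.zero and minus = additive.minus and diff = additive.diff
  and finsum = additive.finsum

end

lemma linear_map_iff:
  "linear_map R X Y \<phi> \<longleftrightarrow> left_module R X \<and> left_module R Y \<and>
    (\<forall>x\<in>carrier X. \<phi> x \<in> carrier Y) \<and>
    (\<forall>x\<in>carrier X. \<forall>y\<in>carrier X. \<phi> (x \<oplus>\<^bsub>X\<^esub> y) = \<phi> x \<oplus>\<^bsub>Y\<^esub> \<phi> y) \<and>
    (\<forall>r\<in>carrier R. \<forall>x\<in>carrier X. \<phi> (r \<odot>\<^bsub>X\<^esub> x) = r \<odot>\<^bsub>Y\<^esub> \<phi> x)"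
  unfolding linear_map_def linear_map_axioms_def by blast

lemma linear_map_comp:
  "linear_map R X Y \<phi> \<Longrightarrow> linear_map R Y Z \<psi> \<Longrightarrow> linear_map R X Z (\<lambda>x. \<psi> (\<phi> x))"
  unfolding linear_map_iff by simp

lemma left_moduleI:
  assumes "ring R"
    and add: "\<And>x y. \<lbrakk>x \<in> carrier M; y \<in> carrier M\<rbrakk> \<Longrightarrow> x \<oplus>\<^bsub>M\<^esub> y \<in> carrier M"
    and "\<zero>\<^bsub>M\<^esub> \<in> carrier M"
    and "\<And>x y z. \<lbrakk>x \<in> carrier M; y \<in> carrier M; z \<in> carrier M\<rbrakk> \<Longrightarrow>
      (x \<oplus>\<^bsub>M\<^esub> y) \<oplus>\<^bsub>M\<^esub> z = x \<oplus>\<^bsub>M\<^esub> (y \<oplus>\<^bsub>M\<^esub> z)"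
    and "\<And>x y. \<lbrakk>x \<in> carrier M; y \<in> carrier M\<rbrakk> \<Longrightarrow> x \<oplus>\<^bsub>M\<^esub> y = y \<oplus>\<^bsub>M\<^esub> x"
    and "\<And>x. x \<in> carrier M \<Longrightarrow> \<zero>\<^bsub>M\<^esub> \<oplus>\<^bsub>M\<^esub> x = x"
    and inv: "\<And>x. x \<in> carrier M \<Longrightarrow> \<exists>y\<in>carrier M. y \<oplus>\<^bsub>M\<^esub> x = \<zero>\<^bsub>M\<^esub>"
    and "\<And>r x. \<lbrakk>r \<in> carrier R; x \<in> carrier M\<rbrakk> \<Longrightarrow> r \<odot>\<^bsub>M\<^esub> x \<in> carrier M"
    and "\<And>r s x. \<lbrakk>r \<in> carrier R; s \<in> carrier R; x \<in> carrier M\<rbrakk> \<Longrightarrow>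
        (r \<oplus>\<^bsub>R\<^esub> s) \<odot>\<^bsub>M\<^esub> x = r \<odot>\<^bsub>M\<^esub> x \<oplus>\<^bsub>M\<^esub> s \<odot>\<^bsub>M\<^esub> x"
    and "\<And>r x y. \<lbrakk>r \<in> carrier R; x \<in> carrier M; y \<in> carrier M\<rbrakk> \<Longrightarrow>
        r \<odot>\<^bsub>M\<^esub> (x \<oplus>\<^bsub>M\<^esub> y) = r \<odot>\<^bsub>M\<^esub> x \<oplus>\<^bsub>M\<^esub> r \<odot>\<^bsub>M\<^esub> y"
    and "\<And>r s x. \<lbrakk>r \<in> carrier R; s \<in> carrier R; x \<in> carrier M\<rbrakk> \<Longrightarrow>
        (r \<otimes>\<^bsub>R\<^esub> s) \<odot>\<^bsub>M\<^esub> x = r \<odot>\<^bsub>M\<^esub> (s \<odot>\<^bsub>M\<^esub> x)"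
    and "\<And>x. x \<in> carrier M \<Longrightarrow> \<one>\<^bsub>R\<^esub> \<odot>\<^bsub>M\<^esub> x = x"
  shows "left_module R M"
proof -
  interpret ring R by fact
  have "abelian_group M" by (rule abelian_groupI) (use assms in auto)
  then show ?thesis
    unfolding left_module_def left_module_axioms_def using assms by blast
qed

lemma left_module_submodule:
  assumes "left_module R M" "K \<subseteq> carrier M" "\<zero>\<^bsub>M\<^esub> \<in> K"
    "\<And>x y. \<lbrakk>x \<in> K; y \<in> K\<rbrakk> \<Longrightarrow> x \<oplus>\<^bsub>M\<^esub> y \<in> K"
    "\<And>r x. \<lbrakk>r \<in> carrier R; x \<in> K\<rbrakk> \<Longrightarrow> r \<odot>\<^bsub>M\<^esub> x \<in> K"
  shows "left_module R (M\<lparr>carrier := K\<rparr>)" and "linear_map R (M\<lparr>carrier := K\<rparr>) M (\<lambda>x. x)"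
proof -
  interpret left_module R M by fact
  have K: "x \<in> K \<Longrightarrow> x \<in> carrier M" for x using assms(2) by auto
  show *: "left_module R (M\<lparr>carrier := K\<rparr>)"
  proof (rule left_moduleI)
    fix x assume x: "x \<in> carrier (M\<lparr>carrier := K\<rparr>)"
    \<comment> \<open>Negatives are multiples by -1, so closure under scalars provides them.\<close>
    then have "\<ominus>\<^bsub>M\<^esub> x \<in> K" using assms(5)[of "\<ominus>\<^bsub>R\<^esub> \<one>\<^bsub>R\<^esub>" x] by (simp add: K minus_one_smult)
    then show "\<exists>y\<in>carrier (M\<lparr>carrier := K\<rparr>). y \<oplus>\<^bsub>M\<lparr>carrier := K\<rparr>\<^esub> x = \<zero>\<^bsub>M\<lparr>carrier := K\<rparr>\<^esub>"
      using x K by (auto intro!: bexI[of _ "\<ominus>\<^bsub>M\<^esub> x"] M.l_neg)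
  qed (use assms(3,4,5) K in \<open>auto simp: M.add.m_assoc smult_l_distr smult_r_distr smult_assoc
        smult_one R.ring_axioms M.a_assoc intro: M.add.m_comm\<close>)
  show "linear_map R (M\<lparr>carrier := K\<rparr>) M (\<lambda>x. x)"
    unfolding linear_map_iff using * assms(1) K by auto
qed

section \<open>Direct sums, free modules and linear extension\<close>

text \<open>The shape is that of \<open>free_module\<close> with coefficients in a module. Besides
  free modules it covers sums of copies of \<open>Z_module (regular_module R)\<close>, which are
  modules over the trivial extension and not free there in general.\<close>

definition direct_sum :: "'b set \<Rightarrow> ('s, 'x, 'f) module_scheme \<Rightarrow> ('s, 'b \<Rightarrow> 'x) module" where
  "direct_sum I N =
    \<lparr>carrier = {f. (\<forall>b. f b \<in> carrier N) \<and> (\<forall>b. b \<notin> I \<longrightarrow> f b = \<zero>\<^bsub>N\<^esub>) \<and> finite {b. f b \<noteq> \<zero>\<^bsub>N\<^esub>}},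
     mult = undefined, one = undefined,
     ring.zero = (\<lambda>_. \<zero>\<^bsub>N\<^esub>), ring.add = (\<lambda>f f' b. f b \<oplus>\<^bsub>N\<^esub> f' b), smult = (\<lambda>s f b. s \<odot>\<^bsub>N\<^esub> f b)\<rparr>"

lemma direct_sum_simps [simp]:
  "\<zero>\<^bsub>direct_sum I N\<^esub> = (\<lambda>_. \<zero>\<^bsub>N\<^esub>)"
  "f \<oplus>\<^bsub>direct_sum I N\<^esub> f' = (\<lambda>b. f b \<oplus>\<^bsub>N\<^esub> f' b)"
  "s \<odot>\<^bsub>direct_sum I N\<^esub> f = (\<lambda>b. s \<odot>\<^bsub>N\<^esub> f b)"
  by (simp_all add: direct_sum_def)

lemma direct_sum_carrier:
  "f \<in> carrier (direct_sum I N) \<longleftrightarrow>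
    (\<forall>b. f b \<in> carrier N) \<and> (\<forall>b. b \<notin> I \<longrightarrow> f b = \<zero>\<^bsub>N\<^esub>) \<and> finite {b. f b \<noteq> \<zero>\<^bsub>N\<^esub>}"
  by (simp add: direct_sum_def)

context left_module
begin

lemma left_module_direct_sum: "left_module R (direct_sum I M)"
proof (rule left_moduleI)
  show "ring R" by (rule R.ring_axioms)
next
  fix f f' assume f: "f \<in> carrier (direct_sum I M)" "f' \<in> carrier (direct_sum I M)"
  have "{b. f b \<oplus>\<^bsub>M\<^esub> f' b \<noteq> \<zero>\<^bsub>M\<^esub>} \<subseteq> {b. f b \<noteq> \<zero>\<^bsub>M\<^esub>} \<union> {b. f' b \<noteq> \<zero>\<^bsub>M\<^esub>}" by auto
  then show "f \<oplus>\<^bsub>direct_sum I M\<^esub> f' \<in> carrier (direct_sum I M)"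
    using f by (auto simp: direct_sum_carrier intro: finite_subset)
  show "f \<oplus>\<^bsub>direct_sum I M\<^esub> f' = f' \<oplus>\<^bsub>direct_sum I M\<^esub> f"
    using f by (auto simp: direct_sum_carrier fun_eq_iff M.a_comm)
next
  fix r f assume f: "r \<in> carrier R" "f \<in> carrier (direct_sum I M)"
  have "{b. r \<odot>\<^bsub>M\<^esub> f b \<noteq> \<zero>\<^bsub>M\<^esub>} \<subseteq> {b. f b \<noteq> \<zero>\<^bsub>M\<^esub>}" using f(1) by (auto simp: smult_r_null)
  then show "r \<odot>\<^bsub>direct_sum I M\<^esub> f \<in> carrier (direct_sum I M)"
    using f by (auto simp: direct_sum_carrier smult_closed smult_r_null intro: finite_subset)
next
  fix f assume f: "f \<in> carrier (direct_sum I M)"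
  then have *: "{b. \<ominus>\<^bsub>M\<^esub> f b \<noteq> \<zero>\<^bsub>M\<^esub>} \<subseteq> {b. f b \<noteq> \<zero>\<^bsub>M\<^esub>}" by (auto simp: direct_sum_carrier)
  have "(\<lambda>b. \<ominus>\<^bsub>M\<^esub> f b) \<in> carrier (direct_sum I M)"
    using f * by (auto simp: direct_sum_carrier intro: finite_subset)
  then show "\<exists>f'\<in>carrier (direct_sum I M). f' \<oplus>\<^bsub>direct_sum I M\<^esub> f = \<zero>\<^bsub>direct_sum I M\<^esub>"
    using f by (intro bexI[of _ "\<lambda>b. \<ominus>\<^bsub>M\<^esub> f b"]) (auto simp: direct_sum_carrier M.l_neg)
next
  show "\<zero>\<^bsub>direct_sum I M\<^esub> \<in> carrier (direct_sum I M)" by (simp add: direct_sum_carrier)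
next
  fix x y z assume "x \<in> carrier (direct_sum I M)" "y \<in> carrier (direct_sum I M)" "z \<in> carrier (direct_sum I M)"
  then show "x \<oplus>\<^bsub>direct_sum I M\<^esub> y \<oplus>\<^bsub>direct_sum I M\<^esub> z = x \<oplus>\<^bsub>direct_sum I M\<^esub> (y \<oplus>\<^bsub>direct_sum I M\<^esub> z)"
    by (simp add: direct_sum_carrier M.a_assoc)
next
  fix x assume "x \<in> carrier (direct_sum I M)"
  then show "\<zero>\<^bsub>direct_sum I M\<^esub> \<oplus>\<^bsub>direct_sum I M\<^esub> x = x" "\<one>\<^bsub>R\<^esub> \<odot>\<^bsub>direct_sum I M\<^esub> x = x"
    by (simp_all add: direct_sum_carrier smult_one)
next
  fix r s x assume "r \<in> carrier R" "s \<in> carrier R" "x \<in> carrier (direct_sum I M)"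
  then show "(r \<oplus>\<^bsub>R\<^esub> s) \<odot>\<^bsub>direct_sum I M\<^esub> x = r \<odot>\<^bsub>direct_sum I M\<^esub> x \<oplus>\<^bsub>direct_sum I M\<^esub> s \<odot>\<^bsub>direct_sum I M\<^esub> x"
    "(r \<otimes>\<^bsub>R\<^esub> s) \<odot>\<^bsub>direct_sum I M\<^esub> x = r \<odot>\<^bsub>direct_sum I M\<^esub> (s \<odot>\<^bsub>direct_sum I M\<^esub> x)"
    by (simp_all add: direct_sum_carrier smult_l_distr smult_assoc)
next
  fix r x y assume "r \<in> carrier R" "x \<in> carrier (direct_sum I M)" "y \<in> carrier (direct_sum I M)"
  then show "r \<odot>\<^bsub>direct_sum I M\<^esub> (x \<oplus>\<^bsub>direct_sum I M\<^esub> y) =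
      r \<odot>\<^bsub>direct_sum I M\<^esub> x \<oplus>\<^bsub>direct_sum I M\<^esub> r \<odot>\<^bsub>direct_sum I M\<^esub> y"
    by (simp add: direct_sum_carrier smult_r_distr)
qed

end

lemma regular_module_simps [simp]:
  "carrier (regular_module R) = carrier R" "\<zero>\<^bsub>regular_module R\<^esub> = \<zero>\<^bsub>R\<^esub>"
  "x \<oplus>\<^bsub>regular_module R\<^esub> y = x \<oplus>\<^bsub>R\<^esub> y" "r \<odot>\<^bsub>regular_module R\<^esub> x = r \<otimes>\<^bsub>R\<^esub> x"
  by (simp_all add: regular_module_def)

lemma (in ring) left_module_regular: "left_module R (regular_module R)"
  by (rule left_moduleI)
    (auto simp: ring_axioms a_ac l_distr r_distr m_assoc intro!: bexI[of _ "\<ominus> _"] l_neg)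

lemma free_module_carrier:
  "f \<in> carrier (free_module S B) \<longleftrightarrow>
    (\<forall>b. f b \<in> carrier S) \<and> (\<forall>b. b \<notin> B \<longrightarrow> f b = \<zero>\<^bsub>S\<^esub>) \<and> finite {b. f b \<noteq> \<zero>\<^bsub>S\<^esub>}"
  by (simp add: free_module_def)

lemma free_module_simps [simp]:
  "\<zero>\<^bsub>free_module S B\<^esub> = (\<lambda>_. \<zero>\<^bsub>S\<^esub>)"
  "f \<oplus>\<^bsub>free_module S B\<^esub> f' = (\<lambda>b. f b \<oplus>\<^bsub>S\<^esub> f' b)"
  "s \<odot>\<^bsub>free_module S B\<^esub> f = (\<lambda>b. s \<otimes>\<^bsub>S\<^esub> f b)"
  by (simp_all add: free_module_def)

lemma free_module_eq_direct_sum: "free_module S B = direct_sum B (regular_module S)"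
  by (simp add: free_module_def direct_sum_def regular_module_def)

lemma (in ring) left_module_free: "left_module R (free_module R B)"
  unfolding free_module_eq_direct_sum by (rule left_module.left_module_direct_sum[OF left_module_regular])

definition basis_vector :: "('s, 'e) ring_scheme \<Rightarrow> 'b \<Rightarrow> 'b \<Rightarrow> 's" where
  "basis_vector S b = (\<lambda>b'. if b' = b then \<one>\<^bsub>S\<^esub> else \<zero>\<^bsub>S\<^esub>)"

lemma (in ring) basis_vector_closed: "b \<in> B \<Longrightarrow> basis_vector R b \<in> carrier (free_module R B)"
proof -
  have "{b'. basis_vector R b b' \<noteq> \<zero>} \<subseteq> {b}" by (auto simp: basis_vector_def)
  then show "b \<in> B \<Longrightarrow> ?thesis"
    by (auto simp: free_module_carrier basis_vector_def intro: finite_subset)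
qed

context left_module
begin

text \<open>\<open>linear_extension\<close> sums over the exact support of \<open>f\<close>, which
  can shrink when functions are added or scaled. Any finite set of basis elements around the support
  gives the same sum, so that several functions can share one index set.\<close>

lemma linear_extension_eq:
  assumes "f \<in> carrier (free_module R B)" "h \<in> B \<rightarrow> carrier M" "finite A" "A \<subseteq> B"
    and "{b. f b \<noteq> \<zero>\<^bsub>R\<^esub>} \<subseteq> A"
  shows "linear_extension R M h f = (\<Oplus>\<^bsub>M\<^esub>b\<in>A. f b \<odot>\<^bsub>M\<^esub> h b)"
  unfolding linear_extension_def
proof (rule M.add.finprod_mono_neutral_cong_left)
  have h: "h b \<in> carrier M" if "b \<in> A" for b using assms that by auto
  then show "(\<lambda>b. f b \<odot>\<^bsub>M\<^esub> h b) \<in> A \<rightarrow> carrier M"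
    using assms(1) by (auto simp: free_module_carrier smult_closed)
  show "\<And>b. b \<in> A - {b. f b \<noteq> \<zero>\<^bsub>R\<^esub>} \<Longrightarrow> f b \<odot>\<^bsub>M\<^esub> h b = \<zero>\<^bsub>M\<^esub>"
    using h by (auto simp: smult_l_null)
qed (use assms in auto)

lemma linear_extension_cong:
  assumes "f \<in> carrier (free_module R B)" "h \<in> B \<rightarrow> carrier M" "\<And>b. b \<in> B \<Longrightarrow> h b = h' b"
  shows "linear_extension R M h f = linear_extension R M h' f"
  unfolding linear_extension_def
proof (rule M.finsum_cong')
  have *: "b \<in> B" if "f b \<noteq> \<zero>\<^bsub>R\<^esub>" for b using assms(1) that by (auto simp: free_module_carrier)
  show "\<And>b. b \<in> {b. f b \<noteq> \<zero>\<^bsub>R\<^esub>} \<Longrightarrow> f b \<odot>\<^bsub>M\<^esub> h b = f b \<odot>\<^bsub>M\<^esub> h' b"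
    using * assms(3) by auto
  show "(\<lambda>b. f b \<odot>\<^bsub>M\<^esub> h' b) \<in> {b. f b \<noteq> \<zero>\<^bsub>R\<^esub>} \<rightarrow> carrier M"
  proof
    fix b assume "b \<in> {b. f b \<noteq> \<zero>\<^bsub>R\<^esub>}"
    then have "b \<in> B" using * by auto
    then have "h' b \<in> carrier M" using assms(2,3) by (metis PiE)
    then show "f b \<odot>\<^bsub>M\<^esub> h' b \<in> carrier M"
      using assms(1) by (auto simp: free_module_carrier intro!: smult_closed)
  qed
qed auto

lemma linear_map_extension:
  assumes h: "h \<in> B \<rightarrow> carrier M"
  shows "linear_map R (free_module R B) M (linear_extension R M h)"
  unfolding linear_map_iff
proof (intro conjI ballI)
  show "left_module R (free_module R B)" by (rule R.left_module_free)
  show "left_module R M" ..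
  interpret F: left_module R "free_module R B" by (rule R.left_module_free)
  let ?F = "free_module R B"
  have supp: "f \<in> carrier ?F \<Longrightarrow> finite {b. f b \<noteq> \<zero>\<^bsub>R\<^esub>} \<and> {b. f b \<noteq> \<zero>\<^bsub>R\<^esub>} \<subseteq> B" for f
    by (auto simp: free_module_carrier)
  have cl: "(\<lambda>b. f b \<odot>\<^bsub>M\<^esub> h b) \<in> A \<rightarrow> carrier M" if "f \<in> carrier ?F" "A \<subseteq> B" for f A
    using that h by (auto simp: free_module_carrier intro!: smult_closed)
  {
    fix f assume f: "f \<in> carrier ?F"
    show "linear_extension R M h f \<in> carrier M"
      unfolding linear_extension_def using cl[OF f] supp[OF f] by (auto intro!: M.finsum_closed)
  }
  {
    fix f f' assume f: "f \<in> carrier ?F" "f' \<in> carrier ?F"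
    \<comment> \<open>Cancellation may make the support of the sum smaller than this union; the
      extra terms are zero.\<close>
    let ?A = "{b. f b \<noteq> \<zero>\<^bsub>R\<^esub>} \<union> {b. f' b \<noteq> \<zero>\<^bsub>R\<^esub>}"
    have A: "finite ?A" "?A \<subseteq> B" using supp[OF f(1)] supp[OF f(2)] by auto
    have "linear_extension R M h (f \<oplus>\<^bsub>?F\<^esub> f') = (\<Oplus>\<^bsub>M\<^esub>b\<in>?A. (f b \<oplus>\<^bsub>R\<^esub> f' b) \<odot>\<^bsub>M\<^esub> h b)"
      by (subst linear_extension_eq[OF F.a_closed[OF f] h A]) auto
    also have "\<dots> = (\<Oplus>\<^bsub>M\<^esub>b\<in>?A. f b \<odot>\<^bsub>M\<^esub> h b \<oplus>\<^bsub>M\<^esub> f' b \<odot>\<^bsub>M\<^esub> h b)"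
      using f h A cl[OF f(1) A(2)] cl[OF f(2) A(2)]
      by (intro M.finsum_cong' smult_l_distr) (auto simp: free_module_carrier)
    also have "\<dots> = linear_extension R M h f \<oplus>\<^bsub>M\<^esub> linear_extension R M h f'"
      using cl[OF f(1) A(2)] cl[OF f(2) A(2)]
      by (subst M.finsum_addf) (auto simp: linear_extension_eq[OF f(1) h A] linear_extension_eq[OF f(2) h A])
    finally show "linear_extension R M h (f \<oplus>\<^bsub>?F\<^esub> f') =
        linear_extension R M h f \<oplus>\<^bsub>M\<^esub> linear_extension R M h f'" .
  }
  {
    fix r f assume f: "r \<in> carrier R" "f \<in> carrier ?F"
    let ?A = "{b. f b \<noteq> \<zero>\<^bsub>R\<^esub>}"
    have A: "finite ?A" "?A \<subseteq> B" using supp[OF f(2)] by auto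
    interpret s: additive_map M M "\<lambda>x. r \<odot>\<^bsub>M\<^esub> x"
      by unfold_locales (use f in \<open>auto simp: smult_closed smult_r_distr\<close>)
    have "linear_extension R M h (r \<odot>\<^bsub>?F\<^esub> f) = (\<Oplus>\<^bsub>M\<^esub>b\<in>?A. (r \<otimes>\<^bsub>R\<^esub> f b) \<odot>\<^bsub>M\<^esub> h b)"
      by (subst linear_extension_eq[OF F.smult_closed[OF f] h A]) (use f in auto)
    also have "\<dots> = (\<Oplus>\<^bsub>M\<^esub>b\<in>?A. r \<odot>\<^bsub>M\<^esub> (f b \<odot>\<^bsub>M\<^esub> h b))"
      using f h A cl[OF f(2) A(2)]
      by (intro M.finsum_cong' smult_assoc) (auto simp: free_module_carrier intro!: smult_closed)
    also have "\<dots> = r \<odot>\<^bsub>M\<^esub> linear_extension R M h f"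
      using cl[OF f(2) A(2)] by (simp add: s.finsum linear_extension_def)
    finally show "linear_extension R M h (r \<odot>\<^bsub>?F\<^esub> f) = r \<odot>\<^bsub>M\<^esub> linear_extension R M h f" .
  }
qed

lemmas linear_extension_closed = linear_map.closed[OF linear_map_extension]
  and linear_extension_zero = linear_map.zero[OF linear_map_extension, simplified]

lemma linear_extension_basis_vector:
  assumes "h b \<in> carrier M" shows "linear_extension R M h (basis_vector R b) = h b"
proof -
  have "linear_extension R M h (basis_vector R b) = (\<Oplus>\<^bsub>M\<^esub>x\<in>{b}. basis_vector R b x \<odot>\<^bsub>M\<^esub> h x)"
    by (rule linear_extension_eq[where B="{b}"])
      (use assms R.basis_vector_closed[of b "{b}"] in \<open>auto simp: basis_vector_def\<close>)
  then show ?thesis using assms by (simp add: basis_vector_def smult_one)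
qed

end

lemma (in linear_map) linear_extension:
  assumes "h \<in> B \<rightarrow> carrier X" "f \<in> carrier (free_module R B)"
  shows "\<phi> (linear_extension R X h f) = linear_extension R Y (\<lambda>b. \<phi> (h b)) f"
proof -
  have *: "f b \<in> carrier R \<and> h b \<in> carrier X" if "f b \<noteq> \<zero>\<^bsub>R\<^esub>" for b
    using assms that by (auto simp: free_module_carrier)
  have "\<phi> (linear_extension R X h f) = finsum Y (\<lambda>b. \<phi> (f b \<odot>\<^bsub>X\<^esub> h b)) {b. f b \<noteq> \<zero>\<^bsub>R\<^esub>}"
    unfolding linear_extension_def by (rule finsum) (use * dom.smult_closed in auto)
  also have "\<dots> = linear_extension R Y (\<lambda>b. \<phi> (h b)) f"
    unfolding linear_extension_def
    by (rule cod.finsum_cong') (use * in \<open>auto simp: smult closed cod.smult_closed\<close>)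
  finally show ?thesis .
qed

text \<open>Compared at one index at a time: evaluation at \<open>b\<close> is additive, and only
  the summand with index \<open>b\<close> survives it.\<close>

lemma (in ring) linear_extension_basis_expansion:
  assumes f: "f \<in> carrier (free_module R B)"
  shows "linear_extension R (free_module R B) (basis_vector R) f = f"
proof
  fix b
  interpret F: left_module R "free_module R B" by (rule left_module_free)
  let ?A = "{b. f b \<noteq> \<zero>}"
  have A: "finite ?A" "?A \<subseteq> B" using f by (auto simp: free_module_carrier)
  have c: "x \<in> ?A \<Longrightarrow> f x \<in> carrier R" for x using f by (auto simp: free_module_carrier)
  have "additive_map (free_module R B) R (\<lambda>f. f b)"
    by unfold_locales (auto simp: free_module_carrier)
  then interpret ev: additive_map "free_module R B" R "\<lambda>f. f b" .
  have cl: "(\<lambda>x. f x \<odot>\<^bsub>free_module R B\<^esub> basis_vector R x) \<in> ?A \<rightarrow> carrier (free_module R B)"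
  proof
    fix x assume x: "x \<in> ?A"
    show "f x \<odot>\<^bsub>free_module R B\<^esub> basis_vector R x \<in> carrier (free_module R B)"
      by (rule F.smult_closed[OF c[OF x] basis_vector_closed]) (use x A in auto)
  qed
  have "linear_extension R (free_module R B) (basis_vector R) f b =
    (\<Oplus>x\<in>?A. f x \<otimes> basis_vector R x b)"
    unfolding linear_extension_def ev.finsum[OF cl] by simp
  also have "\<dots> = (\<Oplus>x\<in>?A. if b = x then f x else \<zero>)"
    by (rule finsum_cong') (use c in \<open>auto simp: basis_vector_def\<close>)
  also have "\<dots> = f b"
  proof (cases "f b = \<zero>")
    case True
    then have "(\<Oplus>x\<in>?A. if b = x then f x else \<zero>) = (\<Oplus>x\<in>?A. \<zero>)"
      by (intro finsum_cong') auto
    then show ?thesis using True add.finprod_one by simp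
  next
    case False
    then show ?thesis using add.finprod_singleton[of b ?A f] A c by auto
  qed
  finally show "linear_extension R (free_module R B) (basis_vector R) f b = f b" .
qed

text \<open>Apply \<open>\<phi>\<close> to the expansion of \<open>f\<close> in basis vectors. This
  is the uniqueness half of the universal property; later identities between linear maps on free
  modules are reduced by it to values on a basis.\<close>

lemma linear_map_on_free:
  assumes "linear_map R (free_module R B) Y \<phi>" "f \<in> carrier (free_module R B)"
  shows "\<phi> f = linear_extension R Y (\<lambda>b. \<phi> (basis_vector R b)) f"
proof -
  interpret linear_map R "free_module R B" Y \<phi> by fact
  show ?thesis
    using linear_extension[of "basis_vector R" B f] assms(2)
    by (simp add: dom.R.linear_extension_basis_expansion dom.R.basis_vector_closed)
qed

context left_module
begin

lemma linear_extension_compose: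
  assumes "h \<in> B' \<rightarrow> carrier M" "t \<in> B \<rightarrow> carrier (free_module R B')" "f \<in> carrier (free_module R B)"
  shows "linear_extension R M h (linear_extension R (free_module R B') t f) =
    linear_extension R M (\<lambda>b. linear_extension R M h (t b)) f"
  using linear_map.linear_extension[OF linear_map_extension[OF assms(1)] assms(2,3)] .

lemma linear_map_add:
  assumes "linear_map R X M \<phi>" "linear_map R X M \<psi>"
  shows "linear_map R X M (\<lambda>x. \<phi> x \<oplus>\<^bsub>M\<^esub> \<psi> x)"
  using assms unfolding linear_map_iff by (simp add: M.a_ac smult_r_distr)

lemma smult_r_minus:
  assumes "r \<in> carrier R" "x \<in> carrier M" shows "r \<odot>\<^bsub>M\<^esub> (\<ominus>\<^bsub>M\<^esub> x) = \<ominus>\<^bsub>M\<^esub> (r \<odot>\<^bsub>M\<^esub> x)"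
proof -
  interpret s: additive_map M M "\<lambda>x. r \<odot>\<^bsub>M\<^esub> x"
    by unfold_locales (use assms in \<open>auto simp: smult_closed smult_r_distr\<close>)
  show ?thesis using assms by (simp add: s.minus)
qed

lemma linear_map_minus:
  assumes "linear_map R X M \<phi>"
  shows "linear_map R X M (\<lambda>x. \<ominus>\<^bsub>M\<^esub> \<phi> x)"
  using assms unfolding linear_map_iff by (simp add: M.minus_add smult_r_minus)

lemma linear_map_const_zero:
  "left_module R X \<Longrightarrow> linear_map R X M (\<lambda>x. \<zero>\<^bsub>M\<^esub>)"
  unfolding linear_map_iff by (simp add: left_module_axioms smult_r_null)

text \<open>The right-hand side is linear in \<open>f\<close>, hence determined by its values on
  basis vectors, and there it is \<open>h b \<oplus> h' b\<close>. The same argument serves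
  negation.\<close>

lemma linear_extension_add:
  assumes "h \<in> B \<rightarrow> carrier M" "h' \<in> B \<rightarrow> carrier M" "f \<in> carrier (free_module R B)"
  shows "linear_extension R M (\<lambda>b. h b \<oplus>\<^bsub>M\<^esub> h' b) f =
    linear_extension R M h f \<oplus>\<^bsub>M\<^esub> linear_extension R M h' f"
proof -
  have "linear_map R (free_module R B) M (\<lambda>f. linear_extension R M h f \<oplus>\<^bsub>M\<^esub> linear_extension R M h' f)"
    using assms linear_map_add linear_map_extension by blast
  from linear_map_on_free[OF this assms(3)] show ?thesis
    using assms
    by (auto intro!: linear_extension_cong[OF assms(3)] simp: linear_extension_basis_vector Pi_iff)
qed

lemma linear_extension_minus:
  assumes "h \<in> B \<rightarrow> carrier M" "f \<in> carrier (free_module R B)"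
  shows "linear_extension R M (\<lambda>b. \<ominus>\<^bsub>M\<^esub> h b) f = \<ominus>\<^bsub>M\<^esub> linear_extension R M h f"
proof -
  have "linear_map R (free_module R B) M (\<lambda>f. \<ominus>\<^bsub>M\<^esub> linear_extension R M h f)"
    using assms linear_map_minus linear_map_extension by blast
  from linear_map_on_free[OF this assms(2)] show ?thesis
    using assms
    by (auto intro!: linear_extension_cong[OF assms(2)] simp: linear_extension_basis_vector Pi_iff)
qed

lemma linear_extension_diff:
  assumes "h \<in> B \<rightarrow> carrier M" "h' \<in> B \<rightarrow> carrier M" "f \<in> carrier (free_module R B)"
  shows "linear_extension R M (\<lambda>b. h b \<ominus>\<^bsub>M\<^esub> h' b) f =
    linear_extension R M h f \<ominus>\<^bsub>M\<^esub> linear_extension R M h' f"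
  unfolding a_minus_def using assms
  by (subst linear_extension_add) (auto simp: linear_extension_minus Pi_iff)

lemma linear_extension_const_zero:
  assumes "f \<in> carrier (free_module R B)" "\<And>b. b \<in> B \<Longrightarrow> h b = \<zero>\<^bsub>M\<^esub>"
  shows "linear_extension R M h f = \<zero>\<^bsub>M\<^esub>"
proof -
  have "linear_extension R M h f = linear_extension R M (\<lambda>b. \<zero>\<^bsub>M\<^esub>) f"
    by (rule linear_extension_cong[OF assms(1)]) (use assms in auto)
  then show ?thesis
    using linear_map_on_free[OF linear_map_const_zero[OF R.left_module_free] assms(1)] by simp
qed

end

lemma (in ring) formal_sum_Cons:
  assumes "s \<in> carrier R" "set l \<subseteq> carrier R \<times> B"
  shows "formal_sum R ((s, b) # l) = (\<lambda>x. s \<otimes> basis_vector R b x \<oplus> formal_sum R l x)"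
proof -
  have "formal_sum R l x \<in> carrier R" for x
    using assms(2) by (induction l) (auto simp: formal_sum_def list_sum_def)
  then show ?thesis using assms(1)
    by (auto simp: formal_sum_def list_sum_def basis_vector_def fun_eq_iff)
qed

lemma (in ring) formal_sum_closed:
  assumes "set l \<subseteq> carrier R \<times> B" shows "formal_sum R l \<in> carrier (free_module R B)"
  using assms
proof (induction l)
  case Nil
  then show ?case by (simp add: formal_sum_def list_sum_def free_module_carrier)
next
  case (Cons p l)
  interpret F: left_module R "free_module R B" by (rule left_module_free)
  obtain s b where p: "p = (s, b)" by (cases p)
  have "s \<odot>\<^bsub>free_module R B\<^esub> basis_vector R b \<oplus>\<^bsub>free_module R B\<^esub> formal_sum R l \<in> carrier (free_module R B)"
    using Cons p by (intro F.a_closed F.smult_closed basis_vector_closed) auto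
  then show ?case using Cons.prems p by (subst p) (auto simp: formal_sum_Cons)
qed

text \<open>Coordinates are split off one at a time from a finite set containing the support. This
  is the source of exactness of the syzygy resolution: every cycle is the value of some list, and
  that list labels a basis element one degree higher.\<close>

lemma (in ring) formal_sum_surj:
  assumes f: "f \<in> carrier (free_module R B)"
  obtains l where "set l \<subseteq> carrier R \<times> B" "formal_sum R l = f"
proof -
  interpret F: left_module R "free_module R B" by (rule left_module_free)
  have "\<exists>l. set l \<subseteq> carrier R \<times> B \<and> formal_sum R l = f"
    if "finite A" "A \<subseteq> B" "f \<in> carrier (free_module R B)" "{b. f b \<noteq> \<zero>} \<subseteq> A" for A f
    using that
  proof (induction A arbitrary: f rule: finite_induct)
    case empty
    then have "f = formal_sum R []" by (auto simp: formal_sum_def list_sum_def)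
    then show ?case by (intro exI[of _ "[]"]) auto
  next
    case (insert a A)
    let ?f = "\<lambda>x. if x = a then \<zero> else f x"
    have fc: "f b \<in> carrier R" for b using insert.prems by (auto simp: free_module_carrier)
    have "{b. ?f b \<noteq> \<zero>} \<subseteq> {b. f b \<noteq> \<zero>}" by auto
    then have "?f \<in> carrier (free_module R B)"
      using insert.prems by (auto simp: free_module_carrier intro: finite_subset)
    moreover have "{b. ?f b \<noteq> \<zero>} \<subseteq> A" "A \<subseteq> B" using insert.prems by auto
    ultimately obtain l where l: "set l \<subseteq> carrier R \<times> B" "formal_sum R l = ?f"
      using insert.IH[of ?f] by auto
    have "formal_sum R ((f a, a) # l) = f"
      using formal_sum_Cons[OF fc l(1)] fc by (auto simp: l(2) basis_vector_def fun_eq_iff)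
    then show ?case using l(1) fc insert.prems by (intro exI[of _ "(f a, a) # l"]) auto
  qed
  moreover have "finite {b. f b \<noteq> \<zero>}" "{b. f b \<noteq> \<zero>} \<subseteq> B"
    using f by (auto simp: free_module_carrier)
  ultimately show ?thesis using f that by blast
qed

section \<open>Free resolutions\<close>

text \<open>The augmentation plays the part of the differential out of degree 0, so that exactness
  takes one form in all degrees.\<close>

definition cycles ::
  "('s, 'e) ring_scheme \<Rightarrow> ('s, 'x, 'f) module_scheme \<Rightarrow> (nat \<Rightarrow> 'b set) \<Rightarrow> (nat \<Rightarrow> 'b \<Rightarrow> 'b \<Rightarrow> 's)
    \<Rightarrow> ('b \<Rightarrow> 'x) \<Rightarrow> nat \<Rightarrow> ('b \<Rightarrow> 's) set"
  where "cycles S X B d e k = {f \<in> carrier (free_module S (B k)).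
    case k of 0 \<Rightarrow> linear_extension S X e f = \<zero>\<^bsub>X\<^esub>
    | Suc j \<Rightarrow> linear_extension S (free_module S (B j)) (d j) f = \<zero>\<^bsub>free_module S (B j)\<^esub>}"

text \<open>
  A free resolution is recorded by bases \<open>B k\<close> and by the values \<open>d k\<close> of the differential
  \<open>F\<^sub>k\<^sub>+\<^sub>1 \<rightarrow> F\<^sub>k\<close> and \<open>e\<close> of the augmentation on basis elements.
\<close>

locale free_resolution = left_module S X
  for S :: "('s, 'e) ring_scheme" (structure) and X :: "('s, 'x, 'f) module_scheme" (structure)
    and B :: "nat \<Rightarrow> 'b set" and d :: "nat \<Rightarrow> 'b \<Rightarrow> 'b \<Rightarrow> 's" and e :: "'b \<Rightarrow> 'x" +
  assumes e_closed: "e \<in> B 0 \<rightarrow> carrier X"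
    and d_closed: "d k \<in> B (Suc k) \<rightarrow> carrier (free_module S (B k))"
    and surj: "linear_extension S X e ` carrier (free_module S (B 0)) = carrier X"
    and exact: "linear_extension S (free_module S (B k)) (d k) ` carrier (free_module S (B (Suc k)))
      = cycles S X B d e k"
begin

abbreviation "F k \<equiv> free_module S (B k)"
abbreviation "D k \<equiv> linear_extension S (F k) (d k)"
abbreviation "Z \<equiv> cycles S X B d e"

lemma F_module: "left_module S (F k)"
  by (rule R.left_module_free)

lemma F_group: "abelian_group (F k)"
  using F_module by (simp add: left_module_def)

lemma D_linear: "linear_map S (F (Suc k)) (F k) (D k)"
  by (rule left_module.linear_map_extension[OF F_module d_closed])

lemma D_closed: "f \<in> carrier (F (Suc k)) \<Longrightarrow> D k f \<in> carrier (F k)"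
  by (rule linear_map.closed[OF D_linear])

lemma D_basis_vector: "b \<in> B (Suc k) \<Longrightarrow> D k (basis_vector S b) = d k b"
  by (rule left_module.linear_extension_basis_vector[OF F_module]) (use d_closed in auto)

lemma D_cycle: "f \<in> carrier (F (Suc k)) \<Longrightarrow> D k f \<in> Z k"
  using exact by blast

lemma d_cycle: "b \<in> B (Suc k) \<Longrightarrow> d k b \<in> Z k"
  using D_cycle[OF R.basis_vector_closed] D_basis_vector by metis

lemma cycle_closed: "f \<in> Z k \<Longrightarrow> f \<in> carrier (F k)"
  by (simp add: cycles_def)

lemma d_in_F: "b \<in> B (Suc k) \<Longrightarrow> d k b \<in> carrier (F k)"
  using d_closed by auto

lemma cycle_0: "f \<in> Z 0 \<longleftrightarrow> f \<in> carrier (F 0) \<and> linear_extension S X e f = \<zero>\<^bsub>X\<^esub>"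
  by (simp add: cycles_def)

lemma cycle_Suc: "f \<in> Z (Suc k) \<longleftrightarrow> f \<in> carrier (F (Suc k)) \<and> D k f = \<zero>\<^bsub>F k\<^esub>"
  by (simp add: cycles_def)

lemma cycle_boundary: "f \<in> Z k \<Longrightarrow> \<exists>f'\<in>carrier (F (Suc k)). D k f' = f"
  unfolding exact[symmetric] by auto

lemma D_d: "b \<in> B (Suc (Suc k)) \<Longrightarrow> D k (d (Suc k) b) = \<zero>\<^bsub>F k\<^esub>"
  using d_cycle[of b "Suc k"] cycle_Suc by blast

lemma e_d: "b \<in> B (Suc 0) \<Longrightarrow> linear_extension S X e (d 0 b) = \<zero>\<^bsub>X\<^esub>"
  using d_cycle[of b 0] cycle_0 by blast

lemma e_linear: "linear_map S (F 0) X (linear_extension S X e)"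
  by (rule linear_map_extension[OF e_closed])

end

text \<open>A cochain is a function on the basis instead of a homomorphism on the free module, and
  its values off the basis are arbitrary. Testing on basis elements is enough:
  \<open>cocycle_boundary_zero\<close> recovers vanishing on all boundaries.\<close>

definition cocycle where
  "cocycle S Y B d k c \<longleftrightarrow> c \<in> B k \<rightarrow> carrier Y \<and>
    (\<forall>b\<in>B (Suc k). linear_extension S Y c (d k b) = \<zero>\<^bsub>Y\<^esub>)"

text \<open>\<open>coboundary S Y B d k c\<close> speaks about cochains \<open>c\<close> of degree \<open>k + 1\<close>.\<close>

definition coboundary where
  "coboundary S Y B d k c \<longleftrightarrow>
    (\<exists>h\<in>B k \<rightarrow> carrier Y. \<forall>b\<in>B (Suc k). c b = linear_extension S Y h (d k b))"

text \<open>Vanishing of the cohomology in all positive degrees, for one given resolution. The index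
  of \<open>coboundary\<close> is that of the bounding cochain, one below the degree of
  \<open>c\<close>.\<close>

definition acyclic_for where
  "acyclic_for S Y B d \<longleftrightarrow> (\<forall>k c. cocycle S Y B d (Suc k) c \<longrightarrow> coboundary S Y B d k c)"

lemma cocycle_boundary_zero:
  assumes "left_module S Y" "cocycle S Y B d k c" "d k \<in> B (Suc k) \<rightarrow> carrier (free_module S (B k))"
    "f \<in> carrier (free_module S (B (Suc k)))"
  shows "linear_extension S Y c (linear_extension S (free_module S (B k)) (d k) f) = \<zero>\<^bsub>Y\<^esub>"
proof -
  interpret Y: left_module S Y by fact
  have c: "c \<in> B k \<rightarrow> carrier Y" using assms(2) by (simp add: cocycle_def)
  show ?thesis
    unfolding Y.linear_extension_compose[OF c assms(3,4)]
    by (rule Y.linear_extension_const_zero[OF assms(4)]) (use assms(2) in \<open>simp add: cocycle_def\<close>)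
qed

section \<open>Comparison of free resolutions\<close>

text \<open>The chain map over the identity of \<open>X\<close> is chosen degree by degree: the
  image of \<open>d k b\<close> under the part already built is a cycle of the second resolution,
  and exactness there provides a preimage for \<open>u (Suc k) b\<close>.\<close>

lemma comparison_lift:
  assumes "free_resolution S X B d e" and "free_resolution S X B' d' e'"
  obtains u where "\<And>k. u k \<in> B k \<rightarrow> carrier (free_module S (B' k))"
    and "\<And>b. b \<in> B 0 \<Longrightarrow> linear_extension S X e' (u 0 b) = e b"
    and "\<And>k b. b \<in> B (Suc k) \<Longrightarrow> linear_extension S (free_module S (B' k)) (d' k) (u (Suc k) b) =
      linear_extension S (free_module S (B' k)) (u k) (d k b)"
proof -
  interpret P: free_resolution S X B d e by fact
  interpret Q: free_resolution S X B' d' e' by fact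
  \<comment> \<open>The invariant says that cycles go to cycles, which is what permits the next
    lift. Its last clause stores the compatibility with the augmentations, which concerns degree 0
    only.\<close>
  let ?P = "\<lambda>k t. t \<in> B k \<rightarrow> carrier (Q.F k) \<and> (\<forall>f\<in>P.Z k. linear_extension S (Q.F k) t f \<in> Q.Z k) \<and>
    (k = 0 \<longrightarrow> (\<forall>b\<in>B 0. linear_extension S X e' (t b) = e b))"
  have "\<exists>u. \<forall>k. ?P k (u k) \<and>
    (\<forall>b\<in>B (Suc k). Q.D k (u (Suc k) b) = linear_extension S (Q.F k) (u k) (d k b))"
  proof (rule dependent_nat_choice)
    have "\<forall>b\<in>B 0. \<exists>x. x \<in> carrier (Q.F 0) \<and> linear_extension S X e' x = e b"
    proof
      fix b assume "b \<in> B 0"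
      then have "e b \<in> carrier X" using P.e_closed by auto
      then show "\<exists>x. x \<in> carrier (Q.F 0) \<and> linear_extension S X e' x = e b"
        unfolding Q.surj[symmetric] by auto
    qed
    then obtain t where t: "\<forall>b\<in>B 0. t b \<in> carrier (Q.F 0) \<and> linear_extension S X e' (t b) = e b"
      using bchoice by meson
    then have tc: "t \<in> B 0 \<rightarrow> carrier (Q.F 0)" by auto
    have "linear_extension S (Q.F 0) t f \<in> Q.Z 0" if f: "f \<in> P.Z 0" for f
    proof -
      have fc: "f \<in> carrier (P.F 0)" using f P.cycle_closed by blast
      have "linear_extension S X e' (linear_extension S (Q.F 0) t f) = linear_extension S X e f"
        unfolding P.linear_extension_compose[OF Q.e_closed tc fc]
        by (rule P.linear_extension_cong[OF fc]) (use t P.e_closed in auto)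
      moreover have "linear_extension S (Q.F 0) t f \<in> carrier (Q.F 0)"
        by (rule left_module.linear_extension_closed[OF Q.F_module tc fc])
      ultimately show ?thesis using f by (simp add: P.cycle_0 Q.cycle_0)
    qed
    with t tc show "\<exists>t. ?P 0 t" by blast
  next
    fix t k assume t: "?P k t"
    have "\<forall>b\<in>B (Suc k). \<exists>x. x \<in> carrier (Q.F (Suc k)) \<and>
      Q.D k x = linear_extension S (Q.F k) t (d k b)"
      using t P.d_cycle Q.cycle_boundary by blast
    then obtain t' where t': "\<forall>b\<in>B (Suc k). t' b \<in> carrier (Q.F (Suc k)) \<and>
      Q.D k (t' b) = linear_extension S (Q.F k) t (d k b)"
      using bchoice by meson
    then have tc': "t' \<in> B (Suc k) \<rightarrow> carrier (Q.F (Suc k))" by auto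
    have tc: "t \<in> B k \<rightarrow> carrier (Q.F k)" using t by auto
    have "linear_extension S (Q.F (Suc k)) t' f \<in> Q.Z (Suc k)" if f: "f \<in> P.Z (Suc k)" for f
    proof -
      have fc: "f \<in> carrier (P.F (Suc k))" using f P.cycle_closed by blast
      have "Q.D k (linear_extension S (Q.F (Suc k)) t' f) =
        linear_extension S (Q.F k) (\<lambda>b. Q.D k (t' b)) f"
        by (rule left_module.linear_extension_compose[OF Q.F_module Q.d_closed tc' fc])
      also have "\<dots> = linear_extension S (Q.F k) (\<lambda>b. linear_extension S (Q.F k) t (d k b)) f"
        by (rule left_module.linear_extension_cong[OF Q.F_module fc]) (use t' tc' Q.D_closed in auto)
      also have "\<dots> = linear_extension S (Q.F k) t (P.D k f)"
        by (rule left_module.linear_extension_compose[OF Q.F_module tc P.d_closed fc, symmetric])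
      also have "\<dots> = \<zero>\<^bsub>Q.F k\<^esub>"
        using left_module.linear_extension_zero[OF Q.F_module tc] f by (simp add: P.cycle_Suc)
      finally show ?thesis
        using left_module.linear_extension_closed[OF Q.F_module tc' fc] by (simp add: Q.cycle_Suc)
    qed
    with t' tc' show "\<exists>t'. ?P (Suc k) t' \<and>
      (\<forall>b\<in>B (Suc k). Q.D k (t' b) = linear_extension S (Q.F k) t (d k b))" by blast
  qed
  then obtain u where u: "\<forall>k. ?P k (u k) \<and>
    (\<forall>b\<in>B (Suc k). Q.D k (u (Suc k) b) = linear_extension S (Q.F k) (u k) (d k b))" ..
  then have "\<And>k. ?P k (u k)" by (rule allE) (erule conjunct1)
  with u show thesis by (intro that[of u]) simp_all
qed

text \<open>The usual construction of a chain homotopy between the identity and a lift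
  \<open>w\<close> of the identity of \<open>X\<close>. The equation is recorded in positive degrees
  only, where the vanishing of cohomology has to be transferred.\<close>

lemma (in free_resolution) homotopy_to_identity:
  assumes w: "\<And>k. w k \<in> B k \<rightarrow> carrier (F k)"
    and w0: "\<And>b. b \<in> B 0 \<Longrightarrow> linear_extension S X e (w 0 b) = e b"
    and wD: "\<And>k b. b \<in> B (Suc k) \<Longrightarrow> D k (w (Suc k) b) = linear_extension S (F k) (w k) (d k b)"
  obtains h where "\<And>k. h k \<in> B k \<rightarrow> carrier (F (Suc k))"
    and "\<And>k b. b \<in> B (Suc k) \<Longrightarrow> basis_vector S b =
      D (Suc k) (h (Suc k) b) \<oplus>\<^bsub>F (Suc k)\<^esub> w (Suc k) b \<oplus>\<^bsub>F (Suc k)\<^esub>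
        linear_extension S (F (Suc k)) (h k) (d k b)"
proof -
  have Fg: "abelian_group (F k)" for k by (rule F_group)
  let ?L = "\<lambda>k. linear_extension S (F k)"
  \<comment> \<open>On a cycle the term of the homotopy that passes through the differential of
    \<open>f\<close> is zero, so what remains there is \<open>D h f = f - w f\<close>; this form is
    the same in degree 0 and in higher degrees.\<close>
  let ?P = "\<lambda>k t. t \<in> B k \<rightarrow> carrier (F (Suc k)) \<and>
    (\<forall>f\<in>Z k. D k (?L (Suc k) t f) = f \<ominus>\<^bsub>F k\<^esub> ?L k (w k) f)"
  have wc: "?L k (w k) f \<in> carrier (F k)" if "f \<in> carrier (F k)" for k f
    by (rule left_module.linear_extension_closed[OF F_module w that])
  have "\<exists>h. \<forall>k. ?P k (h k) \<and>
    (\<forall>b\<in>B (Suc k). D (Suc k) (h (Suc k) b) =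
      basis_vector S b \<ominus>\<^bsub>F (Suc k)\<^esub> w (Suc k) b \<ominus>\<^bsub>F (Suc k)\<^esub> ?L (Suc k) (h k) (d k b))"
  proof (rule dependent_nat_choice)
    interpret F0: left_module S "F 0" by (rule F_module)
    have z: "basis_vector S b \<ominus>\<^bsub>F 0\<^esub> w 0 b \<in> Z 0" if "b \<in> B 0" for b
    proof -
      have c: "basis_vector S b \<in> carrier (F 0)" "w 0 b \<in> carrier (F 0)" "e b \<in> carrier X"
        by (rule R.basis_vector_closed[OF that] Pi_mem[OF w that] Pi_mem[OF e_closed that])+
      then show ?thesis
        using linear_map.diff[OF e_linear c(1,2)] that w0 linear_extension_basis_vector[of e b]
        by (simp add: cycle_0 M.diff_eq_zero_iff del: free_module_simps)
    qed
    have "\<forall>b\<in>B 0. \<exists>x. x \<in> carrier (F (Suc 0)) \<and> D 0 x = basis_vector S b \<ominus>\<^bsub>F 0\<^esub> w 0 b"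
      using z cycle_boundary by blast
    then obtain t where t: "\<forall>b\<in>B 0. t b \<in> carrier (F (Suc 0)) \<and> D 0 (t b) = basis_vector S b \<ominus>\<^bsub>F 0\<^esub> w 0 b"
      using bchoice by meson
    then have tc: "t \<in> B 0 \<rightarrow> carrier (F (Suc 0))" by auto
    have "D 0 (?L (Suc 0) t f) = f \<ominus>\<^bsub>F 0\<^esub> ?L 0 (w 0) f" if f: "f \<in> carrier (F 0)" for f
    proof -
      have "D 0 (?L (Suc 0) t f) = ?L 0 (\<lambda>b. D 0 (t b)) f"
        by (rule F0.linear_extension_compose[OF d_closed tc f])
      also have "\<dots> = ?L 0 (\<lambda>b. basis_vector S b \<ominus>\<^bsub>F 0\<^esub> w 0 b) f"
        by (rule F0.linear_extension_cong[OF f]) (use t D_closed in auto)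
      also have "\<dots> = f \<ominus>\<^bsub>F 0\<^esub> ?L 0 (w 0) f"
        using F0.linear_extension_diff[of "basis_vector S" "B 0" "w 0" f] w[of 0] f
        by (simp add: R.basis_vector_closed R.linear_extension_basis_expansion)
      finally show ?thesis .
    qed
    then have "?P 0 t" using tc cycle_closed by simp
    then show "\<exists>t. ?P 0 t" by (rule exI[of _ t])
  next
    fix t k assume t: "?P k t"
    interpret Fk: left_module S "F k" by (rule F_module)
    interpret Fs: left_module S "F (Suc k)" by (rule F_module)
    interpret Dk: linear_map S "F (Suc k)" "F k" "D k" by (rule D_linear)
    have tc: "t \<in> B k \<rightarrow> carrier (F (Suc k))" using t by auto
    \<comment> \<open>This element is a cycle: applied to the cycle \<open>d k b\<close>, the
      invariant says that the last term has boundary \<open>d k b - w (d k b)\<close>, and so has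
      the difference of the first two.\<close>
    let ?z = "\<lambda>b. basis_vector S b \<ominus>\<^bsub>F (Suc k)\<^esub> w (Suc k) b \<ominus>\<^bsub>F (Suc k)\<^esub> ?L (Suc k) t (d k b)"
    have zc: "basis_vector S b \<in> carrier (F (Suc k)) \<and> w (Suc k) b \<in> carrier (F (Suc k)) \<and>
        ?L (Suc k) t (d k b) \<in> carrier (F (Suc k))" if "b \<in> B (Suc k)" for b
      by (intro conjI R.basis_vector_closed[OF that] Pi_mem[OF w that] Fs.linear_extension_closed[OF tc d_in_F[OF that]])
    have z: "?z b \<in> Z (Suc k)" if b: "b \<in> B (Suc k)" for b
    proof -
      note c = zc[OF b]
      have "D k (?z b) = D k (basis_vector S b) \<ominus>\<^bsub>F k\<^esub> D k (w (Suc k) b) \<ominus>\<^bsub>F k\<^esub> D k (?L (Suc k) t (d k b))"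
        using c by (simp add: Dk.diff del: free_module_simps)
      also have "\<dots> = d k b \<ominus>\<^bsub>F k\<^esub> ?L k (w k) (d k b) \<ominus>\<^bsub>F k\<^esub> (d k b \<ominus>\<^bsub>F k\<^esub> ?L k (w k) (d k b))"
        using t d_cycle[OF b] by (simp add: D_basis_vector[OF b] wD[OF b])
      also have "\<dots> = \<zero>\<^bsub>F k\<^esub>"
        using d_in_F[OF b] wc[of "d k b" k] by (simp add: Fk.M.diff_eq_zero_iff del: free_module_simps)
      finally show ?thesis using c by (simp add: cycle_Suc del: free_module_simps)
    qed
    then have "\<forall>b\<in>B (Suc k). \<exists>x. x \<in> carrier (F (Suc (Suc k))) \<and> D (Suc k) x = ?z b"
      using cycle_boundary by blast
    then obtain t' where t': "\<forall>b\<in>B (Suc k). t' b \<in> carrier (F (Suc (Suc k))) \<and> D (Suc k) (t' b) = ?z b"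
      using bchoice by meson
    then have tc': "t' \<in> B (Suc k) \<rightarrow> carrier (F (Suc (Suc k)))" by auto
    have "D (Suc k) (?L (Suc (Suc k)) t' f) = f \<ominus>\<^bsub>F (Suc k)\<^esub> ?L (Suc k) (w (Suc k)) f"
      if f: "f \<in> Z (Suc k)" for f
    proof -
      have fc: "f \<in> carrier (F (Suc k))" using f by (rule cycle_closed)
      have bc: "basis_vector S \<in> B (Suc k) \<rightarrow> carrier (F (Suc k))" 
        by (rule funcsetI) (rule R.basis_vector_closed)
      have dc: "(\<lambda>b. ?L (Suc k) t (d k b)) \<in> B (Suc k) \<rightarrow> carrier (F (Suc k))"
        by (rule funcsetI) (rule zc[THEN conjunct2, THEN conjunct2])
      have "D (Suc k) (?L (Suc (Suc k)) t' f) = ?L (Suc k) (\<lambda>b. D (Suc k) (t' b)) f"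
        by (rule Fs.linear_extension_compose[OF d_closed tc' fc])
      also have "\<dots> = ?L (Suc k) ?z f"
        by (rule Fs.linear_extension_cong[OF fc]) (use t' D_closed in auto)
      also have "\<dots> = ?L (Suc k) (basis_vector S) f \<ominus>\<^bsub>F (Suc k)\<^esub> ?L (Suc k) (w (Suc k)) f \<ominus>\<^bsub>F (Suc k)\<^esub>
          ?L (Suc k) (\<lambda>b. ?L (Suc k) t (d k b)) f"
        using Fs.linear_extension_diff[OF bc w fc] bc w[of "Suc k"]
        by (subst Fs.linear_extension_diff[OF _ dc fc]) (use w[of "Suc k"] R.basis_vector_closed in \<open>auto intro!: Fs.M.minus_closed simp del: free_module_simps\<close>)
      also have "?L (Suc k) (basis_vector S) f = f" by (rule R.linear_extension_basis_expansion[OF fc])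
      also have "?L (Suc k) (\<lambda>b. ?L (Suc k) t (d k b)) f = ?L (Suc k) t (D k f)"
        by (rule Fs.linear_extension_compose[OF tc d_closed fc, symmetric])
      also have "\<dots> = \<zero>\<^bsub>F (Suc k)\<^esub>"
        using Fs.linear_extension_zero[OF tc] f by (simp add: cycle_Suc)
      finally show ?thesis using fc wc[OF fc] by (simp add: a_minus_def del: free_module_simps)
    qed
    with t' tc' show "\<exists>t'. ?P (Suc k) t' \<and> (\<forall>b\<in>B (Suc k). D (Suc k) (t' b) = ?z b)" by blast
  qed
  then obtain h where "\<forall>k. ?P k (h k) \<and>
    (\<forall>b\<in>B (Suc k). D (Suc k) (h (Suc k) b) =
      basis_vector S b \<ominus>\<^bsub>F (Suc k)\<^esub> w (Suc k) b \<ominus>\<^bsub>F (Suc k)\<^esub> ?L (Suc k) (h k) (d k b))" ..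
  then have h: "\<And>k. h k \<in> B k \<rightarrow> carrier (F (Suc k))"
    "\<And>k b. b \<in> B (Suc k) \<Longrightarrow> D (Suc k) (h (Suc k) b) =
      basis_vector S b \<ominus>\<^bsub>F (Suc k)\<^esub> w (Suc k) b \<ominus>\<^bsub>F (Suc k)\<^esub> ?L (Suc k) (h k) (d k b)"
    by (simp_all del: free_module_simps)
  show thesis
  proof (rule that[of h])
    fix k b assume b: "b \<in> B (Suc k)"
    interpret Fs: left_module S "F (Suc k)" by (rule F_module)
    have c: "basis_vector S b \<in> carrier (F (Suc k))" "w (Suc k) b \<in> carrier (F (Suc k))"
      "?L (Suc k) (h k) (d k b) \<in> carrier (F (Suc k))"
      by (rule R.basis_vector_closed[OF b] Pi_mem[OF w b] Fs.linear_extension_closed[OF h(1) d_in_F[OF b]])+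
    show "basis_vector S b = D (Suc k) (h (Suc k) b) \<oplus>\<^bsub>F (Suc k)\<^esub> w (Suc k) b \<oplus>\<^bsub>F (Suc k)\<^esub>
        ?L (Suc k) (h k) (d k b)"
      using Fs.M.diff_diff_add_cancel[OF c] by (simp only: h(2)[OF b])
  qed (rule h(1))
qed

text \<open>Take comparison maps \<open>u\<close> from \<open>B\<close> to \<open>B'\<close> and
  \<open>v\<close> back; their composite \<open>w\<close> on \<open>B'\<close> is homotopic to the
  identity by some \<open>h\<close>. A cocycle \<open>\<phi>\<close> on \<open>B'\<close> becomes a
  coboundary of some \<open>\<eta>\<close> after composition with \<open>u\<close>. Since
  \<open>\<phi>\<close> kills boundaries, the homotopy equation shows that \<open>\<phi>\<close> is
  the coboundary of \<open>\<eta> v + \<phi> h\<close>.\<close>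

lemma acyclic_for_transfer:
  assumes "free_resolution S X B d e" and "free_resolution S X B' d' e'"
    and "left_module S Y" and acyc: "acyclic_for S Y B d"
  shows "acyclic_for S Y B' d'"
  unfolding acyclic_for_def
proof (intro allI impI)
  fix k \<phi> assume \<phi>: "cocycle S Y B' d' (Suc k) \<phi>"
  interpret P: free_resolution S X B d e by fact
  interpret Q: free_resolution S X B' d' e' by fact
  interpret Y: left_module S Y by fact
  let ?L = "\<lambda>c. linear_extension S Y c"
  obtain u where u: "\<And>k. u k \<in> B k \<rightarrow> carrier (Q.F k)"
    "\<And>b. b \<in> B 0 \<Longrightarrow> linear_extension S X e' (u 0 b) = e b"
    "\<And>k b. b \<in> B (Suc k) \<Longrightarrow> Q.D k (u (Suc k) b) = linear_extension S (Q.F k) (u k) (d k b)"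
    using comparison_lift[OF assms(1,2)] by blast
  obtain v where v: "\<And>k. v k \<in> B' k \<rightarrow> carrier (P.F k)"
    "\<And>b. b \<in> B' 0 \<Longrightarrow> linear_extension S X e (v 0 b) = e' b"
    "\<And>k b. b \<in> B' (Suc k) \<Longrightarrow> P.D k (v (Suc k) b) = linear_extension S (P.F k) (v k) (d' k b)"
    using comparison_lift[OF assms(2,1)] by blast
  have vc: "b \<in> B' k \<Longrightarrow> v k b \<in> carrier (P.F k)" for k b by (rule Pi_mem[OF v(1)])
  define w where "w k b = linear_extension S (Q.F k) (u k) (v k b)" for k b
  have w1: "w k \<in> B' k \<rightarrow> carrier (Q.F k)" for k
    unfolding w_def by (rule funcsetI) (rule left_module.linear_extension_closed[OF Q.F_module u(1) vc])
  have w2: "linear_extension S X e' (w 0 b) = e' b" if b: "b \<in> B' 0" for b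
  proof -
    have "linear_extension S X e' (w 0 b) = linear_extension S X e (v 0 b)"
      unfolding w_def P.linear_extension_compose[OF Q.e_closed u(1) vc[OF b]]
      by (rule P.linear_extension_cong[OF vc[OF b]]) (use u(2) P.e_closed in auto)
    then show ?thesis using v(2)[OF b] by simp
  qed
  have w3: "Q.D k (w (Suc k) b) = linear_extension S (Q.F k) (w k) (d' k b)" if b: "b \<in> B' (Suc k)" for k b
  proof -
    interpret Qk: left_module S "Q.F k" by (rule Q.F_module)
    have "Q.D k (w (Suc k) b) = linear_extension S (Q.F k) (\<lambda>x. Q.D k (u (Suc k) x)) (v (Suc k) b)"
      unfolding w_def by (rule Qk.linear_extension_compose[OF Q.d_closed u(1) vc[OF b]])
    also have "\<dots> = linear_extension S (Q.F k) (\<lambda>x. linear_extension S (Q.F k) (u k) (d k x)) (v (Suc k) b)"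
      by (rule Qk.linear_extension_cong[OF vc[OF b]])
        (use u(1)[of "Suc k"] in \<open>auto simp flip: u(3) intro!: Q.D_closed\<close>)
    also have "\<dots> = linear_extension S (Q.F k) (u k) (P.D k (v (Suc k) b))"
      by (rule Qk.linear_extension_compose[OF u(1) P.d_closed vc[OF b], symmetric])
    also have "\<dots> = linear_extension S (Q.F k) (w k) (d' k b)"
      unfolding v(3)[OF b] w_def
      by (rule Qk.linear_extension_compose[OF u(1) v(1) Q.d_in_F[OF b]])
    finally show ?thesis .
  qed
  obtain h where h: "\<And>k. h k \<in> B' k \<rightarrow> carrier (Q.F (Suc k))"
    "\<And>k b. b \<in> B' (Suc k) \<Longrightarrow> basis_vector S b =
      Q.D (Suc k) (h (Suc k) b) \<oplus>\<^bsub>Q.F (Suc k)\<^esub> w (Suc k) b \<oplus>\<^bsub>Q.F (Suc k)\<^esub>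
        linear_extension S (Q.F (Suc k)) (h k) (d' k b)"
    using Q.homotopy_to_identity[OF w1 w2 w3] by blast
  have \<phi>c: "\<phi> \<in> B' (Suc k) \<rightarrow> carrier Y" using \<phi> by (simp add: cocycle_def)
  interpret L\<phi>: linear_map S "Q.F (Suc k)" Y "?L \<phi>" by (rule Y.linear_map_extension[OF \<phi>c])
  have "cocycle S Y B d (Suc k) (\<lambda>b. ?L \<phi> (u (Suc k) b))"
    unfolding cocycle_def
  proof (intro conjI ballI)
    show "(\<lambda>b. ?L \<phi> (u (Suc k) b)) \<in> B (Suc k) \<rightarrow> carrier Y"
      by (rule funcsetI) (rule L\<phi>.closed[OF Pi_mem[OF u(1)]])
    fix b assume b: "b \<in> B (Suc (Suc k))"
    have "?L (\<lambda>b. ?L \<phi> (u (Suc k) b)) (d (Suc k) b) = ?L \<phi> (Q.D (Suc k) (u (Suc (Suc k)) b))"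
      unfolding u(3)[OF b] by (rule Y.linear_extension_compose[OF \<phi>c u(1) P.d_in_F[OF b], symmetric])
    also have "\<dots> = \<zero>\<^bsub>Y\<^esub>"
      by (rule cocycle_boundary_zero[OF assms(3) \<phi> Q.d_closed]) (rule Pi_mem[OF u(1) b])
    finally show "?L (\<lambda>b. ?L \<phi> (u (Suc k) b)) (d (Suc k) b) = \<zero>\<^bsub>Y\<^esub>" .
  qed
  then obtain \<eta> where \<eta>: "\<eta> \<in> B k \<rightarrow> carrier Y"
    "\<And>b. b \<in> B (Suc k) \<Longrightarrow> ?L \<phi> (u (Suc k) b) = ?L \<eta> (d k b)"
    using acyc unfolding acyclic_for_def coboundary_def by meson
  show "coboundary S Y B' d' k \<phi>"
    unfolding coboundary_def
  proof (intro bexI ballI)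
    have c1: "(\<lambda>b. ?L \<eta> (v k b)) \<in> B' k \<rightarrow> carrier Y"
      by (rule funcsetI) (rule Y.linear_extension_closed[OF \<eta>(1) vc])
    have c2: "(\<lambda>b. ?L \<phi> (h k b)) \<in> B' k \<rightarrow> carrier Y" by (rule funcsetI) (rule L\<phi>.closed[OF Pi_mem[OF h(1)]])
    show "(\<lambda>b. ?L \<eta> (v k b) \<oplus>\<^bsub>Y\<^esub> ?L \<phi> (h k b)) \<in> B' k \<rightarrow> carrier Y" using c1 c2 by auto
    fix b assume b: "b \<in> B' (Suc k)"
    have hc: "h (Suc k) b \<in> carrier (Q.F (Suc (Suc k)))" by (rule Pi_mem[OF h(1) b])
    have c3: "Q.D (Suc k) (h (Suc k) b) \<in> carrier (Q.F (Suc k))" "w (Suc k) b \<in> carrier (Q.F (Suc k))"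
      "linear_extension S (Q.F (Suc k)) (h k) (d' k b) \<in> carrier (Q.F (Suc k))"
      by (rule Q.D_closed[OF hc] Pi_mem[OF w1 b] left_module.linear_extension_closed[OF Q.F_module h(1) Q.d_in_F[OF b]])+
    interpret Qs: left_module S "Q.F (Suc k)" by (rule Q.F_module)
    have "\<phi> b = ?L \<phi> (basis_vector S b)"
      by (rule Y.linear_extension_basis_vector[symmetric]) (rule Pi_mem[OF \<phi>c b])
    also have "\<dots> = ?L \<phi> (Q.D (Suc k) (h (Suc k) b)) \<oplus>\<^bsub>Y\<^esub> ?L \<phi> (w (Suc k) b) \<oplus>\<^bsub>Y\<^esub>
      ?L \<phi> (linear_extension S (Q.F (Suc k)) (h k) (d' k b))"
      unfolding h(2)[OF b] using c3 by (simp add: L\<phi>.add del: free_module_simps)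
    also have "?L \<phi> (Q.D (Suc k) (h (Suc k) b)) = \<zero>\<^bsub>Y\<^esub>"
      by (rule cocycle_boundary_zero[OF assms(3) \<phi> Q.d_closed hc])
    also have "?L \<phi> (linear_extension S (Q.F (Suc k)) (h k) (d' k b)) = ?L (\<lambda>b. ?L \<phi> (h k b)) (d' k b)"
      by (rule Y.linear_extension_compose[OF \<phi>c h(1) Q.d_in_F[OF b]])
    also have "?L \<phi> (w (Suc k) b) = ?L (\<lambda>x. ?L \<phi> (u (Suc k) x)) (v (Suc k) b)"
      unfolding w_def by (rule Y.linear_extension_compose[OF \<phi>c u(1) vc[OF b]])
    also have "\<dots> = ?L (\<lambda>x. ?L \<eta> (d k x)) (v (Suc k) b)"
      by (rule Y.linear_extension_cong[OF vc[OF b]]) (rule funcsetI, rule L\<phi>.closed[OF Pi_mem[OF u(1)]], assumption, rule \<eta>(2))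
    also have "\<dots> = ?L \<eta> (P.D k (v (Suc k) b))"
      by (rule Y.linear_extension_compose[OF \<eta>(1) P.d_closed vc[OF b], symmetric])
    also have "\<dots> = ?L (\<lambda>b. ?L \<eta> (v k b)) (d' k b)"
      unfolding v(3)[OF b] by (rule Y.linear_extension_compose[OF \<eta>(1) v(1) Q.d_in_F[OF b]])
    finally show "\<phi> b = ?L (\<lambda>b. ?L \<eta> (v k b) \<oplus>\<^bsub>Y\<^esub> ?L \<phi> (h k b)) (d' k b)"
      using Y.linear_extension_add[OF c1 c2 Q.d_in_F[OF b]]
        Y.linear_extension_closed[OF c1 Q.d_in_F[OF b]] by simp
  qed
qed

text \<open>That boundaries are cycles needs checking on basis elements only, by linearity. What is
  left to prove in applications is that the augmentation is onto and that every cycle is a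
  boundary.\<close>

lemma free_resolutionI:
  assumes "left_module S X" and e: "e \<in> B 0 \<rightarrow> carrier X"
    and "\<And>x. x \<in> carrier X \<Longrightarrow> \<exists>f\<in>carrier (free_module S (B 0)). linear_extension S X e f = x"
    and d: "\<And>k b. b \<in> B (Suc k) \<Longrightarrow> d k b \<in> cycles S X B d e k"
    and ex: "\<And>k f. f \<in> cycles S X B d e k \<Longrightarrow>
      \<exists>f'\<in>carrier (free_module S (B (Suc k))). linear_extension S (free_module S (B k)) (d k) f' = f"
  shows "free_resolution S X B d e"
proof -
  interpret left_module S X by fact
  let ?F = "\<lambda>k. free_module S (B k)" and ?Z = "cycles S X B d e"
  let ?D = "\<lambda>k. linear_extension S (?F k) (d k)"
  have F: "left_module S (?F k)" for k by (rule R.left_module_free)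
  have dc: "d k \<in> B (Suc k) \<rightarrow> carrier (?F k)" for k using d by (auto simp: cycles_def)
  have "?D k f \<in> ?Z k" if f: "f \<in> carrier (?F (Suc k))" for k f
  proof -
    have c: "?D k f \<in> carrier (?F k)" by (rule left_module.linear_extension_closed[OF F dc f])
    show ?thesis
    proof (cases k)
      case 0
      have "linear_extension S X e (?D 0 f) = linear_extension S X (\<lambda>b. linear_extension S X e (d 0 b)) f"
        by (rule linear_extension_compose[OF e dc]) (use f 0 in simp)
      also have "\<dots> = \<zero>\<^bsub>X\<^esub>"
        by (rule linear_extension_const_zero) (use f 0 d[of _ 0] in \<open>auto simp: cycles_def\<close>)
      finally show ?thesis using c 0 by (simp add: cycles_def)
    next
      case (Suc j)
      have "?D j (?D k f) = linear_extension S (?F j) (\<lambda>b. ?D j (d k b)) f"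
        by (rule left_module.linear_extension_compose[OF F]) (use f Suc dc in auto)
      also have "\<dots> = \<zero>\<^bsub>?F j\<^esub>"
        by (rule left_module.linear_extension_const_zero[OF F f]) (use Suc d[of _ k] in \<open>auto simp: cycles_def\<close>)
      finally show ?thesis using c Suc by (simp add: cycles_def)
    qed
  qed
  then have "?D k ` carrier (?F (Suc k)) = ?Z k" for k using ex by blast
  moreover have "linear_extension S X e ` carrier (?F 0) = carrier X"
    using assms(3) linear_extension_closed[OF e] by blast
  ultimately show ?thesis using e dc by unfold_locales auto
qed

section \<open>The resolution used in the definition of Ext\<close>

text \<open>The two successor clauses of \<open>syzygy_basis\<close> merge here, because
  \<open>cycles\<close> treats the augmentation as the map out of degree 0.\<close>

lemma syzygy_basis_Suc:
  "syzygy_basis S X (Suc k) = {Rel l | l. set l \<subseteq> carrier S \<times> syzygy_basis S X k \<and>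
    formal_sum S l \<in> carrier (free_module S (syzygy_basis S X k)) \<and>
    formal_sum S l \<in> cycles S X (syzygy_basis S X) (\<lambda>_. syzygy_boundary S) the_gen k}"
  if "ring S" for S (structure)
proof -
  interpret ring S by fact
  show ?thesis
    by (cases k) (auto simp: cycles_def Let_def formal_sum_closed)
qed

text \<open>A cycle is the formal sum of some list \<open>l\<close>; then \<open>Rel l\<close> is a
  basis element one degree up, and the differential sends its basis vector to that cycle. The
  differential is one function in all degrees, as it only reads the label.\<close>

lemma (in left_module) syzygy_resolution:
  "free_resolution R M (syzygy_basis R M) (\<lambda>_. syzygy_boundary R) the_gen"
proof (rule free_resolutionI)
  show "left_module R M" ..
  show "the_gen \<in> syzygy_basis R M 0 \<rightarrow> carrier M" by auto
  show "\<exists>f\<in>carrier (free_module R (syzygy_basis R M 0)). linear_extension R M the_gen f = x"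
    if "x \<in> carrier M" for x
    using that linear_extension_basis_vector[of the_gen "Gen x"]
    by (intro bexI[of _ "basis_vector R (Gen x)"] R.basis_vector_closed) auto
  fix k
  let ?Z = "cycles R M (syzygy_basis R M) (\<lambda>_. syzygy_boundary R) the_gen"
  let ?F = "\<lambda>k. free_module R (syzygy_basis R M k)"
  show "syzygy_boundary R b \<in> ?Z k" if "b \<in> syzygy_basis R M (Suc k)" for b
    using that unfolding syzygy_basis_Suc[OF R.ring_axioms] by (auto simp: syzygy_boundary_def)
  fix f assume f: "f \<in> ?Z k"
  then have fc: "f \<in> carrier (?F k)" by (simp add: cycles_def)
  then obtain l where l: "set l \<subseteq> carrier R \<times> syzygy_basis R M k" "formal_sum R l = f"
    using R.formal_sum_surj by blast
  then have b: "Rel l \<in> syzygy_basis R M (Suc k)"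
    using f fc unfolding syzygy_basis_Suc[OF R.ring_axioms] by auto
  have "linear_extension R (?F k) (syzygy_boundary R) (basis_vector R (Rel l)) = syzygy_boundary R (Rel l)"
    by (rule left_module.linear_extension_basis_vector[OF R.left_module_free])
      (use l fc in \<open>simp add: syzygy_boundary_def\<close>)
  then show "\<exists>f'\<in>carrier (?F (Suc k)). linear_extension R (?F k) (syzygy_boundary R) f' = f"
    using R.basis_vector_closed[OF b] l(2) by (auto simp: syzygy_boundary_def)
qed

section \<open>The horseshoe resolution of the middle term of a short exact sequence\<close>

locale short_exact_sequence = inj: linear_map S A X \<iota> + proj: linear_map S X C \<pi>
  for S (structure) and A (structure) and X (structure) and C (structure) and \<iota> and \<pi> +
  assumes inj_on: "inj_on \<iota> (carrier A)"
    and surj: "\<pi> ` carrier X = carrier C"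
    and exact: "\<iota> ` carrier A = {x \<in> carrier X. \<pi> x = \<zero>\<^bsub>C\<^esub>}"
begin

lemma proj_inj: "a \<in> carrier A \<Longrightarrow> \<pi> (\<iota> a) = \<zero>\<^bsub>C\<^esub>"
  using exact by auto

lemma inj_zero: "a \<in> carrier A \<Longrightarrow> \<iota> a = \<zero>\<^bsub>X\<^esub> \<Longrightarrow> a = \<zero>\<^bsub>A\<^esub>"
  using inj_on inj.zero inj.dom.M.zero_closed by (metis inj_onD)

end

text \<open>The free module on a disjoint union is the product of the two free modules: elements of
  the middle resolution are written as \<open>case_sum f g\<close>.\<close>

lemma case_sum_free_module [simp]:
  "case_sum f g \<in> carrier (free_module S (B1 <+> B2)) \<longleftrightarrow>
    f \<in> carrier (free_module S B1) \<and> g \<in> carrier (free_module S B2)"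
proof -
  have *: "{b. case_sum f g b \<noteq> \<zero>\<^bsub>S\<^esub>} = Inl ` {b. f b \<noteq> \<zero>\<^bsub>S\<^esub>} \<union> Inr ` {b. g b \<noteq> \<zero>\<^bsub>S\<^esub>}"
    by (auto simp: image_iff split: sum.splits) (metis sum.exhaust)+
  show ?thesis
    unfolding free_module_carrier * by (auto simp: finite_image_iff split: sum.splits)
qed

lemma free_module_case_sum:
  assumes "h \<in> carrier (free_module S (B1 <+> B2))"
  obtains f g where "h = case_sum f g" "f \<in> carrier (free_module S B1)" "g \<in> carrier (free_module S B2)"
proof -
  have "h = case_sum (h \<circ> Inl) (h \<circ> Inr)" by (auto simp: fun_eq_iff split: sum.splits)
  with assms show ?thesis using that by (metis case_sum_free_module)
qed

text \<open>\<open>case_sum f g\<close> is the sum of \<open>case_sum f 0\<close> and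
  \<open>case_sum 0 g\<close>. Each summand depends linearly on one variable, so it is enough to
  look at basis vectors, and these go to basis vectors with label \<open>Inl\<close> or
  \<open>Inr\<close>.\<close>

lemma (in left_module) linear_extension_case_sum:
  fixes B1 :: "'p set" and B2 :: "'q set"
  assumes "h \<in> B1 <+> B2 \<rightarrow> carrier M" "f \<in> carrier (free_module R B1)" "g \<in> carrier (free_module R B2)"
  shows "linear_extension R M h (case_sum f g) =
    linear_extension R M (\<lambda>b. h (Inl b)) f \<oplus>\<^bsub>M\<^esub> linear_extension R M (\<lambda>b. h (Inr b)) g"
proof -
  let ?z = "\<lambda>_. \<zero>\<^bsub>R\<^esub>"
  have z: "?z \<in> carrier (free_module R B)" for B :: "'t set" by (simp add: free_module_carrier)
  have hc: "b \<in> B1 \<Longrightarrow> h (Inl b) \<in> carrier M" "b' \<in> B2 \<Longrightarrow> h (Inr b') \<in> carrier M" for b b'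
    using assms(1) by auto
  interpret H: linear_map R "free_module R (B1 <+> B2)" M "linear_extension R M h"
    by (rule linear_map_extension[OF assms(1)])
  have 1: "case_sum f g = case_sum f ?z \<oplus>\<^bsub>free_module R (B1 <+> B2)\<^esub> case_sum ?z g"
    using assms by (auto simp: fun_eq_iff free_module_carrier split: sum.splits)
  have "linear_map R (free_module R B1) (free_module R (B1 <+> B2)) (\<lambda>f. case_sum f ?z)"
    unfolding linear_map_iff
    by (auto simp: R.left_module_free z fun_eq_iff split: sum.splits)
  from linear_map_on_free[OF linear_map_comp[OF this H.linear_map_axioms] assms(2)]
  have 2: "linear_extension R M h (case_sum f ?z) =
      linear_extension R M (\<lambda>b. linear_extension R M h (case_sum (basis_vector R b) ?z)) f" .
  have "case_sum (basis_vector R b) ?z = basis_vector R (Inl b :: 'p + 'q)" for b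
    by (auto simp: fun_eq_iff basis_vector_def split: sum.splits)
  then have 3: "linear_extension R M h (case_sum f ?z) = linear_extension R M (\<lambda>b. h (Inl b)) f"
    unfolding 2 using hc
    by (intro linear_extension_cong[OF assms(2)]) (auto simp: linear_extension_basis_vector)
  have "linear_map R (free_module R B2) (free_module R (B1 <+> B2)) (\<lambda>f. case_sum ?z f)"
    unfolding linear_map_iff
    by (auto simp: R.left_module_free z fun_eq_iff split: sum.splits)
  from linear_map_on_free[OF linear_map_comp[OF this H.linear_map_axioms] assms(3)]
  have 4: "linear_extension R M h (case_sum ?z g) =
      linear_extension R M (\<lambda>b. linear_extension R M h (case_sum ?z (basis_vector R b))) g" .
  have "case_sum ?z (basis_vector R b) = basis_vector R (Inr b :: 'p + 'q)" for b
    by (auto simp: fun_eq_iff basis_vector_def split: sum.splits)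
  then have 5: "linear_extension R M h (case_sum ?z g) = linear_extension R M (\<lambda>b. h (Inr b)) g"
    unfolding 4 using hc
    by (intro linear_extension_cong[OF assms(3)]) (auto simp: linear_extension_basis_vector)
  show ?thesis unfolding 1 3[symmetric] 5[symmetric]
    by (rule H.add) (use assms z in auto)
qed


lemma (in left_module) linear_extension_case_sum_values:
  assumes "p \<in> B \<rightarrow> carrier (free_module R B1)" "q \<in> B \<rightarrow> carrier (free_module R B2)"
    "f \<in> carrier (free_module R B)"
  shows "linear_extension R (free_module R (B1 <+> B2)) (\<lambda>b. case_sum (p b) (q b)) f =
    case_sum (linear_extension R (free_module R B1) p f) (linear_extension R (free_module R B2) q f)"
    (is "?L = _")
proof -
  have 1: "linear_map R (free_module R (B1 <+> B2)) (free_module R B1) (\<lambda>h. h \<circ> Inl)"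
    unfolding linear_map_iff
    by (auto simp: R.left_module_free fun_eq_iff comp_def elim!: free_module_case_sum)
  have 2: "linear_map R (free_module R (B1 <+> B2)) (free_module R B2) (\<lambda>h. h \<circ> Inr)"
    unfolding linear_map_iff
    by (auto simp: R.left_module_free fun_eq_iff comp_def elim!: free_module_case_sum)
  have c: "(\<lambda>b. case_sum (p b) (q b)) \<in> B \<rightarrow> carrier (free_module R (B1 <+> B2))"
    using assms by auto
  have "?L \<circ> Inl = linear_extension R (free_module R B1) p f"
    using linear_map.linear_extension[OF 1 c assms(3)] by (simp add: comp_def)
  moreover have "?L \<circ> Inr = linear_extension R (free_module R B2) q f"
    using linear_map.linear_extension[OF 2 c assms(3)] by (simp add: comp_def)
  ultimately show ?thesis by (auto simp: fun_eq_iff split: sum.splits)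
qed

text \<open>The differential on the middle resolution is to be a triangular matrix with
  \<open>d1\<close> and \<open>d2\<close> on the diagonal and \<open>\<theta>\<close> in the corner,
  and the augmentation is the row of \<open>\<iota> e1\<close> and \<open>s\<close>. The conditions
  \<open>\<theta>_0\<close> and \<open>\<theta>_Suc\<close>, with their signs, say that consecutive
  maps compose to zero. Note the drop of degree: \<open>\<theta> k\<close> goes from degree
  \<open>Suc k\<close> of \<open>C\<close> to degree \<open>k\<close> of \<open>A\<close>.\<close>

locale horseshoe = short_exact_sequence S A X C \<iota> \<pi> +
    P: free_resolution S A B1 d1 e1 + Q: free_resolution S C B2 d2 e2
  for S :: "('s, 'e) ring_scheme" (structure) and A :: "('s, 'a, 'fa) module_scheme" (structure)
    and X :: "('s, 'x, 'fx) module_scheme" (structure) and C :: "('s, 'c, 'fc) module_scheme" (structure)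
    and \<iota> \<pi> and B1 :: "nat \<Rightarrow> 'b1 set" and d1 e1 and B2 :: "nat \<Rightarrow> 'b2 set" and d2 e2 +
  fixes s :: "'b2 \<Rightarrow> 'x" and \<theta> :: "nat \<Rightarrow> 'b2 \<Rightarrow> 'b1 \<Rightarrow> 's"
  assumes s_closed: "s \<in> B2 0 \<rightarrow> carrier X"
    and s_lift: "b \<in> B2 0 \<Longrightarrow> \<pi> (s b) = e2 b"
    and \<theta>_closed: "\<theta> k \<in> B2 (Suc k) \<rightarrow> carrier (free_module S (B1 k))"
    and \<theta>_0: "b \<in> B2 (Suc 0) \<Longrightarrow>
      \<iota> (linear_extension S A e1 (\<theta> 0 b)) = \<ominus>\<^bsub>X\<^esub> linear_extension S X s (d2 0 b)"
    and \<theta>_Suc: "b \<in> B2 (Suc (Suc k)) \<Longrightarrow>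
      linear_extension S (free_module S (B1 k)) (d1 k) (\<theta> (Suc k) b) =
        \<ominus>\<^bsub>free_module S (B1 k)\<^esub> linear_extension S (free_module S (B1 k)) (\<theta> k) (d2 (Suc k) b)"

text \<open>\<open>s\<close> lifts the augmentation of \<open>C\<close> through the surjection
  \<open>\<pi>\<close>, and the corner entries \<open>\<theta>\<close> are then found by recursion
  on the degree, each as a preimage under the resolution of \<open>A\<close>.\<close>

lemma horseshoe_exists:
  assumes "short_exact_sequence S A X C \<iota> \<pi>" "free_resolution S A B1 d1 e1" "free_resolution S C B2 d2 e2"
  obtains s \<theta> where "horseshoe S A X C \<iota> \<pi> B1 d1 e1 B2 d2 e2 s \<theta>"
proof -
  interpret short_exact_sequence S A X C \<iota> \<pi> by fact
  interpret P: free_resolution S A B1 d1 e1 by fact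
  interpret Q: free_resolution S C B2 d2 e2 by fact
  have "\<forall>b\<in>B2 0. \<exists>x. x \<in> carrier X \<and> \<pi> x = e2 b"
  proof
    fix b assume "b \<in> B2 0"
    then have "e2 b \<in> \<pi> ` carrier X" unfolding surj by (rule Pi_mem[OF Q.e_closed])
    then show "\<exists>x. x \<in> carrier X \<and> \<pi> x = e2 b" by auto
  qed
  then obtain s where s: "\<forall>b\<in>B2 0. s b \<in> carrier X \<and> \<pi> (s b) = e2 b" using bchoice by meson
  then have sc: "s \<in> B2 0 \<rightarrow> carrier X" by auto
  have \<pi>s: "\<pi> (linear_extension S X s f) = linear_extension S C e2 f" if "f \<in> carrier (Q.F 0)" for f
    unfolding proj.linear_extension[OF sc that]
    by (rule proj.cod.linear_extension_cong[OF that]) (use s Q.e_closed in auto)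
  \<comment> \<open>As in the comparison of resolutions, the invariant is that cycles go to cycles,
    here with a drop of one degree. The clause for \<open>k = 0\<close> stores the equation that
    links \<open>\<theta> 0\<close> with \<open>s\<close>.\<close>
  let ?P = "\<lambda>k t. t \<in> B2 (Suc k) \<rightarrow> carrier (P.F k) \<and>
    (\<forall>f\<in>Q.Z (Suc k). linear_extension S (P.F k) t f \<in> P.Z k) \<and>
    (k = 0 \<longrightarrow> (\<forall>b\<in>B2 (Suc 0). \<iota> (linear_extension S A e1 (t b)) = \<ominus>\<^bsub>X\<^esub> linear_extension S X s (d2 0 b)))"
  have "\<exists>\<theta>. \<forall>k. ?P k (\<theta> k) \<and> (\<forall>b\<in>B2 (Suc (Suc k)). P.D k (\<theta> (Suc k) b) =
    \<ominus>\<^bsub>P.F k\<^esub> linear_extension S (P.F k) (\<theta> k) (d2 (Suc k) b))"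
  proof (rule dependent_nat_choice)
    have "\<forall>b\<in>B2 (Suc 0). \<exists>x. x \<in> carrier (P.F 0) \<and>
      \<iota> (linear_extension S A e1 x) = \<ominus>\<^bsub>X\<^esub> linear_extension S X s (d2 0 b)"
    proof
      fix b assume b: "b \<in> B2 (Suc 0)"
      have c: "linear_extension S X s (d2 0 b) \<in> carrier X"
        by (rule inj.cod.linear_extension_closed[OF sc Q.d_in_F[OF b]])
      then have "\<pi> (\<ominus>\<^bsub>X\<^esub> linear_extension S X s (d2 0 b)) = \<zero>\<^bsub>C\<^esub>"
        using \<pi>s[OF Q.d_in_F[OF b]] by (simp add: proj.minus Q.e_d[OF b])
      \<comment> \<open>\<open>\<pi>\<close> kills this element because the augmentation of
        \<open>C\<close> kills \<open>d2 0 b\<close>; hence it comes from \<open>A\<close>, where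
        \<open>e1\<close> is onto.\<close>
      then have "\<ominus>\<^bsub>X\<^esub> linear_extension S X s (d2 0 b) \<in> \<iota> ` carrier A" using c exact by simp
      then show "\<exists>x. x \<in> carrier (P.F 0) \<and> \<iota> (linear_extension S A e1 x) = \<ominus>\<^bsub>X\<^esub> linear_extension S X s (d2 0 b)"
        unfolding P.surj[symmetric] by auto
    qed
    then obtain t where t: "\<forall>b\<in>B2 (Suc 0). t b \<in> carrier (P.F 0) \<and>
        \<iota> (linear_extension S A e1 (t b)) = \<ominus>\<^bsub>X\<^esub> linear_extension S X s (d2 0 b)"
      using bchoice by meson
    then have tc: "t \<in> B2 (Suc 0) \<rightarrow> carrier (P.F 0)" by auto
    have "linear_extension S (P.F 0) t f \<in> P.Z 0" if f: "f \<in> Q.Z (Suc 0)" for f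
    proof -
      have fc: "f \<in> carrier (Q.F (Suc 0))" using f by (rule Q.cycle_closed)
      have tf: "linear_extension S (P.F 0) t f \<in> carrier (P.F 0)"
        by (rule left_module.linear_extension_closed[OF P.F_module tc fc])
      have ec: "(\<lambda>b. linear_extension S A e1 (t b)) \<in> B2 (Suc 0) \<rightarrow> carrier A"
        using inj.dom.linear_extension_closed[OF P.e_closed] tc by (simp add: Pi_iff)
      have sd: "(\<lambda>b. linear_extension S X s (d2 0 b)) \<in> B2 (Suc 0) \<rightarrow> carrier X"
        by (rule funcsetI) (rule inj.cod.linear_extension_closed[OF sc Q.d_in_F])
      have "\<iota> (linear_extension S A e1 (linear_extension S (P.F 0) t f)) =
          linear_extension S X (\<lambda>b. \<iota> (linear_extension S A e1 (t b))) f"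
        unfolding inj.dom.linear_extension_compose[OF P.e_closed tc fc] by (rule inj.linear_extension[OF ec fc])
      also have "\<dots> = linear_extension S X (\<lambda>b. \<ominus>\<^bsub>X\<^esub> linear_extension S X s (d2 0 b)) f"
        by (rule inj.cod.linear_extension_cong[OF fc]) (use t ec inj.closed in auto)
      also have "\<dots> = \<ominus>\<^bsub>X\<^esub> linear_extension S X s (Q.D 0 f)"
        unfolding inj.cod.linear_extension_minus[OF sd fc] inj.cod.linear_extension_compose[OF sc Q.d_closed fc] ..
      also have "\<dots> = \<zero>\<^bsub>X\<^esub>"
        using inj.cod.linear_extension_zero[OF sc] f by (simp add: Q.cycle_Suc)
      finally show ?thesis
        using tf inj_zero inj.dom.linear_extension_closed[OF P.e_closed tf] by (simp add: P.cycle_0)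
    qed
    with t tc have "?P 0 t" by simp
    then show "\<exists>t. ?P 0 t" by (rule exI[of _ t])
  next
    fix t k assume t: "?P k t"
    interpret Pk: left_module S "P.F k" by (rule P.F_module)
    have tc: "t \<in> B2 (Suc k) \<rightarrow> carrier (P.F k)" using t by auto
    have tZ: "linear_extension S (P.F k) t f \<in> P.Z k" if "f \<in> Q.Z (Suc k)" for f using t that by blast
    have "\<forall>b\<in>B2 (Suc (Suc k)). \<exists>x. x \<in> carrier (P.F (Suc k)) \<and>
      P.D k x = \<ominus>\<^bsub>P.F k\<^esub> linear_extension S (P.F k) t (d2 (Suc k) b)"
    proof
      fix b assume b: "b \<in> B2 (Suc (Suc k))"
      \<comment> \<open>The invariant makes the image of the cycle \<open>d2 (Suc k) b\<close> a
        cycle, so it has a preimage \<open>x\<close>; the sign is put right by taking the negative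
        of \<open>x\<close>.\<close>
      obtain x where x: "x \<in> carrier (P.F (Suc k))" "P.D k x = linear_extension S (P.F k) t (d2 (Suc k) b)"
        using P.cycle_boundary[OF tZ[OF Q.d_cycle[OF b]]] by auto
      interpret Ps: left_module S "P.F (Suc k)" by (rule P.F_module)
      show "\<exists>x. x \<in> carrier (P.F (Suc k)) \<and>
          P.D k x = \<ominus>\<^bsub>P.F k\<^esub> linear_extension S (P.F k) t (d2 (Suc k) b)"
        using x linear_map.minus[OF P.D_linear x(1)] by (intro exI[of _ "\<ominus>\<^bsub>P.F (Suc k)\<^esub> x"]) simp
    qed
    then obtain t' where t': "\<forall>b\<in>B2 (Suc (Suc k)). t' b \<in> carrier (P.F (Suc k)) \<and>
      P.D k (t' b) = \<ominus>\<^bsub>P.F k\<^esub> linear_extension S (P.F k) t (d2 (Suc k) b)"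
      using bchoice by meson
    then have tc': "t' \<in> B2 (Suc (Suc k)) \<rightarrow> carrier (P.F (Suc k))" by auto
    have "linear_extension S (P.F (Suc k)) t' f \<in> P.Z (Suc k)" if f: "f \<in> Q.Z (Suc (Suc k))" for f
    proof -
      have fc: "f \<in> carrier (Q.F (Suc (Suc k)))" using f by (rule Q.cycle_closed)
      have td: "(\<lambda>b. linear_extension S (P.F k) t (d2 (Suc k) b)) \<in> B2 (Suc (Suc k)) \<rightarrow> carrier (P.F k)"
        by (rule funcsetI) (rule Pk.linear_extension_closed[OF tc Q.d_in_F])
      have "P.D k (linear_extension S (P.F (Suc k)) t' f) = linear_extension S (P.F k) (\<lambda>b. P.D k (t' b)) f"
        by (rule Pk.linear_extension_compose[OF P.d_closed tc' fc])
      also have "\<dots> = linear_extension S (P.F k) (\<lambda>b. \<ominus>\<^bsub>P.F k\<^esub> linear_extension S (P.F k) t (d2 (Suc k) b)) f"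
        by (rule Pk.linear_extension_cong[OF fc]) (use t' tc' P.D_closed in auto)
      also have "\<dots> = \<ominus>\<^bsub>P.F k\<^esub> linear_extension S (P.F k) t (Q.D (Suc k) f)"
        unfolding Pk.linear_extension_minus[OF td fc] Pk.linear_extension_compose[OF tc Q.d_closed fc] ..
      also have "\<dots> = \<zero>\<^bsub>P.F k\<^esub>"
      proof -
        have "Q.D (Suc k) f = \<zero>\<^bsub>Q.F (Suc k)\<^esub>" using f by (simp add: Q.cycle_Suc)
        then show ?thesis using linear_map.zero[OF Pk.linear_map_extension[OF tc]] Pk.M.a_inv_zero by metis
      qed
      finally show ?thesis
        using left_module.linear_extension_closed[OF P.F_module tc' fc] by (simp add: P.cycle_Suc)
    qed
    with t' tc' show "\<exists>t'. ?P (Suc k) t' \<and> (\<forall>b\<in>B2 (Suc (Suc k)). P.D k (t' b) =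
        \<ominus>\<^bsub>P.F k\<^esub> linear_extension S (P.F k) t (d2 (Suc k) b))"
      by (intro exI[of _ t']) simp
  qed
  then obtain \<theta> where \<theta>: "\<forall>k. ?P k (\<theta> k) \<and> (\<forall>b\<in>B2 (Suc (Suc k)). P.D k (\<theta> (Suc k) b) =
    \<ominus>\<^bsub>P.F k\<^esub> linear_extension S (P.F k) (\<theta> k) (d2 (Suc k) b))" ..
  have "horseshoe S A X C \<iota> \<pi> B1 d1 e1 B2 d2 e2 s \<theta>"
  proof
    fix k show "\<theta> k \<in> B2 (Suc k) \<rightarrow> carrier (P.F k)" using \<theta> by auto
  qed (use s sc \<theta> in \<open>auto simp del: free_module_simps\<close>)
  then show thesis by (rule that)
qed

context horseshoe
begin

abbreviation "B k \<equiv> B1 k <+> B2 k"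

definition d :: "nat \<Rightarrow> 'b1 + 'b2 \<Rightarrow> 'b1 + 'b2 \<Rightarrow> 's" where
  "d k = case_sum (\<lambda>b. case_sum (d1 k b) (\<lambda>_. \<zero>)) (\<lambda>b. case_sum (\<theta> k b) (d2 k b))"

definition e :: "'b1 + 'b2 \<Rightarrow> 'x" where
  "e = case_sum (\<lambda>b. \<iota> (e1 b)) s"

lemma zero_in_free: "(\<lambda>_. \<zero>) \<in> carrier (free_module S I)"
  by (simp add: free_module_carrier)

lemma e_closed: "e \<in> B 0 \<rightarrow> carrier X"
  using s_closed P.e_closed inj.closed by (auto simp: e_def Pi_iff)

lemma d_closed: "d k \<in> B (Suc k) \<rightarrow> carrier (free_module S (B k))"
  using \<theta>_closed[of k] P.d_closed Q.d_closed by (auto simp: d_def Pi_iff zero_in_free)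

lemma extension_e:
  assumes "f \<in> carrier (P.F 0)" "g \<in> carrier (Q.F 0)"
  shows "linear_extension S X e (case_sum f g) =
    \<iota> (linear_extension S A e1 f) \<oplus>\<^bsub>X\<^esub> linear_extension S X s g"
  using inj.cod.linear_extension_case_sum[OF e_closed assms] inj.linear_extension[OF P.e_closed assms(1)]
  by (simp add: e_def)

lemma extension_d:
  assumes f: "f \<in> carrier (P.F (Suc k))" and g: "g \<in> carrier (Q.F (Suc k))"
  shows "linear_extension S (free_module S (B k)) (d k) (case_sum f g) =
    case_sum (P.D k f \<oplus>\<^bsub>P.F k\<^esub> linear_extension S (P.F k) (\<theta> k) g) (Q.D k g)"
proof -
  have "linear_extension S (free_module S (B k)) (\<lambda>b. d k (Inl b)) f =
      case_sum (P.D k f) (linear_extension S (Q.F k) (\<lambda>_ _. \<zero>) f)"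
    using inj.dom.linear_extension_case_sum_values[OF P.d_closed _ f, of "\<lambda>_ _. \<zero>" "B2 k"]
    by (simp add: d_def zero_in_free)
  moreover have "linear_extension S (Q.F k) (\<lambda>_ _. \<zero>) f = (\<lambda>_. \<zero>)"
    using left_module.linear_extension_const_zero[OF Q.F_module f, of "\<lambda>_ _. \<zero>" k] by simp
  moreover have "linear_extension S (free_module S (B k)) (\<lambda>b. d k (Inr b)) g =
      case_sum (linear_extension S (P.F k) (\<theta> k) g) (Q.D k g)"
    using inj.dom.linear_extension_case_sum_values[OF \<theta>_closed Q.d_closed g] by (simp add: d_def)
  moreover have "Q.D k g b \<in> carrier S" for b using Q.D_closed[OF g] by (simp add: free_module_carrier)
  ultimately show ?thesis
    unfolding left_module.linear_extension_case_sum[OF inj.dom.R.left_module_free d_closed f g]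
    by (auto simp: fun_eq_iff split: sum.splits)
qed

lemma \<theta>_boundary_0:
  assumes g: "g \<in> carrier (Q.F (Suc 0))"
  shows "\<iota> (linear_extension S A e1 (linear_extension S (P.F 0) (\<theta> 0) g)) = \<ominus>\<^bsub>X\<^esub> linear_extension S X s (Q.D 0 g)"
proof -
  have ec: "(\<lambda>b. linear_extension S A e1 (\<theta> 0 b)) \<in> B2 (Suc 0) \<rightarrow> carrier A"
    using inj.dom.linear_extension_closed[OF P.e_closed] \<theta>_closed[of 0] by (simp add: Pi_iff)
  have sd: "(\<lambda>b. linear_extension S X s (d2 0 b)) \<in> B2 (Suc 0) \<rightarrow> carrier X"
    by (rule funcsetI) (rule inj.cod.linear_extension_closed[OF s_closed Q.d_in_F])
  have "\<iota> (linear_extension S A e1 (linear_extension S (P.F 0) (\<theta> 0) g)) =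
      linear_extension S X (\<lambda>b. \<iota> (linear_extension S A e1 (\<theta> 0 b))) g"
    unfolding inj.dom.linear_extension_compose[OF P.e_closed \<theta>_closed g] by (rule inj.linear_extension[OF ec g])
  also have "\<dots> = linear_extension S X (\<lambda>b. \<ominus>\<^bsub>X\<^esub> linear_extension S X s (d2 0 b)) g"
    by (rule inj.cod.linear_extension_cong[OF g]) (use \<theta>_0 ec inj.closed in auto)
  also have "\<dots> = \<ominus>\<^bsub>X\<^esub> linear_extension S X s (Q.D 0 g)"
    unfolding inj.cod.linear_extension_minus[OF sd g] inj.cod.linear_extension_compose[OF s_closed Q.d_closed g] ..
  finally show ?thesis .
qed

lemma \<theta>_boundary_Suc:
  assumes g: "g \<in> carrier (Q.F (Suc (Suc k)))"
  shows "P.D k (linear_extension S (P.F (Suc k)) (\<theta> (Suc k)) g) =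
    \<ominus>\<^bsub>P.F k\<^esub> linear_extension S (P.F k) (\<theta> k) (Q.D (Suc k) g)"
proof -
  interpret Pk: left_module S "P.F k" by (rule P.F_module)
  have td: "(\<lambda>b. linear_extension S (P.F k) (\<theta> k) (d2 (Suc k) b)) \<in> B2 (Suc (Suc k)) \<rightarrow> carrier (P.F k)"
    by (rule funcsetI) (rule Pk.linear_extension_closed[OF \<theta>_closed Q.d_in_F])
  have "P.D k (linear_extension S (P.F (Suc k)) (\<theta> (Suc k)) g) =
      linear_extension S (P.F k) (\<lambda>b. P.D k (\<theta> (Suc k) b)) g"
    by (rule Pk.linear_extension_compose[OF P.d_closed \<theta>_closed g])
  also have "\<dots> = linear_extension S (P.F k) (\<lambda>b. \<ominus>\<^bsub>P.F k\<^esub> linear_extension S (P.F k) (\<theta> k) (d2 (Suc k) b)) g"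
    by (rule Pk.linear_extension_cong[OF g], rule funcsetI, rule P.D_closed, rule Pi_mem[OF \<theta>_closed],
        assumption, rule \<theta>_Suc)
  also have "\<dots> = \<ominus>\<^bsub>P.F k\<^esub> linear_extension S (P.F k) (\<theta> k) (Q.D (Suc k) g)"
    unfolding Pk.linear_extension_minus[OF td g] Pk.linear_extension_compose[OF \<theta>_closed Q.d_closed g] ..
  finally show ?thesis .
qed

lemma proj_s: "g \<in> carrier (Q.F 0) \<Longrightarrow> \<pi> (linear_extension S X s g) = linear_extension S C e2 g"
  unfolding proj.linear_extension[OF s_closed]
  by (rule proj.cod.linear_extension_cong) (use s_lift proj.closed s_closed in \<open>auto simp: Pi_iff\<close>)

text \<open>The augmentation is onto since an element of \<open>X\<close> can be corrected, by an
  element in the image of \<open>s\<close>, to one in the image of \<open>\<iota>\<close>. For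
  exactness, let \<open>case_sum f g\<close> be a cycle. Then \<open>g\<close> is a cycle over
  \<open>C\<close>, hence the boundary of some \<open>g'\<close>; subtracting the corner term
  \<open>\<theta> g'\<close> from \<open>f\<close> leaves a cycle over \<open>A\<close>, the
  boundary of some \<open>f'\<close>, and \<open>case_sum f' g'\<close> is the required
  preimage.\<close>

lemma resolution: "free_resolution S X B d e"
proof (rule free_resolutionI)
  show "left_module S X" by (rule inj.cod.left_module_axioms)
  show "e \<in> B 0 \<rightarrow> carrier X" by (rule e_closed)
  show "\<exists>f\<in>carrier (free_module S (B 0)). linear_extension S X e f = x" if x: "x \<in> carrier X" for x
  proof -
    have "\<pi> x \<in> linear_extension S C e2 ` carrier (Q.F 0)" unfolding Q.surj using x proj.closed by simp
    then obtain g where g: "g \<in> carrier (Q.F 0)" "linear_extension S C e2 g = \<pi> x" by auto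
    have sg: "linear_extension S X s g \<in> carrier X" by (rule inj.cod.linear_extension_closed[OF s_closed g(1)])
    then have "x \<ominus>\<^bsub>X\<^esub> linear_extension S X s g \<in> \<iota> ` carrier A"
      unfolding exact using x proj_s[OF g(1)] g(2) proj.closed[OF x]
      by (simp add: proj.diff proj.cod.M.diff_eq_zero_iff)
    then obtain f where f: "f \<in> carrier (P.F 0)" "\<iota> (linear_extension S A e1 f) = x \<ominus>\<^bsub>X\<^esub> linear_extension S X s g"
      unfolding P.surj[symmetric] by auto
    then show ?thesis
      using g x sg by (intro bexI[of _ "case_sum f g"]) (simp_all add: extension_e inj.cod.M.diff_add_cancel)
  qed
next
  fix k b assume b: "b \<in> B (Suc k)"
  have c: "d k b \<in> carrier (free_module S (B k))" by (rule Pi_mem[OF d_closed b])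
  show "d k b \<in> cycles S X B d e k"
  proof (cases b)
    case (Inl a)
    with b have a: "a \<in> B1 (Suc k)" by auto
    have k: "d k b = case_sum (d1 k a) (\<lambda>_. \<zero>)" using Inl by (simp add: d_def)
    show ?thesis
    proof (cases k)
      case 0
      have "linear_extension S X s (\<lambda>_. \<zero>) = \<zero>\<^bsub>X\<^esub>" by (rule inj.cod.linear_extension_zero[OF s_closed])
      then show ?thesis using c a 0 unfolding k
        by (simp add: cycles_def extension_e zero_in_free P.d_in_F P.e_d inj.zero)
    next
      case (Suc j)
      have *: "linear_extension S (P.F j) (\<theta> j) (\<lambda>_. \<zero>) = (\<lambda>_. \<zero>)" "Q.D j (\<lambda>_. \<zero>) = (\<lambda>_. \<zero>)"
        using left_module.linear_extension_zero[OF P.F_module \<theta>_closed]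
          left_module.linear_extension_zero[OF Q.F_module Q.d_closed] by auto
      show ?thesis using c a P.d_in_F[OF a] P.D_d[of a j] Suc unfolding k
        by (auto simp: cycles_def extension_d zero_in_free * fun_eq_iff split: sum.splits)
    qed
  next
    case (Inr a)
    with b have a: "a \<in> B2 (Suc k)" by auto
    have k: "d k b = case_sum (\<theta> k a) (d2 k a)" using Inr by (simp add: d_def)
    have \<theta>a: "\<theta> k a \<in> carrier (P.F k)" by (rule Pi_mem[OF \<theta>_closed a])
    show ?thesis
    proof (cases k)
      case 0
      then show ?thesis using c a \<theta>a Q.d_in_F[OF a] \<theta>_0[of a]
          inj.cod.linear_extension_closed[OF s_closed, of "d2 0 a"] unfolding k
        by (simp add: cycles_def extension_e inj.cod.M.l_neg)
    next
      case (Suc j)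
      have "linear_extension S (P.F j) (\<theta> j) (d2 k a) \<in> carrier (P.F j)"
        using left_module.linear_extension_closed[OF P.F_module \<theta>_closed] Q.d_in_F[OF a] Suc by blast
      then have "P.D j (\<theta> k a) \<oplus>\<^bsub>P.F j\<^esub> linear_extension S (P.F j) (\<theta> j) (d2 k a) = \<zero>\<^bsub>P.F j\<^esub>"
        using \<theta>_Suc[of a j] a Suc abelian_group.l_neg[OF P.F_group] by (simp del: free_module_simps)
      then show ?thesis using c a \<theta>a Q.d_in_F[OF a] Q.D_d[of a j] Suc unfolding k
        by (auto simp: cycles_def extension_d fun_eq_iff split: sum.splits)
    qed
  qed
next
  fix k h assume h: "h \<in> cycles S X B d e k"
  then have "h \<in> carrier (free_module S (B k))" by (simp add: cycles_def)
  then obtain f g where fg: "h = case_sum f g" and f: "f \<in> carrier (P.F k)" and g: "g \<in> carrier (Q.F k)"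
    by (rule free_module_case_sum)
  interpret Pk: left_module S "P.F k" by (rule P.F_module)
  have "g \<in> Q.Z k"
  proof (cases k)
    case 0
    with h have "\<iota> (linear_extension S A e1 f) \<oplus>\<^bsub>X\<^esub> linear_extension S X s g = \<zero>\<^bsub>X\<^esub>"
      using f g extension_e[of f g] unfolding fg by (simp add: cycles_def)
    moreover have *: "linear_extension S A e1 f \<in> carrier A" "linear_extension S X s g \<in> carrier X"
      using inj.dom.linear_extension_closed[OF P.e_closed] inj.cod.linear_extension_closed[OF s_closed] f g 0 by auto
    ultimately have "\<pi> (\<iota> (linear_extension S A e1 f)) \<oplus>\<^bsub>C\<^esub> \<pi> (linear_extension S X s g) = \<zero>\<^bsub>C\<^esub>"
      using proj.add[of "\<iota> (linear_extension S A e1 f)" "linear_extension S X s g"]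
      by (simp add: inj.closed proj.zero)
    then show ?thesis using g 0 * proj_s[of g] proj.closed[of "linear_extension S X s g"]
      by (simp add: proj_inj Q.cycle_0)
  next
    case (Suc j)
    with h have "case_sum (P.D j f \<oplus>\<^bsub>P.F j\<^esub> linear_extension S (P.F j) (\<theta> j) g) (Q.D j g) = (\<lambda>_. \<zero>)"
      using f g extension_d[of f j g] unfolding fg by (simp add: cycles_def)
    then have "Q.D j g = (\<lambda>_. \<zero>)" by (metis case_sum_o_inj(2) comp_def)
    then show ?thesis using g Suc by (simp add: Q.cycle_Suc)
  qed
  then obtain g' where g': "g' \<in> carrier (Q.F (Suc k))" "Q.D k g' = g" using Q.cycle_boundary by blast
  let ?t = "linear_extension S (P.F k) (\<theta> k) g'"
  have t: "?t \<in> carrier (P.F k)" by (rule Pk.linear_extension_closed[OF \<theta>_closed g'(1)])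
  \<comment> \<open>The sign conditions on \<open>\<theta>\<close> say that \<open>?t\<close> has
    the same image as \<open>f\<close> one degree lower: both cancel the contribution of
    \<open>g\<close>. In degree 0 this is seen in \<open>X\<close> and brought back to
    \<open>A\<close> by injectivity of \<open>\<iota>\<close>.\<close>
  have "f \<ominus>\<^bsub>P.F k\<^esub> ?t \<in> P.Z k"
  proof (cases k)
    case 0
    have *: "linear_extension S A e1 f \<in> carrier A" "linear_extension S A e1 ?t \<in> carrier A"
      "linear_extension S X s g \<in> carrier X"
      using inj.dom.linear_extension_closed[OF P.e_closed] inj.cod.linear_extension_closed[OF s_closed] f g t 0 by auto
    have "\<iota> (linear_extension S A e1 f) \<oplus>\<^bsub>X\<^esub> linear_extension S X s g = \<zero>\<^bsub>X\<^esub>"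
      using h f g 0 extension_e[of f g] unfolding fg by (simp add: cycles_def)
    then have "\<iota> (linear_extension S A e1 f) = \<ominus>\<^bsub>X\<^esub> linear_extension S X s g"
      using * inj.closed inj.cod.M.minus_equality by metis
    also have "\<dots> = \<iota> (linear_extension S A e1 ?t)" using \<theta>_boundary_0[of g'] g' 0 by simp
    finally have "linear_extension S A e1 f = linear_extension S A e1 ?t" using * inj_on inj_onD by metis
    then show ?thesis
      using f t 0 * linear_map.diff[OF P.e_linear, of f ?t] Pk.M.minus_closed[OF f t]
      by (simp add: P.cycle_0 inj.dom.M.diff_eq_zero_iff del: free_module_simps)
  next
    case (Suc j)
    interpret Pj: left_module S "P.F j" by (rule P.F_module)
    let ?u = "linear_extension S (P.F j) (\<theta> j) g"
    have *: "P.D j f \<in> carrier (P.F j)" "?u \<in> carrier (P.F j)"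
      using P.D_closed Pj.linear_extension_closed[OF \<theta>_closed] f g Suc by auto
    have "P.D j f \<oplus>\<^bsub>P.F j\<^esub> ?u = \<zero>\<^bsub>P.F j\<^esub>"
    proof -
      have "case_sum (P.D j f \<oplus>\<^bsub>P.F j\<^esub> ?u) (Q.D j g) = (\<lambda>_. \<zero>)"
        using h f g Suc extension_d[of f j g] unfolding fg by (simp add: cycles_def)
      then have "P.D j f \<oplus>\<^bsub>P.F j\<^esub> ?u = (\<lambda>_. \<zero>)" by (metis case_sum_o_inj(1) comp_def)
      then show ?thesis by simp
    qed
    then have "P.D j f = \<ominus>\<^bsub>P.F j\<^esub> ?u" using * Pj.M.minus_equality by metis
    also have "\<dots> = P.D j ?t" using \<theta>_boundary_Suc[of g' j] g' Suc by simp
    finally show ?thesis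
      using f t Suc * linear_map.diff[OF P.D_linear, of f j ?t] Pk.M.minus_closed[OF f t]
      by (simp add: P.cycle_Suc Pj.M.diff_eq_zero_iff del: free_module_simps)
  qed
  then obtain f' where f': "f' \<in> carrier (P.F (Suc k))" "P.D k f' = f \<ominus>\<^bsub>P.F k\<^esub> ?t"
    using P.cycle_boundary by blast
  have "linear_extension S (free_module S (B k)) (d k) (case_sum f' g') = h"
    unfolding fg extension_d[OF f'(1) g'(1)] f'(2) g'(2) Pk.M.diff_add_cancel[OF f t] ..
  then show "\<exists>f'\<in>carrier (free_module S (B (Suc k))). linear_extension S (free_module S (B k)) (d k) f' = h"
    using f' g' by (intro bexI[of _ "case_sum f' g'"]) auto
qed

end

section \<open>Homomorphisms as cocycles of degree 0\<close>

text \<open>\<open>q\<close> is an arbitrary section of \<open>p\<close> as a map of sets. The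
  choice is invisible after \<open>\<phi>\<close>, because two preimages differ by an element of the
  kernel of \<open>p\<close>.\<close>

lemma linear_map_factor:
  assumes "linear_map S U X p" "p ` carrier U = carrier X" "linear_map S U Y \<phi>"
    and ker: "\<And>u. u \<in> carrier U \<Longrightarrow> p u = \<zero>\<^bsub>X\<^esub> \<Longrightarrow> \<phi> u = \<zero>\<^bsub>Y\<^esub>"
  obtains \<psi> where "linear_map S X Y \<psi>" "\<And>u. u \<in> carrier U \<Longrightarrow> \<psi> (p u) = \<phi> u"
proof -
  interpret p: linear_map S U X p by fact
  interpret \<phi>: linear_map S U Y \<phi> by fact
  have eq: "\<phi> u = \<phi> v" if "u \<in> carrier U" "v \<in> carrier U" "p u = p v" for u v
    using that ker[of "u \<ominus>\<^bsub>U\<^esub> v"] p.closed \<phi>.closed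
    by (simp add: p.diff \<phi>.diff p.cod.M.diff_eq_zero_iff \<phi>.cod.M.diff_eq_zero_iff)
  define q where "q x = (SOME u. u \<in> carrier U \<and> p u = x)" for x
  have q: "q x \<in> carrier U \<and> p (q x) = x" if "x \<in> carrier X" for x
  proof -
    have "\<exists>u. u \<in> carrier U \<and> p u = x" using that unfolding assms(2)[symmetric] by auto
    then show ?thesis unfolding q_def by (rule someI_ex)
  qed
  have \<psi>: "\<phi> (q (p u)) = \<phi> u" if "u \<in> carrier U" for u
    using that q[OF p.closed[OF that]] by (auto intro: eq)
  have "linear_map S X Y (\<lambda>x. \<phi> (q x))"
    unfolding linear_map_iff
  proof (intro conjI ballI)
    show "\<phi> (q x) \<in> carrier Y" if "x \<in> carrier X" for x using q[OF that] \<phi>.closed by simp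
    show "\<phi> (q (x \<oplus>\<^bsub>X\<^esub> y)) = \<phi> (q x) \<oplus>\<^bsub>Y\<^esub> \<phi> (q y)" if "x \<in> carrier X" "y \<in> carrier X" for x y
      using q[OF that(1)] q[OF that(2)] \<psi>[of "q x \<oplus>\<^bsub>U\<^esub> q y"] by (simp add: p.add \<phi>.add)
    show "\<phi> (q (r \<odot>\<^bsub>X\<^esub> x)) = r \<odot>\<^bsub>Y\<^esub> \<phi> (q x)" if "r \<in> carrier S" "x \<in> carrier X" for r x
      using q[OF that(2)] that \<psi>[of "r \<odot>\<^bsub>U\<^esub> q x"] by (simp add: p.smult \<phi>.smult p.dom.smult_closed)
  qed (rule p.cod.left_module_axioms \<phi>.cod.left_module_axioms)+
  then show thesis using \<psi> by (rule that)
qed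

text \<open>\<open>X\<close> is the cokernel of the first differential, so a homomorphism on the
  free module of degree 0 that kills boundaries descends to \<open>X\<close>.\<close>

lemma (in free_resolution) cocycle_0_factor:
  assumes "left_module S Y" "cocycle S Y B d 0 c"
  obtains \<psi> where "linear_map S X Y \<psi>" "\<And>b. b \<in> B 0 \<Longrightarrow> \<psi> (e b) = c b"
proof -
  interpret Y: left_module S Y by fact
  have c: "c \<in> B 0 \<rightarrow> carrier Y" using assms(2) by (simp add: cocycle_def)
  have "linear_extension S Y c f = \<zero>\<^bsub>Y\<^esub>"
    if f: "f \<in> carrier (F 0)" "linear_extension S X e f = \<zero>\<^bsub>X\<^esub>" for f
  proof -
    have "f \<in> Z 0" using f by (simp add: cycle_0)
    then obtain f' where "f' \<in> carrier (F (Suc 0))" "D 0 f' = f" using cycle_boundary by blast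
    then show ?thesis using cocycle_boundary_zero[OF assms d_closed] by blast
  qed
  then obtain \<psi> where \<psi>: "linear_map S X Y \<psi>"
    "\<And>f. f \<in> carrier (F 0) \<Longrightarrow> \<psi> (linear_extension S X e f) = linear_extension S Y c f"
    using linear_map_factor[OF e_linear surj Y.linear_map_extension[OF c]] by blast
  have "\<psi> (e b) = c b" if b: "b \<in> B 0" for b
    using \<psi>(2)[OF R.basis_vector_closed[OF b]] Pi_mem[OF e_closed b] Pi_mem[OF c b]
    by (simp add: linear_extension_basis_vector Y.linear_extension_basis_vector)
  with \<psi>(1) show thesis by (rule that)
qed

subsection \<open>Dimension shifting\<close>

text \<open>Here the vanishing of the positive Ext groups of \<open>X\<close> enters, as a property
  of the horseshoe resolution. It replaces the long exact sequence.\<close>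

locale acyclic_horseshoe = horseshoe S A X C \<iota> \<pi> B1 d1 e1 B2 d2 e2 s \<theta> + Y: left_module S Y
  for S (structure) and A (structure) and X (structure) and C (structure) and \<iota> and \<pi>
    and B1 d1 e1 B2 d2 e2 s \<theta> and Y (structure) +
  assumes acyclic: "acyclic_for S Y B d"
begin

abbreviation "L \<equiv> linear_extension S Y"

lemma L_d_Inl:
  assumes "c1 \<in> B1 k \<rightarrow> carrier Y" "c2 \<in> B2 k \<rightarrow> carrier Y" "b \<in> B1 (Suc k)"
  shows "L (case_sum c1 c2) (d k (Inl b)) = L c1 (d1 k b)"
proof -
  have "case_sum c1 c2 \<in> B k \<rightarrow> carrier Y" using assms(1,2) by auto
  then show ?thesis
    using Y.linear_extension_case_sum[OF _ P.d_in_F[OF assms(3)] zero_in_free, of "case_sum c1 c2" "B2 k"]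
      Y.linear_extension_zero[OF assms(2)] Y.linear_extension_closed[OF assms(1) P.d_in_F[OF assms(3)]]
    by (simp add: d_def)
qed

lemma L_d_Inr:
  assumes "c1 \<in> B1 k \<rightarrow> carrier Y" "c2 \<in> B2 k \<rightarrow> carrier Y" "b \<in> B2 (Suc k)"
  shows "L (case_sum c1 c2) (d k (Inr b)) = L c1 (\<theta> k b) \<oplus>\<^bsub>Y\<^esub> L c2 (d2 k b)"
proof -
  have "case_sum c1 c2 \<in> B k \<rightarrow> carrier Y" using assms(1,2) by auto
  then show ?thesis
    using Y.linear_extension_case_sum[OF _ Pi_mem[OF \<theta>_closed assms(3)] Q.d_in_F[OF assms(3)], of "case_sum c1 c2"]
    by (simp add: d_def)
qed

lemma cocycle_case_sum:
  assumes "c1 \<in> B1 k \<rightarrow> carrier Y" "c2 \<in> B2 k \<rightarrow> carrier Y"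
  shows "cocycle S Y B d k (case_sum c1 c2) \<longleftrightarrow> cocycle S Y B1 d1 k c1 \<and>
    (\<forall>b\<in>B2 (Suc k). L c1 (\<theta> k b) \<oplus>\<^bsub>Y\<^esub> L c2 (d2 k b) = \<zero>\<^bsub>Y\<^esub>)"
proof -
  have "(\<forall>b\<in>B (Suc k). P b) \<longleftrightarrow> (\<forall>b\<in>B1 (Suc k). P (Inl b)) \<and> (\<forall>b\<in>B2 (Suc k). P (Inr b))" for P
    by auto
  moreover have "case_sum c1 c2 \<in> B k \<rightarrow> carrier Y" using assms by auto
  ultimately show ?thesis using assms by (simp add: cocycle_def L_d_Inl L_d_Inr)
qed

lemma coboundary_case_sum:
  assumes "cocycle S Y B d (Suc k) (case_sum c1 c2)"
  obtains a1 a2 where "a1 \<in> B1 k \<rightarrow> carrier Y" "a2 \<in> B2 k \<rightarrow> carrier Y"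
    "\<And>b. b \<in> B1 (Suc k) \<Longrightarrow> c1 b = L a1 (d1 k b)"
    "\<And>b. b \<in> B2 (Suc k) \<Longrightarrow> c2 b = L a1 (\<theta> k b) \<oplus>\<^bsub>Y\<^esub> L a2 (d2 k b)"
proof -
  obtain h where h: "h \<in> B k \<rightarrow> carrier Y" "\<And>b. b \<in> B (Suc k) \<Longrightarrow> case_sum c1 c2 b = L h (d k b)"
    using assms acyclic unfolding acyclic_for_def coboundary_def by meson
  have "h = case_sum (h \<circ> Inl) (h \<circ> Inr)" by (auto simp: fun_eq_iff split: sum.splits)
  then obtain a1 a2 where h12: "h = case_sum a1 a2" by blast
  have a: "a1 \<in> B1 k \<rightarrow> carrier Y" "a2 \<in> B2 k \<rightarrow> carrier Y"
    using h(1) unfolding h12 by (force dest: Pi_mem)+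
  show thesis
  proof (rule that[OF a])
    show "c1 b = L a1 (d1 k b)" if "b \<in> B1 (Suc k)" for b
      using h(2)[OF InlI[OF that]] L_d_Inl[OF a that] by (simp add: h12)
    show "c2 b = L a1 (\<theta> k b) \<oplus>\<^bsub>Y\<^esub> L a2 (d2 k b)" if "b \<in> B2 (Suc k)" for b
      using h(2)[OF InrI[OF that]] L_d_Inr[OF a that] by (simp add: h12)
  qed
qed

text \<open>Up to a coboundary, \<open>c'\<close> is \<open>c\<close> composed with the corner
  \<open>\<theta>\<close>: this is the graph of the connecting homomorphism from degree
  \<open>k\<close> on \<open>A\<close> to degree \<open>Suc k\<close> on \<open>C\<close>, taken on
  cochains. Leaving \<open>h\<close> open makes the relation closed under differences without a
  choice of representatives.\<close>

definition connects where
  "connects k c c' \<longleftrightarrow> c \<in> B1 k \<rightarrow> carrier Y \<and>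
    (\<exists>h\<in>B2 k \<rightarrow> carrier Y. \<forall>b\<in>B2 (Suc k). c' b = L c (\<theta> k b) \<oplus>\<^bsub>Y\<^esub> L h (d2 k b))"

text \<open>Extended by zero to the basis over \<open>A\<close>, \<open>c'\<close> is a cocycle of
  the middle resolution, hence a coboundary. The component over \<open>A\<close> of the bounding
  cochain is the wanted \<open>c\<close>: it is a cocycle because the extension is zero there, and
  its component over \<open>C\<close> is the \<open>h\<close> of the relation.\<close>

lemma connects_onto:
  assumes c': "cocycle S Y B2 d2 (Suc k) c'"
  obtains c where "cocycle S Y B1 d1 k c" "connects k c c'"
proof -
  have c'c: "c' \<in> B2 (Suc k) \<rightarrow> carrier Y" using c' by (simp add: cocycle_def)
  let ?z = "\<lambda>_. \<zero>\<^bsub>Y\<^esub>"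
  have z: "?z \<in> B1 (Suc k) \<rightarrow> carrier Y" by auto
  have Lz: "L ?z f = \<zero>\<^bsub>Y\<^esub>" if "f \<in> carrier (P.F j)" for f j
    by (rule Y.linear_extension_const_zero[OF that]) simp
  have "cocycle S Y B d (Suc k) (case_sum ?z c')"
    unfolding cocycle_case_sum[OF z c'c] using c'
    by (auto simp: cocycle_def Lz[OF P.d_in_F] Lz[OF Pi_mem[OF \<theta>_closed]])
  then obtain a1 a2 where a: "a1 \<in> B1 k \<rightarrow> carrier Y" "a2 \<in> B2 k \<rightarrow> carrier Y"
    "\<And>b. b \<in> B1 (Suc k) \<Longrightarrow> \<zero>\<^bsub>Y\<^esub> = L a1 (d1 k b)"
    "\<And>b. b \<in> B2 (Suc k) \<Longrightarrow> c' b = L a1 (\<theta> k b) \<oplus>\<^bsub>Y\<^esub> L a2 (d2 k b)"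
    by (rule coboundary_case_sum) blast
  show thesis
    by (rule that[of a1]) (use a in \<open>auto simp: cocycle_def connects_def\<close>)
qed

text \<open>The coboundary of \<open>c \<theta>\<close> is, up to sign, \<open>c\<close> evaluated
  on boundaries of \<open>\<theta> (Suc k) b\<close>, and \<open>c\<close> is a cocycle.\<close>

lemma connects_total:
  assumes c: "cocycle S Y B1 d1 k c"
  shows "cocycle S Y B2 d2 (Suc k) (\<lambda>b. L c (\<theta> k b))" "connects k c (\<lambda>b. L c (\<theta> k b))"
proof -
  have cc: "c \<in> B1 k \<rightarrow> carrier Y" using c by (simp add: cocycle_def)
  show "cocycle S Y B2 d2 (Suc k) (\<lambda>b. L c (\<theta> k b))"
    unfolding cocycle_def
  proof (intro conjI ballI)
    show "(\<lambda>b. L c (\<theta> k b)) \<in> B2 (Suc k) \<rightarrow> carrier Y"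
      by (rule funcsetI) (rule Y.linear_extension_closed[OF cc Pi_mem[OF \<theta>_closed]])
    fix b assume b: "b \<in> B2 (Suc (Suc k))"
    let ?u = "linear_extension S (P.F k) (\<theta> k) (d2 (Suc k) b)"
    have u: "?u \<in> carrier (P.F k)"
      by (rule left_module.linear_extension_closed[OF P.F_module \<theta>_closed Q.d_in_F[OF b]])
    have "\<ominus>\<^bsub>Y\<^esub> L c ?u = L c (\<ominus>\<^bsub>P.F k\<^esub> ?u)"
      by (rule linear_map.minus[OF Y.linear_map_extension[OF cc] u, symmetric])
    also have "\<dots> = L c (P.D k (\<theta> (Suc k) b))" unfolding \<theta>_Suc[OF b] ..
    also have "\<dots> = \<zero>\<^bsub>Y\<^esub>"
      by (rule cocycle_boundary_zero[OF Y.left_module_axioms c P.d_closed Pi_mem[OF \<theta>_closed b]])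
    finally have "L c ?u = \<zero>\<^bsub>Y\<^esub>"
      using Y.linear_extension_closed[OF cc u] by (metis Y.M.minus_minus Y.M.a_inv_zero)
    then show "L (\<lambda>b. L c (\<theta> k b)) (d2 (Suc k) b) = \<zero>\<^bsub>Y\<^esub>"
      unfolding Y.linear_extension_compose[OF cc \<theta>_closed Q.d_in_F[OF b]] .
  qed
  have "L c (\<theta> k b) = L c (\<theta> k b) \<oplus>\<^bsub>Y\<^esub> L (\<lambda>_. \<zero>\<^bsub>Y\<^esub>) (d2 k b)" if "b \<in> B2 (Suc k)" for b
    using Y.linear_extension_closed[OF cc Pi_mem[OF \<theta>_closed that]] Q.d_in_F[OF that]
    by (simp add: Y.linear_extension_const_zero)
  then show "connects k c (\<lambda>b. L c (\<theta> k b))"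
    unfolding connects_def using cc by (intro conjI bexI[of _ "\<lambda>_. \<zero>\<^bsub>Y\<^esub>"]) auto
qed

text \<open>If \<open>h\<close> is the cochain in the relation and \<open>h'\<close> bounds
  \<open>c'\<close>, then \<open>h - h'\<close> completes \<open>c\<close> to a cocycle of the
  middle resolution. In positive degree that cocycle is bounded; in degree 0 it is a homomorphism on
  \<open>X\<close>.\<close>

lemma connects_coboundaryD:
  assumes "cocycle S Y B1 d1 k c" "connects k c c'" "coboundary S Y B2 d2 k c'"
  obtains h where "h \<in> B2 k \<rightarrow> carrier Y" "cocycle S Y B d k (case_sum c h)"
proof -
  have cc: "c \<in> B1 k \<rightarrow> carrier Y" using assms(1) by (simp add: cocycle_def)
  obtain h where h: "h \<in> B2 k \<rightarrow> carrier Y"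
      "\<And>b. b \<in> B2 (Suc k) \<Longrightarrow> c' b = L c (\<theta> k b) \<oplus>\<^bsub>Y\<^esub> L h (d2 k b)"
    using assms(2) unfolding connects_def by blast
  obtain h' where h': "h' \<in> B2 k \<rightarrow> carrier Y" "\<And>b. b \<in> B2 (Suc k) \<Longrightarrow> c' b = L h' (d2 k b)"
    using assms(3) unfolding coboundary_def by blast
  have hh: "(\<lambda>b. h b \<ominus>\<^bsub>Y\<^esub> h' b) \<in> B2 k \<rightarrow> carrier Y" using h(1) h'(1) by auto
  have "L c (\<theta> k b) \<oplus>\<^bsub>Y\<^esub> L (\<lambda>b. h b \<ominus>\<^bsub>Y\<^esub> h' b) (d2 k b) = \<zero>\<^bsub>Y\<^esub>" if b: "b \<in> B2 (Suc k)" for b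
  proof -
    note db = Q.d_in_F[OF b]
    have *: "L c (\<theta> k b) \<in> carrier Y" "L h (d2 k b) \<in> carrier Y" "L h' (d2 k b) \<in> carrier Y"
      using Y.linear_extension_closed cc h(1) h'(1) db Pi_mem[OF \<theta>_closed b] by blast+
    have "L c (\<theta> k b) \<oplus>\<^bsub>Y\<^esub> L h (d2 k b) = L h' (d2 k b)" using h(2)[OF b] h'(2)[OF b] by simp
    then show ?thesis unfolding Y.linear_extension_diff[OF h(1) h'(1) db] using *
      by (simp add: a_minus_def Y.M.r_neg flip: Y.M.a_assoc)
  qed
  then have "cocycle S Y B d k (case_sum c (\<lambda>b. h b \<ominus>\<^bsub>Y\<^esub> h' b))"
    unfolding cocycle_case_sum[OF cc hh] using assms(1) by simp
  with hh show thesis by (rule that)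
qed

text \<open>Forwards, the completed cocycle on the middle resolution is a coboundary, and its
  restriction to the basis over \<open>A\<close> bounds \<open>c\<close>. Backwards, if
  \<open>a\<close> bounds \<open>c\<close>, then
  \<open>c \<theta> = a d1 \<theta> = - (a \<theta>) d2\<close>, so that
  \<open>h - a \<theta>\<close> bounds \<open>c'\<close>.\<close>

lemma connects_coboundary_iff:
  assumes c: "cocycle S Y B1 d1 (Suc j) c" and c': "connects (Suc j) c c'"
  shows "coboundary S Y B2 d2 (Suc j) c' \<longleftrightarrow> coboundary S Y B1 d1 j c"
proof
  assume "coboundary S Y B2 d2 (Suc j) c'"
  then obtain h where "cocycle S Y B d (Suc j) (case_sum c h)"
    by (rule connects_coboundaryD[OF assms])
  then obtain a1 where "a1 \<in> B1 j \<rightarrow> carrier Y" "\<And>b. b \<in> B1 (Suc j) \<Longrightarrow> c b = L a1 (d1 j b)"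
    by (rule coboundary_case_sum) blast
  then show "coboundary S Y B1 d1 j c" unfolding coboundary_def by blast
next
  assume "coboundary S Y B1 d1 j c"
  then obtain a where a: "a \<in> B1 j \<rightarrow> carrier Y" "\<And>b. b \<in> B1 (Suc j) \<Longrightarrow> c b = L a (d1 j b)"
    unfolding coboundary_def by blast
  obtain h where h: "h \<in> B2 (Suc j) \<rightarrow> carrier Y"
      "\<And>b. b \<in> B2 (Suc (Suc j)) \<Longrightarrow> c' b = L c (\<theta> (Suc j) b) \<oplus>\<^bsub>Y\<^esub> L h (d2 (Suc j) b)"
    using c' unfolding connects_def by blast
  have cc: "c \<in> B1 (Suc j) \<rightarrow> carrier Y" using c by (simp add: cocycle_def)
  let ?a = "\<lambda>b. L a (\<theta> j b)"
  have ac: "?a \<in> B2 (Suc j) \<rightarrow> carrier Y"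
    by (rule funcsetI) (rule Y.linear_extension_closed[OF a(1) Pi_mem[OF \<theta>_closed]])
  have "c' b = L (\<lambda>b. h b \<ominus>\<^bsub>Y\<^esub> ?a b) (d2 (Suc j) b)" if b: "b \<in> B2 (Suc (Suc j))" for b
  proof -
    note db = Q.d_in_F[OF b] and \<theta>b = Pi_mem[OF \<theta>_closed b]
    let ?u = "linear_extension S (P.F j) (\<theta> j) (d2 (Suc j) b)"
    have u: "?u \<in> carrier (P.F j)" by (rule left_module.linear_extension_closed[OF P.F_module \<theta>_closed db])
    have "L c (\<theta> (Suc j) b) = L (\<lambda>b. L a (d1 j b)) (\<theta> (Suc j) b)"
      by (rule Y.linear_extension_cong[OF \<theta>b cc a(2)])
    also have "\<dots> = L a (P.D j (\<theta> (Suc j) b))"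
      by (rule Y.linear_extension_compose[OF a(1) P.d_closed \<theta>b, symmetric])
    also have "\<dots> = \<ominus>\<^bsub>Y\<^esub> L a ?u"
      unfolding \<theta>_Suc[OF b] by (rule linear_map.minus[OF Y.linear_map_extension[OF a(1)] u])
    also have "L a ?u = L ?a (d2 (Suc j) b)"
      by (rule Y.linear_extension_compose[OF a(1) \<theta>_closed db])
    finally show ?thesis
      unfolding h(2)[OF b] Y.linear_extension_diff[OF h(1) ac db]
      using Y.linear_extension_closed[OF h(1) db] Y.linear_extension_closed[OF ac db]
      by (simp add: a_minus_def Y.M.a_comm)
  qed
  then show "coboundary S Y B2 d2 (Suc j) c'"
    unfolding coboundary_def using h(1) ac by (intro bexI[of _ "\<lambda>b. h b \<ominus>\<^bsub>Y\<^esub> ?a b"]) auto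
qed

lemma linear_map_cocycle_0:
  assumes "linear_map S A Y \<psi>" shows "cocycle S Y B1 d1 0 (\<lambda>b. \<psi> (e1 b))"
proof -
  interpret \<psi>: linear_map S A Y \<psi> by fact
  show ?thesis
    unfolding cocycle_def
  proof (intro conjI ballI)
    show "(\<lambda>b. \<psi> (e1 b)) \<in> B1 0 \<rightarrow> carrier Y" using P.e_closed \<psi>.closed by auto
    fix b assume b: "b \<in> B1 (Suc 0)"
    show "L (\<lambda>b. \<psi> (e1 b)) (d1 0 b) = \<zero>\<^bsub>Y\<^esub>"
      unfolding \<psi>.linear_extension[OF P.e_closed P.d_in_F[OF b], symmetric] by (simp add: P.e_d[OF b] \<psi>.zero)
  qed
qed

text \<open>In degree 0 the cocycles on \<open>A\<close> are homomorphisms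
  \<open>A \<rightarrow> Y\<close>; they are recorded as such, because homomorphisms out of
  \<open>Z(Q)\<close> can be compared with homomorphisms over \<open>R\<close>.\<close>

lemma connects_0_onto:
  assumes "cocycle S Y B2 d2 (Suc 0) c'"
  obtains \<psi> where "linear_map S A Y \<psi>" "connects 0 (\<lambda>b. \<psi> (e1 b)) c'"
proof -
  obtain c where c: "cocycle S Y B1 d1 0 c" "connects 0 c c'" by (rule connects_onto[OF assms])
  obtain \<psi> where \<psi>: "linear_map S A Y \<psi>" "\<And>b. b \<in> B1 0 \<Longrightarrow> \<psi> (e1 b) = c b"
    by (rule P.cocycle_0_factor[OF Y.left_module_axioms c(1)]) blast
  interpret \<psi>: linear_map S A Y \<psi> by fact
  have "L c (\<theta> 0 b) = L (\<lambda>b. \<psi> (e1 b)) (\<theta> 0 b)" if "b \<in> B2 (Suc 0)" for b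
    by (rule Y.linear_extension_cong[OF Pi_mem[OF \<theta>_closed that]]) (use c \<psi>(2) in \<open>auto simp: cocycle_def\<close>)
  then have "connects 0 (\<lambda>b. \<psi> (e1 b)) c'"
    using c(2) \<psi>.closed P.e_closed unfolding connects_def by auto
  with \<psi>(1) show thesis by (rule that)
qed

text \<open>Exactness of \<open>Hom(X, Y) \<rightarrow> Hom(A, Y) \<rightarrow> Ext^1(C, Y)\<close>
  in the middle. Forwards, the completed cocycle of degree 0 descends to a homomorphism on
  \<open>X\<close>. Backwards, an extension \<open>\<Psi>\<close> turns \<open>\<theta>_0\<close>
  into a formula for \<open>\<psi> e1 \<theta>\<close>, and \<open>h - \<Psi> s\<close> bounds
  \<open>c'\<close>.\<close>

lemma connects_0_coboundary_iff:
  assumes \<psi>: "linear_map S A Y \<psi>" and c': "connects 0 (\<lambda>b. \<psi> (e1 b)) c'"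
  shows "coboundary S Y B2 d2 0 c' \<longleftrightarrow> (\<exists>\<Psi>. linear_map S X Y \<Psi> \<and> (\<forall>a\<in>carrier A. \<Psi> (\<iota> a) = \<psi> a))"
proof
  interpret \<psi>: linear_map S A Y \<psi> by fact
  assume "coboundary S Y B2 d2 0 c'"
  then obtain h where "cocycle S Y B d 0 (case_sum (\<lambda>b. \<psi> (e1 b)) h)"
    by (rule connects_coboundaryD[OF linear_map_cocycle_0[OF \<psi>] c'])
  then obtain \<Psi> where \<Psi>: "linear_map S X Y \<Psi>" "\<And>b. b \<in> B 0 \<Longrightarrow> \<Psi> (e b) = case_sum (\<lambda>b. \<psi> (e1 b)) h b"
    by (rule free_resolution.cocycle_0_factor[OF resolution Y.left_module_axioms]) blast
  have "\<Psi> (\<iota> a) = \<psi> a" if a: "a \<in> carrier A" for a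
  proof -
    obtain f where f: "f \<in> carrier (P.F 0)" "a = linear_extension S A e1 f"
      using a unfolding P.surj[symmetric] by auto
    have "\<Psi> (\<iota> a) = L (\<lambda>b. \<Psi> (\<iota> (e1 b))) f"
      unfolding f(2) by (rule linear_map.linear_extension[OF linear_map_comp[OF inj.linear_map_axioms \<Psi>(1)] P.e_closed f(1)])
    also have "\<dots> = L (\<lambda>b. \<psi> (e1 b)) f"
      by (rule Y.linear_extension_cong[OF f(1)])
        (use \<Psi>(2)[OF InlI] \<psi>.closed P.e_closed in \<open>auto simp: e_def Pi_iff\<close>)
    also have "\<dots> = \<psi> a" unfolding f(2) by (rule \<psi>.linear_extension[OF P.e_closed f(1), symmetric])
    finally show ?thesis .
  qed
  with \<Psi>(1) show "\<exists>\<Psi>. linear_map S X Y \<Psi> \<and> (\<forall>a\<in>carrier A. \<Psi> (\<iota> a) = \<psi> a)" by blast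
next
  interpret \<psi>: linear_map S A Y \<psi> by fact
  assume "\<exists>\<Psi>. linear_map S X Y \<Psi> \<and> (\<forall>a\<in>carrier A. \<Psi> (\<iota> a) = \<psi> a)"
  then obtain \<Psi> where \<Psi>: "linear_map S X Y \<Psi>" "\<And>a. a \<in> carrier A \<Longrightarrow> \<Psi> (\<iota> a) = \<psi> a" by blast
  interpret \<Psi>: linear_map S X Y \<Psi> by fact
  obtain h where h: "h \<in> B2 0 \<rightarrow> carrier Y"
      "\<And>b. b \<in> B2 (Suc 0) \<Longrightarrow> c' b = L (\<lambda>b. \<psi> (e1 b)) (\<theta> 0 b) \<oplus>\<^bsub>Y\<^esub> L h (d2 0 b)"
    using c' unfolding connects_def by blast
  have sc: "(\<lambda>b. \<Psi> (s b)) \<in> B2 0 \<rightarrow> carrier Y" using s_closed \<Psi>.closed by auto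
  have "c' b = L (\<lambda>b. h b \<ominus>\<^bsub>Y\<^esub> \<Psi> (s b)) (d2 0 b)" if b: "b \<in> B2 (Suc 0)" for b
  proof -
    note db = Q.d_in_F[OF b] and \<theta>b = Pi_mem[OF \<theta>_closed b]
    have "L (\<lambda>b. \<psi> (e1 b)) (\<theta> 0 b) = \<psi> (linear_extension S A e1 (\<theta> 0 b))"
      by (rule \<psi>.linear_extension[OF P.e_closed \<theta>b, symmetric])
    also have "\<dots> = \<Psi> (\<iota> (linear_extension S A e1 (\<theta> 0 b)))"
      by (rule \<Psi>(2)[symmetric]) (rule inj.dom.linear_extension_closed[OF P.e_closed \<theta>b])
    also have "\<dots> = \<ominus>\<^bsub>Y\<^esub> \<Psi> (linear_extension S X s (d2 0 b))"
      unfolding \<theta>_0[OF b] by (rule \<Psi>.minus[OF inj.cod.linear_extension_closed[OF s_closed db]])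
    also have "\<Psi> (linear_extension S X s (d2 0 b)) = L (\<lambda>b. \<Psi> (s b)) (d2 0 b)"
      by (rule \<Psi>.linear_extension[OF s_closed db])
    finally show ?thesis
      unfolding h(2)[OF b] Y.linear_extension_diff[OF h(1) sc db]
      using Y.linear_extension_closed[OF h(1) db] Y.linear_extension_closed[OF sc db]
      by (simp add: a_minus_def Y.M.a_comm)
  qed
  then show "coboundary S Y B2 d2 0 c'"
    unfolding coboundary_def using h(1) sc by (intro bexI[of _ "\<lambda>b. h b \<ominus>\<^bsub>Y\<^esub> \<Psi> (s b)"]) auto
qed

text \<open>The differences are prescribed on basis elements only, since cochains carry no
  information elsewhere; this is the form that \<open>Ext_iso_by_relation\<close> asks for.\<close>

lemma connects_diff:
  assumes "connects k c c'" "connects k a a'"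
    and eq: "\<And>b. b \<in> B1 k \<Longrightarrow> x b = c b \<ominus>\<^bsub>Y\<^esub> a b" "\<And>b. b \<in> B2 (Suc k) \<Longrightarrow> x' b = c' b \<ominus>\<^bsub>Y\<^esub> a' b"
  shows "connects k x x'"
proof -
  have cc: "c \<in> B1 k \<rightarrow> carrier Y" "a \<in> B1 k \<rightarrow> carrier Y" using assms(1,2) by (simp_all add: connects_def)
  then have xc: "x \<in> B1 k \<rightarrow> carrier Y" by (intro funcsetI) (simp add: eq(1) Pi_iff)
  obtain h where h: "h \<in> B2 k \<rightarrow> carrier Y"
      "\<And>b. b \<in> B2 (Suc k) \<Longrightarrow> c' b = L c (\<theta> k b) \<oplus>\<^bsub>Y\<^esub> L h (d2 k b)"
    using assms(1) unfolding connects_def by blast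
  obtain h' where h': "h' \<in> B2 k \<rightarrow> carrier Y"
      "\<And>b. b \<in> B2 (Suc k) \<Longrightarrow> a' b = L a (\<theta> k b) \<oplus>\<^bsub>Y\<^esub> L h' (d2 k b)"
    using assms(2) unfolding connects_def by blast
  have "x' b = L x (\<theta> k b) \<oplus>\<^bsub>Y\<^esub> L (\<lambda>b. h b \<ominus>\<^bsub>Y\<^esub> h' b) (d2 k b)" if b: "b \<in> B2 (Suc k)" for b
  proof -
    note db = Q.d_in_F[OF b] and \<theta>b = Pi_mem[OF \<theta>_closed b]
    have "L x (\<theta> k b) = L (\<lambda>b. c b \<ominus>\<^bsub>Y\<^esub> a b) (\<theta> k b)"
      by (rule Y.linear_extension_cong[OF \<theta>b xc eq(1)])
    also have "\<dots> = L c (\<theta> k b) \<ominus>\<^bsub>Y\<^esub> L a (\<theta> k b)" by (rule Y.linear_extension_diff[OF cc \<theta>b])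
    finally show ?thesis
      unfolding eq(2)[OF b] h(2)[OF b] h'(2)[OF b] Y.linear_extension_diff[OF h(1) h'(1) db]
      using Y.linear_extension_closed[OF h(1) db] Y.linear_extension_closed[OF h'(1) db]
        Y.linear_extension_closed[OF cc(1) \<theta>b] Y.linear_extension_closed[OF cc(2) \<theta>b]
      by (simp add: a_minus_def Y.M.minus_add Y.M.a_ac)
  qed
  then show ?thesis unfolding connects_def using xc h(1) h'(1)
    by (intro conjI bexI[of _ "\<lambda>b. h b \<ominus>\<^bsub>Y\<^esub> h' b"]) auto
qed

end

subsection \<open>Direct sums\<close>

lemma free_module_slice: "ring S \<Longrightarrow> f \<in> carrier (free_module S (I \<times> T)) \<Longrightarrow>
    (\<lambda>t. f (b, t)) \<in> carrier (free_module S T)"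
proof -
  assume f: "f \<in> carrier (free_module S (I \<times> T))"
  have "(\<lambda>t. (b, t)) ` {t. f (b, t) \<noteq> \<zero>\<^bsub>S\<^esub>} \<subseteq> {x. f x \<noteq> \<zero>\<^bsub>S\<^esub>}" by auto
  then have "finite ((\<lambda>t. (b, t)) ` {t. f (b, t) \<noteq> \<zero>\<^bsub>S\<^esub>})"
    using f by (auto simp: free_module_carrier intro: finite_subset)
  then have "finite {t. f (b, t) \<noteq> \<zero>\<^bsub>S\<^esub>}" by (rule finite_imageD) (auto intro: inj_onI)
  then show ?thesis using f by (auto simp: free_module_carrier)
qed

text \<open>A basis element of the sum is a pair of an index and a basis element for
  \<open>N\<close>. Differential and augmentation are block diagonal, so all properties are read off
  from the blocks \<open>at b f\<close>.\<close>

locale direct_sum_resolution = P: free_resolution S N T dT eT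
  for S (structure) and N (structure) and T dT eT +
  fixes I :: "'i set"
begin

definition d where "d k = (\<lambda>(b, t) (b', t'). if b' = b then dT k t t' else \<zero>)"
definition e where "e = (\<lambda>(b, t) b'. if b' = b then eT t else \<zero>\<^bsub>N\<^esub>)"

abbreviation "F k \<equiv> free_module S (I \<times> T k)"
abbreviation "at b f \<equiv> (\<lambda>t. f (b, t))"

lemma at_linear: "linear_map S (F k) (P.F k) (at b)"
  unfolding linear_map_iff
  by (auto simp: P.R.left_module_free free_module_slice P.R.ring_axioms)

lemma at_d: "at b' (d k (b, t)) = (if b' = b then dT k t else (\<lambda>_. \<zero>))"
  by (auto simp: d_def)

text \<open>Finitely many blocks, each of finite support, have finite support together;
  \<open>J\<close> bounds the blocks that may be nonzero.\<close>

lemma in_freeI: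
  assumes "\<And>b. b \<in> I \<Longrightarrow> at b f \<in> carrier (P.F k)" "\<And>b t. b \<notin> J \<Longrightarrow> f (b, t) = \<zero>" "finite J" "J \<subseteq> I"
  shows "f \<in> carrier (F k)"
proof -
  have sub: "{x. f x \<noteq> \<zero>} \<subseteq> (\<Union>b\<in>J. (\<lambda>t. (b, t)) ` {t. f (b, t) \<noteq> \<zero>})"
  proof
    fix x assume x: "x \<in> {x. f x \<noteq> \<zero>}"
    obtain b t where bt: "x = (b, t)" by (cases x)
    then have "b \<in> J" using x assms(2) by blast
    then show "x \<in> (\<Union>b\<in>J. (\<lambda>t. (b, t)) ` {t. f (b, t) \<noteq> \<zero>})" using x bt by blast
  qed
  have "finite {t. f (b, t) \<noteq> \<zero>}" if "b \<in> J" for b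
    using assms(1)[of b] that assms(4) by (auto simp: free_module_carrier)
  then have fin: "finite {x. f x \<noteq> \<zero>}" using assms(3) by (intro finite_subset[OF sub]) auto
  have "f x \<in> carrier S \<and> (x \<notin> I \<times> T k \<longrightarrow> f x = \<zero>)" for x
  proof -
    obtain b t where bt: "x = (b, t)" by (cases x)
    show ?thesis
    proof (cases "b \<in> J")
      case True
      then show ?thesis using assms(1)[of b] assms(4) bt by (auto simp: free_module_carrier)
    next
      case False
      then show ?thesis using assms(2)[of b] bt by simp
    qed
  qed
  then show ?thesis using fin by (simp add: free_module_carrier)
qed

lemma d_closed: "d k \<in> I \<times> T (Suc k) \<rightarrow> carrier (F k)"
proof
  fix x assume "x \<in> I \<times> T (Suc k)"
  then obtain b t where x: "x = (b, t)" "b \<in> I" "t \<in> T (Suc k)" by auto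
  show "d k x \<in> carrier (F k)"
    by (rule in_freeI[where J = "{b}"]) (use x P.d_in_F in \<open>auto simp: d_def free_module_carrier\<close>)
qed

lemma e_closed: "e \<in> I \<times> T 0 \<rightarrow> carrier (direct_sum I N)"
proof
  fix x assume "x \<in> I \<times> T 0"
  then obtain b t where x: "x = (b, t)" "b \<in> I" "t \<in> T 0" by auto
  then have et: "eT t \<in> carrier N" using P.e_closed by auto
  have "{b'. (if b' = b then eT t else \<zero>\<^bsub>N\<^esub>) \<noteq> \<zero>\<^bsub>N\<^esub>} \<subseteq> {b}" by auto
  then have "finite {b'. (if b' = b then eT t else \<zero>\<^bsub>N\<^esub>) \<noteq> \<zero>\<^bsub>N\<^esub>}" by (rule finite_subset) simp
  then show "e x \<in> carrier (direct_sum I N)"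
    using x et by (auto simp: direct_sum_carrier e_def)
qed

lemma at_basis_vector: "at b' (basis_vector S (b, t)) = (if b' = b then basis_vector S t else (\<lambda>_. \<zero>))"
  by (auto simp: basis_vector_def fun_eq_iff)

text \<open>Both sides are linear in \<open>f\<close>, so they are compared on basis vectors, where
  the block of index \<open>b\<close> is \<open>dT k t\<close> or zero.\<close>

lemma D_at:
  assumes f: "f \<in> carrier (F (Suc k))"
  shows "at b (linear_extension S (F k) (d k) f) = P.D k (at b f)"
proof -
  have "at b (linear_extension S (F k) (d k) f) = linear_extension S (P.F k) (\<lambda>x. at b (d k x)) f"
    by (rule linear_map.linear_extension[OF at_linear d_closed f])
  also have "\<dots> = linear_extension S (P.F k) (\<lambda>x. P.D k (at b (basis_vector S x))) f"
  proof (rule left_module.linear_extension_cong[OF P.F_module f])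
    show "(\<lambda>x. at b (d k x)) \<in> I \<times> T (Suc k) \<rightarrow> carrier (P.F k)"
      using d_closed linear_map.closed[OF at_linear] by blast
    fix x assume "x \<in> I \<times> T (Suc k)"
    then obtain b' t where x: "x = (b', t)" "t \<in> T (Suc k)" by auto
    then show "at b (d k x) = P.D k (at b (basis_vector S x))"
      using P.D_basis_vector[OF x(2)] linear_map.zero[OF P.D_linear, of k]
      by (simp add: at_d at_basis_vector)
  qed
  also have "\<dots> = P.D k (at b f)"
    by (rule linear_map_on_free[OF linear_map_comp[OF at_linear P.D_linear] f, symmetric])
  finally show ?thesis .
qed

lemma ev_linear: "linear_map S (direct_sum I N) N (\<lambda>x. x b)"
  unfolding linear_map_iff
  by (auto simp: P.left_module_direct_sum P.left_module_axioms direct_sum_carrier)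

lemma e_at:
  assumes f: "f \<in> carrier (F 0)"
  shows "linear_extension S (direct_sum I N) e f b = linear_extension S N eT (at b f)"
proof -
  have "linear_extension S (direct_sum I N) e f b = linear_extension S N (\<lambda>x. e x b) f"
    by (rule linear_map.linear_extension[OF ev_linear e_closed f])
  also have "\<dots> = linear_extension S N (\<lambda>x. linear_extension S N eT (at b (basis_vector S x))) f"
  proof (rule P.linear_extension_cong[OF f])
    show "(\<lambda>x. e x b) \<in> I \<times> T 0 \<rightarrow> carrier N"
      using e_closed linear_map.closed[OF ev_linear] by blast
    fix x assume "x \<in> I \<times> T 0"
    then obtain b' t where x: "x = (b', t)" "t \<in> T 0" by auto
    then show "e x b = linear_extension S N eT (at b (basis_vector S x))"
      using P.linear_extension_basis_vector[of eT t] Pi_mem[OF P.e_closed x(2)] linear_map.zero[OF P.e_linear]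
      by (auto simp: e_def at_basis_vector)
  qed
  also have "\<dots> = linear_extension S N eT (at b f)"
    by (rule linear_map_on_free[OF linear_map_comp[OF at_linear P.e_linear] f, symmetric])
  finally show ?thesis .
qed

lemma cycles_at:
  "f \<in> cycles S (direct_sum I N) (\<lambda>k. I \<times> T k) d e k \<longleftrightarrow> f \<in> carrier (F k) \<and> (\<forall>b. at b f \<in> P.Z k)"
proof (cases k)
  case 0
  show ?thesis
    using linear_map.closed[OF at_linear, of f 0] 0
    by (auto simp: cycles_def e_at fun_eq_iff)
next
  case (Suc j)
  have "(linear_extension S (F j) (d j) f = (\<lambda>_. \<zero>)) \<longleftrightarrow> (\<forall>b. P.D j (at b f) = (\<lambda>_. \<zero>))"
    if "f \<in> carrier (F k)"
    using D_at[of f j] that Suc by (auto simp: fun_eq_iff)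
  then show ?thesis
    using linear_map.closed[OF at_linear, of f k] Suc by (auto simp: cycles_def)
qed

lemma resolution: "free_resolution S (direct_sum I N) (\<lambda>k. I \<times> T k) d e"
proof (rule free_resolutionI)
  show "left_module S (direct_sum I N)" by (rule P.left_module_direct_sum)
  show "e \<in> I \<times> T 0 \<rightarrow> carrier (direct_sum I N)" by (rule e_closed)
  show "\<exists>f\<in>carrier (F 0). linear_extension S (direct_sum I N) e f = x" if x: "x \<in> carrier (direct_sum I N)" for x
  proof -
    have "\<exists>g. g \<in> carrier (P.F 0) \<and> linear_extension S N eT g = x b" for b
    proof -
      have "x b \<in> linear_extension S N eT ` carrier (P.F 0)" unfolding P.surj using x by (simp add: direct_sum_carrier)
      then show ?thesis by auto
    qed
    then obtain g where g: "\<And>b. g b \<in> carrier (P.F 0)" "\<And>b. linear_extension S N eT (g b) = x b" by metis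
    \<comment> \<open>Preimages are chosen in every block, but replaced by zero where
      \<open>x b\<close> vanishes; otherwise the support might be infinite.\<close>
    let ?f = "\<lambda>(b, t). if x b = \<zero>\<^bsub>N\<^esub> then \<zero> else g b t"
    have at: "at b ?f = (if x b = \<zero>\<^bsub>N\<^esub> then (\<lambda>_. \<zero>) else g b)" for b by auto
    have f: "?f \<in> carrier (F 0)"
      by (rule in_freeI[where J = "{b. x b \<noteq> \<zero>\<^bsub>N\<^esub>}"])
        (use x g(1) in \<open>auto simp: direct_sum_carrier free_module_carrier\<close>)
    have "linear_extension S N eT (at b ?f) = x b" for b
      unfolding at using g(2) linear_map.zero[OF P.e_linear] by simp
    then show ?thesis using f e_at[OF f] by (intro bexI[of _ ?f]) (auto simp: fun_eq_iff)
  qed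
next
  fix k x assume x: "x \<in> I \<times> T (Suc k)"
  have "(\<lambda>_. \<zero>) \<in> P.Z k"
    using P.D_cycle[of "\<lambda>_. \<zero>" k] linear_map.zero[OF P.D_linear, of k] by (simp add: free_module_carrier)
  then show "d k x \<in> cycles S (direct_sum I N) (\<lambda>k. I \<times> T k) d e k"
    unfolding cycles_at using x Pi_mem[OF d_closed x] P.d_cycle by (auto simp: at_d)
next
  fix k f assume "f \<in> cycles S (direct_sum I N) (\<lambda>k. I \<times> T k) d e k"
  then have f: "f \<in> carrier (F k)" "\<And>b. at b f \<in> P.Z k" by (auto simp: cycles_at)
  then have "\<exists>g. g \<in> carrier (P.F (Suc k)) \<and> P.D k g = at b f" for b using P.cycle_boundary by blast
  then obtain g where g: "\<And>b. g b \<in> carrier (P.F (Suc k))" "\<And>b. P.D k (g b) = at b f" by metis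
  \<comment> \<open>Only the finitely many blocks in which \<open>f\<close> is nonzero receive a
    preimage; the others get zero.\<close>
  let ?J = "fst ` {x. f x \<noteq> \<zero>}"
  have "x \<in> I \<times> T k" if "f x \<noteq> \<zero>" for x using f(1) that unfolding free_module_carrier by blast
  then have J2: "?J \<subseteq> I" by (auto simp: image_iff)
  have J: "finite ?J" using f(1) by (simp add: free_module_carrier)
  let ?h = "\<lambda>(b, t). if b \<in> ?J then g b t else \<zero>"
  have at: "at b ?h = (if b \<in> ?J then g b else (\<lambda>_. \<zero>))" for b by auto
  have h: "?h \<in> carrier (F (Suc k))"
    by (rule in_freeI[OF _ _ J J2]) (use g(1) in \<open>auto simp: at free_module_carrier\<close>)
  have "P.D k (at b ?h) = at b f" for b
  proof (cases "b \<in> ?J")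
    case True
    then show ?thesis unfolding at using g(2) by simp
  next
    case False
    then have "at b f = (\<lambda>_. \<zero>)" by (force simp: fun_eq_iff)
    then show ?thesis unfolding at using False linear_map.zero[OF P.D_linear, of k] by simp
  qed
  then have "at b (linear_extension S (F k) (d k) ?h) = at b f" for b unfolding D_at[OF h] .
  then have "linear_extension S (F k) (d k) ?h = f" by (auto simp: fun_eq_iff)
  with h show "\<exists>f'\<in>carrier (F (Suc k)). linear_extension S (F k) (d k) f' = f" by blast
qed

text \<open>Homomorphisms out of a direct sum form a product: a cochain on pairs is an arbitrary
  family of cochains on the blocks. Bounding cochains are chosen block by block and put together,
  with no finiteness to watch.\<close>

lemma acyclic:
  assumes "left_module S Y" "acyclic_for S Y T dT"
  shows "acyclic_for S Y (\<lambda>k. I \<times> T k) d"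
  unfolding acyclic_for_def
proof (intro allI impI)
  interpret Y: left_module S Y by fact
  have L: "linear_extension S Y c (d k (b, t)) = linear_extension S Y (\<lambda>t. c (b, t)) (dT k t)"
    if c: "c \<in> I \<times> T k \<rightarrow> carrier Y" and b: "b \<in> I" and t: "t \<in> T (Suc k)" for c k b t
  proof -
    \<comment> \<open>Inclusion of the block of index \<open>b\<close>; it sends basis vectors to
      basis vectors and \<open>dT k t\<close> to \<open>d k (b, t)\<close>.\<close>
    let ?i = "\<lambda>f (b', t'). if b' = b then f t' else \<zero>"
    have i: "?i f \<in> carrier (F k)" if "f \<in> carrier (P.F k)" for f
      by (rule in_freeI[where J = "{b}"]) (use that b in \<open>auto simp: free_module_carrier\<close>)
    have "linear_map S (P.F k) (F k) ?i"
      unfolding linear_map_iff by (auto simp: P.R.left_module_free i fun_eq_iff)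
    from linear_map_on_free[OF linear_map_comp[OF this Y.linear_map_extension[OF c]] P.d_in_F[OF t]]
    have "linear_extension S Y c (?i (dT k t)) =
        linear_extension S Y (\<lambda>t. linear_extension S Y c (?i (basis_vector S t))) (dT k t)" .
    also have "\<dots> = linear_extension S Y (\<lambda>t. c (b, t)) (dT k t)"
    proof (rule Y.linear_extension_cong[OF P.d_in_F[OF t]])
      have *: "?i (basis_vector S t) = basis_vector S (b, t)" for t
        by (auto simp: basis_vector_def fun_eq_iff)
      show "(\<lambda>t. linear_extension S Y c (?i (basis_vector S t))) \<in> T k \<rightarrow> carrier Y"
        by (rule funcsetI) (rule Y.linear_extension_closed[OF c i[OF P.R.basis_vector_closed]])
      fix t assume "t \<in> T k"
      then show "linear_extension S Y c (?i (basis_vector S t)) = c (b, t)"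
        unfolding * using c b by (intro Y.linear_extension_basis_vector) auto
    qed
    finally show ?thesis by (simp add: d_def)
  qed
  fix k c assume c: "cocycle S Y (\<lambda>k. I \<times> T k) d (Suc k) c"
  then have cc: "c \<in> I \<times> T (Suc k) \<rightarrow> carrier Y" by (simp add: cocycle_def)
  have "\<exists>h. h \<in> T k \<rightarrow> carrier Y \<and> (\<forall>t\<in>T (Suc k). c (b, t) = linear_extension S Y h (dT k t))"
    if b: "b \<in> I" for b
  proof -
    have "cocycle S Y T dT (Suc k) (\<lambda>t. c (b, t))"
      unfolding cocycle_def
    proof (intro conjI ballI)
      show "(\<lambda>t. c (b, t)) \<in> T (Suc k) \<rightarrow> carrier Y" using cc b by auto
      fix t assume t: "t \<in> T (Suc (Suc k))"
      show "linear_extension S Y (\<lambda>t. c (b, t)) (dT (Suc k) t) = \<zero>\<^bsub>Y\<^esub>"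
        using c b t L[OF cc b t] by (auto simp: cocycle_def)
    qed
    then show ?thesis using assms(2) unfolding acyclic_for_def coboundary_def by blast
  qed
  then obtain h where h: "\<And>b. b \<in> I \<Longrightarrow> h b \<in> T k \<rightarrow> carrier Y"
    "\<And>b t. b \<in> I \<Longrightarrow> t \<in> T (Suc k) \<Longrightarrow> c (b, t) = linear_extension S Y (h b) (dT k t)" by metis
  have hc: "(\<lambda>(b, t). h b t) \<in> I \<times> T k \<rightarrow> carrier Y" using h(1) by auto
  show "coboundary S Y (\<lambda>k. I \<times> T k) d k c"
    unfolding coboundary_def using hc h(2) L[OF hc]
    by (intro bexI[of _ "\<lambda>(b, t). h b t"]) auto
qed

end

section \<open>Ext groups\<close>

lemma (in group) rcoset_eq_iff:
  assumes "subgroup K G" "x \<in> carrier G" "y \<in> carrier G"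
  shows "K #> x = K #> y \<longleftrightarrow> x \<otimes> inv y \<in> K"
proof -
  have "x \<in> K #> y \<longleftrightarrow> x \<otimes> inv y \<in> K"
    by (rule subgroup.rcos_module[OF assms(1) group_axioms assms(3,2)])
  moreover have "x \<in> K #> y \<longleftrightarrow> K #> x = K #> y"
    using repr_independence[OF _ assms(3,1), of x] rcos_self[OF assms(2,1)] by auto
  ultimately show ?thesis by simp
qed

text \<open>\<open>\<rho>\<close> is a subgroup of \<open>G \<times> H\<close> that projects onto
  both factors and relates \<open>N\<close> exactly to \<open>K\<close>. Any choice of partners
  becomes a homomorphism modulo \<open>K\<close>; its kernel is \<open>N\<close> and its image
  everything.\<close>

lemma quotient_iso_by_relation:
  fixes G (structure) and H (structure)
  assumes "comm_group G" "comm_group H" and N: "subgroup N G" and K: "subgroup K H"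
    and div: "\<And>x y x' y'. \<lbrakk>x \<in> carrier G; x' \<in> carrier G; y \<in> carrier H; y' \<in> carrier H; \<rho> x y; \<rho> x' y'\<rbrakk>
      \<Longrightarrow> \<rho> (x \<otimes>\<^bsub>G\<^esub> inv\<^bsub>G\<^esub> x') (y \<otimes>\<^bsub>H\<^esub> inv\<^bsub>H\<^esub> y')"
    and total: "\<And>x. x \<in> carrier G \<Longrightarrow> \<exists>y\<in>carrier H. \<rho> x y"
    and onto: "\<And>y. y \<in> carrier H \<Longrightarrow> \<exists>x\<in>carrier G. \<rho> x y"
    and null: "\<And>x y. \<lbrakk>x \<in> carrier G; y \<in> carrier H; \<rho> x y\<rbrakk> \<Longrightarrow> x \<in> N \<longleftrightarrow> y \<in> K"
  shows "G Mod N \<cong> H Mod K"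
proof -
  interpret G: comm_group G by fact
  interpret H: comm_group H by fact
  interpret N: normal N G by (rule G.subgroup_imp_normal[OF N])
  interpret K: normal K H by (rule H.subgroup_imp_normal[OF K])
  obtain f where f: "\<And>x. x \<in> carrier G \<Longrightarrow> f x \<in> carrier H" "\<And>x. x \<in> carrier G \<Longrightarrow> \<rho> x (f x)"
    using total by metis
  \<comment> \<open>For two partners of one \<open>x\<close>, their quotient is a partner of the
    unit, which lies in \<open>N\<close>; so the quotient lies in \<open>K\<close>.\<close>
  have eq: "K #>\<^bsub>H\<^esub> y = K #>\<^bsub>H\<^esub> y'" if "x \<in> carrier G" "y \<in> carrier H" "y' \<in> carrier H" "\<rho> x y" "\<rho> x y'" for x y y'
  proof -
    have "\<rho> \<one> (y \<otimes>\<^bsub>H\<^esub> inv\<^bsub>H\<^esub> y')" using div[OF that(1,1,2,3,4,5)] that by simp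
    then have "y \<otimes>\<^bsub>H\<^esub> inv\<^bsub>H\<^esub> y' \<in> K" using null[of \<one> "y \<otimes>\<^bsub>H\<^esub> inv\<^bsub>H\<^esub> y'"] that N.one_closed by simp
    then show ?thesis using H.rcoset_eq_iff[OF K that(2,3)] by simp
  qed
  have one: "\<rho> \<one> \<one>\<^bsub>H\<^esub>"
    using div[OF G.one_closed G.one_closed f(1) f(1) f(2) f(2)] f(1)[OF G.one_closed] by simp
  have mult: "\<rho> (x \<otimes> x') (y \<otimes>\<^bsub>H\<^esub> y')"
    if "x \<in> carrier G" "x' \<in> carrier G" "y \<in> carrier H" "y' \<in> carrier H" "\<rho> x y" "\<rho> x' y'" for x x' y y'
  proof -
    have "\<rho> (inv x') (inv\<^bsub>H\<^esub> y')" using div[OF G.one_closed that(2) H.one_closed that(4) one that(6)] that by simp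
    then show ?thesis using div[of x "inv x'" y "inv\<^bsub>H\<^esub> y'"] that by simp
  qed
  let ?h = "\<lambda>x. K #>\<^bsub>H\<^esub> f x"
  have "?h \<in> hom G (H Mod K)"
  proof (rule homI)
    fix x assume "x \<in> carrier G"
    then show "?h x \<in> carrier (H Mod K)" using f(1) by (simp add: FactGroup_def H.rcosetsI K.subset)
  next
    fix x y assume xy: "x \<in> carrier G" "y \<in> carrier G"
    have "?h (x \<otimes> y) = K #>\<^bsub>H\<^esub> (f x \<otimes>\<^bsub>H\<^esub> f y)"
      by (rule eq[of "x \<otimes> y"]) (use xy f mult in auto)
    then show "?h (x \<otimes> y) = ?h x \<otimes>\<^bsub>H Mod K\<^esub> ?h y" using xy f(1) K.rcos_sum by (simp add: FactGroup_def)
  qed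
  then interpret h: group_hom G "H Mod K" ?h
    by (intro group_hom.intro group_hom_axioms.intro) (auto simp: K.factorgroup_is_group)
  have "kernel G (H Mod K) ?h = N"
  proof (rule Set.set_eqI)
    fix x
    show "x \<in> kernel G (H Mod K) ?h \<longleftrightarrow> x \<in> N"
    proof (cases "x \<in> carrier G")
      case True
      then have "?h x = K \<longleftrightarrow> f x \<in> K"
        using H.rcoset_eq_iff[OF K f(1)[OF True] H.one_closed] f(1) H.coset_mult_one[OF K.subset] by simp
      then show ?thesis using True null f by (auto simp: kernel_def)
    next
      case False
      then show ?thesis using N.subset by (auto simp: kernel_def)
    qed
  qed
  moreover have "?h ` carrier G = carrier (H Mod K)"
  proof
    show "?h ` carrier G \<subseteq> carrier (H Mod K)" using h.hom_closed by auto
    show "carrier (H Mod K) \<subseteq> ?h ` carrier G"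
    proof
      fix c assume "c \<in> carrier (H Mod K)"
      then obtain y where y: "y \<in> carrier H" "c = K #>\<^bsub>H\<^esub> y" by (auto simp: FactGroup_def RCOSETS_def)
      then obtain x where "x \<in> carrier G" "\<rho> x y" using onto by blast
      then show "c \<in> ?h ` carrier G" using y f eq by blast
    qed
  qed
  ultimately show ?thesis using h.FactGroup_iso by simp
qed

section \<open>Ext groups in terms of cochains on bases\<close>

lemma lmod_hom_iff:
  assumes "left_module S X" "left_module S Y"
  shows "\<phi> \<in> lmod_hom S X Y \<longleftrightarrow> \<phi> \<in> extensional (carrier X) \<and> linear_map S X Y \<phi>"
  using assms unfolding lmod_hom_def linear_map_iff PiE_def by auto

lemma linear_map_restrict:
  assumes "linear_map S X Y \<phi>" shows "restrict \<phi> (carrier X) \<in> lmod_hom S X Y"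
proof -
  interpret linear_map S X Y \<phi> by fact
  show ?thesis
    unfolding lmod_hom_iff[OF dom.left_module_axioms cod.left_module_axioms] linear_map_iff
    using dom.left_module_axioms cod.left_module_axioms
    by (auto simp: closed add smult dom.smult_closed)
qed

lemma hom_group_simps [simp]:
  "carrier (hom_group S X Y) = lmod_hom S X Y"
  "\<phi> \<otimes>\<^bsub>hom_group S X Y\<^esub> \<psi> = (\<lambda>x\<in>carrier X. \<phi> x \<oplus>\<^bsub>Y\<^esub> \<psi> x)"
  "\<one>\<^bsub>hom_group S X Y\<^esub> = (\<lambda>x\<in>carrier X. \<zero>\<^bsub>Y\<^esub>)"
  by (simp_all add: hom_group_def)

lemma hom_group_comm_group:
  assumes X: "left_module S X" and Y: "left_module S Y"
  shows "comm_group (hom_group S X Y)"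
    and "\<phi> \<in> lmod_hom S X Y \<Longrightarrow> inv\<^bsub>hom_group S X Y\<^esub> \<phi> = (\<lambda>x\<in>carrier X. \<ominus>\<^bsub>Y\<^esub> \<phi> x)"
proof -
  interpret Y: left_module S Y by fact
  note iff = lmod_hom_iff[OF X Y]
  have c: "\<phi> x \<in> carrier Y" if "\<phi> \<in> lmod_hom S X Y" "x \<in> carrier X" for \<phi> x
    using that by (auto simp: lmod_hom_def)
  have e: "\<phi> \<in> extensional (carrier X)" if "\<phi> \<in> lmod_hom S X Y" for \<phi>
    using that by (simp add: iff)
  have add: "(\<lambda>x\<in>carrier X. \<phi> x \<oplus>\<^bsub>Y\<^esub> \<psi> x) \<in> lmod_hom S X Y"
    if "\<phi> \<in> lmod_hom S X Y" "\<psi> \<in> lmod_hom S X Y" for \<phi> \<psi>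
    using that by (intro linear_map_restrict Y.linear_map_add) (simp_all add: iff)
  have minus: "(\<lambda>x\<in>carrier X. \<ominus>\<^bsub>Y\<^esub> \<phi> x) \<in> lmod_hom S X Y" if "\<phi> \<in> lmod_hom S X Y" for \<phi>
    using that by (intro linear_map_restrict Y.linear_map_minus) (simp_all add: iff)
  have inv: "(\<lambda>x\<in>carrier X. \<ominus>\<^bsub>Y\<^esub> \<phi> x) \<otimes>\<^bsub>hom_group S X Y\<^esub> \<phi> = \<one>\<^bsub>hom_group S X Y\<^esub>"
    if "\<phi> \<in> lmod_hom S X Y" for \<phi>
    using c[OF that] by (auto simp: fun_eq_iff Y.M.l_neg)
  show *: "comm_group (hom_group S X Y)"
  proof (rule comm_groupI)
    show "\<one>\<^bsub>hom_group S X Y\<^esub> \<in> carrier (hom_group S X Y)"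
      using linear_map_restrict[OF Y.linear_map_const_zero[OF X]] by simp
  next
    fix \<phi> \<psi> \<chi> assume *: "\<phi> \<in> carrier (hom_group S X Y)" "\<psi> \<in> carrier (hom_group S X Y)" "\<chi> \<in> carrier (hom_group S X Y)"
    show "\<phi> \<otimes>\<^bsub>hom_group S X Y\<^esub> \<psi> \<otimes>\<^bsub>hom_group S X Y\<^esub> \<chi> = \<phi> \<otimes>\<^bsub>hom_group S X Y\<^esub> (\<psi> \<otimes>\<^bsub>hom_group S X Y\<^esub> \<chi>)"
      using * c by (auto simp: fun_eq_iff Y.M.a_assoc)
  next
    fix \<phi> \<psi> assume *: "\<phi> \<in> carrier (hom_group S X Y)" "\<psi> \<in> carrier (hom_group S X Y)"
    show "\<phi> \<otimes>\<^bsub>hom_group S X Y\<^esub> \<psi> = \<psi> \<otimes>\<^bsub>hom_group S X Y\<^esub> \<phi>"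
      using * c by (auto simp: fun_eq_iff Y.M.a_comm)
    show "\<phi> \<otimes>\<^bsub>hom_group S X Y\<^esub> \<psi> \<in> carrier (hom_group S X Y)" using * add by simp
  next
    fix \<phi> assume "\<phi> \<in> carrier (hom_group S X Y)"
    then have *: "\<phi> \<in> lmod_hom S X Y" by simp
    show "\<one>\<^bsub>hom_group S X Y\<^esub> \<otimes>\<^bsub>hom_group S X Y\<^esub> \<phi> = \<phi>"
      using e[OF *] c[OF *] by (auto simp: fun_eq_iff extensional_def)
    show "\<exists>\<psi>\<in>carrier (hom_group S X Y). \<psi> \<otimes>\<^bsub>hom_group S X Y\<^esub> \<phi> = \<one>\<^bsub>hom_group S X Y\<^esub>"
      using minus[OF *] inv[OF *] by (intro bexI[of _ "\<lambda>x\<in>carrier X. \<ominus>\<^bsub>Y\<^esub> \<phi> x"]) simp_all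
  qed
  interpret G: comm_group "hom_group S X Y" by (rule *)
  show "inv\<^bsub>hom_group S X Y\<^esub> \<phi> = (\<lambda>x\<in>carrier X. \<ominus>\<^bsub>Y\<^esub> \<phi> x)" if "\<phi> \<in> lmod_hom S X Y"
    by (rule G.inv_equality[OF inv[OF that]]) (use that minus in simp_all)
qed

text \<open>Translates the definition of Ext, which speaks of extensional homomorphisms on the
  syzygy resolution, into cochains: \<open>values \<phi>\<close> is the cochain of
  \<open>\<phi>\<close>, and \<open>hom_of_values\<close> goes back.\<close>

locale ext_data = X: left_module S X + Y: left_module S Y
  for S (structure) and X (structure) and Y (structure)
begin

sublocale res: free_resolution S X "syzygy_basis S X" "\<lambda>_. syzygy_boundary S" the_gen
  by (rule X.syzygy_resolution)

abbreviation "values \<phi> \<equiv> \<lambda>b. \<phi> (basis_vector S b)"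

lemma hom_iff: "\<phi> \<in> lmod_hom S (resolution S X k) Y \<longleftrightarrow>
    \<phi> \<in> extensional (carrier (res.F k)) \<and> linear_map S (res.F k) Y \<phi>"
  unfolding resolution_def by (rule lmod_hom_iff[OF res.F_module Y.left_module_axioms])

lemma hom_values:
  assumes "\<phi> \<in> lmod_hom S (resolution S X k) Y"
  shows "values \<phi> \<in> syzygy_basis S X k \<rightarrow> carrier Y"
    and "f \<in> carrier (res.F k) \<Longrightarrow> \<phi> f = linear_extension S Y (values \<phi>) f"
proof -
  have \<phi>: "linear_map S (res.F k) Y \<phi>" using assms hom_iff by simp
  show "values \<phi> \<in> syzygy_basis S X k \<rightarrow> carrier Y"
    by (rule funcsetI) (rule linear_map.closed[OF \<phi> X.R.basis_vector_closed])
  show "f \<in> carrier (res.F k) \<Longrightarrow> \<phi> f = linear_extension S Y (values \<phi>) f"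
    by (rule linear_map_on_free[OF \<phi>])
qed

lemma hom_of_values:
  assumes "c \<in> syzygy_basis S X k \<rightarrow> carrier Y"
  obtains \<phi> where "\<phi> \<in> lmod_hom S (resolution S X k) Y"
    "\<And>b. b \<in> syzygy_basis S X k \<Longrightarrow> values \<phi> b = c b"
proof
  let ?\<phi> = "restrict (linear_extension S Y c) (carrier (res.F k))"
  show "?\<phi> \<in> lmod_hom S (resolution S X k) Y"
    unfolding resolution_def by (rule linear_map_restrict[OF Y.linear_map_extension[OF assms]])
  show "values ?\<phi> b = c b" if "b \<in> syzygy_basis S X k" for b
    using X.R.basis_vector_closed[OF that] Y.linear_extension_basis_vector[where h = c, OF Pi_mem[OF assms that]] by simp
qed

lemma differential_eq: "f \<in> carrier (res.F (Suc k)) \<Longrightarrow> differential S X k f = res.D k f"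
  by (simp add: differential_def resolution_def)

text \<open>The definition tests all elements of the next free module, the cochain condition its
  basis only; the gap is closed by linearity.\<close>

lemma cocycles_iff:
  "\<phi> \<in> cocycles S X Y k \<longleftrightarrow> \<phi> \<in> lmod_hom S (resolution S X k) Y \<and>
    cocycle S Y (syzygy_basis S X) (\<lambda>_. syzygy_boundary S) k (values \<phi>)"
proof (cases "\<phi> \<in> lmod_hom S (resolution S X k) Y")
  case True
  have "\<phi> \<in> cocycles S X Y k \<longleftrightarrow> (\<forall>f\<in>carrier (res.F (Suc k)). \<phi> (res.D k f) = \<zero>\<^bsub>Y\<^esub>)"
    using True unfolding cocycles_def
    by (auto simp: compose_def fun_eq_iff differential_eq resolution_def)
  also have "\<dots> \<longleftrightarrow> (\<forall>f\<in>carrier (res.F (Suc k)). linear_extension S Y (values \<phi>) (res.D k f) = \<zero>\<^bsub>Y\<^esub>)"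
    using hom_values(2)[OF True res.D_closed] by simp
  also have "\<dots> \<longleftrightarrow> cocycle S Y (syzygy_basis S X) (\<lambda>_. syzygy_boundary S) k (values \<phi>)"
  proof
    assume *: "\<forall>f\<in>carrier (res.F (Suc k)). linear_extension S Y (values \<phi>) (res.D k f) = \<zero>\<^bsub>Y\<^esub>"
    have "linear_extension S Y (values \<phi>) (syzygy_boundary S b) = \<zero>\<^bsub>Y\<^esub>" if "b \<in> syzygy_basis S X (Suc k)" for b
      using *[rule_format, OF X.R.basis_vector_closed[OF that]] res.D_basis_vector[OF that] by simp
    then show "cocycle S Y (syzygy_basis S X) (\<lambda>_. syzygy_boundary S) k (values \<phi>)"
      unfolding cocycle_def using hom_values(1)[OF True] by blast
  next
    assume "cocycle S Y (syzygy_basis S X) (\<lambda>_. syzygy_boundary S) k (values \<phi>)"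
    from cocycle_boundary_zero[OF Y.left_module_axioms this res.d_closed]
    show "\<forall>f\<in>carrier (res.F (Suc k)). linear_extension S Y (values \<phi>) (res.D k f) = \<zero>\<^bsub>Y\<^esub>" by blast
  qed
  finally show ?thesis using True by simp
qed (simp add: cocycles_def)

lemma coboundaries_iff:
  assumes "\<phi> \<in> lmod_hom S (resolution S X (Suc k)) Y"
  shows "\<phi> \<in> coboundaries S X Y (Suc k) \<longleftrightarrow>
    coboundary S Y (syzygy_basis S X) (\<lambda>_. syzygy_boundary S) k (values \<phi>)"
proof
  assume "\<phi> \<in> coboundaries S X Y (Suc k)"
  then obtain \<eta> where \<eta>: "\<eta> \<in> lmod_hom S (resolution S X k) Y"
    "\<phi> = compose (carrier (resolution S X (Suc k))) \<eta> (differential S X k)" by auto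
  have "values \<phi> b = linear_extension S Y (values \<eta>) (syzygy_boundary S b)" if b: "b \<in> syzygy_basis S X (Suc k)" for b
    using X.R.basis_vector_closed[OF b] res.D_basis_vector[OF b] hom_values(2)[OF \<eta>(1) res.d_in_F[OF b]]
    by (simp add: \<eta>(2) compose_def differential_eq) (simp add: resolution_def)
  then show "coboundary S Y (syzygy_basis S X) (\<lambda>_. syzygy_boundary S) k (values \<phi>)"
    unfolding coboundary_def using hom_values(1)[OF \<eta>(1)] by blast
next
  assume "coboundary S Y (syzygy_basis S X) (\<lambda>_. syzygy_boundary S) k (values \<phi>)"
  then obtain h where h: "h \<in> syzygy_basis S X k \<rightarrow> carrier Y"
    "\<And>b. b \<in> syzygy_basis S X (Suc k) \<Longrightarrow> values \<phi> b = linear_extension S Y h (syzygy_boundary S b)"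
    unfolding coboundary_def by blast
  obtain \<eta> where \<eta>: "\<eta> \<in> lmod_hom S (resolution S X k) Y"
    "\<And>b. b \<in> syzygy_basis S X k \<Longrightarrow> values \<eta> b = h b" by (rule hom_of_values[OF h(1)]) blast
  \<comment> \<open>Agreement on the carrier gives equality of functions only because both sides are
    \<open>undefined\<close> outside it.\<close>
  have ext: "\<phi> \<in> extensional (carrier (res.F (Suc k)))" using assms hom_iff by simp
  have "\<phi> f = \<eta> (res.D k f)" if f: "f \<in> carrier (res.F (Suc k))" for f
  proof -
    have "\<phi> f = linear_extension S Y (values \<phi>) f" by (rule hom_values(2)[OF assms f])
    also have "\<dots> = linear_extension S Y (\<lambda>b. linear_extension S Y h (syzygy_boundary S b)) f"
      by (rule Y.linear_extension_cong[OF f hom_values(1)[OF assms] h(2)])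
    also have "\<dots> = linear_extension S Y h (res.D k f)"
      by (rule Y.linear_extension_compose[OF h(1) res.d_closed f, symmetric])
    also have "\<dots> = linear_extension S Y (values \<eta>) (res.D k f)"
      by (rule Y.linear_extension_cong[OF res.D_closed[OF f] h(1) \<eta>(2)[symmetric]])
    also have "\<dots> = \<eta> (res.D k f)"
      by (rule hom_values(2)[OF \<eta>(1) res.D_closed[OF f], symmetric])
    finally show ?thesis .
  qed
  then have "\<phi> = compose (carrier (resolution S X (Suc k))) \<eta> (differential S X k)"
    using ext by (auto simp: compose_def fun_eq_iff extensional_def resolution_def differential_eq)
  then show "\<phi> \<in> coboundaries S X Y (Suc k)" using \<eta>(1) by auto
qed

abbreviation "C k \<equiv> hom_group S (resolution S X k) Y"

lemma C_comm_group: "comm_group (C k)"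
  unfolding resolution_def by (rule hom_group_comm_group[OF res.F_module Y.left_module_axioms])

lemma C_inv: "\<phi> \<in> lmod_hom S (resolution S X k) Y \<Longrightarrow>
    inv\<^bsub>C k\<^esub> \<phi> = (\<lambda>x\<in>carrier (resolution S X k). \<ominus>\<^bsub>Y\<^esub> \<phi> x)"
  unfolding resolution_def by (rule hom_group_comm_group[OF res.F_module Y.left_module_axioms])

lemma values_add: "b \<in> syzygy_basis S X k \<Longrightarrow> values (\<phi> \<otimes>\<^bsub>C k\<^esub> \<psi>) b = values \<phi> b \<oplus>\<^bsub>Y\<^esub> values \<psi> b"
  using X.R.basis_vector_closed[of b "syzygy_basis S X k"] by (simp add: resolution_def)

lemma values_inv: "\<phi> \<in> lmod_hom S (resolution S X k) Y \<Longrightarrow> b \<in> syzygy_basis S X k \<Longrightarrow>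
    values (inv\<^bsub>C k\<^esub> \<phi>) b = \<ominus>\<^bsub>Y\<^esub> values \<phi> b"
  using X.R.basis_vector_closed[of b "syzygy_basis S X k"] unfolding C_inv by (simp add: resolution_def)

lemma cocycles_subgroup: "subgroup (cocycles S X Y k) (C k)"
proof -
  interpret C: comm_group "C k" by (rule C_comm_group)
  let ?B = "syzygy_basis S X" and ?d = "\<lambda>_::nat. syzygy_boundary S"
  \<comment> \<open>The group operations of \<open>C k\<close> restrict to the carrier of the
    resolution, so the values of a product or an inverse are known on basis elements only; that
    suffices for being a cocycle.\<close>
  have cong: "cocycle S Y ?B ?d k c" if "cocycle S Y ?B ?d k c'" "\<And>b. b \<in> ?B k \<Longrightarrow> c b = c' b" for c c'
  proof -
    have "linear_extension S Y c' (syzygy_boundary S b) = linear_extension S Y c (syzygy_boundary S b)"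
      if b: "b \<in> ?B (Suc k)" for b
      by (rule Y.linear_extension_cong[OF res.d_in_F[OF b]]) (use that \<open>cocycle S Y ?B ?d k c'\<close> in \<open>auto simp: cocycle_def \<open>\<And>b. b \<in> ?B k \<Longrightarrow> c b = c' b\<close>\<close>)
    then show ?thesis using that by (auto simp: cocycle_def Pi_iff)
  qed
  show ?thesis
  proof (rule C.subgroupI)
    show "cocycles S X Y k \<subseteq> carrier (C k)" by (auto simp: cocycles_def)
    have "cocycle S Y ?B ?d k (\<lambda>b. \<zero>\<^bsub>Y\<^esub>)"
      unfolding cocycle_def using Y.linear_extension_const_zero[OF res.d_in_F] by auto
    then have "cocycle S Y ?B ?d k (values \<one>\<^bsub>C k\<^esub>)"
      by (rule cong) (use X.R.basis_vector_closed[of _ "?B k"] in \<open>simp add: resolution_def\<close>)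
    then have "\<one>\<^bsub>C k\<^esub> \<in> cocycles S X Y k" unfolding cocycles_iff using C.one_closed by simp
    then show "cocycles S X Y k \<noteq> {}" by blast
  next
    fix \<phi> assume "\<phi> \<in> cocycles S X Y k"
    then have \<phi>: "\<phi> \<in> lmod_hom S (resolution S X k) Y" "cocycle S Y ?B ?d k (values \<phi>)"
      by (auto simp: cocycles_iff)
    have "cocycle S Y ?B ?d k (\<lambda>b. \<ominus>\<^bsub>Y\<^esub> values \<phi> b)"
      using \<phi>(2) Y.linear_extension_minus[OF hom_values(1)[OF \<phi>(1)] res.d_in_F] by (auto simp: cocycle_def Y.M.a_inv_zero)
    then have "cocycle S Y ?B ?d k (values (inv\<^bsub>C k\<^esub> \<phi>))"
      by (rule cong) (rule values_inv[OF \<phi>(1)])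
    then show "inv\<^bsub>C k\<^esub> \<phi> \<in> cocycles S X Y k"
      unfolding cocycles_iff using C.inv_closed[of \<phi>] \<phi>(1) by simp
  next
    fix \<phi> \<psi> assume "\<phi> \<in> cocycles S X Y k" "\<psi> \<in> cocycles S X Y k"
    then have \<phi>: "\<phi> \<in> lmod_hom S (resolution S X k) Y" "cocycle S Y ?B ?d k (values \<phi>)"
      and \<psi>: "\<psi> \<in> lmod_hom S (resolution S X k) Y" "cocycle S Y ?B ?d k (values \<psi>)"
      by (auto simp: cocycles_iff)
    have "cocycle S Y ?B ?d k (\<lambda>b. values \<phi> b \<oplus>\<^bsub>Y\<^esub> values \<psi> b)"
      using \<phi>(2) \<psi>(2) Y.linear_extension_add[OF hom_values(1)[OF \<phi>(1)] hom_values(1)[OF \<psi>(1)] res.d_in_F]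
      by (auto simp: cocycle_def)
    then have "cocycle S Y ?B ?d k (values (\<phi> \<otimes>\<^bsub>C k\<^esub> \<psi>))"
      by (rule cong) (rule values_add)
    then show "\<phi> \<otimes>\<^bsub>C k\<^esub> \<psi> \<in> cocycles S X Y k"
      unfolding cocycles_iff using C.m_closed[of \<phi> \<psi>] \<phi>(1) \<psi>(1) by simp
  qed
qed

abbreviation "Zgroup k \<equiv> (C k)\<lparr>carrier := cocycles S X Y k\<rparr>"

lemma Zgroup_comm_group: "comm_group (Zgroup k)"
proof -
  interpret C: comm_group "C k" by (rule C_comm_group)
  have "group (Zgroup k)" by (rule C.subgroup_imp_group[OF cocycles_subgroup])
  then show ?thesis
    by (rule group.group_comm_groupI)
      (use C.m_comm subgroup.subset[OF cocycles_subgroup] in \<open>auto simp: subset_iff\<close>)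
qed

lemma Zgroup_inv: "\<phi> \<in> cocycles S X Y k \<Longrightarrow> inv\<^bsub>Zgroup k\<^esub> \<phi> = inv\<^bsub>C k\<^esub> \<phi>"
  using group.m_inv_consistent[OF comm_group.axioms(2)[OF C_comm_group] cocycles_subgroup] by blast

lemma coboundaries_cocycles: "coboundaries S X Y (Suc k) \<subseteq> cocycles S X Y (Suc k)"
proof
  fix \<phi> assume \<phi>: "\<phi> \<in> coboundaries S X Y (Suc k)"
  then obtain \<eta> where \<eta>: "\<eta> \<in> lmod_hom S (resolution S X k) Y"
    "\<phi> = compose (carrier (resolution S X (Suc k))) \<eta> (differential S X k)" by auto
  have l: "linear_map S (res.F k) Y \<eta>" using \<eta>(1) hom_iff by simp
  have "\<phi> = restrict (\<lambda>f. \<eta> (res.D k f)) (carrier (res.F (Suc k)))"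
    unfolding \<eta>(2) by (auto simp: compose_def resolution_def differential_eq)
  then have h: "\<phi> \<in> lmod_hom S (resolution S X (Suc k)) Y"
    unfolding resolution_def using linear_map_restrict[OF linear_map_comp[OF res.D_linear l]] by simp
  obtain h where h': "h \<in> syzygy_basis S X k \<rightarrow> carrier Y"
    "\<And>b. b \<in> syzygy_basis S X (Suc k) \<Longrightarrow> values \<phi> b = linear_extension S Y h (syzygy_boundary S b)"
    using \<phi> unfolding coboundaries_iff[OF h] coboundary_def by blast
  have "linear_extension S Y (values \<phi>) (syzygy_boundary S b) = \<zero>\<^bsub>Y\<^esub>" if b: "b \<in> syzygy_basis S X (Suc (Suc k))" for b
  proof -
    have "linear_extension S Y (values \<phi>) (syzygy_boundary S b) =
        linear_extension S Y (\<lambda>b. linear_extension S Y h (syzygy_boundary S b)) (syzygy_boundary S b)"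
      by (rule Y.linear_extension_cong[OF res.d_in_F[OF b] hom_values(1)[OF h] h'(2)])
    also have "\<dots> = linear_extension S Y h (res.D k (syzygy_boundary S b))"
      by (rule Y.linear_extension_compose[OF h'(1) res.d_closed res.d_in_F[OF b], symmetric])
    also have "\<dots> = \<zero>\<^bsub>Y\<^esub>"
      using res.D_d[OF b] Y.linear_extension_zero[OF h'(1)] by simp
    finally show ?thesis .
  qed
  then show "\<phi> \<in> cocycles S X Y (Suc k)" unfolding cocycles_iff cocycle_def using h hom_values(1)[OF h] by blast
qed

lemma coboundaries_subgroup: "subgroup (coboundaries S X Y (Suc k)) (Zgroup (Suc k))"
proof -
  interpret Zg: comm_group "Zgroup (Suc k)" by (rule Zgroup_comm_group)
  let ?B = "syzygy_basis S X" and ?d = "\<lambda>_::nat. syzygy_boundary S"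
  show ?thesis
  proof (rule Zg.subgroupI)
    show "coboundaries S X Y (Suc k) \<subseteq> carrier (Zgroup (Suc k))" using coboundaries_cocycles by simp
    have "lmod_hom S (resolution S X k) Y \<noteq> {}"
      using comm_group.axioms(2)[OF C_comm_group[of k], THEN group.is_monoid, THEN monoid.one_closed] by auto
    then show "coboundaries S X Y (Suc k) \<noteq> {}" by simp
  next
    fix \<phi> assume \<phi>: "\<phi> \<in> coboundaries S X Y (Suc k)"
    have hom: "\<phi> \<in> lmod_hom S (resolution S X (Suc k)) Y" using \<phi> coboundaries_cocycles cocycles_iff by blast
    have z: "\<phi> \<in> cocycles S X Y (Suc k)" using \<phi> coboundaries_cocycles by blast
    obtain h where h: "h \<in> ?B k \<rightarrow> carrier Y"
      "\<And>b. b \<in> ?B (Suc k) \<Longrightarrow> values \<phi> b = linear_extension S Y h (syzygy_boundary S b)"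
      using \<phi> unfolding coboundaries_iff[OF hom] coboundary_def by blast
    have "coboundary S Y ?B ?d k (values (inv\<^bsub>C (Suc k)\<^esub> \<phi>))"
      unfolding coboundary_def
      by (rule bexI[of _ "\<lambda>b. \<ominus>\<^bsub>Y\<^esub> h b"])
        (use h in \<open>auto simp: values_inv[OF hom] Y.linear_extension_minus[OF h(1) res.d_in_F]\<close>)
    moreover have "inv\<^bsub>C (Suc k)\<^esub> \<phi> \<in> lmod_hom S (resolution S X (Suc k)) Y"
      using group.inv_closed[OF comm_group.axioms(2)[OF C_comm_group], of \<phi> "Suc k"] hom by simp
    ultimately show "inv\<^bsub>Zgroup (Suc k)\<^esub> \<phi> \<in> coboundaries S X Y (Suc k)"
      unfolding Zgroup_inv[OF z] using coboundaries_iff by blast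
  next
    fix \<phi> \<psi> assume \<phi>: "\<phi> \<in> coboundaries S X Y (Suc k)" and \<psi>: "\<psi> \<in> coboundaries S X Y (Suc k)"
    have hom: "\<phi> \<in> lmod_hom S (resolution S X (Suc k)) Y" "\<psi> \<in> lmod_hom S (resolution S X (Suc k)) Y"
      using \<phi> \<psi> coboundaries_cocycles cocycles_iff by blast+
    obtain h where h: "h \<in> ?B k \<rightarrow> carrier Y"
      "\<And>b. b \<in> ?B (Suc k) \<Longrightarrow> values \<phi> b = linear_extension S Y h (syzygy_boundary S b)"
      using \<phi> unfolding coboundaries_iff[OF hom(1)] coboundary_def by blast
    obtain h' where h': "h' \<in> ?B k \<rightarrow> carrier Y"
      "\<And>b. b \<in> ?B (Suc k) \<Longrightarrow> values \<psi> b = linear_extension S Y h' (syzygy_boundary S b)"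
      using \<psi> unfolding coboundaries_iff[OF hom(2)] coboundary_def by blast
    have "coboundary S Y ?B ?d k (values (\<phi> \<otimes>\<^bsub>C (Suc k)\<^esub> \<psi>))"
      unfolding coboundary_def
    proof (rule bexI[of _ "\<lambda>b. h b \<oplus>\<^bsub>Y\<^esub> h' b"], intro ballI)
      fix b assume b: "b \<in> ?B (Suc k)"
      show "values (\<phi> \<otimes>\<^bsub>C (Suc k)\<^esub> \<psi>) b = linear_extension S Y (\<lambda>b. h b \<oplus>\<^bsub>Y\<^esub> h' b) (syzygy_boundary S b)"
        unfolding values_add[OF b] Y.linear_extension_add[OF h(1) h'(1) res.d_in_F[OF b]]
        using h(2)[OF b] h'(2)[OF b] by simp
    qed (use h(1) h'(1) in auto)
    moreover have "\<phi> \<otimes>\<^bsub>C (Suc k)\<^esub> \<psi> \<in> lmod_hom S (resolution S X (Suc k)) Y"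
      using group.is_monoid[OF comm_group.axioms(2)[OF C_comm_group[of "Suc k"]], THEN monoid.m_closed, of \<phi> \<psi>] hom by simp
    ultimately show "\<phi> \<otimes>\<^bsub>Zgroup (Suc k)\<^esub> \<psi> \<in> coboundaries S X Y (Suc k)"
      using coboundaries_iff by simp
  qed
qed

lemma Ext_eq: "Ext S k X Y = Zgroup k Mod coboundaries S X Y k"
  by (simp add: Ext_def)

lemma Ext_group: "group (Ext S (Suc k) X Y)"
  unfolding Ext_eq
  by (rule normal.factorgroup_is_group[OF comm_group.subgroup_imp_normal[OF Zgroup_comm_group coboundaries_subgroup]])

lemma Ext_trivial_iff:
  "trivial_group (Ext S (Suc k) X Y) \<longleftrightarrow>
    (\<forall>c. cocycle S Y (syzygy_basis S X) (\<lambda>_. syzygy_boundary S) (Suc k) c \<longrightarrow>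
      coboundary S Y (syzygy_basis S X) (\<lambda>_. syzygy_boundary S) k c)"
proof -
  interpret Zg: comm_group "Zgroup (Suc k)" by (rule Zgroup_comm_group)
  let ?N = "coboundaries S X Y (Suc k)" and ?B = "syzygy_basis S X" and ?d = "\<lambda>_::nat. syzygy_boundary S"
  interpret N: normal ?N "Zgroup (Suc k)" by (rule Zg.subgroup_imp_normal[OF coboundaries_subgroup])
  have "trivial_group (Ext S (Suc k) X Y) \<longleftrightarrow> (\<forall>\<phi>\<in>carrier (Zgroup (Suc k)). ?N #>\<^bsub>Zgroup (Suc k)\<^esub> \<phi> = ?N)"
    unfolding group.trivial_group_subset[OF Ext_group] unfolding Ext_eq
    by (auto simp: FactGroup_def RCOSETS_def)
  also have "\<dots> \<longleftrightarrow> cocycles S X Y (Suc k) \<subseteq> ?N"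
  proof -
    have "?N #>\<^bsub>Zgroup (Suc k)\<^esub> \<phi> = ?N \<longleftrightarrow> \<phi> \<in> ?N" if "\<phi> \<in> carrier (Zgroup (Suc k))" for \<phi>
      using Zg.coset_join1[OF _ that N.subgroup_axioms] Zg.coset_join2[OF that N.subgroup_axioms] by blast
    then show ?thesis by auto
  qed
  also have "\<dots> \<longleftrightarrow> (\<forall>c. cocycle S Y ?B ?d (Suc k) c \<longrightarrow> coboundary S Y ?B ?d k c)"
  proof
    assume *: "cocycles S X Y (Suc k) \<subseteq> ?N"
    show "\<forall>c. cocycle S Y ?B ?d (Suc k) c \<longrightarrow> coboundary S Y ?B ?d k c"
    proof (intro allI impI)
      fix c assume c: "cocycle S Y ?B ?d (Suc k) c"
      then have cc: "c \<in> ?B (Suc k) \<rightarrow> carrier Y" by (simp add: cocycle_def)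
      obtain \<phi> where \<phi>: "\<phi> \<in> lmod_hom S (resolution S X (Suc k)) Y" "\<And>b. b \<in> ?B (Suc k) \<Longrightarrow> values \<phi> b = c b"
        by (rule hom_of_values[OF cc]) blast
      have "linear_extension S Y (values \<phi>) (syzygy_boundary S b) = linear_extension S Y c (syzygy_boundary S b)"
        if "b \<in> ?B (Suc (Suc k))" for b
        by (rule Y.linear_extension_cong[OF res.d_in_F[OF that] hom_values(1)[OF \<phi>(1)] \<phi>(2)])
      then have "cocycle S Y ?B ?d (Suc k) (values \<phi>)"
        using c hom_values(1)[OF \<phi>(1)] by (simp add: cocycle_def)
      then have "\<phi> \<in> ?N" using * \<phi>(1) cocycles_iff by blast
      then show "coboundary S Y ?B ?d k c"
        unfolding coboundaries_iff[OF \<phi>(1)] coboundary_def by (simp add: \<phi>(2))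
    qed
  next
    assume "\<forall>c. cocycle S Y ?B ?d (Suc k) c \<longrightarrow> coboundary S Y ?B ?d k c"
    then show "cocycles S X Y (Suc k) \<subseteq> ?N" using cocycles_iff coboundaries_iff by blast
  qed
  finally show ?thesis .
qed

lemma Ext_all_trivial_iff:
  "(\<forall>i\<ge>1. trivial_group (Ext S i X Y)) \<longleftrightarrow> acyclic_for S Y (syzygy_basis S X) (\<lambda>_. syzygy_boundary S)"
proof -
  have "(\<forall>i\<ge>1. P i) \<longleftrightarrow> (\<forall>k. P (Suc k))" for P :: "nat \<Rightarrow> bool"
    by (metis Suc_le_D le_add1 plus_1_eq_Suc One_nat_def)
  then show ?thesis unfolding acyclic_for_def by (simp add: Ext_trivial_iff)
qed

end

text \<open>Both rings and both degrees are independent, since the lemma serves the shift of degree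
  over the trivial extension and also the comparison with Ext over \<open>R\<close>. The degrees are
  successors because \<open>coboundary\<close> describes cochains of positive degree.\<close>

lemma Ext_iso_by_relation:
  fixes S1 :: "('s1, 'e1) ring_scheme" and X1 :: "('s1, 'x1, 'f1) module_scheme" and Y1 :: "('s1, 'y1, 'g1) module_scheme"
    and S2 :: "('s2, 'e2) ring_scheme" and X2 :: "('s2, 'x2, 'f2) module_scheme" and Y2 :: "('s2, 'y2, 'g2) module_scheme"
  defines "B1 \<equiv> syzygy_basis S1 X1" and "d1 \<equiv> \<lambda>_::nat. syzygy_boundary S1"
    and "B2 \<equiv> syzygy_basis S2 X2" and "d2 \<equiv> \<lambda>_::nat. syzygy_boundary S2"
  assumes "ext_data S1 X1 Y1" "ext_data S2 X2 Y2"
    and diff: "\<And>c1 c2 a1 a2 x1 x2. \<lbrakk>\<rho> c1 c2; \<rho> a1 a2;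
      \<And>b. b \<in> B1 (Suc i) \<Longrightarrow> x1 b = c1 b \<ominus>\<^bsub>Y1\<^esub> a1 b; \<And>b. b \<in> B2 (Suc j) \<Longrightarrow> x2 b = c2 b \<ominus>\<^bsub>Y2\<^esub> a2 b\<rbrakk>
      \<Longrightarrow> \<rho> x1 x2"
    and total: "\<And>c. cocycle S1 Y1 B1 d1 (Suc i) c \<Longrightarrow> \<exists>c'. cocycle S2 Y2 B2 d2 (Suc j) c' \<and> \<rho> c c'"
    and onto: "\<And>c'. cocycle S2 Y2 B2 d2 (Suc j) c' \<Longrightarrow> \<exists>c. cocycle S1 Y1 B1 d1 (Suc i) c \<and> \<rho> c c'"
    and null: "\<And>c c'. \<lbrakk>cocycle S1 Y1 B1 d1 (Suc i) c; cocycle S2 Y2 B2 d2 (Suc j) c'; \<rho> c c'\<rbrakk> \<Longrightarrow>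
      coboundary S1 Y1 B1 d1 i c \<longleftrightarrow> coboundary S2 Y2 B2 d2 j c'"
  shows "Ext S1 (Suc i) X1 Y1 \<cong> Ext S2 (Suc j) X2 Y2"
proof -
  interpret E1: ext_data S1 X1 Y1 by fact
  interpret E2: ext_data S2 X2 Y2 by fact
  \<comment> \<open>\<open>\<rho>\<close> does not see values off the basis: subtracting a related
    pair from itself relates the zero cochains, and subtracting these from the pair allows any
    change off the basis.\<close>
  have cong: "\<rho> x1 x2" if r: "\<rho> c1 c2" and c: "c1 \<in> B1 (Suc i) \<rightarrow> carrier Y1" "c2 \<in> B2 (Suc j) \<rightarrow> carrier Y2"
    and x: "\<And>b. b \<in> B1 (Suc i) \<Longrightarrow> x1 b = c1 b" "\<And>b. b \<in> B2 (Suc j) \<Longrightarrow> x2 b = c2 b" for c1 c2 x1 x2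
  proof -
    have "\<rho> (\<lambda>_. \<zero>\<^bsub>Y1\<^esub>) (\<lambda>_. \<zero>\<^bsub>Y2\<^esub>)"
      by (rule diff[OF r r]) (use Pi_mem[OF c(1)] Pi_mem[OF c(2)] in \<open>simp_all add: a_minus_def E1.Y.M.r_neg E2.Y.M.r_neg\<close>)
    note z = this
    show ?thesis
      by (rule diff[OF r z]) (use x Pi_mem[OF c(1)] Pi_mem[OF c(2)] in \<open>simp_all add: a_minus_def E1.Y.M.a_inv_zero E2.Y.M.a_inv_zero\<close>)
  qed
  have coc1: "\<phi> \<in> cocycles S1 X1 Y1 (Suc i) \<longleftrightarrow> \<phi> \<in> lmod_hom S1 (resolution S1 X1 (Suc i)) Y1 \<and>
      cocycle S1 Y1 B1 d1 (Suc i) (E1.values \<phi>)" for \<phi>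
    unfolding B1_def d1_def by (rule E1.cocycles_iff)
  have coc2: "\<phi> \<in> cocycles S2 X2 Y2 (Suc j) \<longleftrightarrow> \<phi> \<in> lmod_hom S2 (resolution S2 X2 (Suc j)) Y2 \<and>
      cocycle S2 Y2 B2 d2 (Suc j) (E2.values \<phi>)" for \<phi>
    unfolding B2_def d2_def by (rule E2.cocycles_iff)
  let ?\<rho> = "\<lambda>\<phi> \<psi>. \<rho> (E1.values \<phi>) (E2.values \<psi>)"
  show ?thesis
    unfolding E1.Ext_eq E2.Ext_eq
  proof (rule quotient_iso_by_relation[where \<rho> = ?\<rho>])
    show "comm_group (E1.Zgroup (Suc i))" by (rule E1.Zgroup_comm_group)
    show "comm_group (E2.Zgroup (Suc j))" by (rule E2.Zgroup_comm_group)
    show "subgroup (coboundaries S1 X1 Y1 (Suc i)) (E1.Zgroup (Suc i))" by (rule E1.coboundaries_subgroup)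
    show "subgroup (coboundaries S2 X2 Y2 (Suc j)) (E2.Zgroup (Suc j))" by (rule E2.coboundaries_subgroup)
  next
    fix x y x' y'
    assume xy: "x \<in> carrier (E1.Zgroup (Suc i))" "x' \<in> carrier (E1.Zgroup (Suc i))"
      "y \<in> carrier (E2.Zgroup (Suc j))" "y' \<in> carrier (E2.Zgroup (Suc j))" and r: "?\<rho> x y" "?\<rho> x' y'"
    have hx: "x' \<in> cocycles S1 X1 Y1 (Suc i)" "x' \<in> lmod_hom S1 (resolution S1 X1 (Suc i)) Y1"
      "y' \<in> cocycles S2 X2 Y2 (Suc j)" "y' \<in> lmod_hom S2 (resolution S2 X2 (Suc j)) Y2"
      using xy by (auto simp: coc1 coc2)
    have ix: "x \<otimes>\<^bsub>E1.Zgroup (Suc i)\<^esub> inv\<^bsub>E1.Zgroup (Suc i)\<^esub> x' = x \<otimes>\<^bsub>E1.C (Suc i)\<^esub> inv\<^bsub>E1.C (Suc i)\<^esub> x'"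
      "y \<otimes>\<^bsub>E2.Zgroup (Suc j)\<^esub> inv\<^bsub>E2.Zgroup (Suc j)\<^esub> y' = y \<otimes>\<^bsub>E2.C (Suc j)\<^esub> inv\<^bsub>E2.C (Suc j)\<^esub> y'"
      unfolding E1.Zgroup_inv[OF hx(1)] E2.Zgroup_inv[OF hx(3)] by simp_all
    show "?\<rho> (x \<otimes>\<^bsub>E1.Zgroup (Suc i)\<^esub> inv\<^bsub>E1.Zgroup (Suc i)\<^esub> x') (y \<otimes>\<^bsub>E2.Zgroup (Suc j)\<^esub> inv\<^bsub>E2.Zgroup (Suc j)\<^esub> y')"
      unfolding ix
    proof (rule diff[OF r])
      fix b assume "b \<in> B1 (Suc i)"
      then have b: "b \<in> syzygy_basis S1 X1 (Suc i)" by (simp add: B1_def)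
      show "E1.values (x \<otimes>\<^bsub>E1.C (Suc i)\<^esub> inv\<^bsub>E1.C (Suc i)\<^esub> x') b = E1.values x b \<ominus>\<^bsub>Y1\<^esub> E1.values x' b"
        unfolding E1.values_add[OF b] E1.values_inv[OF hx(2) b] a_minus_def ..
    next
      fix b assume "b \<in> B2 (Suc j)"
      then have b: "b \<in> syzygy_basis S2 X2 (Suc j)" by (simp add: B2_def)
      show "E2.values (y \<otimes>\<^bsub>E2.C (Suc j)\<^esub> inv\<^bsub>E2.C (Suc j)\<^esub> y') b = E2.values y b \<ominus>\<^bsub>Y2\<^esub> E2.values y' b"
        unfolding E2.values_add[OF b] E2.values_inv[OF hx(4) b] a_minus_def ..
    qed
  next
    fix x assume "x \<in> carrier (E1.Zgroup (Suc i))"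
    then have x: "x \<in> lmod_hom S1 (resolution S1 X1 (Suc i)) Y1" "cocycle S1 Y1 B1 d1 (Suc i) (E1.values x)"
      by (auto simp: coc1)
    obtain c where c: "cocycle S2 Y2 B2 d2 (Suc j) c" "\<rho> (E1.values x) c" using total[OF x(2)] by blast
    then have cc: "c \<in> syzygy_basis S2 X2 (Suc j) \<rightarrow> carrier Y2" by (simp add: cocycle_def B2_def)
    obtain y where y: "y \<in> lmod_hom S2 (resolution S2 X2 (Suc j)) Y2"
      "\<And>b. b \<in> syzygy_basis S2 X2 (Suc j) \<Longrightarrow> E2.values y b = c b" by (rule E2.hom_of_values[OF cc]) blast
    have "linear_extension S2 Y2 (E2.values y) (syzygy_boundary S2 b) = linear_extension S2 Y2 c (syzygy_boundary S2 b)"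
      if "b \<in> syzygy_basis S2 X2 (Suc (Suc j))" for b
      by (rule E2.Y.linear_extension_cong[OF E2.res.d_in_F[OF that] E2.hom_values(1)[OF y(1)] y(2)])
    then have "cocycle S2 Y2 B2 d2 (Suc j) (E2.values y)"
      using c(1) E2.hom_values(1)[OF y(1)] by (simp add: cocycle_def B2_def d2_def)
    moreover have "?\<rho> x y"
      by (rule cong[OF c(2)]) (use x c y in \<open>auto simp: cocycle_def B2_def\<close>)
    ultimately show "\<exists>y\<in>carrier (E2.Zgroup (Suc j)). ?\<rho> x y" using y(1) coc2 by auto
  next
    fix y assume "y \<in> carrier (E2.Zgroup (Suc j))"
    then have y: "y \<in> lmod_hom S2 (resolution S2 X2 (Suc j)) Y2" "cocycle S2 Y2 B2 d2 (Suc j) (E2.values y)"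
      by (auto simp: coc2)
    obtain c where c: "cocycle S1 Y1 B1 d1 (Suc i) c" "\<rho> c (E2.values y)" using onto[OF y(2)] by blast
    then have cc: "c \<in> syzygy_basis S1 X1 (Suc i) \<rightarrow> carrier Y1" by (simp add: cocycle_def B1_def)
    obtain x where x: "x \<in> lmod_hom S1 (resolution S1 X1 (Suc i)) Y1"
      "\<And>b. b \<in> syzygy_basis S1 X1 (Suc i) \<Longrightarrow> E1.values x b = c b" by (rule E1.hom_of_values[OF cc]) blast
    have "linear_extension S1 Y1 (E1.values x) (syzygy_boundary S1 b) = linear_extension S1 Y1 c (syzygy_boundary S1 b)"
      if "b \<in> syzygy_basis S1 X1 (Suc (Suc i))" for b
      by (rule E1.Y.linear_extension_cong[OF E1.res.d_in_F[OF that] E1.hom_values(1)[OF x(1)] x(2)])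
    then have "cocycle S1 Y1 B1 d1 (Suc i) (E1.values x)"
      using c(1) E1.hom_values(1)[OF x(1)] by (simp add: cocycle_def B1_def d1_def)
    moreover have "?\<rho> x y"
      by (rule cong[OF c(2)]) (use x c y in \<open>auto simp: cocycle_def B1_def\<close>)
    ultimately show "\<exists>x\<in>carrier (E1.Zgroup (Suc i)). ?\<rho> x y" using x(1) coc1 by auto
  next
    fix x y assume "x \<in> carrier (E1.Zgroup (Suc i))" "y \<in> carrier (E2.Zgroup (Suc j))" and r: "?\<rho> x y"
    then have x: "x \<in> lmod_hom S1 (resolution S1 X1 (Suc i)) Y1" "cocycle S1 Y1 B1 d1 (Suc i) (E1.values x)"
      and y: "y \<in> lmod_hom S2 (resolution S2 X2 (Suc j)) Y2" "cocycle S2 Y2 B2 d2 (Suc j) (E2.values y)"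
      by (auto simp: coc1 coc2)
    show "x \<in> coboundaries S1 X1 Y1 (Suc i) \<longleftrightarrow> y \<in> coboundaries S2 X2 Y2 (Suc j)"
      using null[OF x(2) y(2) r] unfolding E1.coboundaries_iff[OF x(1)] E2.coboundaries_iff[OF y(1)]
        B1_def B2_def d1_def d2_def .
  qed
qed

section \<open>Tensor powers\<close>

definition balanced ::
  "('r, 'e) ring_scheme \<Rightarrow> ('r, 'm, 'f) bimodule_scheme \<Rightarrow> ('r, 'x, 'g) module_scheme
    \<Rightarrow> ('y, 'h) ring_scheme \<Rightarrow> ('m \<Rightarrow> 'x \<Rightarrow> 'y) \<Rightarrow> bool"
  where "balanced R M N G \<beta> \<longleftrightarrow>
    (\<forall>m\<in>carrier M. \<forall>x\<in>carrier N. \<beta> m x \<in> carrier G) \<and>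
    (\<forall>m\<in>carrier M. \<forall>m'\<in>carrier M. \<forall>x\<in>carrier N. \<beta> (m \<oplus>\<^bsub>M\<^esub> m') x = \<beta> m x \<oplus>\<^bsub>G\<^esub> \<beta> m' x) \<and>
    (\<forall>m\<in>carrier M. \<forall>x\<in>carrier N. \<forall>x'\<in>carrier N. \<beta> m (x \<oplus>\<^bsub>N\<^esub> x') = \<beta> m x \<oplus>\<^bsub>G\<^esub> \<beta> m x') \<and>
    (\<forall>m\<in>carrier M. \<forall>r\<in>carrier R. \<forall>x\<in>carrier N. \<beta> (m \<bullet>\<^bsub>M\<^esub> r) x = \<beta> m (r \<odot>\<^bsub>N\<^esub> x))"

text \<open>\<open>N\<close> is stored in the element type of the tensor powers, so that
  \<open>tensor_code\<close> applies to its tensor product with \<open>M\<close>.\<close>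

locale tensor = bimodule R M + N: left_module R N
  for R :: "('r, 'e) ring_scheme" (structure) and M :: "('r, 'm, 'f) bimodule_scheme" (structure)
    and N :: "('r, ('r, 'm) tensor, 'g) module_scheme" (structure)
begin

abbreviation "A \<equiv> free_Abelian_group (carrier M \<times> carrier N)"
abbreviation "K \<equiv> tensor_null R M N"
abbreviation "TP \<equiv> tensor_product R M N"
abbreviation "cl \<equiv> tensor_class R M N"
abbreviation "ten m x \<equiv> cl (frag_of (m, x))"

sublocale A: comm_group A
  by (rule abelian_free_Abelian_group)

lemma A_add: "p \<in> carrier A \<Longrightarrow> q \<in> carrier A \<Longrightarrow> p + q \<in> carrier A"
  using A.m_closed[of p q] by simp

lemma A_minus: "p \<in> carrier A \<Longrightarrow> - p \<in> carrier A"
  using A.inv_closed[of p] by simp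

lemma A_diff: "p \<in> carrier A \<Longrightarrow> q \<in> carrier A \<Longrightarrow> p - q \<in> carrier A"
  using A_add[of p "- q"] A_minus[of q] by simp

lemma A_frag: "frag_of p \<in> carrier A \<longleftrightarrow> p \<in> carrier M \<times> carrier N"
  by (rule frag_of_in_free_Abelian_group)

lemma relations_closed: "tensor_relations R M N \<subseteq> carrier A"
proof
  fix p assume "p \<in> tensor_relations R M N"
  then show "p \<in> carrier A"
    unfolding tensor_relations_def
    by (auto simp del: carrier_free_Abelian_group_iff intro!: A_diff
        simp: A_frag rsmult_closed N.smult_closed)
qed

lemma K_subgroup: "subgroup K A"
  unfolding tensor_null_def by (rule A.generate_is_subgroup[OF relations_closed])

sublocale K: normal K A
  by (rule A.subgroup_imp_normal[OF K_subgroup])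

lemma relation_in_K: "p \<in> tensor_relations R M N \<Longrightarrow> p \<in> K"
  unfolding tensor_null_def by (rule generate.incl)

lemma cl_eq: "p \<in> carrier A \<Longrightarrow> q \<in> carrier A \<Longrightarrow> cl p = cl q \<longleftrightarrow> p - q \<in> K"
  unfolding tensor_class_def using A.rcoset_eq_iff[OF K_subgroup] by simp

lemma TP_carrier: "carrier TP = cl ` carrier A"
  by (auto simp: tensor_product_def Let_def FactGroup_def RCOSETS_def tensor_class_def)

lemma cl_closed: "p \<in> carrier A \<Longrightarrow> cl p \<in> carrier TP"
  unfolding TP_carrier by blast

lemma cl_add: "p \<in> carrier A \<Longrightarrow> q \<in> carrier A \<Longrightarrow> cl p \<oplus>\<^bsub>TP\<^esub> cl q = cl (p + q)"
  using K.rcos_sum by (simp add: tensor_product_def Let_def FactGroup_def tensor_class_def)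

lemma TP_zero: "\<zero>\<^bsub>TP\<^esub> = cl 0"
  using A.coset_mult_one[OF K.subset] by (simp add: tensor_product_def Let_def FactGroup_def tensor_class_def)

lemma A_zero: "0 \<in> carrier A" by simp

lemma TP_group: "abelian_group TP"
proof (rule abelian_groupI)
  show "\<exists>y\<in>carrier TP. y \<oplus>\<^bsub>TP\<^esub> x = \<zero>\<^bsub>TP\<^esub>" if x: "x \<in> carrier TP" for x
  proof -
    obtain p where p: "p \<in> carrier A" "x = cl p" using x unfolding TP_carrier by blast
    then have "cl (- p) \<oplus>\<^bsub>TP\<^esub> x = \<zero>\<^bsub>TP\<^esub>" by (simp add: TP_zero cl_add[OF A_minus] del: carrier_free_Abelian_group_iff)
    then show ?thesis using cl_closed[OF A_minus[OF p(1)]] by blast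
  qed
qed (auto simp: TP_carrier TP_zero cl_add A_add A_zero add_ac simp del: carrier_free_Abelian_group_iff)

sublocale TP: abelian_group TP
  by (rule TP_group)

lemma cl_minus: "p \<in> carrier A \<Longrightarrow> cl (- p) = \<ominus>\<^bsub>TP\<^esub> cl p"
  by (rule TP.minus_equality[symmetric]) (simp_all add: cl_add A_minus TP_zero cl_closed del: carrier_free_Abelian_group_iff)

lemma cl_diff: "p \<in> carrier A \<Longrightarrow> q \<in> carrier A \<Longrightarrow> cl (p - q) = cl p \<ominus>\<^bsub>TP\<^esub> cl q"
  using cl_add[of p "- q"] A_minus[of q] cl_minus[of q] by (simp add: a_minus_def del: carrier_free_Abelian_group_iff)

lemma ten_balanced: "balanced R M N TP ten"
proof -
  have cl: "frag_of (m, x) \<in> carrier A" if "m \<in> carrier M" "x \<in> carrier N" for m x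
    using that by simp
  have 1: "ten (m \<oplus>\<^bsub>M\<^esub> m') x = ten m x \<oplus>\<^bsub>TP\<^esub> ten m' x"
    if "m \<in> carrier M" "m' \<in> carrier M" "x \<in> carrier N" for m m' x
  proof -
    have "frag_of (m \<oplus>\<^bsub>M\<^esub> m', x) - frag_of (m, x) - frag_of (m', x) \<in> K"
      using that by (intro relation_in_K) (auto simp: tensor_relations_def)
    then have "cl (frag_of (m \<oplus>\<^bsub>M\<^esub> m', x)) = cl (frag_of (m, x) + frag_of (m', x))"
      using that cl A_add by (subst cl_eq) (simp_all add: diff_diff_eq del: carrier_free_Abelian_group_iff)
    then show ?thesis using that cl by (simp add: cl_add del: carrier_free_Abelian_group_iff)
  qed
  have 2: "ten m (x \<oplus>\<^bsub>N\<^esub> x') = ten m x \<oplus>\<^bsub>TP\<^esub> ten m x'"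
    if "m \<in> carrier M" "x \<in> carrier N" "x' \<in> carrier N" for m x x'
  proof -
    have "frag_of (m, x \<oplus>\<^bsub>N\<^esub> x') - frag_of (m, x) - frag_of (m, x') \<in> K"
      using that by (intro relation_in_K) (auto simp: tensor_relations_def)
    then have "cl (frag_of (m, x \<oplus>\<^bsub>N\<^esub> x')) = cl (frag_of (m, x) + frag_of (m, x'))"
      using that cl A_add by (subst cl_eq) (simp_all add: diff_diff_eq del: carrier_free_Abelian_group_iff)
    then show ?thesis using that cl by (simp add: cl_add del: carrier_free_Abelian_group_iff)
  qed
  have 3: "ten (m \<bullet>\<^bsub>M\<^esub> r) x = ten m (r \<odot>\<^bsub>N\<^esub> x)"
    if "m \<in> carrier M" "r \<in> carrier R" "x \<in> carrier N" for m r x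
  proof -
    have "frag_of (m \<bullet>\<^bsub>M\<^esub> r, x) - frag_of (m, r \<odot>\<^bsub>N\<^esub> x) \<in> K"
      using that by (intro relation_in_K) (auto simp: tensor_relations_def)
    then show ?thesis using that cl rsmult_closed N.smult_closed
      by (subst cl_eq) (simp_all del: carrier_free_Abelian_group_iff)
  qed
  show ?thesis unfolding balanced_def by (intro conjI ballI 1 2 3 cl_closed cl)
qed

lemma ten_closed: "m \<in> carrier M \<Longrightarrow> x \<in> carrier N \<Longrightarrow> ten m x \<in> carrier TP"
  using ten_balanced unfolding balanced_def by blast

lemma ten_minus: "m \<in> carrier M \<Longrightarrow> x \<in> carrier N \<Longrightarrow> ten (\<ominus>\<^bsub>M\<^esub> m) x = \<ominus>\<^bsub>TP\<^esub> ten m x"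
proof -
  assume m: "m \<in> carrier M" "x \<in> carrier N"
  interpret additive_map M TP "\<lambda>m. ten m x"
    by unfold_locales (use ten_balanced m in \<open>auto simp: balanced_def\<close>)
  show ?thesis using m by (simp add: minus)
qed

text \<open>Pure tensors generate under addition alone, because the negative of
  \<open>m \<otimes> x\<close> is \<open>(-m) \<otimes> x\<close>; hence there is no case for
  negatives.\<close>

lemma TP_induct [consumes 1, case_names zero ten add]:
  assumes "c \<in> carrier TP" and 0: "P \<zero>\<^bsub>TP\<^esub>"
    and ten: "\<And>m x. m \<in> carrier M \<Longrightarrow> x \<in> carrier N \<Longrightarrow> P (ten m x)"
    and add: "\<And>a b. \<lbrakk>a \<in> carrier TP; b \<in> carrier TP; P a; P b\<rbrakk> \<Longrightarrow> P (a \<oplus>\<^bsub>TP\<^esub> b)"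
  shows "P c"
proof -
  obtain p where p: "p \<in> carrier A" "c = cl p" using assms(1) unfolding TP_carrier by blast
  have "Poly_Mapping.keys p \<subseteq> carrier M \<times> carrier N" using p(1) by simp
  \<comment> \<open>Induction in the free abelian group proceeds by differences, so the claim is
    strengthened to \<open>p\<close> and \<open>- p\<close> at once.\<close>
  then have "P (cl p) \<and> P (cl (- p))"
  proof (induction p rule: free_Abelian_group_induct[consumes 1, case_names 1 2 3])
    case 1
    then show ?case using 0 by (simp add: TP_zero)
  next
    case (2 x y)
    then have xy: "x \<in> carrier A" "y \<in> carrier A" by simp_all
    have "P (cl x \<oplus>\<^bsub>TP\<^esub> cl (- y))" "P (cl y \<oplus>\<^bsub>TP\<^esub> cl (- x))"
      using 2 xy by (auto intro!: add cl_closed A_minus simp del: carrier_free_Abelian_group_iff)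
    then show ?case using cl_add[OF xy(1) A_minus[OF xy(2)]] cl_add[OF xy(2) A_minus[OF xy(1)]] by simp
  next
    case (3 a)
    then obtain m x where a: "a = (m, x)" "m \<in> carrier M" "x \<in> carrier N" by auto
    then show ?case using ten[OF a(2,3)] ten[of "\<ominus>\<^bsub>M\<^esub> m" x] ten_minus[OF a(2,3)]
      by (simp add: cl_minus)
  qed
  then show ?thesis using p(2) by simp
qed

text \<open>\<open>\<beta>\<close> extends to the free abelian group; being balanced means that the
  extension kills the three families of relations, hence the subgroup they generate, and so depends
  on the class only.\<close>

lemma lift:
  assumes G: "abelian_group G" and \<beta>: "balanced R M N G \<beta>"
  obtains h where "additive_map TP G h" "\<And>m x. m \<in> carrier M \<Longrightarrow> x \<in> carrier N \<Longrightarrow> h (ten m x) = \<beta> m x"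
proof -
  interpret G: abelian_group G by fact
  have "(\<lambda>(m, x). \<beta> m x) ` (carrier M \<times> carrier N) \<subseteq> carrier (add_monoid G)"
    using \<beta> by (auto simp: balanced_def)
  then obtain h0 where h0: "h0 \<in> hom A (add_monoid G)"
    "\<And>p. p \<in> carrier M \<times> carrier N \<Longrightarrow> h0 (frag_of p) = (\<lambda>(m, x). \<beta> m x) p"
    by (rule comm_group.free_Abelian_group_universal[OF G.a_comm_group]) blast
  interpret h0: group_hom A "add_monoid G" h0
    by (intro group_hom.intro group_hom_axioms.intro) (auto simp: h0 G.a_group)
  have h0_add: "h0 (p + q) = h0 p \<oplus>\<^bsub>G\<^esub> h0 q" if "p \<in> carrier A" "q \<in> carrier A" for p q
    using h0.hom_mult[OF that] by simp
  have h0_cl: "h0 p \<in> carrier G" if "p \<in> carrier A" for p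
    using h0.hom_closed[OF that] by simp
  have h0_diff: "h0 (p - q) = h0 p \<ominus>\<^bsub>G\<^esub> h0 q" if "p \<in> carrier A" "q \<in> carrier A" for p q
  proof -
    have "h0 (- q) \<oplus>\<^bsub>G\<^esub> h0 q = \<zero>\<^bsub>G\<^esub>"
      using h0_add[OF A_minus[OF that(2)] that(2)] h0.hom_one by simp
    then have "h0 (- q) = \<ominus>\<^bsub>G\<^esub> h0 q"
      using h0_cl[OF that(2)] h0_cl[OF A_minus[OF that(2)]] by (simp add: G.minus_equality)
    then show ?thesis using h0_add[OF that(1) A_minus[OF that(2)]] by (simp add: a_minus_def)
  qed
  have frag: "frag_of (m, x) \<in> carrier A" "h0 (frag_of (m, x)) = \<beta> m x" "\<beta> m x \<in> carrier G"
    if "m \<in> carrier M" "x \<in> carrier N" for m x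
    using that h0(2) \<beta> by (auto simp: balanced_def)
  have cancel: "x \<oplus>\<^bsub>G\<^esub> y \<ominus>\<^bsub>G\<^esub> x \<ominus>\<^bsub>G\<^esub> y = \<zero>\<^bsub>G\<^esub>" if "x \<in> carrier G" "y \<in> carrier G" for x y
  proof -
    have "x \<oplus>\<^bsub>G\<^esub> y \<ominus>\<^bsub>G\<^esub> x \<ominus>\<^bsub>G\<^esub> y = (x \<oplus>\<^bsub>G\<^esub> y) \<ominus>\<^bsub>G\<^esub> (x \<oplus>\<^bsub>G\<^esub> y)"
      using that by (simp add: a_minus_def G.minus_add G.a_assoc)
    then show ?thesis using that by (simp add: G.diff_eq_zero_iff)
  qed
  have "tensor_relations R M N \<subseteq> kernel A (add_monoid G) h0"
  proof
    fix p assume p: "p \<in> tensor_relations R M N"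
    then have "h0 p = \<zero>\<^bsub>G\<^esub>"
      unfolding tensor_relations_def using \<beta>
      by (auto simp: h0_diff A_diff frag rsmult_closed N.smult_closed balanced_def cancel G.diff_eq_zero_iff
          simp del: carrier_free_Abelian_group_iff)
    then show "p \<in> kernel A (add_monoid G) h0" using subsetD[OF relations_closed p] by (simp add: kernel_def)
  qed
  then have K: "K \<subseteq> kernel A (add_monoid G) h0"
    unfolding tensor_null_def by (rule A.generate_subgroup_incl[OF _ h0.subgroup_kernel])
  have eq: "h0 p = h0 q" if "p \<in> carrier A" "q \<in> carrier A" "cl p = cl q" for p q
  proof -
    have "p - q \<in> K" using that cl_eq by blast
    then have "h0 (p - q) = \<zero>\<^bsub>G\<^esub>" using K by (auto simp: kernel_def)
    then show ?thesis
      using h0_diff[OF that(1,2)] h0_cl[OF that(1)] h0_cl[OF that(2)] by (simp add: G.diff_eq_zero_iff)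
  qed
  define h where "h c = h0 (SOME p. p \<in> carrier A \<and> cl p = c)" for c
  have h: "h (cl p) = h0 p" if p: "p \<in> carrier A" for p
  proof -
    have "(SOME q. q \<in> carrier A \<and> cl q = cl p) \<in> carrier A \<and> cl (SOME q. q \<in> carrier A \<and> cl q = cl p) = cl p"
      by (rule someI[where x = p]) (use p in simp)
    then show ?thesis unfolding h_def using eq p by blast
  qed
  have "additive_map TP G h"
    by unfold_locales
      (auto simp: TP_carrier h h0_cl cl_add A_add h0_add simp del: carrier_free_Abelian_group_iff)
  then show thesis by (rule that) (simp add: h frag del: carrier_free_Abelian_group_iff)
qed

lemma list_sum_ten:
  "set l \<subseteq> carrier M \<times> carrier N \<Longrightarrow>
    (\<Sum>p\<leftarrow>l. frag_of p) \<in> carrier A \<and> list_sum TP (map (\<lambda>(m, x). ten m x) l) = cl (\<Sum>p\<leftarrow>l. frag_of p)"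
proof (induction l)
  case Nil
  then show ?case by (simp add: list_sum_def TP_zero)
next
  case (Cons a l)
  have IH: "(\<Sum>p\<leftarrow>l. frag_of p) \<in> carrier A \<and> list_sum TP (map (\<lambda>(m, x). ten m x) l) = cl (\<Sum>p\<leftarrow>l. frag_of p)"
    by (rule Cons.IH) (use Cons.prems in simp)
  have "(\<Sum>p\<leftarrow>l. frag_of p) \<in> carrier A" "frag_of a \<in> carrier A" using IH Cons.prems by simp_all
  moreover note IH[THEN conjunct2]
  moreover have "list_sum TP (map (\<lambda>(m, x). ten m x) (a # l)) =
      cl (frag_of a) \<oplus>\<^bsub>TP\<^esub> list_sum TP (map (\<lambda>(m, x). ten m x) l)" by (cases a) (simp add: list_sum_def)
  ultimately show ?case by (simp add: cl_add A_add split_def del: carrier_free_Abelian_group_iff)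
qed

text \<open>Guarantees that the list selected in \<open>tensor_code\<close> exists. Lists carry no
  signs, which is possible because negatives are absorbed into the left factor.\<close>

lemma list_representation:
  assumes "c \<in> carrier TP"
  shows "\<exists>l. set l \<subseteq> carrier M \<times> carrier N \<and> cl (\<Sum>p\<leftarrow>l. frag_of p) = c"
  using assms
proof (induction c rule: TP_induct)
  case zero
  show ?case by (rule exI[of _ "[]"]) (simp add: TP_zero)
next
  case (ten m x)
  then show ?case by (intro exI[of _ "[(m, x)]"]) simp
next
  case (add a b)
  then obtain l l' where l: "set l \<subseteq> carrier M \<times> carrier N" "cl (\<Sum>p\<leftarrow>l. frag_of p) = a"
    "set l' \<subseteq> carrier M \<times> carrier N" "cl (\<Sum>p\<leftarrow>l'. frag_of p) = b" by blast
  have "cl (\<Sum>p\<leftarrow>l @ l'. frag_of p) = a \<oplus>\<^bsub>TP\<^esub> b"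
    using list_sum_ten[OF l(1)] list_sum_ten[OF l(3)] l(2,4)
    by (simp add: cl_add[symmetric] del: carrier_free_Abelian_group_iff)
  then show ?case using l by (intro exI[of _ "l @ l'"]) simp
qed

text \<open>The definition acts on an arbitrary representative of the class. It agrees with the lift
  of \<open>(m, x) \<mapsto> (r m) \<otimes> x\<close>, which is balanced because the two actions on
  \<open>M\<close> commute, and is therefore well defined.\<close>

lemma smult_lift:
  assumes r: "r \<in> carrier R"
  shows "additive_map TP TP (\<lambda>c. r \<odot>\<^bsub>TP\<^esub> c)"
    and "\<And>m x. m \<in> carrier M \<Longrightarrow> x \<in> carrier N \<Longrightarrow> r \<odot>\<^bsub>TP\<^esub> ten m x = ten (r \<odot>\<^bsub>M\<^esub> m) x"
proof -
  have "balanced R M N TP (\<lambda>m x. ten (r \<odot>\<^bsub>M\<^esub> m) x)"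
    using ten_balanced r unfolding balanced_def
    by (intro conjI ballI) (simp_all add: smult_closed smult_r_distr smult_rsmult[symmetric])
  then obtain h where h: "additive_map TP TP h"
    "\<And>m x. m \<in> carrier M \<Longrightarrow> x \<in> carrier N \<Longrightarrow> h (ten m x) = ten (r \<odot>\<^bsub>M\<^esub> m) x"
    by (rule lift[OF TP_group]) blast
  interpret h: additive_map TP TP h by fact
  let ?E = "frag_extend (\<lambda>(m, x). frag_of (r \<odot>\<^bsub>M\<^esub> m, x))"
  have E: "?E p \<in> carrier A \<and> cl (?E p) = h (cl p)" if "p \<in> carrier A" for p
  proof -
    have "Poly_Mapping.keys p \<subseteq> carrier M \<times> carrier N" using that by simp
    then show ?thesis
    proof (induction p rule: free_Abelian_group_induct[consumes 1, case_names 1 2 3])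
      case 1
      then show ?case using h.zero by (simp add: TP_zero)
    next
      case (2 x y)
      then have xy: "x \<in> carrier A" "y \<in> carrier A" by simp_all
      show ?case
        using 2 xy h.diff[OF cl_closed[OF xy(1)] cl_closed[OF xy(2)]]
        by (simp add: frag_extend_diff A_diff cl_diff del: carrier_free_Abelian_group_iff)
    next
      case (3 a)
      then show ?case using r by (auto simp: smult_closed h(2))
    qed
  qed
  have s: "r \<odot>\<^bsub>TP\<^esub> c = h c" if c: "c \<in> carrier TP" for c
  proof -
    obtain p where p: "p \<in> carrier A" "c = cl p" using c unfolding TP_carrier by blast
    \<comment> \<open>A class is a coset, hence nonempty; the representative picked from it lies in
      the free abelian group and has the same class.\<close>
    have "p \<in> c" unfolding p(2) tensor_class_def by (rule A.rcos_self[OF p(1) K_subgroup])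
    then have q: "(SOME q. q \<in> c) \<in> c" by (rule someI)
    then have "(SOME q. q \<in> c) \<in> carrier A"
      unfolding p(2) tensor_class_def using A.r_coset_subset_G[OF K.subset p(1)] by blast
    moreover have "cl (SOME q. q \<in> c) = c"
      using A.repr_independence[OF q[unfolded p(2) tensor_class_def] p(1) K_subgroup]
      unfolding p(2) tensor_class_def by simp
    ultimately have "cl (?E (SOME q. q \<in> c)) = h c" using E by metis
    then show ?thesis by (simp add: tensor_product_def Let_def)
  qed
  show "additive_map TP TP (\<lambda>c. r \<odot>\<^bsub>TP\<^esub> c)"
    by unfold_locales (simp_all add: s h.closed h.add)
  show "\<And>m x. m \<in> carrier M \<Longrightarrow> x \<in> carrier N \<Longrightarrow> r \<odot>\<^bsub>TP\<^esub> ten m x = ten (r \<odot>\<^bsub>M\<^esub> m) x"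
    by (simp add: s ten_closed h(2))
qed

lemma TP_module: "left_module R TP"
proof -
  note additive = additive_map.add[OF smult_lift(1)] and zero = additive_map.zero[OF smult_lift(1)]
    and cl = additive_map.closed[OF smult_lift(1)] and t = smult_lift(2)
  have b: "ten (m \<oplus>\<^bsub>M\<^esub> m') x = ten m x \<oplus>\<^bsub>TP\<^esub> ten m' x" if "m \<in> carrier M" "m' \<in> carrier M" "x \<in> carrier N" for m m' x
    using ten_balanced that unfolding balanced_def by blast
  have 1: "(r \<oplus> s) \<odot>\<^bsub>TP\<^esub> c = r \<odot>\<^bsub>TP\<^esub> c \<oplus>\<^bsub>TP\<^esub> s \<odot>\<^bsub>TP\<^esub> c"
    if "c \<in> carrier TP" "r \<in> carrier R" "s \<in> carrier R" for r s c
    using that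
  proof (induction c rule: TP_induct)
    case (ten m x)
    then show ?case by (simp add: t smult_l_distr b smult_closed)
  next
    case (add a b)
    then show ?case by (simp add: additive cl TP.a_ac)
  qed (simp add: zero)
  have 2: "(r \<otimes> s) \<odot>\<^bsub>TP\<^esub> c = r \<odot>\<^bsub>TP\<^esub> (s \<odot>\<^bsub>TP\<^esub> c)"
    if "c \<in> carrier TP" "r \<in> carrier R" "s \<in> carrier R" for r s c
    using that
  proof (induction c rule: TP_induct)
    case (ten m x)
    then show ?case by (simp add: t smult_assoc smult_closed)
  next
    case (add a b)
    then show ?case by (simp add: additive cl)
  qed (simp add: zero)
  have 3: "\<one> \<odot>\<^bsub>TP\<^esub> c = c" if "c \<in> carrier TP" for c
    using that
  proof (induction c rule: TP_induct)
    case (ten m x)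
    then show ?case by (simp add: t smult_one)
  next
    case (add a b)
    then show ?case by (simp add: additive)
  qed (simp add: zero)
  show ?thesis
    by unfold_locales (simp_all add: cl additive 1 2 3)
qed

lemma code:
  assumes "c \<in> carrier TP"
  obtains l where "tensor_code R M N c = Tens l" "set l \<subseteq> carrier M \<times> carrier N"
    "list_sum TP (map (\<lambda>(m, x). ten m x) l) = c"
proof -
  let ?l = "SOME l. set l \<subseteq> carrier M \<times> carrier N \<and> cl (\<Sum>p\<leftarrow>l. frag_of p) = c"
  have "set ?l \<subseteq> carrier M \<times> carrier N \<and> cl (\<Sum>p\<leftarrow>?l. frag_of p) = c"
    by (rule someI_ex[OF list_representation[OF assms]])
  then show thesis using list_sum_ten[of ?l] by (intro that[of ?l]) (auto simp: tensor_code_def)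
qed

text \<open>Summing the pure tensors of the stored list gives the class back, so coding has a left
  inverse.\<close>

lemma code_inj: "inj_on (tensor_code R M N) (carrier TP)"
proof (rule inj_onI)
  fix c c' assume c: "c \<in> carrier TP" "c' \<in> carrier TP" "tensor_code R M N c = tensor_code R M N c'"
  obtain l where l: "tensor_code R M N c = Tens l" "list_sum TP (map (\<lambda>(m, x). ten m x) l) = c"
    by (rule code[OF c(1)])
  obtain l' where "tensor_code R M N c' = Tens l'" "list_sum TP (map (\<lambda>(m, x). ten m x) l') = c'"
    by (rule code[OF c(2)])
  with l c(3) show "c = c'" by simp
qed

end

section \<open>Tensor powers\<close>

lemma transport_simps:
  "carrier (transport h N) = h ` carrier N"
  "\<zero>\<^bsub>transport h N\<^esub> = h \<zero>\<^bsub>N\<^esub>"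
  "a \<oplus>\<^bsub>transport h N\<^esub> b = h (inv_into (carrier N) h a \<oplus>\<^bsub>N\<^esub> inv_into (carrier N) h b)"
  "r \<odot>\<^bsub>transport h N\<^esub> a = h (r \<odot>\<^bsub>N\<^esub> inv_into (carrier N) h a)"
  by (simp_all add: transport_def Let_def)

lemma (in left_module) transport:
  assumes inj: "inj_on h (carrier M)"
  shows "left_module R (transport h M)" and "linear_map R M (transport h M) h"
    and "linear_map R (transport h M) M (inv_into (carrier M) h)"
proof -
  note inv = inv_into_f_f[OF inj]
  show 1: "left_module R (transport h M)"
  proof (rule left_moduleI)
    fix x assume "x \<in> carrier (transport h M)"
    then obtain x' where x: "x' \<in> carrier M" "x = h x'" by (auto simp: transport_simps)
    then show "\<exists>y\<in>carrier (transport h M). y \<oplus>\<^bsub>transport h M\<^esub> x = \<zero>\<^bsub>transport h M\<^esub>"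
      by (intro bexI[of _ "h (\<ominus>\<^bsub>M\<^esub> x')"]) (simp_all add: transport_simps inv M.l_neg)
  qed (auto simp: transport_simps inv R.ring_axioms M.a_ac smult_closed smult_l_distr
        smult_r_distr smult_assoc smult_one)
  show "linear_map R M (transport h M) h"
    unfolding linear_map_iff using 1 left_module_axioms by (auto simp: transport_simps inv)
  show "linear_map R (transport h M) M (inv_into (carrier M) h)"
    unfolding linear_map_iff using 1 left_module_axioms by (auto simp: transport_simps inv smult_closed)
qed

context bimodule
begin

abbreviation "T i \<equiv> tensor_power R M i"
abbreviation "cons \<equiv> tensor_cons R M"

lemma T_module: "left_module R (T i)"
proof (induction i rule: induct_nat_012)
  case 0
  show ?case by (simp add: left_module.transport(1)[OF R.left_module_regular] inj_on_def)
next
  case 1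
  show ?case by (simp add: transport(1) inj_on_def)
next
  case (ge2 i)
  then interpret left_module R "T (Suc i)" by simp
  interpret tensor R M "T (Suc i)" ..
  show ?case by (simp add: left_module.transport(1)[OF TP_module code_inj])
qed

lemma T_tensor: "tensor R M (T i)"
  unfolding tensor_def using bimodule_axioms T_module by blast

lemma T_group: "abelian_group (T i)"
  using T_module[of i] by (simp add: left_module_def)

lemma T_0_linear: "linear_map R (regular_module R) (T 0) Scal"
  by (simp add: left_module.transport(2)[OF R.left_module_regular] inj_on_def)

lemma T_0_carrier: "carrier (T 0) = Scal ` carrier R"
  by (simp add: transport_simps)

lemma T_0_smult: "r \<in> carrier R \<Longrightarrow> s \<in> carrier R \<Longrightarrow> r \<odot>\<^bsub>T 0\<^esub> Scal s = Scal (r \<otimes> s)"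
  using linear_map.smult[OF T_0_linear, of r s] by simp

lemma T_0_add: "r \<in> carrier R \<Longrightarrow> s \<in> carrier R \<Longrightarrow> Scal r \<oplus>\<^bsub>T 0\<^esub> Scal s = Scal (r \<oplus> s)"
  using linear_map.add[OF T_0_linear, of r s] by simp

lemma T_0_zero: "\<zero>\<^bsub>T 0\<^esub> = Scal \<zero>"
  by (simp add: transport_simps)

lemma T_1_linear: "linear_map R M (T (Suc 0)) Vec"
  by (simp add: transport(2) inj_on_def)

lemma T_1_carrier: "carrier (T (Suc 0)) = Vec ` carrier M"
  by (simp add: transport_simps)

lemma T_code_linear: "linear_map R (tensor_product R M (T (Suc i))) (T (Suc (Suc i))) (tensor_code R M (T (Suc i)))"
proof -
  interpret tensor R M "T (Suc i)" by (rule T_tensor)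
  show ?thesis using left_module.transport(2)[OF TP_module code_inj] by simp
qed

lemma cons_0: "r \<in> carrier R \<Longrightarrow> cons 0 m (Scal r) = Vec (m \<bullet>\<^bsub>M\<^esub> r)"
  by (simp add: tensor_cons_def)

lemma cons_Suc: "cons (Suc i) m x = tensor_code R M (T (Suc i)) (tensor_class R M (T (Suc i)) (frag_of (m, x)))"
  by (simp add: tensor_cons_def)

text \<open>The first power is \<open>M\<close> itself and not a tensor product, so degree 0 is done
  by hand through \<open>m \<otimes> r = m r\<close>. Afterwards all degrees are uniform.\<close>

lemma cons_balanced: "balanced R M (T i) (T (Suc i)) (cons i)"
proof (cases i)
  case 0
  interpret V: linear_map R M "T (Suc 0)" Vec by (rule T_1_linear)
  show ?thesis
    unfolding 0 balanced_def T_0_carrier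
    by (auto simp: cons_0 T_0_add T_0_smult rsmult_closed rsmult_l_distr rsmult_r_distr rsmult_assoc V.add V.closed
        simp del: tensor_power.simps)
next
  case (Suc j)
  interpret tensor R M "T i" by (rule T_tensor)
  interpret C: linear_map R "tensor_product R M (T i)" "T (Suc i)" "tensor_code R M (T i)"
    unfolding Suc by (rule T_code_linear)
  have "cons i m x = tensor_code R M (T i) (ten m x)" for m x unfolding Suc cons_Suc ..
  then show ?thesis
    using ten_balanced unfolding balanced_def by (simp add: C.closed C.add)
qed

lemma cons_closed: "m \<in> carrier M \<Longrightarrow> x \<in> carrier (T i) \<Longrightarrow> cons i m x \<in> carrier (T (Suc i))"
  using cons_balanced unfolding balanced_def by blast

lemma cons_smult:
  assumes "r \<in> carrier R" "m \<in> carrier M" "x \<in> carrier (T i)"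
  shows "r \<odot>\<^bsub>T (Suc i)\<^esub> cons i m x = cons i (r \<odot>\<^bsub>M\<^esub> m) x"
proof (cases i)
  case 0
  interpret V: linear_map R M "T (Suc 0)" Vec by (rule T_1_linear)
  show ?thesis
    using assms unfolding 0 T_0_carrier
    by (auto simp: cons_0 rsmult_closed smult_rsmult V.smult[symmetric] simp del: tensor_power.simps)
next
  case (Suc j)
  interpret tensor R M "T i" by (rule T_tensor)
  interpret C: linear_map R "tensor_product R M (T i)" "T (Suc i)" "tensor_code R M (T i)"
    unfolding Suc by (rule T_code_linear)
  have "cons i m x = tensor_code R M (T i) (ten m x)" for m x unfolding Suc cons_Suc ..
  then show ?thesis using assms smult_lift(2)[of r m x] by (simp add: C.smult[symmetric] ten_closed)
qed

text \<open>In degree one every \<open>m\<close> is \<open>m \<otimes> 1\<close>; above, this is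
  induction on the tensor product, carried along the coding.\<close>

lemma T_Suc_induct [consumes 1, case_names zero cons add]:
  assumes "a \<in> carrier (T (Suc i))" and 0: "P \<zero>\<^bsub>T (Suc i)\<^esub>"
    and cons: "\<And>m x. m \<in> carrier M \<Longrightarrow> x \<in> carrier (T i) \<Longrightarrow> P (cons i m x)"
    and add: "\<And>a b. \<lbrakk>a \<in> carrier (T (Suc i)); b \<in> carrier (T (Suc i)); P a; P b\<rbrakk> \<Longrightarrow> P (a \<oplus>\<^bsub>T (Suc i)\<^esub> b)"
  shows "P a"
proof (cases i)
  case 0
  then obtain m where m: "m \<in> carrier M" "a = Vec m" using assms(1) by (auto simp: transport_simps)
  then have "cons i m (Scal \<one>) = a" using 0 by (simp add: cons_0 rsmult_one)
  moreover have "Scal \<one> \<in> carrier (T i)" using 0 T_0_carrier by blast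
  ultimately show ?thesis using cons[OF m(1)] by metis
next
  case (Suc j)
  interpret tensor R M "T i" by (rule T_tensor)
  interpret C: linear_map R "tensor_product R M (T i)" "T (Suc i)" "tensor_code R M (T i)"
    unfolding Suc by (rule T_code_linear)
  have c: "cons i m x = tensor_code R M (T i) (ten m x)" for m x unfolding Suc cons_Suc ..
  obtain t where t: "t \<in> carrier (tensor_product R M (T i))" "a = tensor_code R M (T i) t"
    using assms(1) Suc by (auto simp: transport_simps)
  from t(1) have "P (tensor_code R M (T i) t)"
  proof (induction t rule: TP_induct)
    case zero
    then show ?case using 0 C.zero by simp
  next
    case (ten m x)
    then show ?case using cons c by metis
  next
    case (add a b)
    then show ?case using assms(4)[OF C.closed[OF add(1)] C.closed[OF add(2)]] by (simp add: C.add)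
  qed
  then show ?thesis using t(2) by simp
qed

text \<open>The last conclusion computes the lift from the stored list, in exactly the form of the
  recursion clauses of \<open>tensor_mult\<close> and \<open>tensor_act\<close>. Those functions are
  thereby identified with lifts, and so do not depend on the list that was selected.\<close>

lemma T_lift:
  assumes G: "abelian_group G" and \<beta>: "balanced R M (T i) G \<beta>"
  obtains h where "additive_map (T (Suc i)) G h"
    "\<And>m x. m \<in> carrier M \<Longrightarrow> x \<in> carrier (T i) \<Longrightarrow> h (cons i m x) = \<beta> m x"
    "\<And>a. a \<in> carrier (T (Suc i)) \<Longrightarrow>
      h a = (if i = 0 then \<beta> (the_vec a) (Scal \<one>) else list_sum G (map (\<lambda>(m, x). \<beta> m x) (the_tens a)))"
proof (cases i)
  case 0
  interpret G: abelian_group G by fact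
  interpret T1: abelian_group "T (Suc 0)" by (rule T_group)
  interpret V: linear_map R M "T (Suc 0)" Vec by (rule T_1_linear)
  let ?h = "\<lambda>a. \<beta> (the_vec a) (Scal \<one>)"
  have 1: "Scal \<one> \<in> carrier (T 0)" using T_0_carrier by blast
  have "additive_map (T (Suc 0)) G ?h"
  proof unfold_locales
    show "?h x \<in> carrier G" if "x \<in> carrier (T (Suc 0))" for x
      using that \<beta> 1 unfolding T_1_carrier 0 balanced_def by auto
    show "?h (x \<oplus>\<^bsub>T (Suc 0)\<^esub> y) = ?h x \<oplus>\<^bsub>G\<^esub> ?h y"
      if "x \<in> carrier (T (Suc 0))" "y \<in> carrier (T (Suc 0))" for x y
      using that \<beta> 1 unfolding T_1_carrier 0 balanced_def
      by (auto simp: V.add[symmetric] simp del: tensor_power.simps)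
  qed
  moreover have "?h (cons 0 m x) = \<beta> m x" if m: "m \<in> carrier M" and x: "x \<in> carrier (T 0)" for m x
  proof -
    obtain r where r: "r \<in> carrier R" "x = Scal r" using x unfolding T_0_carrier by auto
    have "\<beta> (m \<bullet>\<^bsub>M\<^esub> r) (Scal \<one>) = \<beta> m (r \<odot>\<^bsub>T 0\<^esub> Scal \<one>)"
      using \<beta> m r 1 unfolding 0 balanced_def by blast
    then show ?thesis using r by (simp add: cons_0 T_0_smult del: tensor_power.simps)
  qed
  ultimately show thesis using 0 by (intro that[of ?h]) simp_all
next
  case (Suc j)
  interpret tensor R M "T i" by (rule T_tensor)
  let ?code = "tensor_code R M (T i)"
  interpret C: linear_map R TP "T (Suc i)" ?code
    unfolding Suc by (rule T_code_linear)
  have c: "cons i m x = ?code (ten m x)" for m x unfolding Suc cons_Suc ..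
  have T: "T (Suc i) = transport ?code TP" unfolding Suc by simp
  interpret I: linear_map R "T (Suc i)" TP "inv_into (carrier TP) ?code"
    unfolding T by (rule left_module.transport(3)[OF TP_module code_inj])
  obtain h0 where h0: "additive_map TP G h0"
    "\<And>m x. m \<in> carrier M \<Longrightarrow> x \<in> carrier (T i) \<Longrightarrow> h0 (ten m x) = \<beta> m x"
    by (rule lift[OF G \<beta>]) blast
  interpret h0: additive_map TP G h0 by fact
  let ?h = "\<lambda>a. h0 (inv_into (carrier TP) ?code a)"
  have inv: "inv_into (carrier TP) ?code (?code t) = t" if "t \<in> carrier TP" for t
    by (rule inv_into_f_f[OF code_inj that])
  have 1: "additive_map (T (Suc i)) G ?h"
    by unfold_locales (simp_all add: I.closed I.add h0.closed h0.add)
  have 2: "?h (cons i m x) = \<beta> m x" if "m \<in> carrier M" "x \<in> carrier (T i)" for m x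
    using that by (simp add: c inv ten_closed h0(2))
  have 3: "?h a = list_sum G (map (\<lambda>(m, x). \<beta> m x) (the_tens a))" if a: "a \<in> carrier (T (Suc i))" for a
  proof -
    obtain t where t: "t \<in> carrier TP" "a = ?code t" using a unfolding T transport_simps by auto
    obtain l where l: "?code t = Tens l" "set l \<subseteq> carrier M \<times> carrier (T i)"
      "list_sum TP (map (\<lambda>(m, x). ten m x) l) = t" by (rule code[OF t(1)])
    have "?h a = h0 (list_sum TP (map (\<lambda>(m, x). ten m x) l))" using t l(3) inv by simp
    also have "\<dots> = list_sum G (map h0 (map (\<lambda>(m, x). ten m x) l))"
      using h0.list_sum[of "map (\<lambda>(m, x). ten m x) l"] l(2) ten_closed by auto
    also have "map h0 (map (\<lambda>(m, x). ten m x) l) = map (\<lambda>(m, x). \<beta> m x) l" using l(2) h0(2) by auto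
    finally show ?thesis using t l(1) by simp
  qed
  show thesis using 1 2 3 Suc by (intro that[of ?h]) simp_all
qed

end

declare tensor_power.simps [simp del] tensor_mult.simps [simp del] tensor_act.simps [simp del]

section \<open>Multiplication of tensors\<close>

context bimodule
begin

abbreviation "tmul \<equiv> tensor_mult R M"

text \<open>The properties are bundled because the induction on \<open>i\<close> needs them
  together: the lift in degree \<open>Suc i\<close> exists only if multiplication in degree
  \<open>i\<close> respects both addition and left scalars.\<close>

definition bilinear_mult where
  "bilinear_mult i j \<longleftrightarrow>
    (\<forall>a\<in>carrier (T i). \<forall>b\<in>carrier (T j). tmul i j a b \<in> carrier (T (i + j))) \<and>
    (\<forall>a\<in>carrier (T i). \<forall>a'\<in>carrier (T i). \<forall>b\<in>carrier (T j).
      tmul i j (a \<oplus>\<^bsub>T i\<^esub> a') b = tmul i j a b \<oplus>\<^bsub>T (i + j)\<^esub> tmul i j a' b) \<and>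
    (\<forall>a\<in>carrier (T i). \<forall>b\<in>carrier (T j). \<forall>b'\<in>carrier (T j).
      tmul i j a (b \<oplus>\<^bsub>T j\<^esub> b') = tmul i j a b \<oplus>\<^bsub>T (i + j)\<^esub> tmul i j a b') \<and>
    (\<forall>r\<in>carrier R. \<forall>a\<in>carrier (T i). \<forall>b\<in>carrier (T j).
      tmul i j (r \<odot>\<^bsub>T i\<^esub> a) b = r \<odot>\<^bsub>T (i + j)\<^esub> tmul i j a b)"

lemma cons_add_l: "\<lbrakk>m \<in> carrier M; m' \<in> carrier M; x \<in> carrier (T i)\<rbrakk> \<Longrightarrow>
    cons i (m \<oplus>\<^bsub>M\<^esub> m') x = cons i m x \<oplus>\<^bsub>T (Suc i)\<^esub> cons i m' x"
  using cons_balanced unfolding balanced_def by blast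

lemma cons_add_r: "\<lbrakk>m \<in> carrier M; x \<in> carrier (T i); x' \<in> carrier (T i)\<rbrakk> \<Longrightarrow>
    cons i m (x \<oplus>\<^bsub>T i\<^esub> x') = cons i m x \<oplus>\<^bsub>T (Suc i)\<^esub> cons i m x'"
  using cons_balanced unfolding balanced_def by blast

lemma cons_rsmult: "\<lbrakk>m \<in> carrier M; r \<in> carrier R; x \<in> carrier (T i)\<rbrakk> \<Longrightarrow>
    cons i (m \<bullet>\<^bsub>M\<^esub> r) x = cons i m (r \<odot>\<^bsub>T i\<^esub> x)"
  using cons_balanced unfolding balanced_def by blast

lemma bilinear_mult_0: "bilinear_mult 0 j"
proof -
  interpret Tj: left_module R "T j" by (rule T_module)
  show ?thesis
    unfolding bilinear_mult_def T_0_carrier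
    by (auto simp: tensor_mult.simps T_0_add T_0_smult Tj.smult_closed Tj.smult_l_distr Tj.smult_r_distr Tj.smult_assoc)
qed

lemma bilinear_mult_Suc:
  assumes IH: "bilinear_mult i j"
  shows "bilinear_mult (Suc i) j \<and> (\<forall>m\<in>carrier M. \<forall>x\<in>carrier (T i). \<forall>b\<in>carrier (T j).
    tmul (Suc i) j (cons i m x) b = cons (i + j) m (tmul i j x b))"
proof -
  interpret Tj: left_module R "T j" by (rule T_module)
  interpret Ti: left_module R "T (Suc i)" by (rule T_module)
  interpret Tij: left_module R "T (Suc (i + j))" by (rule T_module)
  have cl: "tmul i j a b \<in> carrier (T (i + j))" if "a \<in> carrier (T i)" "b \<in> carrier (T j)" for a b
    using IH that unfolding bilinear_mult_def by blast
  have al: "tmul i j (a \<oplus>\<^bsub>T i\<^esub> a') b = tmul i j a b \<oplus>\<^bsub>T (i + j)\<^esub> tmul i j a' b"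
    if "a \<in> carrier (T i)" "a' \<in> carrier (T i)" "b \<in> carrier (T j)" for a a' b
    using IH that unfolding bilinear_mult_def by blast
  have ar: "tmul i j a (b \<oplus>\<^bsub>T j\<^esub> b') = tmul i j a b \<oplus>\<^bsub>T (i + j)\<^esub> tmul i j a b'"
    if "a \<in> carrier (T i)" "b \<in> carrier (T j)" "b' \<in> carrier (T j)" for a b b'
    using IH that unfolding bilinear_mult_def by blast
  have sm: "tmul i j (r \<odot>\<^bsub>T i\<^esub> a) b = r \<odot>\<^bsub>T (i + j)\<^esub> tmul i j a b"
    if "r \<in> carrier R" "a \<in> carrier (T i)" "b \<in> carrier (T j)" for r a b
    using IH that unfolding bilinear_mult_def by blast
  \<comment> \<open>For fixed \<open>b\<close>, the map
    \<open>(m, x) \<mapsto> m \<otimes> (x \<otimes> b)\<close> is balanced: a scalar moved from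
    \<open>m\<close> to \<open>x\<close> passes through \<open>x \<otimes> b\<close> by left
    linearity in degree \<open>i\<close>. Its lift is the recursively defined product.\<close>
  have lift: "\<exists>h. additive_map (T (Suc i)) (T (Suc (i + j))) h \<and>
      (\<forall>m\<in>carrier M. \<forall>x\<in>carrier (T i). h (cons i m x) = cons (i + j) m (tmul i j x b)) \<and>
      (\<forall>a\<in>carrier (T (Suc i)). h a = tmul (Suc i) j a b)" if b: "b \<in> carrier (T j)" for b
  proof -
    let ?\<beta> = "\<lambda>m x. cons (i + j) m (tmul i j x b)"
    have "balanced R M (T i) (T (Suc (i + j))) ?\<beta>"
      unfolding balanced_def using b
      by (intro conjI ballI) (simp_all add: cons_closed cl al sm cons_add_l cons_add_r cons_rsmult)
    then obtain h where h: "additive_map (T (Suc i)) (T (Suc (i + j))) h"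
      "\<And>m x. m \<in> carrier M \<Longrightarrow> x \<in> carrier (T i) \<Longrightarrow> h (cons i m x) = ?\<beta> m x"
      "\<And>a. a \<in> carrier (T (Suc i)) \<Longrightarrow>
        h a = (if i = 0 then ?\<beta> (the_vec a) (Scal \<one>) else list_sum (T (Suc (i + j))) (map (\<lambda>(m, x). ?\<beta> m x) (the_tens a)))"
      by (rule T_lift[OF T_group]) blast
    have "h a = tmul (Suc i) j a b" if "a \<in> carrier (T (Suc i))" for a
      unfolding h(3)[OF that] using b by (simp add: tensor_mult.simps Tj.smult_one)
    with h(1,2) show ?thesis by blast
  qed
  have tcons: "tmul (Suc i) j (cons i m x) b = cons (i + j) m (tmul i j x b)"
    if "m \<in> carrier M" "x \<in> carrier (T i)" "b \<in> carrier (T j)" for m x b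
    using lift[OF that(3)] that cons_closed by metis
  have additive: "additive_map (T (Suc i)) (T (Suc (i + j))) (\<lambda>a. tmul (Suc i) j a b)" if b: "b \<in> carrier (T j)" for b
  proof -
    obtain h where h: "additive_map (T (Suc i)) (T (Suc (i + j))) h"
      "\<And>a. a \<in> carrier (T (Suc i)) \<Longrightarrow> h a = tmul (Suc i) j a b" using lift[OF b] by blast
    interpret h: additive_map "T (Suc i)" "T (Suc (i + j))" h by fact
    show ?thesis using h.closed h.add by unfold_locales (simp_all flip: h(2))
  qed
  note add = additive_map.add[OF additive] and closed = additive_map.closed[OF additive]
    and tzero = additive_map.zero[OF additive]
  have right: "tmul (Suc i) j a (b \<oplus>\<^bsub>T j\<^esub> b') = tmul (Suc i) j a b \<oplus>\<^bsub>T (Suc (i + j))\<^esub> tmul (Suc i) j a b'"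
    if "a \<in> carrier (T (Suc i))" and b: "b \<in> carrier (T j)" "b' \<in> carrier (T j)" for a b b'
    using that(1)
  proof (induction a rule: T_Suc_induct)
    case zero
    then show ?case using b by (simp add: tzero)
  next
    case (cons m x)
    then show ?case using b by (simp add: tcons ar cons_add_r cl)
  next
    case (add a a')
    then show ?case using b by (simp add: additive_map.add[OF additive] closed Tij.M.a_ac)
  qed
  have smult: "tmul (Suc i) j (r \<odot>\<^bsub>T (Suc i)\<^esub> a) b = r \<odot>\<^bsub>T (Suc (i + j))\<^esub> tmul (Suc i) j a b"
    if r: "r \<in> carrier R" and "a \<in> carrier (T (Suc i))" and b: "b \<in> carrier (T j)" for r a b
    using that(2)
  proof (induction a rule: T_Suc_induct)
    case zero
    then show ?case using b r by (simp add: tzero Ti.smult_r_null Tij.smult_r_null)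
  next
    case (cons m x)
    then show ?case using b r
      by (simp add: tcons cons_smult smult_closed cl)
  next
    case (add a a')
    then show ?case using b r
      by (simp add: additive_map.add[OF additive] closed Ti.smult_r_distr Tij.smult_r_distr Ti.smult_closed)
  qed
  show ?thesis
    unfolding bilinear_mult_def by (simp add: closed add right smult tcons)
qed

lemma bilinear_mult: "bilinear_mult i j"
  by (induction i) (simp_all add: bilinear_mult_0 bilinear_mult_Suc)

lemma tmul_closed: "a \<in> carrier (T i) \<Longrightarrow> b \<in> carrier (T j) \<Longrightarrow> tmul i j a b \<in> carrier (T (i + j))"
  using bilinear_mult unfolding bilinear_mult_def by blast

lemma tmul_additive_l: "b \<in> carrier (T j) \<Longrightarrow> additive_map (T i) (T (i + j)) (\<lambda>a. tmul i j a b)"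
  using bilinear_mult[of i j] T_group[of i] T_group[of "i + j"]
  unfolding additive_map_def additive_map_axioms_def bilinear_mult_def by blast

lemma tmul_additive_r: "a \<in> carrier (T i) \<Longrightarrow> additive_map (T j) (T (i + j)) (\<lambda>b. tmul i j a b)"
  using bilinear_mult[of i j] T_group[of j] T_group[of "i + j"]
  unfolding additive_map_def additive_map_axioms_def bilinear_mult_def by blast

lemma tmul_smult: "\<lbrakk>r \<in> carrier R; a \<in> carrier (T i); b \<in> carrier (T j)\<rbrakk> \<Longrightarrow>
    tmul i j (r \<odot>\<^bsub>T i\<^esub> a) b = r \<odot>\<^bsub>T (i + j)\<^esub> tmul i j a b"
  using bilinear_mult unfolding bilinear_mult_def by blast

lemma tmul_cons: "\<lbrakk>m \<in> carrier M; x \<in> carrier (T i); b \<in> carrier (T j)\<rbrakk> \<Longrightarrow>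
    tmul (Suc i) j (cons i m x) b = cons (i + j) m (tmul i j x b)"
  using bilinear_mult_Suc[OF bilinear_mult] by blast

lemma tmul_0: "r \<in> carrier R \<Longrightarrow> tmul 0 j (Scal r) b = r \<odot>\<^bsub>T j\<^esub> b"
  by (simp add: tensor_mult.simps)

text \<open>Induction on the degree of \<open>a\<close> and, within a degree, on generators:
  \<open>m \<otimes> x\<close> is moved out in front on both sides by
  \<open>tmul_cons\<close>.\<close>

lemma tmul_assoc:
  assumes "a \<in> carrier (T i)" and b: "b \<in> carrier (T j)" and c: "c \<in> carrier (T k)"
  shows "tmul (i + j) k (tmul i j a b) c = tmul i (j + k) a (tmul j k b c)"
  using assms(1)
proof (induction i arbitrary: a)
  case 0
  then obtain r where "r \<in> carrier R" "a = Scal r" unfolding T_0_carrier by auto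
  then show ?case using b c by (simp add: tmul_0 tmul_smult)
next
  case (Suc i)
  interpret L: additive_map "T (Suc i)" "T (Suc i + j)" "\<lambda>a. tmul (Suc i) j a b" by (rule tmul_additive_l[OF b])
  interpret L': additive_map "T (Suc i + j)" "T (Suc i + j + k)" "\<lambda>a. tmul (Suc i + j) k a c" by (rule tmul_additive_l[OF c])
  interpret L'': additive_map "T (Suc i)" "T (Suc i + (j + k))" "\<lambda>a. tmul (Suc i) (j + k) a (tmul j k b c)"
    by (rule tmul_additive_l[OF tmul_closed[OF b c]])
  from Suc.prems show ?case
  proof (induction a rule: T_Suc_induct)
    case zero
    then show ?case using L.zero L'.zero L''.zero by (simp add: add.assoc)
  next
    case (cons m x)
    then show ?case using b c Suc.IH by (simp add: tmul_cons tmul_closed add.assoc)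
  next
    case (add a a')
    then show ?case using L.add L'.add L''.add L.closed by (simp add: add.assoc)
  qed
qed

lemma Scal_one: "Scal \<one> \<in> carrier (T 0)"
  unfolding T_0_carrier by blast

lemma tmul_one_l: "b \<in> carrier (T j) \<Longrightarrow> tmul 0 j (Scal \<one>) b = b"
  by (simp add: tmul_0 left_module.smult_one[OF T_module])

lemma tmul_one_r: "a \<in> carrier (T i) \<Longrightarrow> tmul i 0 a (Scal \<one>) = a"
proof (induction i arbitrary: a)
  case 0
  then show ?case unfolding T_0_carrier by (auto simp: tmul_0 T_0_smult)
next
  case (Suc i)
  interpret L: additive_map "T (Suc i)" "T (Suc i + 0)" "\<lambda>a. tmul (Suc i) 0 a (Scal \<one>)"
    by (rule tmul_additive_l[OF Scal_one])
  from Suc.prems show ?case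
  proof (induction a rule: T_Suc_induct)
    case zero
    then show ?case using L.zero by simp
  next
    case (cons m x)
    then show ?case using Suc.IH Scal_one by (simp add: tmul_cons)
  next
    case (add a a')
    then show ?case using L.add by simp
  qed
qed

end

section \<open>The trivial extension\<close>

text \<open>Both sides run over the pairs with \<open>i + j \<le> k\<close>, by antidiagonals and by
  rows. The induction on \<open>k\<close> adds one antidiagonal, that is, one further term to each
  row and one new row. It is used for associativity of the product and of the action.\<close>

lemma (in abelian_monoid) finsum_triangle:
  assumes "\<And>i j. i + j \<le> k \<Longrightarrow> f i j \<in> carrier G"
  shows "(\<Oplus>p\<in>{..k::nat}. \<Oplus>i\<in>{..p}. f i (p - i)) = (\<Oplus>i\<in>{..k}. \<Oplus>j\<in>{..k - i}. f i j)"
  using assms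
proof (induction k)
  case (Suc k)
  have in1: "(\<Oplus>i\<in>{..p}. f i (p - i)) \<in> carrier G" if "p \<le> Suc k" for p
    by (rule finsum_closed) (use that Suc.prems in auto)
  have in2: "(\<Oplus>j\<in>{..k - i}. f i j) \<in> carrier G" if "i \<le> k" for i
    by (rule finsum_closed) (use that Suc.prems in auto)
  have "(\<Oplus>p\<in>{..Suc k}. \<Oplus>i\<in>{..p}. f i (p - i)) =
      (\<Oplus>i\<in>{..Suc k}. f i (Suc k - i)) \<oplus> (\<Oplus>p\<in>{..k}. \<Oplus>i\<in>{..p}. f i (p - i))"
    by (rule finsum_Suc) (use in1 in auto)
  also have "(\<Oplus>p\<in>{..k}. \<Oplus>i\<in>{..p}. f i (p - i)) = (\<Oplus>i\<in>{..k}. \<Oplus>j\<in>{..k - i}. f i j)"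
    by (rule Suc.IH) (use Suc.prems in auto)
  also have "(\<Oplus>i\<in>{..Suc k}. f i (Suc k - i)) = f (Suc k) 0 \<oplus> (\<Oplus>i\<in>{..k}. f i (Suc k - i))"
    using finsum_Suc[of "\<lambda>i. f i (Suc k - i)" k] Suc.prems by auto
  finally have 1: "(\<Oplus>p\<in>{..Suc k}. \<Oplus>i\<in>{..p}. f i (p - i)) =
      f (Suc k) 0 \<oplus> (\<Oplus>i\<in>{..k}. f i (Suc k - i)) \<oplus> (\<Oplus>i\<in>{..k}. \<Oplus>j\<in>{..k - i}. f i j)" .
  have in3: "(\<Oplus>j\<in>{..Suc k - i}. f i j) \<in> carrier G" if "i \<le> Suc k" for i
    by (rule finsum_closed) (use that Suc.prems in auto)
  have "(\<Oplus>i\<in>{..Suc k}. \<Oplus>j\<in>{..Suc k - i}. f i j) =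
      (\<Oplus>j\<in>{..Suc k - Suc k}. f (Suc k) j) \<oplus> (\<Oplus>i\<in>{..k}. \<Oplus>j\<in>{..Suc k - i}. f i j)"
    by (rule finsum_Suc) (use in3 in auto)
  also have "(\<Oplus>j\<in>{..Suc k - Suc k}. f (Suc k) j) = f (Suc k) 0" using Suc.prems by simp
  also have "(\<Oplus>i\<in>{..k}. \<Oplus>j\<in>{..Suc k - i}. f i j) =
      (\<Oplus>i\<in>{..k}. f i (Suc k - i) \<oplus> (\<Oplus>j\<in>{..k - i}. f i j))"
  proof (rule finsum_cong')
    fix i assume i: "i \<in> {..k}"
    have "(\<Oplus>j\<in>{..Suc (k - i)}. f i j) = f i (Suc (k - i)) \<oplus> (\<Oplus>j\<in>{..k - i}. f i j)"
      by (rule finsum_Suc) (use i Suc.prems in auto)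
    then show "(\<Oplus>j\<in>{..Suc k - i}. f i j) = f i (Suc k - i) \<oplus> (\<Oplus>j\<in>{..k - i}. f i j)"
      using i by (simp add: Suc_diff_le)
  qed (use in2 Suc.prems in auto)
  also have "\<dots> = (\<Oplus>i\<in>{..k}. f i (Suc k - i)) \<oplus> (\<Oplus>i\<in>{..k}. \<Oplus>j\<in>{..k - i}. f i j)"
    by (rule finsum_addf) (use in2 Suc.prems in auto)
  finally show ?case unfolding 1
    using Suc.prems in2 by (subst a_assoc) (auto intro!: finsum_closed)
qed (simp)

lemma (in abelian_monoid) finsum_single:
  assumes "finite A" "i \<in> A" "f i \<in> carrier G" "\<And>j. j \<in> A \<Longrightarrow> j \<noteq> i \<Longrightarrow> f j = \<zero>"
  shows "finsum G f A = f i"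
proof -
  have "finsum G f A = (\<Oplus>j\<in>A. if i = j then f i else \<zero>)"
    by (rule finsum_cong') (use assms in auto)
  also have "\<dots> = f i" using add.finprod_singleton[of i A "\<lambda>_. f i"] assms by simp
  finally show ?thesis .
qed

locale triv_ext = bimodule R M
  for R :: "('r, 'e) ring_scheme" (structure) and M :: "('r, 'm, 'f) bimodule_scheme" (structure) +
  fixes n :: nat
begin

abbreviation "S \<equiv> trivial_extension n R M"

lemma S_carrier: "a \<in> carrier S \<longleftrightarrow> a \<in> extensional {..n} \<and> (\<forall>k\<le>n. a k \<in> carrier (T k))"
  by (auto simp: trivial_extension_def PiE_def)

lemma S_simps:
  "\<zero>\<^bsub>S\<^esub> = (\<lambda>k\<in>{..n}. \<zero>\<^bsub>T k\<^esub>)"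
  "\<one>\<^bsub>S\<^esub> = (\<lambda>k\<in>{..n}. if k = 0 then Scal \<one> else \<zero>\<^bsub>T k\<^esub>)"
  "a \<oplus>\<^bsub>S\<^esub> b = (\<lambda>k\<in>{..n}. a k \<oplus>\<^bsub>T k\<^esub> b k)"
  "a \<otimes>\<^bsub>S\<^esub> b = (\<lambda>k\<in>{..n}. \<Oplus>\<^bsub>T k\<^esub>i\<in>{..k}. tmul i (k - i) (a i) (b (k - i)))"
  by (simp_all add: trivial_extension_def)

lemma S_eqI: "a \<in> carrier S \<Longrightarrow> b \<in> carrier S \<Longrightarrow> (\<And>k. k \<le> n \<Longrightarrow> a k = b k) \<Longrightarrow> a = b"
  unfolding S_carrier by (auto intro: extensionalityI)

lemma tmul_closed': "i \<le> k \<Longrightarrow> a \<in> carrier (T i) \<Longrightarrow> b \<in> carrier (T (k - i)) \<Longrightarrow> tmul i (k - i) a b \<in> carrier (T k)"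
  using tmul_closed[of a i b "k - i"] by simp

lemma tmul_l: "i \<le> k \<Longrightarrow> b \<in> carrier (T (k - i)) \<Longrightarrow> additive_map (T i) (T k) (\<lambda>a. tmul i (k - i) a b)"
  using tmul_additive_l[of b "k - i" i] by simp

lemma tmul_r: "i \<le> k \<Longrightarrow> a \<in> carrier (T i) \<Longrightarrow> additive_map (T (k - i)) (T k) (\<lambda>b. tmul i (k - i) a b)"
  using tmul_additive_r[of a i "k - i"] by simp

lemma S_mult_closed:
  assumes "a \<in> carrier S" "b \<in> carrier S" shows "a \<otimes>\<^bsub>S\<^esub> b \<in> carrier S"
  unfolding S_carrier S_simps
proof (intro conjI allI impI)
  fix k assume k: "k \<le> n"
  interpret Tk: abelian_group "T k" by (rule T_group)
  have "(\<Oplus>\<^bsub>T k\<^esub>i\<in>{..k}. tmul i (k - i) (a i) (b (k - i))) \<in> carrier (T k)"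
    by (rule Tk.finsum_closed) (use assms k in \<open>auto simp: S_carrier intro!: tmul_closed'\<close>)
  then show "(\<lambda>k\<in>{..n}. \<Oplus>\<^bsub>T k\<^esub>i\<in>{..k}. tmul i (k - i) (a i) (b (k - i))) k \<in> carrier (T k)"
    using k by simp
qed auto

text \<open>In degree \<open>k\<close> both sides are the sum of all triple products of total degree
  \<open>k\<close>; \<open>finsum_triangle\<close> reorders one into the other.\<close>

lemma S_mult_assoc:
  assumes a: "a \<in> carrier S" and b: "b \<in> carrier S" and c: "c \<in> carrier S"
  shows "a \<otimes>\<^bsub>S\<^esub> b \<otimes>\<^bsub>S\<^esub> c = a \<otimes>\<^bsub>S\<^esub> (b \<otimes>\<^bsub>S\<^esub> c)"
proof (rule S_eqI)
  fix k assume k: "k \<le> n"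
  interpret Tk: abelian_group "T k" by (rule T_group)
  have cl: "a i \<in> carrier (T i)" "b i \<in> carrier (T i)" "c i \<in> carrier (T i)" if "i \<le> k" for i
    using a b c k that by (auto simp: S_carrier)
  \<comment> \<open>The triple product with degrees \<open>i\<close>, \<open>q\<close> and
    \<open>k - i - q\<close>, bracketed to the right.\<close>
  let ?f = "\<lambda>i q. tmul i (k - i) (a i) (tmul q (k - i - q) (b q) (c (k - i - q)))"
  have f: "?f i q \<in> carrier (T k)" if "i + q \<le> k" for i q
    using that by (intro tmul_closed' cl) auto
  have "(a \<otimes>\<^bsub>S\<^esub> b \<otimes>\<^bsub>S\<^esub> c) k =
      (\<Oplus>\<^bsub>T k\<^esub>p\<in>{..k}. tmul p (k - p) (\<Oplus>\<^bsub>T p\<^esub>i\<in>{..p}. tmul i (p - i) (a i) (b (p - i))) (c (k - p)))"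
    using k by (auto simp: S_simps intro!: Tk.finsum_cong' tmul_closed' abelian_monoid.finsum_closed
        abelian_group.axioms(1)[OF T_group] cl)
  also have "\<dots> = (\<Oplus>\<^bsub>T k\<^esub>p\<in>{..k}. \<Oplus>\<^bsub>T k\<^esub>i\<in>{..p}. ?f i (p - i))"
  proof (rule Tk.finsum_cong')
    fix p assume p: "p \<in> {..k}"
    have in1: "(\<lambda>i. tmul i (p - i) (a i) (b (p - i))) \<in> {..p} \<rightarrow> carrier (T p)"
      using p by (auto intro!: tmul_closed' cl)
    have "tmul p (k - p) (\<Oplus>\<^bsub>T p\<^esub>i\<in>{..p}. tmul i (p - i) (a i) (b (p - i))) (c (k - p)) =
        (\<Oplus>\<^bsub>T k\<^esub>i\<in>{..p}. tmul p (k - p) (tmul i (p - i) (a i) (b (p - i))) (c (k - p)))"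
      by (rule additive_map.finsum[OF tmul_l in1]) (use p cl in auto)
    also have "\<dots> = (\<Oplus>\<^bsub>T k\<^esub>i\<in>{..p}. ?f i (p - i))"
    proof (rule Tk.finsum_cong')
      fix i assume i: "i \<in> {..p}"
      have "tmul (i + (p - i)) (k - p) (tmul i (p - i) (a i) (b (p - i))) (c (k - p)) =
          tmul i (p - i + (k - p)) (a i) (tmul (p - i) (k - p) (b (p - i)) (c (k - p)))"
        by (rule tmul_assoc) (use p i cl in auto)
      moreover have "i + (p - i) = p" "p - i + (k - p) = k - i" "k - i - (p - i) = k - p" using p i by auto
      ultimately show "tmul p (k - p) (tmul i (p - i) (a i) (b (p - i))) (c (k - p)) = ?f i (p - i)" by simp
    qed (rule refl, rule funcsetI, rule f, use p in auto)
    finally show "tmul p (k - p) (\<Oplus>\<^bsub>T p\<^esub>i\<in>{..p}. tmul i (p - i) (a i) (b (p - i))) (c (k - p)) =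
        (\<Oplus>\<^bsub>T k\<^esub>i\<in>{..p}. ?f i (p - i))" .
  qed (rule refl, rule funcsetI, rule Tk.finsum_closed, rule funcsetI, rule f, auto)
  also have "\<dots> = (\<Oplus>\<^bsub>T k\<^esub>i\<in>{..k}. \<Oplus>\<^bsub>T k\<^esub>q\<in>{..k - i}. ?f i q)"
    by (rule Tk.finsum_triangle) (rule f)
  also have "\<dots> = (\<Oplus>\<^bsub>T k\<^esub>i\<in>{..k}. tmul i (k - i) (a i) (\<Oplus>\<^bsub>T (k - i)\<^esub>q\<in>{..k - i}. tmul q (k - i - q) (b q) (c (k - i - q))))"
  proof (rule Tk.finsum_cong')
    fix i assume i: "i \<in> {..k}"
    have in1: "(\<lambda>q. tmul q (k - i - q) (b q) (c (k - i - q))) \<in> {..k - i} \<rightarrow> carrier (T (k - i))"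
      by (rule funcsetI, rule tmul_closed') (auto intro!: cl simp del: diff_diff_left)
    show "(\<Oplus>\<^bsub>T k\<^esub>q\<in>{..k - i}. ?f i q) =
        tmul i (k - i) (a i) (\<Oplus>\<^bsub>T (k - i)\<^esub>q\<in>{..k - i}. tmul q (k - i - q) (b q) (c (k - i - q)))"
      by (rule additive_map.finsum[OF tmul_r in1, symmetric]) (use i cl in auto)
  qed (auto intro!: tmul_closed' abelian_monoid.finsum_closed abelian_group.axioms(1)[OF T_group] cl
      simp del: diff_diff_left)
  also have "\<dots> = (a \<otimes>\<^bsub>S\<^esub> (b \<otimes>\<^bsub>S\<^esub> c)) k"
    using k by (auto simp: S_simps le_trans[OF diff_le_self k] simp del: diff_diff_left intro!: Tk.finsum_cong'
        tmul_closed' abelian_monoid.finsum_closed abelian_group.axioms(1)[OF T_group] cl)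
  finally show "(a \<otimes>\<^bsub>S\<^esub> b \<otimes>\<^bsub>S\<^esub> c) k = (a \<otimes>\<^bsub>S\<^esub> (b \<otimes>\<^bsub>S\<^esub> c)) k" .
qed (use assms in \<open>auto intro: S_mult_closed\<close>)

lemma S_add_closed: "a \<in> carrier S \<Longrightarrow> b \<in> carrier S \<Longrightarrow> a \<oplus>\<^bsub>S\<^esub> b \<in> carrier S"
  using abelian_group.axioms(1)[OF T_group] by (auto simp: S_carrier S_simps abelian_monoid.a_closed)

lemma S_group: "abelian_group S"
proof (rule abelian_groupI)
  note G = T_group
  note Mo = abelian_group.axioms(1)[OF T_group]
  show "\<zero>\<^bsub>S\<^esub> \<in> carrier S" by (simp add: S_carrier S_simps abelian_monoid.zero_closed[OF Mo])
  show "a \<oplus>\<^bsub>S\<^esub> b \<in> carrier S" if "a \<in> carrier S" "b \<in> carrier S" for a b using that by (rule S_add_closed)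
  fix a assume a: "a \<in> carrier S"
  then have ac: "a k \<in> carrier (T k)" if "k \<le> n" for k using that by (simp add: S_carrier)
  show "\<zero>\<^bsub>S\<^esub> \<oplus>\<^bsub>S\<^esub> a = a"
    using a ac by (auto simp: S_simps abelian_monoid.l_zero[OF Mo] S_carrier extensional_def fun_eq_iff)
  have "(\<lambda>k\<in>{..n}. \<ominus>\<^bsub>T k\<^esub> a k) \<in> carrier S"
    using ac by (simp add: S_carrier abelian_group.a_inv_closed[OF G])
  moreover have "(\<lambda>k\<in>{..n}. \<ominus>\<^bsub>T k\<^esub> a k) \<oplus>\<^bsub>S\<^esub> a = \<zero>\<^bsub>S\<^esub>"
    using ac by (auto simp: S_simps abelian_group.l_neg[OF G])
  ultimately show "\<exists>b\<in>carrier S. b \<oplus>\<^bsub>S\<^esub> a = \<zero>\<^bsub>S\<^esub>" by blast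
  fix b assume b: "b \<in> carrier S"
  show "a \<oplus>\<^bsub>S\<^esub> b = b \<oplus>\<^bsub>S\<^esub> a"
    using ac b by (auto simp: S_simps S_carrier abelian_monoid.a_comm[OF Mo])
  fix c assume c: "c \<in> carrier S"
  show "a \<oplus>\<^bsub>S\<^esub> b \<oplus>\<^bsub>S\<^esub> c = a \<oplus>\<^bsub>S\<^esub> (b \<oplus>\<^bsub>S\<^esub> c)"
    using ac b c by (auto simp: S_simps S_carrier abelian_monoid.a_assoc[OF Mo])
qed

lemma T_zero_closed: "\<zero>\<^bsub>T k\<^esub> \<in> carrier (T k)"
  by (rule abelian_monoid.zero_closed[OF abelian_group.axioms(1)[OF T_group]])

lemma S_one_closed: "\<one>\<^bsub>S\<^esub> \<in> carrier S"
  by (auto simp: S_carrier S_simps Scal_one T_zero_closed)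

lemma S_ring: "ring S"
proof (rule ringI)
  show "abelian_group S" by (rule S_group)
  show "monoid S"
  proof
    fix a assume a: "a \<in> carrier S"
    then have ac: "a k \<in> carrier (T k)" if "k \<le> n" for k using that by (simp add: S_carrier)
    show "\<one>\<^bsub>S\<^esub> \<otimes>\<^bsub>S\<^esub> a = a"
    proof (rule S_eqI[OF S_mult_closed[OF S_one_closed a] a])
      fix k assume k: "k \<le> n"
      interpret Tk: abelian_group "T k" by (rule T_group)
      have "(\<one>\<^bsub>S\<^esub> \<otimes>\<^bsub>S\<^esub> a) k = (\<Oplus>\<^bsub>T k\<^esub>i\<in>{..k}. tmul i (k - i) (\<one>\<^bsub>S\<^esub> i) (a (k - i)))"
        using k by (simp add: S_simps(4))
      also have "\<dots> = tmul 0 (k - 0) (\<one>\<^bsub>S\<^esub> 0) (a (k - 0))"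
      proof (rule Tk.finsum_single)
        fix i assume i: "i \<in> {..k}" "i \<noteq> 0"
        then show "tmul i (k - i) (\<one>\<^bsub>S\<^esub> i) (a (k - i)) = \<zero>\<^bsub>T k\<^esub>"
          using additive_map.zero[OF tmul_l[of i k "a (k - i)"]] ac[of "k - i"] k by (simp add: S_simps)
      qed (use k ac in \<open>auto simp: S_simps tmul_one_l\<close>)
      also have "\<dots> = a k" using k ac by (simp add: S_simps tmul_one_l)
      finally show "(\<one>\<^bsub>S\<^esub> \<otimes>\<^bsub>S\<^esub> a) k = a k" .
    qed
    show "a \<otimes>\<^bsub>S\<^esub> \<one>\<^bsub>S\<^esub> = a"
    proof (rule S_eqI[OF S_mult_closed[OF a S_one_closed] a])
      fix k assume k: "k \<le> n"
      interpret Tk: abelian_group "T k" by (rule T_group)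
      have "(a \<otimes>\<^bsub>S\<^esub> \<one>\<^bsub>S\<^esub>) k = (\<Oplus>\<^bsub>T k\<^esub>i\<in>{..k}. tmul i (k - i) (a i) (\<one>\<^bsub>S\<^esub> (k - i)))"
        using k by (simp add: S_simps(4))
      also have "\<dots> = tmul k (k - k) (a k) (\<one>\<^bsub>S\<^esub> (k - k))"
      proof (rule Tk.finsum_single)
        fix i assume i: "i \<in> {..k}" "i \<noteq> k"
        then show "tmul i (k - i) (a i) (\<one>\<^bsub>S\<^esub> (k - i)) = \<zero>\<^bsub>T k\<^esub>"
          using additive_map.zero[OF tmul_r[of i k "a i"]] ac[of i] k le_trans[OF diff_le_self k, of i] by (simp add: S_simps)
      qed (use k ac in \<open>auto simp: S_simps tmul_one_r\<close>)
      also have "\<dots> = a k" using k ac by (simp add: S_simps tmul_one_r)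
      finally show "(a \<otimes>\<^bsub>S\<^esub> \<one>\<^bsub>S\<^esub>) k = a k" .
    qed
  qed (auto intro: S_mult_closed S_mult_assoc S_one_closed)
next
  fix a b c assume abc: "a \<in> carrier S" "b \<in> carrier S" "c \<in> carrier S"
  have cl: "a i \<in> carrier (T i)" "b i \<in> carrier (T i)" "c i \<in> carrier (T i)" if "i \<le> n" for i
    using abc that by (auto simp: S_carrier)
  show "(a \<oplus>\<^bsub>S\<^esub> b) \<otimes>\<^bsub>S\<^esub> c = a \<otimes>\<^bsub>S\<^esub> c \<oplus>\<^bsub>S\<^esub> b \<otimes>\<^bsub>S\<^esub> c"
  proof (rule S_eqI)
    fix k assume k: "k \<le> n"
    interpret Tk: abelian_group "T k" by (rule T_group)
    have "((a \<oplus>\<^bsub>S\<^esub> b) \<otimes>\<^bsub>S\<^esub> c) k = (\<Oplus>\<^bsub>T k\<^esub>i\<in>{..k}. tmul i (k - i) ((a \<oplus>\<^bsub>S\<^esub> b) i) (c (k - i)))"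
      using k by (simp add: S_simps(4))
    also have "\<dots> = (\<Oplus>\<^bsub>T k\<^esub>i\<in>{..k}. tmul i (k - i) (a i) (c (k - i)) \<oplus>\<^bsub>T k\<^esub> tmul i (k - i) (b i) (c (k - i)))"
    proof (rule Tk.finsum_cong')
      fix i assume i: "i \<in> {..k}"
      then show "tmul i (k - i) ((a \<oplus>\<^bsub>S\<^esub> b) i) (c (k - i)) =
          tmul i (k - i) (a i) (c (k - i)) \<oplus>\<^bsub>T k\<^esub> tmul i (k - i) (b i) (c (k - i))"
        using additive_map.add[OF tmul_l[of i k "c (k - i)"], of "a i" "b i"] cl k by (simp add: S_simps)
    qed (use k cl in \<open>auto intro!: tmul_closed'\<close>)
    also have "\<dots> = (a \<otimes>\<^bsub>S\<^esub> c \<oplus>\<^bsub>S\<^esub> b \<otimes>\<^bsub>S\<^esub> c) k"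
      using k cl by (subst Tk.finsum_addf) (auto simp: S_simps intro!: tmul_closed')
    finally show "((a \<oplus>\<^bsub>S\<^esub> b) \<otimes>\<^bsub>S\<^esub> c) k = (a \<otimes>\<^bsub>S\<^esub> c \<oplus>\<^bsub>S\<^esub> b \<otimes>\<^bsub>S\<^esub> c) k" .
  qed (use abc in \<open>auto intro: S_mult_closed S_add_closed\<close>)
  show "c \<otimes>\<^bsub>S\<^esub> (a \<oplus>\<^bsub>S\<^esub> b) = c \<otimes>\<^bsub>S\<^esub> a \<oplus>\<^bsub>S\<^esub> c \<otimes>\<^bsub>S\<^esub> b"
  proof (rule S_eqI)
    fix k assume k: "k \<le> n"
    interpret Tk: abelian_group "T k" by (rule T_group)
    have "(c \<otimes>\<^bsub>S\<^esub> (a \<oplus>\<^bsub>S\<^esub> b)) k = (\<Oplus>\<^bsub>T k\<^esub>i\<in>{..k}. tmul i (k - i) (c i) ((a \<oplus>\<^bsub>S\<^esub> b) (k - i)))"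
      using k by (simp add: S_simps(4))
    also have "\<dots> = (\<Oplus>\<^bsub>T k\<^esub>i\<in>{..k}. tmul i (k - i) (c i) (a (k - i)) \<oplus>\<^bsub>T k\<^esub> tmul i (k - i) (c i) (b (k - i)))"
    proof (rule Tk.finsum_cong')
      fix i assume i: "i \<in> {..k}"
      then show "tmul i (k - i) (c i) ((a \<oplus>\<^bsub>S\<^esub> b) (k - i)) =
          tmul i (k - i) (c i) (a (k - i)) \<oplus>\<^bsub>T k\<^esub> tmul i (k - i) (c i) (b (k - i))"
        using additive_map.add[OF tmul_r[of i k "c i"], of "a (k - i)" "b (k - i)"] cl k
          le_trans[OF diff_le_self k, of i] by (simp add: S_simps)
    qed (use k cl in \<open>auto intro!: tmul_closed'\<close>)
    also have "\<dots> = (c \<otimes>\<^bsub>S\<^esub> a \<oplus>\<^bsub>S\<^esub> c \<otimes>\<^bsub>S\<^esub> b) k"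
      using k cl by (subst Tk.finsum_addf) (auto simp: S_simps intro!: tmul_closed')
    finally show "(c \<otimes>\<^bsub>S\<^esub> (a \<oplus>\<^bsub>S\<^esub> b)) k = (c \<otimes>\<^bsub>S\<^esub> a \<oplus>\<^bsub>S\<^esub> c \<otimes>\<^bsub>S\<^esub> b) k" .
  qed (use abc in \<open>auto intro: S_mult_closed S_add_closed\<close>)
qed

end

section \<open>The action of the trivial extension on the module \<open>[Y, g]\<close>\<close>

locale pair_data = triv_ext R M n
  for R :: "('r, 'e) ring_scheme" (structure) and M :: "('r, 'm, 'f) bimodule_scheme" (structure) and n +
  fixes Y :: "('r, 'y) module" and g :: "'y \<Rightarrow> 'm \<Rightarrow> 'y"
  assumes pair: "module_pair n R M Y g" and n: "n \<ge> 1"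
begin

sublocale Y: left_module R Y
  using pair by (simp add: module_pair_def)

lemma g_hom: "g \<in> lmod_hom R Y (hom_module R M Y)"
  using pair by (simp add: module_pair_def)

lemma g_y_hom: "y \<in> carrier Y \<Longrightarrow> g y \<in> lmod_hom R M Y"
proof -
  assume y: "y \<in> carrier Y"
  have "g \<in> carrier Y \<rightarrow>\<^sub>E carrier (hom_module R M Y)" using g_hom by (simp add: lmod_hom_def)
  from PiE_mem[OF this y] show ?thesis by (simp add: hom_module_def)
qed

lemma g_closed: "y \<in> carrier Y \<Longrightarrow> m \<in> carrier M \<Longrightarrow> g y m \<in> carrier Y"
  using g_y_hom[of y] unfolding lmod_hom_def by (auto dest: PiE_mem)

lemma g_add_m: "\<lbrakk>y \<in> carrier Y; m \<in> carrier M; m' \<in> carrier M\<rbrakk> \<Longrightarrow> g y (m \<oplus>\<^bsub>M\<^esub> m') = g y m \<oplus>\<^bsub>Y\<^esub> g y m'"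
  using g_y_hom unfolding lmod_hom_def by auto

lemma g_smult_m: "\<lbrakk>y \<in> carrier Y; m \<in> carrier M; r \<in> carrier R\<rbrakk> \<Longrightarrow> g y (r \<odot>\<^bsub>M\<^esub> m) = r \<odot>\<^bsub>Y\<^esub> g y m"
  using g_y_hom unfolding lmod_hom_def by auto

lemma g_add: "\<lbrakk>y \<in> carrier Y; y' \<in> carrier Y; m \<in> carrier M\<rbrakk> \<Longrightarrow> g (y \<oplus>\<^bsub>Y\<^esub> y') m = g y m \<oplus>\<^bsub>Y\<^esub> g y' m"
  using g_hom unfolding lmod_hom_def hom_module_def by auto

lemma g_smult: "\<lbrakk>r \<in> carrier R; y \<in> carrier Y; m \<in> carrier M\<rbrakk> \<Longrightarrow> g (r \<odot>\<^bsub>Y\<^esub> y) m = g y (m \<bullet>\<^bsub>M\<^esub> r)"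
  using g_hom unfolding lmod_hom_def hom_module_def by auto

lemma g_additive: "m \<in> carrier M \<Longrightarrow> additive_map Y Y (\<lambda>y. g y m)"
  by unfold_locales (auto simp: g_closed g_add)

lemma g_zero: "m \<in> carrier M \<Longrightarrow> g \<zero>\<^bsub>Y\<^esub> m = \<zero>\<^bsub>Y\<^esub>"
  using additive_map.zero[OF g_additive] by simp

text \<open>The first \<open>n + 1\<close> entries already give zero, and zero stays zero under
  further applications of \<open>g\<close>.\<close>

lemma g_nilpotent: "\<lbrakk>y \<in> carrier Y; set ms \<subseteq> carrier M; length ms \<ge> n + 1\<rbrakk> \<Longrightarrow> foldl g y ms = \<zero>\<^bsub>Y\<^esub>"
proof -
  assume y: "y \<in> carrier Y" and ms: "set ms \<subseteq> carrier M" "length ms \<ge> n + 1"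
  have "set (take (n + 1) ms) \<subseteq> carrier M" "set (drop (n + 1) ms) \<subseteq> carrier M"
    using ms(1) by (auto dest: in_set_takeD in_set_dropD)
  moreover from this have "foldl g y (take (n + 1) ms) = \<zero>\<^bsub>Y\<^esub>"
    using pair y ms(2) by (simp add: module_pair_def)
  moreover have "foldl g \<zero>\<^bsub>Y\<^esub> l = \<zero>\<^bsub>Y\<^esub>" if "set l \<subseteq> carrier M" for l
    using that by (induction l) (auto simp: g_zero)
  ultimately show ?thesis by (subst append_take_drop_id[of "n + 1" ms, symmetric]) (simp only: foldl_append)
qed

abbreviation "act \<equiv> tensor_act Y g"

lemma act_0: "r \<in> carrier R \<Longrightarrow> act 0 (Scal r) y = r \<odot>\<^bsub>Y\<^esub> y"
  by (simp add: tensor_act.simps)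

text \<open>The facts depend on each other across degrees: R-linearity in degree \<open>i\<close>
  makes \<open>(m, x) \<mapsto> g (act i x y) m\<close> balanced, since
  \<open>g (r y) m = g y (m r)\<close>. The lift of this map is the action in degree
  \<open>Suc i\<close>, which gives additivity and the formula on generators.\<close>

lemma act_facts:
  "(\<forall>a\<in>carrier (T i). \<forall>y\<in>carrier Y. act i a y \<in> carrier Y) \<and>
   (\<forall>a\<in>carrier (T i). \<forall>a'\<in>carrier (T i). \<forall>y\<in>carrier Y.
      act i (a \<oplus>\<^bsub>T i\<^esub> a') y = act i a y \<oplus>\<^bsub>Y\<^esub> act i a' y) \<and>
   (\<forall>r\<in>carrier R. \<forall>a\<in>carrier (T i). \<forall>y\<in>carrier Y. act i (r \<odot>\<^bsub>T i\<^esub> a) y = r \<odot>\<^bsub>Y\<^esub> act i a y) \<and>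
   (\<forall>m\<in>carrier M. \<forall>x\<in>carrier (T i). \<forall>y\<in>carrier Y. act (Suc i) (cons i m x) y = g (act i x y) m)"
proof (induction i)
  \<comment> \<open>One passage from degree \<open>i\<close> to \<open>Suc i\<close>, without
    R-linearity in the new degree, which needs the formula on generators first.\<close>
  have step: "(\<forall>a\<in>carrier (T (Suc i)). \<forall>y\<in>carrier Y. act (Suc i) a y \<in> carrier Y) \<and>
   (\<forall>a\<in>carrier (T (Suc i)). \<forall>a'\<in>carrier (T (Suc i)). \<forall>y\<in>carrier Y.
      act (Suc i) (a \<oplus>\<^bsub>T (Suc i)\<^esub> a') y = act (Suc i) a y \<oplus>\<^bsub>Y\<^esub> act (Suc i) a' y) \<and>
   (\<forall>m\<in>carrier M. \<forall>x\<in>carrier (T i). \<forall>y\<in>carrier Y. act (Suc i) (cons i m x) y = g (act i x y) m)"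
    if cl: "\<And>a y. a \<in> carrier (T i) \<Longrightarrow> y \<in> carrier Y \<Longrightarrow> act i a y \<in> carrier Y"
      and ad: "\<And>a a' y. a \<in> carrier (T i) \<Longrightarrow> a' \<in> carrier (T i) \<Longrightarrow> y \<in> carrier Y \<Longrightarrow>
        act i (a \<oplus>\<^bsub>T i\<^esub> a') y = act i a y \<oplus>\<^bsub>Y\<^esub> act i a' y"
      and sm: "\<And>r a y. r \<in> carrier R \<Longrightarrow> a \<in> carrier (T i) \<Longrightarrow> y \<in> carrier Y \<Longrightarrow>
        act i (r \<odot>\<^bsub>T i\<^esub> a) y = r \<odot>\<^bsub>Y\<^esub> act i a y" for i
  proof -
    have "\<exists>h. additive_map (T (Suc i)) Y h \<and>
        (\<forall>m\<in>carrier M. \<forall>x\<in>carrier (T i). h (cons i m x) = g (act i x y) m) \<and>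
        (\<forall>a\<in>carrier (T (Suc i)). h a = act (Suc i) a y)" if y: "y \<in> carrier Y" for y
    proof -
      let ?\<beta> = "\<lambda>m x. g (act i x y) m"
      have "balanced R M (T i) Y ?\<beta>"
        unfolding balanced_def using y
        by (intro conjI ballI) (simp_all add: cl ad sm g_closed g_add g_add_m g_smult)
      then obtain h where h: "additive_map (T (Suc i)) Y h"
        "\<And>m x. m \<in> carrier M \<Longrightarrow> x \<in> carrier (T i) \<Longrightarrow> h (cons i m x) = ?\<beta> m x"
        "\<And>a. a \<in> carrier (T (Suc i)) \<Longrightarrow>
          h a = (if i = 0 then ?\<beta> (the_vec a) (Scal \<one>) else list_sum Y (map (\<lambda>(m, x). ?\<beta> m x) (the_tens a)))"
        by (rule T_lift[OF Y.M.abelian_group_axioms]) blast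
      have "h a = act (Suc i) a y" if "a \<in> carrier (T (Suc i))" for a
        unfolding h(3)[OF that] using y by (simp add: tensor_act.simps Y.smult_one)
      with h(1,2) show ?thesis by blast
    qed
    then obtain h where h: "\<And>y. y \<in> carrier Y \<Longrightarrow> additive_map (T (Suc i)) Y (h y)"
      "\<And>y m x. \<lbrakk>y \<in> carrier Y; m \<in> carrier M; x \<in> carrier (T i)\<rbrakk> \<Longrightarrow> h y (cons i m x) = g (act i x y) m"
      "\<And>y a. \<lbrakk>y \<in> carrier Y; a \<in> carrier (T (Suc i))\<rbrakk> \<Longrightarrow> act (Suc i) a y = h y a"
      by metis
    interpret Ti: left_module R "T (Suc i)" by (rule T_module)
    show ?thesis
      using additive_map.closed[OF h(1)] additive_map.add[OF h(1)] by (simp add: h(2,3) cons_closed)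
  qed
  {
    case 0
    have 1: "act 0 a y \<in> carrier Y" if "a \<in> carrier (T 0)" "y \<in> carrier Y" for a y
      using that unfolding T_0_carrier by (auto simp: act_0 Y.smult_closed)
    have 2: "act 0 (a \<oplus>\<^bsub>T 0\<^esub> a') y = act 0 a y \<oplus>\<^bsub>Y\<^esub> act 0 a' y"
      if "a \<in> carrier (T 0)" "a' \<in> carrier (T 0)" "y \<in> carrier Y" for a a' y
      using that unfolding T_0_carrier by (auto simp: act_0 T_0_add Y.smult_l_distr)
    have 3: "act 0 (r \<odot>\<^bsub>T 0\<^esub> a) y = r \<odot>\<^bsub>Y\<^esub> act 0 a y"
      if "r \<in> carrier R" "a \<in> carrier (T 0)" "y \<in> carrier Y" for r a y
      using that unfolding T_0_carrier by (auto simp: act_0 T_0_smult Y.smult_assoc)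
    note 4 = step[OF 1 2 3, THEN conjunct2, THEN conjunct2]
    show ?case by (intro conjI) (rule 4 | simp add: 1 2 3)+
  next
    case (Suc i)
    interpret Ti: left_module R "T (Suc i)" by (rule T_module)
    have IH: "(\<forall>a\<in>carrier (T (Suc i)). \<forall>y\<in>carrier Y. act (Suc i) a y \<in> carrier Y) \<and>
     (\<forall>a\<in>carrier (T (Suc i)). \<forall>a'\<in>carrier (T (Suc i)). \<forall>y\<in>carrier Y.
        act (Suc i) (a \<oplus>\<^bsub>T (Suc i)\<^esub> a') y = act (Suc i) a y \<oplus>\<^bsub>Y\<^esub> act (Suc i) a' y) \<and>
     (\<forall>m\<in>carrier M. \<forall>x\<in>carrier (T i). \<forall>y\<in>carrier Y. act (Suc i) (cons i m x) y = g (act i x y) m)"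
      by (rule step) (use Suc in blast)+
    have 1: "act (Suc i) a y \<in> carrier Y" if "a \<in> carrier (T (Suc i))" "y \<in> carrier Y" for a y
      using IH that by blast
    have 2: "act (Suc i) (a \<oplus>\<^bsub>T (Suc i)\<^esub> a') y = act (Suc i) a y \<oplus>\<^bsub>Y\<^esub> act (Suc i) a' y"
      if "a \<in> carrier (T (Suc i))" "a' \<in> carrier (T (Suc i))" "y \<in> carrier Y" for a a' y
      using IH that by blast
    have c: "act (Suc i) (cons i m x) y = g (act i x y) m"
      if "m \<in> carrier M" "x \<in> carrier (T i)" "y \<in> carrier Y" for m x y
      using IH that by blast
    have ci: "act i x y \<in> carrier Y" if "x \<in> carrier (T i)" "y \<in> carrier Y" for x y
      using Suc that by blast
    have z: "act (Suc i) \<zero>\<^bsub>T (Suc i)\<^esub> y = \<zero>\<^bsub>Y\<^esub>" if y: "y \<in> carrier Y" for y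
    proof -
      interpret additive_map "T (Suc i)" Y "\<lambda>a. act (Suc i) a y"
        by unfold_locales (use y 1 2 in auto)
      show ?thesis by (rule zero)
    qed
    \<comment> \<open>On generators, \<open>r\<close> is absorbed into \<open>m\<close> and comes
      out again because each \<open>g y\<close> is left linear in its argument from
      \<open>M\<close>.\<close>
    have 3: "act (Suc i) (r \<odot>\<^bsub>T (Suc i)\<^esub> a) y = r \<odot>\<^bsub>Y\<^esub> act (Suc i) a y"
      if r: "r \<in> carrier R" and a: "a \<in> carrier (T (Suc i))" and y: "y \<in> carrier Y" for r a y
      using a
    proof (induction a rule: T_Suc_induct)
      case zero
      then show ?case using r y by (simp add: z Ti.smult_r_null Y.smult_r_null)
    next
      case (cons m x)
      then show ?case using r y by (simp add: cons_smult c smult_closed g_smult_m ci)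
    next
      case (add a a')
      then show ?case using r y by (simp add: Ti.smult_r_distr Ti.smult_closed 1 2 Y.smult_r_distr)
    qed
    note 4 = step[OF 1 2 3, THEN conjunct2, THEN conjunct2]
    show ?case by (intro conjI) (rule 4 | simp add: 1 2 3)+
  }
qed

lemma act_closed: "a \<in> carrier (T i) \<Longrightarrow> y \<in> carrier Y \<Longrightarrow> act i a y \<in> carrier Y"
  using act_facts by blast

lemma act_additive: "y \<in> carrier Y \<Longrightarrow> additive_map (T i) Y (\<lambda>a. act i a y)"
  using act_facts T_group Y.M.abelian_group_axioms
  unfolding additive_map_def additive_map_axioms_def by blast

lemma act_smult: "\<lbrakk>r \<in> carrier R; a \<in> carrier (T i); y \<in> carrier Y\<rbrakk> \<Longrightarrow> act i (r \<odot>\<^bsub>T i\<^esub> a) y = r \<odot>\<^bsub>Y\<^esub> act i a y"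
  using act_facts by blast

lemma act_cons: "\<lbrakk>m \<in> carrier M; x \<in> carrier (T i); y \<in> carrier Y\<rbrakk> \<Longrightarrow> act (Suc i) (cons i m x) y = g (act i x y) m"
  using act_facts by blast

lemma act_add_r:
  assumes "a \<in> carrier (T i)" "y \<in> carrier Y" "y' \<in> carrier Y"
  shows "act i a (y \<oplus>\<^bsub>Y\<^esub> y') = act i a y \<oplus>\<^bsub>Y\<^esub> act i a y'"
  using assms(1)
proof (induction i arbitrary: a)
  case 0
  then show ?case using assms unfolding T_0_carrier by (auto simp: act_0 Y.smult_r_distr)
next
  case (Suc i)
  note z = additive_map.zero[OF act_additive] and ad = additive_map.add[OF act_additive]
  have y: "y \<oplus>\<^bsub>Y\<^esub> y' \<in> carrier Y" using assms by simp
  from Suc.prems show ?case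
  proof (induction a rule: T_Suc_induct)
    case zero
    then show ?case using assms y by (simp add: z)
  next
    case (cons m x)
    then show ?case using assms y Suc.IH by (simp add: act_cons g_add act_closed)
  next
    case (add a a')
    then show ?case using assms y by (simp add: ad act_closed Y.M.a_ac)
  qed
qed

lemma act_additive_r: "a \<in> carrier (T i) \<Longrightarrow> additive_map Y Y (act i a)"
  by unfold_locales (auto simp: act_closed act_add_r)

text \<open>The action turns tensor multiplication into composition, with the right factor acting
  before the left one. This is the core of associativity of the module structure.\<close>

lemma act_tmul:
  assumes "a \<in> carrier (T i)" and b: "b \<in> carrier (T j)" and y: "y \<in> carrier Y"
  shows "act (i + j) (tmul i j a b) y = act i a (act j b y)"
  using assms(1)
proof (induction i arbitrary: a)
  case 0
  then show ?case using b y unfolding T_0_carrier by (auto simp: tmul_0 act_0 act_smult)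
next
  case (Suc i)
  interpret L: additive_map "T (Suc i)" "T (Suc i + j)" "\<lambda>a. tmul (Suc i) j a b" by (rule tmul_additive_l[OF b])
  interpret A: additive_map "T (Suc i + j)" Y "\<lambda>a. act (Suc i + j) a y" by (rule act_additive[OF y])
  interpret B: additive_map "T (Suc i)" Y "\<lambda>a. act (Suc i) a (act j b y)" by (rule act_additive[OF act_closed[OF b y]])
  from Suc.prems show ?case
  proof (induction a rule: T_Suc_induct)
    case zero
    then show ?case using L.zero A.zero B.zero by simp
  next
    case (cons m x)
    then show ?case using b y Suc.IH by (simp add: tmul_cons act_cons tmul_closed act_closed)
  next
    case (add a a')
    then show ?case using L.add A.add B.add L.closed by simp
  qed
qed

text \<open>The claim about \<open>act i\<close> alone does not pass through an induction; the list
  \<open>ms\<close> collects the factors already split off, so that the degree drops while the list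
  grows and the total stays above \<open>n\<close>.\<close>

lemma foldl_act:
  assumes "a \<in> carrier (T i)" "y \<in> carrier Y" "set ms \<subseteq> carrier M" "i + length ms \<ge> n + 1"
  shows "foldl g (act i a y) ms = \<zero>\<^bsub>Y\<^esub>"
  using assms
proof (induction i arbitrary: a ms)
  case 0
  then show ?case by (intro g_nilpotent act_closed) auto
next
  case (Suc i)
  have fa: "foldl g (u \<oplus>\<^bsub>Y\<^esub> v) l = foldl g u l \<oplus>\<^bsub>Y\<^esub> foldl g v l"
    if "u \<in> carrier Y" "v \<in> carrier Y" "set l \<subseteq> carrier M" for u v l
    using that by (induction l arbitrary: u v) (auto simp: g_add g_closed)
  have fz: "foldl g \<zero>\<^bsub>Y\<^esub> l = \<zero>\<^bsub>Y\<^esub>" if "set l \<subseteq> carrier M" for l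
    using that by (induction l) (auto simp: g_zero)
  interpret A: additive_map "T (Suc i)" Y "\<lambda>a. act (Suc i) a y" by (rule act_additive[OF Suc.prems(2)])
  from Suc.prems(1) show ?case
  proof (induction a rule: T_Suc_induct)
    case zero
    then show ?case using A.zero Suc.prems fz by simp
  next
    case (cons m x)
    then show ?case using Suc.prems Suc.IH[of x "m # ms"] by (simp add: act_cons)
  next
    case (add a a')
    then show ?case using A.add A.closed Suc.prems fa by simp
  qed
qed

lemma act_vanishes: "\<lbrakk>a \<in> carrier (T i); y \<in> carrier Y; i > n\<rbrakk> \<Longrightarrow> act i a y = \<zero>\<^bsub>Y\<^esub>"
  using foldl_act[of a i y "[]"] by simp

abbreviation "PY \<equiv> pair_module n Y g :: (nat \<Rightarrow> ('r, 'm) tensor, 'y) module"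

lemma PY_simps:
  "carrier PY = carrier Y" "\<zero>\<^bsub>PY\<^esub> = \<zero>\<^bsub>Y\<^esub>" "x \<oplus>\<^bsub>PY\<^esub> y = x \<oplus>\<^bsub>Y\<^esub> y"
  "a \<odot>\<^bsub>PY\<^esub> y = (\<Oplus>\<^bsub>Y\<^esub>i\<in>{..n}. act i (a i) y)"
  by (simp_all add: pair_module_def)

lemma PY_module: "left_module S PY"
proof (rule left_moduleI)
  show "ring S" by (rule S_ring)
  show "\<exists>y\<in>carrier PY. y \<oplus>\<^bsub>PY\<^esub> x = \<zero>\<^bsub>PY\<^esub>" if "x \<in> carrier PY" for x
    using that Y.M.l_neg[of x] by (intro bexI[of _ "\<ominus>\<^bsub>Y\<^esub> x"]) (simp_all add: PY_simps)
  have cl: "(\<lambda>i. act i (a i) y) \<in> {..n} \<rightarrow> carrier Y" if "a \<in> carrier S" "y \<in> carrier Y" for a y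
    using that by (auto simp: S_carrier intro!: act_closed)
  show "a \<odot>\<^bsub>PY\<^esub> y \<in> carrier PY" if "a \<in> carrier S" "y \<in> carrier PY" for a y
    using that cl unfolding PY_simps by (intro Y.M.finsum_closed) auto
  show "a \<odot>\<^bsub>PY\<^esub> (y \<oplus>\<^bsub>PY\<^esub> y') = a \<odot>\<^bsub>PY\<^esub> y \<oplus>\<^bsub>PY\<^esub> a \<odot>\<^bsub>PY\<^esub> y'"
    if "a \<in> carrier S" "y \<in> carrier PY" "y' \<in> carrier PY" for a y y'
  proof -
    have y: "y \<in> carrier Y" "y' \<in> carrier Y" using that by (simp_all add: PY_simps)
    have "(\<Oplus>\<^bsub>Y\<^esub>i\<in>{..n}. act i (a i) (y \<oplus>\<^bsub>Y\<^esub> y')) = (\<Oplus>\<^bsub>Y\<^esub>i\<in>{..n}. act i (a i) y \<oplus>\<^bsub>Y\<^esub> act i (a i) y')"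
      using y that(1) by (intro Y.M.finsum_cong') (auto simp: S_carrier act_add_r intro!: act_closed)
    then show ?thesis unfolding PY_simps using Y.M.finsum_addf[OF cl[OF that(1) y(1)] cl[OF that(1) y(2)]] by simp
  qed
  show "(a \<oplus>\<^bsub>S\<^esub> b) \<odot>\<^bsub>PY\<^esub> y = a \<odot>\<^bsub>PY\<^esub> y \<oplus>\<^bsub>PY\<^esub> b \<odot>\<^bsub>PY\<^esub> y"
    if "a \<in> carrier S" "b \<in> carrier S" "y \<in> carrier PY" for a b y
  proof -
    have y: "y \<in> carrier Y" using that by (simp add: PY_simps)
    have "(\<Oplus>\<^bsub>Y\<^esub>i\<in>{..n}. act i ((a \<oplus>\<^bsub>S\<^esub> b) i) y) = (\<Oplus>\<^bsub>Y\<^esub>i\<in>{..n}. act i (a i) y \<oplus>\<^bsub>Y\<^esub> act i (b i) y)"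
      using y that(1,2) additive_map.add[OF act_additive[OF y]]
      by (intro Y.M.finsum_cong') (auto simp: S_carrier S_simps intro!: act_closed)
    then show ?thesis unfolding PY_simps using Y.M.finsum_addf[OF cl[OF that(1) y] cl[OF that(2) y]] by simp
  qed
  show "\<one>\<^bsub>S\<^esub> \<odot>\<^bsub>PY\<^esub> y = y" if "y \<in> carrier PY" for y
  proof -
    have y: "y \<in> carrier Y" using that by (simp add: PY_simps)
    have "(\<Oplus>\<^bsub>Y\<^esub>i\<in>{..n}. act i (\<one>\<^bsub>S\<^esub> i) y) = act 0 (\<one>\<^bsub>S\<^esub> 0) y"
      by (rule Y.M.finsum_single)
        (use y additive_map.zero[OF act_additive[OF y]] in \<open>auto simp: S_simps act_0 Y.smult_one\<close>)
    then show ?thesis using y by (simp add: PY_simps S_simps act_0 Y.smult_one)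
  qed
  show "(a \<otimes>\<^bsub>S\<^esub> b) \<odot>\<^bsub>PY\<^esub> y = a \<odot>\<^bsub>PY\<^esub> (b \<odot>\<^bsub>PY\<^esub> y)"
    if "a \<in> carrier S" "b \<in> carrier S" "y \<in> carrier PY" for a b y
  proof -
    have y: "y \<in> carrier Y" using that by (simp add: PY_simps)
    have ab: "a i \<in> carrier (T i)" "b i \<in> carrier (T i)" if "i \<le> n" for i
      using \<open>a \<in> carrier S\<close> \<open>b \<in> carrier S\<close> that by (auto simp: S_carrier)
    let ?f = "\<lambda>i q. act i (a i) (act q (b q) y)"
    have f: "?f i q \<in> carrier Y" if "i \<le> n" "q \<le> n" for i q
      using that ab y by (intro act_closed) auto
    have "(\<Oplus>\<^bsub>Y\<^esub>k\<in>{..n}. act k ((a \<otimes>\<^bsub>S\<^esub> b) k) y) = (\<Oplus>\<^bsub>Y\<^esub>k\<in>{..n}. \<Oplus>\<^bsub>Y\<^esub>i\<in>{..k}. ?f i (k - i))"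
    proof (rule Y.M.finsum_cong')
      fix k assume k: "k \<in> {..n}"
      have "act k ((a \<otimes>\<^bsub>S\<^esub> b) k) y = act k (\<Oplus>\<^bsub>T k\<^esub>i\<in>{..k}. tmul i (k - i) (a i) (b (k - i))) y"
        using k by (simp add: S_simps)
      also have "\<dots> = (\<Oplus>\<^bsub>Y\<^esub>i\<in>{..k}. act k (tmul i (k - i) (a i) (b (k - i))) y)"
        by (rule additive_map.finsum[OF act_additive[OF y]]) (use k ab in \<open>auto intro!: tmul_closed'\<close>)
      also have "\<dots> = (\<Oplus>\<^bsub>Y\<^esub>i\<in>{..k}. ?f i (k - i))"
      proof (rule Y.M.finsum_cong')
        fix i assume i: "i \<in> {..k}"
        show "act k (tmul i (k - i) (a i) (b (k - i))) y = ?f i (k - i)"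
          using act_tmul[of "a i" i "b (k - i)" "k - i" y] ab y i k by simp
      qed (use f k in auto)
      finally show "act k ((a \<otimes>\<^bsub>S\<^esub> b) k) y = (\<Oplus>\<^bsub>Y\<^esub>i\<in>{..k}. ?f i (k - i))" .
    qed (use f in \<open>auto intro!: Y.M.finsum_closed\<close>)
    also have "\<dots> = (\<Oplus>\<^bsub>Y\<^esub>i\<in>{..n}. \<Oplus>\<^bsub>Y\<^esub>q\<in>{..n - i}. ?f i q)"
      by (rule Y.M.finsum_triangle) (rule f, auto)
    also have "\<dots> = (\<Oplus>\<^bsub>Y\<^esub>i\<in>{..n}. act i (a i) (\<Oplus>\<^bsub>Y\<^esub>q\<in>{..n}. act q (b q) y))"
    proof (rule Y.M.finsum_cong')
      fix i assume i: "i \<in> {..n}"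
      \<comment> \<open>The product in the ring stops at total degree \<open>n\<close>, the iterated
        action does not; the additional terms have degree \<open>i + q > n\<close> and vanish by the
        nilpotency condition on \<open>g\<close>.\<close>
      have "(\<Oplus>\<^bsub>Y\<^esub>q\<in>{..n - i}. ?f i q) = (\<Oplus>\<^bsub>Y\<^esub>q\<in>{..n}. ?f i q)"
      proof (rule Y.M.add.finprod_mono_neutral_cong_left)
        fix q assume q: "q \<in> {..n} - {..n - i}"
        then show "?f i q = \<zero>\<^bsub>Y\<^esub>"
          using i ab y act_tmul[of "a i" i "b q" q y] act_vanishes[of "tmul i q (a i) (b q)" "i + q" y] tmul_closed
          by auto
      qed (use f i in auto)
      also have "\<dots> = act i (a i) (\<Oplus>\<^bsub>Y\<^esub>q\<in>{..n}. act q (b q) y)"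
        by (rule additive_map.finsum[OF act_additive_r, symmetric]) (use i ab cl[OF \<open>b \<in> carrier S\<close> y] in auto)
      finally show "(\<Oplus>\<^bsub>Y\<^esub>q\<in>{..n - i}. ?f i q) = act i (a i) (\<Oplus>\<^bsub>Y\<^esub>q\<in>{..n}. act q (b q) y)" .
    qed (use ab cl[OF \<open>b \<in> carrier S\<close> y] in \<open>auto intro!: act_closed Y.M.finsum_closed\<close>)
    finally show ?thesis by (simp add: PY_simps)
  qed
qed (auto simp: PY_simps Y.M.a_ac)

section \<open>The modules \<open>Z(Q)\<close> and the kernel of \<open>g\<close>\<close>

lemma Z_simps [simp]:
  "carrier (Z_module Q) = carrier Q" "\<zero>\<^bsub>Z_module Q\<^esub> = \<zero>\<^bsub>Q\<^esub>" "x \<oplus>\<^bsub>Z_module Q\<^esub> y = x \<oplus>\<^bsub>Q\<^esub> y"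
  "a \<odot>\<^bsub>Z_module Q\<^esub> x = the_scal (a 0) \<odot>\<^bsub>Q\<^esub> x"
  by (simp_all add: Z_module_def)

lemma S_0: "a \<in> carrier S \<Longrightarrow> \<exists>r\<in>carrier R. a 0 = Scal r"
proof -
  assume "a \<in> carrier S"
  then have "a 0 \<in> carrier (T 0)" by (simp add: S_carrier)
  then show ?thesis unfolding T_0_carrier by auto
qed

text \<open>Restriction of scalars along the ring homomorphism \<open>a \<mapsto> a 0\<close> onto
  \<open>R\<close>.\<close>

lemma Z_left_module:
  assumes "left_module R Q" shows "left_module S (Z_module Q)"
proof -
  interpret Q: left_module R Q by fact
  have s: "the_scal (a 0) \<in> carrier R" "Scal (the_scal (a 0)) = a 0" if "a \<in> carrier S" for a
    using S_0[OF that] by auto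
  have mult: "the_scal ((a \<otimes>\<^bsub>S\<^esub> b) 0) = the_scal (a 0) \<otimes> the_scal (b 0)" if a: "a \<in> carrier S" and b: "b \<in> carrier S" for a b
  proof -
    obtain r t where r: "r \<in> carrier R" "a 0 = Scal r" "t \<in> carrier R" "b 0 = Scal t"
      using S_0[OF a] S_0[OF b] by blast
    interpret T0: abelian_group "T 0" by (rule T_group)
    have "Scal (r \<otimes> t) \<in> carrier (T 0)" using r T_0_carrier by blast
    then show ?thesis using r by (simp add: S_simps tmul_0 T_0_smult)
  qed
  have add: "the_scal ((a \<oplus>\<^bsub>S\<^esub> b) 0) = the_scal (a 0) \<oplus> the_scal (b 0)" if "a \<in> carrier S" "b \<in> carrier S" for a b
    using S_0[OF that(1)] S_0[OF that(2)] by (auto simp: S_simps T_0_add)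
  have one: "the_scal (\<one>\<^bsub>S\<^esub> 0) = \<one>" by (simp add: S_simps)
  show ?thesis
    by (rule left_moduleI)
      (auto simp: S_ring s mult add one Q.smult_closed Q.smult_l_distr Q.smult_r_distr Q.smult_assoc
        Q.smult_one Q.M.a_ac intro!: bexI[of _ "\<ominus>\<^bsub>Q\<^esub> _"] Q.M.l_neg)
qed

text \<open>The homogeneous element with entry \<open>t\<close> in degree \<open>k\<close>. Degrees
  0 and 1 provide the test elements \<open>r\<close> and
  \<open>(0, m, 0, \<dots>, 0)\<close>.\<close>

definition component :: "nat \<Rightarrow> ('r, 'm) tensor \<Rightarrow> nat \<Rightarrow> ('r, 'm) tensor" where
  "component k t = (\<lambda>j\<in>{..n}. if j = k then t else \<zero>\<^bsub>T j\<^esub>)"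

lemma component_closed: "k \<le> n \<Longrightarrow> t \<in> carrier (T k) \<Longrightarrow> component k t \<in> carrier S"
  by (auto simp: S_carrier component_def T_zero_closed)

lemma component_act:
  assumes "k \<le> n" "t \<in> carrier (T k)" and y: "y \<in> carrier Y"
  shows "component k t \<odot>\<^bsub>PY\<^esub> y = act k t y"
proof -
  have "(\<Oplus>\<^bsub>Y\<^esub>i\<in>{..n}. act i (component k t i) y) = act k (component k t k) y"
    by (rule Y.M.finsum_single)
      (use assms additive_map.zero[OF act_additive[OF y]] in \<open>auto simp: component_def act_closed\<close>)
  then show ?thesis using assms(1) by (simp add: PY_simps component_def)
qed

abbreviation "ker \<equiv> kernel_module R M Y g"

lemma ker_carrier: "y \<in> carrier ker \<longleftrightarrow> y \<in> carrier Y \<and> (\<forall>m\<in>carrier M. g y m = \<zero>\<^bsub>Y\<^esub>)"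
proof -
  have "g y = (\<lambda>m\<in>carrier M. \<zero>\<^bsub>Y\<^esub>) \<longleftrightarrow> (\<forall>m\<in>carrier M. g y m = \<zero>\<^bsub>Y\<^esub>)" if "y \<in> carrier Y"
    using g_y_hom[OF that] by (auto simp: lmod_hom_def PiE_def extensional_def fun_eq_iff)
  then show ?thesis by (auto simp: kernel_module_def a_kernel_def kernel_def hom_module_def)
qed

text \<open>The kernel is stable under \<open>R\<close> because
  \<open>g (r y) m = g y (m r)\<close>: the right action on \<open>M\<close> only permutes the
  conditions.\<close>

lemma ker_module: "left_module R ker" and ker_inclusion: "linear_map R ker Y (\<lambda>x. x)"
proof -
  have *: "ker = Y\<lparr>carrier := carrier ker\<rparr>" by (simp add: kernel_module_def)
  have "left_module R (Y\<lparr>carrier := carrier ker\<rparr>) \<and> linear_map R (Y\<lparr>carrier := carrier ker\<rparr>) Y (\<lambda>x. x)"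
    by (intro conjI left_module_submodule[OF Y.left_module_axioms])
      (auto simp: ker_carrier g_zero g_add g_smult Y.smult_closed rsmult_closed)
  then show "left_module R ker" "linear_map R ker Y (\<lambda>x. x)" using * by simp_all
qed

lemma ker_simps: "\<zero>\<^bsub>ker\<^esub> = \<zero>\<^bsub>Y\<^esub>" "x \<oplus>\<^bsub>ker\<^esub> y = x \<oplus>\<^bsub>Y\<^esub> y" "r \<odot>\<^bsub>ker\<^esub> x = r \<odot>\<^bsub>Y\<^esub> x"
  by (simp_all add: kernel_module_def)

text \<open>The innermost factor of a tensor acts first and already sends an element of the kernel
  to zero.\<close>

lemma act_Suc_ker:
  assumes "y \<in> carrier ker" "a \<in> carrier (T (Suc i))" shows "act (Suc i) a y = \<zero>\<^bsub>Y\<^esub>"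
  using assms(2)
proof (induction i arbitrary: a)
  have y: "y \<in> carrier Y" using assms(1) ker_carrier by blast
  note z = additive_map.zero[OF act_additive[OF y]] and ad = additive_map.add[OF act_additive[OF y]]
  {
    case 0
    then show ?case
    proof (induction a rule: T_Suc_induct)
      case (cons m x)
      then obtain r where "r \<in> carrier R" "x = Scal r" unfolding T_0_carrier by blast
      then show ?case using cons y assms(1) by (simp add: act_cons act_0 g_smult rsmult_closed ker_carrier)
    qed (use z ad in auto)
  next
    case (Suc i)
    from Suc.prems show ?case
    proof (induction a rule: T_Suc_induct)
      case (cons m x)
      then show ?case using Suc.IH y by (simp add: act_cons g_zero)
    qed (use z ad in auto)
  }
qed

text \<open>The identification of the two Hom sets does not change the function, so cocycles of
  degree 0 over the trivial extension and homomorphisms over \<open>R\<close> can share one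
  \<open>\<psi>\<close>.\<close>

lemma linear_map_Z_iff:
  assumes Q: "left_module R Q"
  shows "linear_map S (Z_module Q) PY f \<longleftrightarrow> linear_map R Q ker f"
proof
  interpret Q: left_module R Q by fact
  assume "linear_map S (Z_module Q) PY f"
  then interpret f: linear_map S "Z_module Q" PY f .
  have cl: "f q \<in> carrier Y" if "q \<in> carrier Q" for q using f.closed[of q] that by (simp add: PY_simps)
  have sm: "f (r \<odot>\<^bsub>Q\<^esub> q) = r \<odot>\<^bsub>Y\<^esub> f q" if "r \<in> carrier R" "q \<in> carrier Q" for r q
  proof -
    have r: "Scal r \<in> carrier (T 0)" using that T_0_carrier by blast
    show ?thesis
      using f.smult[OF component_closed[OF _ r], of q] that cl component_act[OF _ r, of "f q"]
      by (simp add: act_0) (simp add: component_def)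
  qed
  have kr: "f q \<in> carrier ker" if q: "q \<in> carrier Q" for q
    unfolding ker_carrier
  proof (intro conjI ballI)
    \<comment> \<open>The test element \<open>(0, m, 0, \<dots>, 0)\<close> exists because
      \<open>n \<ge> 1\<close>; it acts as zero on \<open>Z(Q)\<close> and as \<open>g\<close> on
      \<open>Y\<close>.\<close>
    fix m assume m: "m \<in> carrier M"
    then have v: "Vec m \<in> carrier (T (Suc 0))" using T_1_carrier by blast
    have "g (f q) m = component (Suc 0) (Vec m) \<odot>\<^bsub>PY\<^esub> f q"
      using n v cl[OF q] by (simp add: component_act tensor_act.simps)
    also have "\<dots> = f (component (Suc 0) (Vec m) \<odot>\<^bsub>Z_module Q\<^esub> q)"
      by (rule f.smult[symmetric]) (use n v q component_closed in auto)
    also have "component (Suc 0) (Vec m) \<odot>\<^bsub>Z_module Q\<^esub> q = \<zero>\<^bsub>Q\<^esub>"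
      using q by (simp add: component_def T_0_zero Q.smult_l_null)
    also have "f \<zero>\<^bsub>Q\<^esub> = \<zero>\<^bsub>Y\<^esub>" using f.zero by (simp add: PY_simps)
    finally show "g (f q) m = \<zero>\<^bsub>Y\<^esub>" .
  qed (rule cl[OF q])
  show "linear_map R Q ker f"
    unfolding linear_map_iff using Q ker_module kr sm f.add by (auto simp: ker_simps PY_simps)
next
  interpret Q: left_module R Q by fact
  assume "linear_map R Q ker f"
  then interpret f: linear_map R Q ker f .
  have cl: "f q \<in> carrier Y" if "q \<in> carrier Q" for q using f.closed[OF that] ker_carrier by blast
  have "f (the_scal (a 0) \<odot>\<^bsub>Q\<^esub> q) = a \<odot>\<^bsub>PY\<^esub> f q" if a: "a \<in> carrier S" and q: "q \<in> carrier Q" for a q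
  proof -
    obtain r where r: "r \<in> carrier R" "a 0 = Scal r" using S_0[OF a] by blast
    \<comment> \<open>On the kernel only the summand of degree 0 survives, which is the action of
      \<open>R\<close>.\<close>
    have "(\<Oplus>\<^bsub>Y\<^esub>i\<in>{..n}. act i (a i) (f q)) = act 0 (a 0) (f q)"
    proof (rule Y.M.finsum_single)
      fix i assume i: "i \<in> {..n}" "i \<noteq> 0"
      then obtain j where j: "i = Suc j" by (cases i) auto
      then show "act i (a i) (f q) = \<zero>\<^bsub>Y\<^esub>"
        using act_Suc_ker[OF f.closed[OF q], of "a i" j] a i by (simp add: S_carrier)
    qed (use r cl[OF q] in \<open>auto simp: act_0 Y.smult_closed\<close>)
    then show ?thesis using r q f.smult[of r q] by (simp add: PY_simps act_0 ker_simps)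
  qed
  then show "linear_map S (Z_module Q) PY f"
    unfolding linear_map_iff using Z_left_module[OF Q] PY_module cl f.add
    by (simp add: ker_simps PY_simps)
qed

end

section \<open>Comparison of Ext over the two rings\<close>

lemma (in free_resolution) transfer_iso:
  assumes "linear_map S X X' \<phi>" "bij_betw \<phi> (carrier X) (carrier X')"
  shows "free_resolution S X' B d (\<lambda>b. \<phi> (e b))"
proof -
  interpret \<phi>: linear_map S X X' \<phi> by fact
  have L: "linear_extension S X' (\<lambda>b. \<phi> (e b)) f = \<phi> (linear_extension S X e f)" if "f \<in> carrier (F 0)" for f
    by (rule \<phi>.linear_extension[OF e_closed that, symmetric])
  have inj: "\<phi> x = \<zero>\<^bsub>X'\<^esub> \<longleftrightarrow> x = \<zero>\<^bsub>X\<^esub>" if "x \<in> carrier X" for x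
    using assms(2) that \<phi>.zero by (metis M.zero_closed bij_betw_def inj_onD)
  have "cycles S X' B d (\<lambda>b. \<phi> (e b)) k = Z k" for k
    using L inj linear_extension_closed[OF e_closed] by (cases k) (auto simp: cycles_def)
  moreover have "linear_extension S X' (\<lambda>b. \<phi> (e b)) ` carrier (F 0) = carrier X'"
  proof -
    have "linear_extension S X' (\<lambda>b. \<phi> (e b)) ` carrier (F 0) = \<phi> ` linear_extension S X e ` carrier (F 0)"
      unfolding image_image by (rule image_cong) (auto simp: L)
    then show ?thesis using assms(2) unfolding surj bij_betw_def by simp
  qed
  moreover have "(\<lambda>b. \<phi> (e b)) \<in> B 0 \<rightarrow> carrier X'"
    by (rule funcsetI) (rule \<phi>.closed[OF Pi_mem[OF e_closed]])
  ultimately show ?thesis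
    by (intro free_resolution.intro free_resolution_axioms.intro \<phi>.cod.left_module_axioms)
      (simp_all add: exact d_closed)
qed

text \<open>Acyclicity is given for the resolution in the definition of Ext; the horseshoe
  resolution is another one of the same \<open>X\<close>, and \<open>acyclic_for_transfer\<close>
  carries the property over.\<close>

lemma acyclic_horseshoe_exists:
  assumes "short_exact_sequence S A X C \<iota> \<pi>" "left_module S Y"
    and "acyclic_for S Y (syzygy_basis S X) (\<lambda>_. syzygy_boundary S)"
  obtains s \<theta> where "acyclic_horseshoe S A X C \<iota> \<pi> (syzygy_basis S A) (\<lambda>_. syzygy_boundary S) the_gen
    (syzygy_basis S C) (\<lambda>_. syzygy_boundary S) the_gen s \<theta> Y"
proof -
  interpret short_exact_sequence S A X C \<iota> \<pi> by fact
  obtain s \<theta> where h: "horseshoe S A X C \<iota> \<pi> (syzygy_basis S A) (\<lambda>_. syzygy_boundary S) the_gen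
    (syzygy_basis S C) (\<lambda>_. syzygy_boundary S) the_gen s \<theta>"
    by (rule horseshoe_exists[OF assms(1) inj.dom.syzygy_resolution proj.cod.syzygy_resolution])
  from acyclic_for_transfer[OF inj.cod.syzygy_resolution horseshoe.resolution[OF h] assms(2,3)]
  show thesis
    by (intro that[of s \<theta>] acyclic_horseshoe.intro h assms acyclic_horseshoe_axioms.intro)
qed

text \<open>In positive degrees the connecting relation matches classes on \<open>A\<close> with
  classes on \<open>C\<close> one degree higher. The arguments of \<open>connects\<close> appear
  swapped, since the isomorphism is stated from \<open>C\<close> to \<open>A\<close>.\<close>

lemma Ext_shift:
  assumes ses: "short_exact_sequence S A X C \<iota> \<pi>" and Y: "left_module S Y"
    and "acyclic_for S Y (syzygy_basis S X) (\<lambda>_. syzygy_boundary S)"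
  shows "Ext S (Suc (Suc k)) C Y \<cong> Ext S (Suc k) A Y"
proof -
  obtain s \<theta> where "acyclic_horseshoe S A X C \<iota> \<pi> (syzygy_basis S A) (\<lambda>_. syzygy_boundary S) the_gen
    (syzygy_basis S C) (\<lambda>_. syzygy_boundary S) the_gen s \<theta> Y"
    by (rule acyclic_horseshoe_exists[OF assms])
  then interpret acyclic_horseshoe S A X C \<iota> \<pi> "syzygy_basis S A" "\<lambda>_. syzygy_boundary S" the_gen
    "syzygy_basis S C" "\<lambda>_. syzygy_boundary S" the_gen s \<theta> Y .
  show ?thesis
  proof (rule Ext_iso_by_relation[where \<rho> = "\<lambda>c' c. connects (Suc k) c c'"])
    show "ext_data S C Y" "ext_data S A Y"
      by (intro ext_data.intro Y inj.dom.left_module_axioms proj.cod.left_module_axioms)+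
    show "\<exists>c. cocycle S Y (syzygy_basis S A) (\<lambda>_. syzygy_boundary S) (Suc k) c \<and> connects (Suc k) c c'"
      if "cocycle S Y (syzygy_basis S C) (\<lambda>_. syzygy_boundary S) (Suc (Suc k)) c'" for c'
      using connects_onto[OF that] by metis
    show "\<exists>c'. cocycle S Y (syzygy_basis S C) (\<lambda>_. syzygy_boundary S) (Suc (Suc k)) c' \<and> connects (Suc k) c c'"
      if "cocycle S Y (syzygy_basis S A) (\<lambda>_. syzygy_boundary S) (Suc k) c" for c
      using connects_total[OF that] by metis
  qed (use connects_diff connects_coboundary_iff in blast)+
qed

context pair_data
begin

lemma Z_linear_map:
  assumes "linear_map R X X' \<phi>" shows "linear_map S (Z_module X) (Z_module X') \<phi>"
proof -
  interpret \<phi>: linear_map R X X' \<phi> by fact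
  have "the_scal (a 0) \<in> carrier R" if "a \<in> carrier S" for a using S_0[OF that] by auto
  then show ?thesis
    unfolding linear_map_iff
    using Z_left_module[OF \<phi>.dom.left_module_axioms] Z_left_module[OF \<phi>.cod.left_module_axioms]
    by (simp add: \<phi>.closed \<phi>.add \<phi>.smult)
qed

lemma Z_short_exact_sequence:
  assumes "short_exact_sequence R A X C \<iota> \<pi>"
  shows "short_exact_sequence S (Z_module A) (Z_module X) (Z_module C) \<iota> \<pi>"
proof -
  interpret short_exact_sequence R A X C \<iota> \<pi> by fact
  show ?thesis
    by (intro short_exact_sequence.intro short_exact_sequence_axioms.intro Z_linear_map
        inj.linear_map_axioms proj.linear_map_axioms) (simp_all add: inj_on surj exact)
qed

lemma ext_data_Z: "left_module R Q \<Longrightarrow> ext_data S (Z_module Q) PY"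
  by (intro ext_data.intro Z_left_module PY_module)

abbreviation "PY_acyclic Q \<equiv> acyclic_for S PY (syzygy_basis S Q) (\<lambda>_. syzygy_boundary S)"

lemma acyclic_free:
  assumes "PY_acyclic (Z_module (regular_module R))"
  shows "PY_acyclic (Z_module (free_module R I))"
proof -
  interpret N: left_module S "Z_module (regular_module R)"
    by (rule Z_left_module[OF R.left_module_regular])
  interpret direct_sum_resolution S "Z_module (regular_module R)" "syzygy_basis S (Z_module (regular_module R))"
    "\<lambda>_. syzygy_boundary S" the_gen I
    by (intro direct_sum_resolution.intro N.syzygy_resolution)
  \<comment> \<open>Equality of records and not just an isomorphism: scalars act on both sides
    through \<open>a 0\<close> in every coordinate.\<close>
  have "(Z_module (free_module R I) :: (nat \<Rightarrow> ('r, 'm) tensor, _) module) = direct_sum I (Z_module (regular_module R))"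
    by (simp add: Z_module_def free_module_def direct_sum_def regular_module_def)
  then have "free_resolution S (Z_module (free_module R I)) (\<lambda>k. I \<times> syzygy_basis S (Z_module (regular_module R)) k) d e"
    using resolution by simp
  from acyclic_for_transfer[OF this left_module.syzygy_resolution[OF Z_left_module[OF R.left_module_free]]
      PY_module acyclic[OF PY_module assms]]
  show ?thesis .
qed

end

locale pair_data_module = pair_data R M n Y g + Q: left_module R Q
  for R :: "('r, 'e) ring_scheme" (structure) and M :: "('r, 'm, 'f) bimodule_scheme" (structure) and n
    and Y :: "('r, 'y) module" and g :: "'y \<Rightarrow> 'm \<Rightarrow> 'y" and Q :: "('r, 'q, 'h) module_scheme" (structure)
begin

sublocale E: ext_data R Q ker
  by (intro ext_data.intro Q.left_module_axioms ker_module)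

abbreviation "BQ \<equiv> syzygy_basis R Q"
text \<open>The kernel of the map out of degree \<open>k\<close>; thus \<open>syz 0\<close>, the
  kernel of the augmentation, is the first syzygy of \<open>Q\<close>.\<close>

abbreviation "syz k \<equiv> (E.res.F k)\<lparr>carrier := E.res.Z k\<rparr>"

lemma augmentation_linear: "linear_map R (E.res.F 0) Q (linear_extension R Q the_gen)"
  by (rule E.res.e_linear)

lemma syz_submodule: "left_module R (syz k)" "linear_map R (syz k) (E.res.F k) (\<lambda>x. x)"
proof -
  interpret Fk: left_module R "E.res.F k" by (rule E.res.F_module)
  interpret D: linear_map R "E.res.F (Suc k)" "E.res.F k" "E.res.D k" by (rule E.res.D_linear)
  have 1: "E.res.Z k \<subseteq> carrier (E.res.F k)" using E.res.cycle_closed by blast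
  \<comment> \<open>Closure is read off from the description of cycles as images of the
    differential, which avoids separating the augmentation from the higher degrees.\<close>
  have 2: "\<zero>\<^bsub>E.res.F k\<^esub> \<in> E.res.Z k"
    using E.res.D_cycle[OF D.dom.M.zero_closed] D.zero by simp
  have 3: "x \<oplus>\<^bsub>E.res.F k\<^esub> y \<in> E.res.Z k" if xy: "x \<in> E.res.Z k" "y \<in> E.res.Z k" for x y
  proof -
    obtain f f' where f: "f \<in> carrier (E.res.F (Suc k))" "E.res.D k f = x"
      "f' \<in> carrier (E.res.F (Suc k))" "E.res.D k f' = y"
      using E.res.cycle_boundary xy by metis
    show ?thesis using E.res.D_cycle[OF D.dom.M.add.m_closed[OF f(1,3)]] D.add[OF f(1,3)] f(2,4) by simp
  qed
  have 4: "r \<odot>\<^bsub>E.res.F k\<^esub> x \<in> E.res.Z k" if r: "r \<in> carrier R" and x: "x \<in> E.res.Z k" for r x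
  proof -
    obtain f where f: "f \<in> carrier (E.res.F (Suc k))" "E.res.D k f = x"
      using E.res.cycle_boundary x by metis
    show ?thesis using E.res.D_cycle[OF D.dom.smult_closed[OF r f(1)]] D.smult[OF r f(1)] f(2) by simp
  qed
  show "left_module R (syz k)" "linear_map R (syz k) (E.res.F k) (\<lambda>x. x)"
    by (rule left_module_submodule[OF Fk.left_module_axioms 1 2 3 4]; assumption)+
qed

lemma D_syz_linear: "linear_map R (E.res.F (Suc k)) (syz k) (E.res.D k)"
  using E.res.D_linear[of k] syz_submodule(1)[of k] E.res.D_cycle[of _ k]
  unfolding linear_map_iff by simp

lemma D_syz_surj: "E.res.D k ` carrier (E.res.F (Suc k)) = carrier (syz k)"
  using E.res.exact by simp

lemma syz_sequence_0:
  "short_exact_sequence R (syz 0) (E.res.F 0) Q (\<lambda>x. x) (linear_extension R Q the_gen)"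
  by (intro short_exact_sequence.intro short_exact_sequence_axioms.intro syz_submodule augmentation_linear)
    (use E.res.surj E.res.cycle_0 in auto)

lemma syz_sequence_Suc:
  "short_exact_sequence R (syz (Suc k)) (E.res.F (Suc k)) (syz k) (\<lambda>x. x) (E.res.D k)"
  by (intro short_exact_sequence.intro short_exact_sequence_axioms.intro syz_submodule D_syz_linear)
    (use D_syz_surj E.res.cycle_Suc in auto)

lemma extension_on_syz:
  assumes \<psi>: "linear_map R (syz k) ker \<psi>" and f: "f \<in> carrier (E.res.F (Suc k))"
  shows "linear_extension R ker (\<lambda>b. \<psi> (syzygy_boundary R b)) f = \<psi> (E.res.D k f)"
proof -
  interpret \<psi>: linear_map R "syz k" ker \<psi> by fact
  have "\<psi> (E.res.D k f) = linear_extension R ker (\<lambda>b. \<psi> (E.res.D k (basis_vector R b))) f"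
    by (rule linear_map_on_free[OF linear_map_comp[OF D_syz_linear \<psi>] f])
  also have "\<dots> = linear_extension R ker (\<lambda>b. \<psi> (syzygy_boundary R b)) f"
  proof (rule E.Y.linear_extension_cong[OF f])
    show "(\<lambda>b. \<psi> (E.res.D k (basis_vector R b))) \<in> BQ (Suc k) \<rightarrow> carrier ker"
      by (rule funcsetI, rule \<psi>.closed) (simp add: E.res.D_cycle R.basis_vector_closed)
  qed (simp add: E.res.D_basis_vector)
  finally show ?thesis by simp
qed

text \<open>
  Both Ext groups are \<open>Hom(syz k, ker g)\<close> modulo the homomorphisms that extend to the free module
  \<open>F k\<close>; a cocycle on either side is related to the homomorphism \<open>\<psi>\<close> that induces it.
\<close>

lemma Ext_1_iso:
  assumes ses: "short_exact_sequence R (syz k) (E.res.F k) C (\<lambda>x. x) \<pi>"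
    and acyclic: "PY_acyclic (Z_module (regular_module R))"
  shows "Ext S (Suc 0) (Z_module C) PY \<cong> Ext R (Suc k) Q ker"
proof -
  interpret C: short_exact_sequence R "syz k" "E.res.F k" C "\<lambda>x. x" \<pi> by fact
  let ?dS = "\<lambda>_::nat. syzygy_boundary S" and ?dR = "\<lambda>_::nat. syzygy_boundary R"
  obtain s \<theta> where "acyclic_horseshoe S (Z_module (syz k)) (Z_module (E.res.F k)) (Z_module C) (\<lambda>x. x) \<pi>
    (syzygy_basis S (Z_module (syz k))) ?dS the_gen (syzygy_basis S (Z_module C)) ?dS the_gen s \<theta> PY"
    by (rule acyclic_horseshoe_exists[OF Z_short_exact_sequence[OF ses] PY_module acyclic_free[OF acyclic]])
  then interpret H: acyclic_horseshoe S "Z_module (syz k)" "Z_module (E.res.F k)" "Z_module C" "\<lambda>x. x" \<pi>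
    "syzygy_basis S (Z_module (syz k))" ?dS the_gen "syzygy_basis S (Z_module C)" ?dS the_gen s \<theta> PY .
  note Z_iff = linear_map_Z_iff[OF syz_submodule(1)[of k]]
  \<comment> \<open>The cochain over \<open>R\<close> is \<open>\<psi>\<close> applied to the
    differential, the one over the trivial extension is connected with \<open>\<psi>\<close>; the
    same function \<open>\<psi>\<close> is linear in both senses by
    \<open>linear_map_Z_iff\<close>.\<close>
  let ?\<rho> = "\<lambda>c' c. \<exists>\<psi>. linear_map S (Z_module (syz k)) PY \<psi> \<and> H.connects 0 (\<lambda>b. \<psi> (the_gen b)) c' \<and>
    (\<forall>b\<in>BQ (Suc k). c b = \<psi> (syzygy_boundary R b))"
  have boundary: "syzygy_boundary R b \<in> carrier (syz k)" if "b \<in> BQ (Suc k)" for b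
    using E.res.d_cycle[OF that] by simp
  show ?thesis
  proof (rule Ext_iso_by_relation[where \<rho> = ?\<rho>])
    show "ext_data S (Z_module C) PY" by (rule ext_data_Z) (rule C.proj.cod.left_module_axioms)
    show "ext_data R Q ker" by (rule E.ext_data_axioms)
  next
    fix c' c a' a x' x
    assume "?\<rho> c' c" "?\<rho> a' a"
      and x': "\<And>b. b \<in> syzygy_basis S (Z_module C) (Suc 0) \<Longrightarrow> x' b = c' b \<ominus>\<^bsub>PY\<^esub> a' b"
      and x: "\<And>b. b \<in> BQ (Suc k) \<Longrightarrow> x b = c b \<ominus>\<^bsub>ker\<^esub> a b"
    then obtain \<psi> \<psi>' where \<psi>: "linear_map S (Z_module (syz k)) PY \<psi>" "H.connects 0 (\<lambda>b. \<psi> (the_gen b)) c'"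
        "\<And>b. b \<in> BQ (Suc k) \<Longrightarrow> c b = \<psi> (syzygy_boundary R b)"
      and \<psi>': "linear_map S (Z_module (syz k)) PY \<psi>'" "H.connects 0 (\<lambda>b. \<psi>' (the_gen b)) a'"
        "\<And>b. b \<in> BQ (Suc k) \<Longrightarrow> a b = \<psi>' (syzygy_boundary R b)"
      by blast
    interpret \<psi>: linear_map R "syz k" ker \<psi> using \<psi>(1) Z_iff by simp
    interpret \<psi>': linear_map R "syz k" ker \<psi>' using \<psi>'(1) Z_iff by simp
    interpret ker_Y: linear_map R ker Y "\<lambda>x. x" by (rule ker_inclusion)
    let ?\<chi> = "\<lambda>x. \<psi> x \<ominus>\<^bsub>PY\<^esub> \<psi>' x"
    have 1: "linear_map S (Z_module (syz k)) PY ?\<chi>"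
      unfolding a_minus_def by (intro H.Y.linear_map_add H.Y.linear_map_minus \<psi>(1) \<psi>'(1))
    have 2: "H.connects 0 (\<lambda>b. ?\<chi> (the_gen b)) x'"
      by (rule H.connects_diff[OF \<psi>(2) \<psi>'(2)]) (simp_all add: x')
    \<comment> \<open>Negation is derived from the carrier of each record, so the negatives formed
      in the kernel, in \<open>Y\<close> and in \<open>[Y, g]\<close> have to be identified.\<close>
    have inv: "\<ominus>\<^bsub>ker\<^esub> y = \<ominus>\<^bsub>PY\<^esub> y" if y: "y \<in> carrier ker" for y
    proof -
      have yY: "y \<in> carrier Y" using y ker_carrier by blast
      have "\<ominus>\<^bsub>ker\<^esub> y = \<ominus>\<^bsub>Y\<^esub> y" using ker_Y.minus[OF y] by simp
      also have "\<dots> = \<ominus>\<^bsub>PY\<^esub> y"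
        by (rule H.Y.M.minus_equality[symmetric]) (use yY Y.M.l_neg in \<open>simp_all add: PY_simps\<close>)
      finally show ?thesis .
    qed
    have 3: "x b = ?\<chi> (syzygy_boundary R b)" if b: "b \<in> BQ (Suc k)" for b
      unfolding x[OF b] \<psi>(3)[OF b] \<psi>'(3)[OF b] a_minus_def inv[OF \<psi>'.closed[OF boundary[OF b]]]
      by (simp add: ker_simps PY_simps)
    show "?\<rho> x' x" using 1 2 3 by blast
  next
    fix c' assume "cocycle S PY (syzygy_basis S (Z_module C)) ?dS (Suc 0) c'"
    then obtain \<psi> where \<psi>: "linear_map S (Z_module (syz k)) PY \<psi>" "H.connects 0 (\<lambda>b. \<psi> (the_gen b)) c'"
      by (rule H.connects_0_onto)
    have \<psi>R: "linear_map R (syz k) ker \<psi>" using \<psi>(1) Z_iff by simp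
    interpret \<psi>: linear_map R "syz k" ker \<psi> by (rule \<psi>R)
    have "cocycle R ker BQ ?dR (Suc k) (\<lambda>b. \<psi> (syzygy_boundary R b))"
      unfolding cocycle_def
    proof (intro conjI ballI)
      show "(\<lambda>b. \<psi> (syzygy_boundary R b)) \<in> BQ (Suc k) \<rightarrow> carrier ker"
        by (rule funcsetI) (rule \<psi>.closed[OF boundary])
      fix b assume b: "b \<in> BQ (Suc (Suc k))"
      show "linear_extension R ker (\<lambda>b. \<psi> (syzygy_boundary R b)) (syzygy_boundary R b) = \<zero>\<^bsub>ker\<^esub>"
        unfolding extension_on_syz[OF \<psi>R E.res.d_in_F[OF b]] E.res.D_d[OF b] using \<psi>.zero by simp
    qed
    then show "\<exists>c. cocycle R ker BQ ?dR (Suc k) c \<and> ?\<rho> c' c" using \<psi> by blast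
  next
    fix c assume c: "cocycle R ker BQ ?dR (Suc k) c"
    then have cc: "c \<in> BQ (Suc k) \<rightarrow> carrier ker" by (simp add: cocycle_def)
    \<comment> \<open>By exactness an element killed by the differential is a boundary, where the
      cocycle \<open>c\<close> vanishes; hence \<open>c\<close> descends to the image, which is
      \<open>syz k\<close>.\<close>
    have ker0: "linear_extension R ker c f = \<zero>\<^bsub>ker\<^esub>"
      if f: "f \<in> carrier (E.res.F (Suc k))" "E.res.D k f = \<zero>\<^bsub>syz k\<^esub>" for f
    proof -
      have "f \<in> E.res.Z (Suc k)" using f by (simp add: E.res.cycle_Suc)
      then obtain f' where f': "f' \<in> carrier (E.res.F (Suc (Suc k)))" "E.res.D (Suc k) f' = f"
        using E.res.cycle_boundary by blast
      show ?thesis using cocycle_boundary_zero[OF ker_module c E.res.d_closed f'(1)] f'(2) by simp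
    qed
    obtain \<psi> where \<psi>: "linear_map R (syz k) ker \<psi>"
      "\<And>f. f \<in> carrier (E.res.F (Suc k)) \<Longrightarrow> \<psi> (E.res.D k f) = linear_extension R ker c f"
      by (rule linear_map_factor[OF D_syz_linear D_syz_surj E.Y.linear_map_extension[OF cc] ker0]) auto
    have \<psi>S: "linear_map S (Z_module (syz k)) PY \<psi>" using \<psi>(1) Z_iff by simp
    have "c b = \<psi> (syzygy_boundary R b)" if b: "b \<in> BQ (Suc k)" for b
      using \<psi>(2)[OF R.basis_vector_closed[OF b]] E.res.D_basis_vector[OF b]
        E.Y.linear_extension_basis_vector[where h = c, OF Pi_mem[OF cc b]] by simp
    then show "\<exists>c'. cocycle S PY (syzygy_basis S (Z_module C)) ?dS (Suc 0) c' \<and> ?\<rho> c' c"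
      using H.connects_total[OF H.linear_map_cocycle_0[OF \<psi>S]] \<psi>S by blast
  next
    fix c' c assume "?\<rho> c' c"
    then obtain \<psi> where \<psi>: "linear_map S (Z_module (syz k)) PY \<psi>" "H.connects 0 (\<lambda>b. \<psi> (the_gen b)) c'"
      "\<And>b. b \<in> BQ (Suc k) \<Longrightarrow> c b = \<psi> (syzygy_boundary R b)" by blast
    have \<psi>R: "linear_map R (syz k) ker \<psi>" using \<psi>(1) Z_iff by simp
    interpret \<psi>: linear_map R "syz k" ker \<psi> by (rule \<psi>R)
    \<comment> \<open>Both conditions say that \<open>\<psi>\<close> extends to the free module of
      degree \<open>k\<close>: over the trivial extension by exactness at \<open>Hom\<close>, over
      \<open>R\<close> because a bounding cochain \<open>h\<close> is such an extension.\<close>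
    have "coboundary S PY (syzygy_basis S (Z_module C)) ?dS 0 c' \<longleftrightarrow>
        (\<exists>\<Psi>. linear_map S (Z_module (E.res.F k)) PY \<Psi> \<and> (\<forall>a\<in>carrier (syz k). \<Psi> a = \<psi> a))"
      using H.connects_0_coboundary_iff[OF \<psi>(1,2)] by simp
    also have "\<dots> \<longleftrightarrow> (\<exists>\<Psi>. linear_map R (E.res.F k) ker \<Psi> \<and> (\<forall>a\<in>carrier (syz k). \<Psi> a = \<psi> a))"
      by (simp add: linear_map_Z_iff[OF E.res.F_module])
    also have "\<dots> \<longleftrightarrow> coboundary R ker BQ ?dR k c"
    proof
      assume "\<exists>\<Psi>. linear_map R (E.res.F k) ker \<Psi> \<and> (\<forall>a\<in>carrier (syz k). \<Psi> a = \<psi> a)"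
      then obtain \<Psi> where \<Psi>: "linear_map R (E.res.F k) ker \<Psi>" "\<And>a. a \<in> carrier (syz k) \<Longrightarrow> \<Psi> a = \<psi> a" by blast
      interpret \<Psi>: linear_map R "E.res.F k" ker \<Psi> by fact
      have "c b = linear_extension R ker (\<lambda>b. \<Psi> (basis_vector R b)) (syzygy_boundary R b)" if b: "b \<in> BQ (Suc k)" for b
        using linear_map_on_free[OF \<Psi>(1) E.res.d_in_F[OF b]] \<psi>(3)[OF b] \<Psi>(2)[OF boundary[OF b]] by simp
      moreover have "(\<lambda>b. \<Psi> (basis_vector R b)) \<in> BQ k \<rightarrow> carrier ker"
        by (rule funcsetI) (rule \<Psi>.closed[OF R.basis_vector_closed])
      ultimately show "coboundary R ker BQ ?dR k c" unfolding coboundary_def by blast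
    next
      assume "coboundary R ker BQ ?dR k c"
      then obtain h where h: "h \<in> BQ k \<rightarrow> carrier ker"
        "\<And>b. b \<in> BQ (Suc k) \<Longrightarrow> c b = linear_extension R ker h (syzygy_boundary R b)"
        unfolding coboundary_def by blast
      have "linear_extension R ker h a = \<psi> a" if a: "a \<in> carrier (syz k)" for a
      proof -
        obtain f where f: "f \<in> carrier (E.res.F (Suc k))" "a = E.res.D k f"
          using a unfolding D_syz_surj[symmetric] by blast
        have "linear_extension R ker h a = linear_extension R ker (\<lambda>b. linear_extension R ker h (syzygy_boundary R b)) f"
          unfolding f(2) by (rule E.Y.linear_extension_compose[OF h(1) E.res.d_closed f(1)])
        also have "\<dots> = linear_extension R ker (\<lambda>b. \<psi> (syzygy_boundary R b)) f"
        proof (rule E.Y.linear_extension_cong[OF f(1)])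
          show "(\<lambda>b. linear_extension R ker h (syzygy_boundary R b)) \<in> BQ (Suc k) \<rightarrow> carrier ker"
            by (rule funcsetI) (rule E.Y.linear_extension_closed[OF h(1) E.res.d_in_F])
        qed (use h(2) \<psi>(3) in simp)
        also have "\<dots> = \<psi> a" unfolding f(2) by (rule extension_on_syz[OF \<psi>R f(1)])
        finally show ?thesis .
      qed
      then show "\<exists>\<Psi>. linear_map R (E.res.F k) ker \<Psi> \<and> (\<forall>a\<in>carrier (syz k). \<Psi> a = \<psi> a)"
        using E.Y.linear_map_extension[OF h(1)] by blast
    qed
    finally show "coboundary S PY (syzygy_basis S (Z_module C)) ?dS 0 c' \<longleftrightarrow> coboundary R ker BQ ?dR k c" .
  qed
qed

text \<open>Each step of the induction trades one degree over the trivial extension for one further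
  syzygy of \<open>Q\<close>, while the degree \<open>k + j + 2\<close> over \<open>R\<close> stays
  fixed.\<close>

lemma Ext_syz_iso:
  assumes "PY_acyclic (Z_module (regular_module R))"
  shows "Ext S (Suc j) (Z_module (syz k)) PY \<cong> Ext R (Suc (Suc (k + j))) Q ker"
proof (induction j arbitrary: k)
  case 0
  show ?case using Ext_1_iso[OF syz_sequence_Suc assms] by simp
next
  case (Suc j)
  have "Ext S (Suc (Suc j)) (Z_module (syz k)) PY \<cong> Ext S (Suc j) (Z_module (syz (Suc k))) PY"
    by (rule Ext_shift[OF Z_short_exact_sequence[OF syz_sequence_Suc] PY_module acyclic_free[OF assms]])
  also have "\<dots> \<cong> Ext R (Suc (Suc (Suc k + j))) Q ker" by (rule Suc.IH)
  finally show ?case by simp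
qed

text \<open>Degree one comes directly from the sequence that ends in \<open>Q\<close>; in higher
  degrees one shift leads to \<open>syz 0\<close>.\<close>

lemma Ext_iso:
  assumes "PY_acyclic (Z_module (regular_module R))"
  shows "Ext S (Suc i) (Z_module Q) PY \<cong> Ext R (Suc i) Q ker"
proof (cases i)
  case 0
  show ?thesis unfolding 0 by (rule Ext_1_iso[OF syz_sequence_0 assms])
next
  case (Suc j)
  have "Ext S (Suc (Suc j)) (Z_module Q) PY \<cong> Ext S (Suc j) (Z_module (syz 0)) PY"
    by (rule Ext_shift[OF Z_short_exact_sequence[OF syz_sequence_0] PY_module acyclic_free[OF assms]])
  also have "\<dots> \<cong> Ext R (Suc (Suc j)) Q ker" using Ext_syz_iso[OF assms, of j 0] by simp
  finally show ?thesis unfolding Suc .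
qed

end

text \<open>The regular module has a free resolution with one basis element in degree 0 and empty
  bases above, so a cochain of positive degree has nothing to satisfy. \<open>X\<close> is any
  isomorphic copy, because the module to which this is applied lives on a larger type.\<close>

lemma (in ring) regular_acyclic:
  assumes "left_module R Y" "linear_map R (regular_module R) X \<phi>" "bij_betw \<phi> (carrier R) (carrier X)"
  shows "acyclic_for R Y (syzygy_basis R X) (\<lambda>_. syzygy_boundary R)"
proof -
  interpret Y: left_module R Y by fact
  interpret reg: left_module R "regular_module R" by (rule left_module_regular)
  interpret X: left_module R X using assms(2) by (simp add: linear_map_def)
  let ?B = "\<lambda>k::nat. if k = 0 then {()} else {}" and ?d = "\<lambda>(k::nat) (_::unit) _. \<zero>" and ?e = "\<lambda>_::unit. \<one>"
  have L: "linear_extension R (regular_module R) ?e f = f ()" if f: "f \<in> carrier (free_module R (?B 0))" for f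
  proof -
    have fc: "f () \<in> carrier R" using f by (simp add: free_module_carrier)
    have "linear_extension R (regular_module R) ?e f =
        (\<Oplus>\<^bsub>regular_module R\<^esub>b\<in>{()}. f b \<odot>\<^bsub>regular_module R\<^esub> ?e b)"
      by (rule reg.linear_extension_eq[OF f]) auto
    then show ?thesis using fc by simp
  qed
  have "free_resolution R (regular_module R) ?B ?d ?e"
  proof (rule free_resolutionI)
    show "left_module R (regular_module R)" ..
    show "\<exists>f\<in>carrier (free_module R (?B 0)). linear_extension R (regular_module R) ?e f = x"
      if "x \<in> carrier (regular_module R)" for x
    proof -
      have "(\<lambda>_. x) \<in> carrier (free_module R (?B 0))" using that by (simp add: free_module_carrier)
      then show ?thesis using L by blast
    qed
    fix k f assume f: "f \<in> cycles R (regular_module R) ?B ?d ?e k"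
    have f0: "f = (\<lambda>_. \<zero>)"
    proof (cases k)
      case 0
      then show ?thesis using f L[of f] by (auto simp: cycles_def)
    next
      case (Suc j)
      then show ?thesis using f by (auto simp: cycles_def free_module_carrier)
    qed
    have z: "(\<lambda>_. \<zero>) \<in> carrier (free_module R (?B (Suc k)))" by (simp add: free_module_carrier)
    have "linear_extension R (free_module R (?B k)) (?d k) (\<lambda>_. \<zero>) = \<zero>\<^bsub>free_module R (?B k)\<^esub>"
      by (rule left_module.linear_extension_const_zero[OF left_module_free z]) simp
    then show "\<exists>f'\<in>carrier (free_module R (?B (Suc k))). linear_extension R (free_module R (?B k)) (?d k) f' = f"
      using z f0 by (intro bexI[of _ "\<lambda>_. \<zero>"]) simp_all
  qed auto
  then have "free_resolution R X ?B ?d (\<lambda>b. \<phi> (?e b))"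
    by (rule free_resolution.transfer_iso) (use assms in simp_all)
  moreover have "acyclic_for R Y ?B ?d"
    unfolding acyclic_for_def coboundary_def by (auto intro!: bexI[of _ "\<lambda>_. \<zero>\<^bsub>Y\<^esub>"])
  ultimately show ?thesis
    using acyclic_for_transfer[OF _ X.syzygy_resolution assms(1)] by blast
qed

text \<open>A bound variable has one fixed element type, so \<open>Q\<close> ranges over the modules
  on \<open>'r + 'q\<close> with \<open>'q\<close> arbitrary; the summand \<open>'r\<close> makes
  room for a copy of the regular module, which the converse direction needs.\<close>

theorem theorem4p8:
  fixes R :: "'r ring" and M :: "('r, 'm) bimodule" and n :: nat
    and Y :: "('r, 'y) module" and g :: "'y \<Rightarrow> 'm \<Rightarrow> 'y"
  assumes "ring R" and "\<one>\<^bsub>R\<^esub> \<noteq> \<zero>\<^bsub>R\<^esub>" and "bimodule R M" and "n \<ge> 1"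
    and "module_pair n R M Y g"
  shows
    "(\<forall>i\<ge>1. trivial_group
        (Ext (trivial_extension n R M) i (Z_module (regular_module R)) (pair_module n Y g)))
     \<longleftrightarrow>
     (\<forall>Q :: ('r, 'r + 'q) module. left_module R Q \<longrightarrow>
        (\<forall>i\<ge>1. Ext (trivial_extension n R M) i (Z_module Q) (pair_module n Y g)
                 \<cong> Ext R i Q (kernel_module R M Y g)))"
proof -
  interpret P: pair_data R M n Y g
    by (intro pair_data.intro triv_ext.intro pair_data_axioms.intro assms)
  interpret reg: ext_data P.S "Z_module (regular_module R)" P.PY
    by (rule P.ext_data_Z[OF P.R.left_module_regular])
  show ?thesis
  proof
    assume "\<forall>i\<ge>1. trivial_group (Ext P.S i (Z_module (regular_module R)) P.PY)"
    then have acyclic: "P.PY_acyclic (Z_module (regular_module R))" using reg.Ext_all_trivial_iff by blast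
    show "\<forall>Q :: ('r, 'r + 'q) module. left_module R Q \<longrightarrow> (\<forall>i\<ge>1. Ext P.S i (Z_module Q) P.PY \<cong> Ext R i Q P.ker)"
    proof (intro allI impI)
      fix Q :: "('r, 'r + 'q) module" and i :: nat
      assume "left_module R Q" and i: "i \<ge> 1"
      then interpret pair_data_module R M n Y g Q
        by (intro pair_data_module.intro P.pair_data_axioms)
      show "Ext P.S i (Z_module Q) P.PY \<cong> Ext R i Q P.ker"
        using Ext_iso[OF acyclic, of "i - 1"] i by simp
    qed
  next
    assume *: "\<forall>Q :: ('r, 'r + 'q) module. left_module R Q \<longrightarrow> (\<forall>i\<ge>1. Ext P.S i (Z_module Q) P.PY \<cong> Ext R i Q P.ker)"
    \<comment> \<open>The copy of the regular module on the type over which \<open>Q\<close>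
      ranges.\<close>
    let ?Q = "transport Inl (regular_module R) :: ('r, 'r + 'q) module"
    let ?h = "inv_into (carrier R) (Inl :: 'r \<Rightarrow> 'r + 'q)"
    have inj: "inj_on (Inl :: 'r \<Rightarrow> 'r + 'q) (carrier (regular_module R))" by (simp add: inj_on_def)
    note tr = left_module.transport[OF P.R.left_module_regular inj]
    have bij: "bij_betw Inl (carrier R) (carrier ?Q)"
      by (simp add: bij_betw_def inj_on_def transport_simps)
    interpret ZQ: ext_data P.S "Z_module ?Q" P.PY by (rule P.ext_data_Z[OF tr(1)])
    interpret RQ: ext_data R ?Q P.ker by (intro ext_data.intro tr(1) P.ker_module)
    have RQ: "\<forall>i\<ge>1. trivial_group (Ext R i ?Q P.ker)"
      unfolding RQ.Ext_all_trivial_iff by (rule P.R.regular_acyclic[OF P.ker_module tr(2) bij])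
    have "trivial_group (Ext P.S i (Z_module ?Q) P.PY)" if i: "i \<ge> 1" for i
    proof -
      obtain j where j: "i = Suc j" using i by (cases i) auto
      have "Ext P.S i (Z_module ?Q) P.PY \<cong> Ext R i ?Q P.ker" using * tr(1) i by blast
      then show ?thesis
        using isomorphic_group_triviality[OF _ ZQ.Ext_group[of j] RQ.Ext_group[of j]] RQ i unfolding j by blast
    qed
    then have acyclic: "P.PY_acyclic (Z_module ?Q)" using ZQ.Ext_all_trivial_iff by blast
    \<comment> \<open>Back from the copy to \<open>R\<close>: only the augmentation is composed with
      the isomorphism, bases and differential stay, so acyclicity stays as well.\<close>
    have "linear_map P.S (Z_module ?Q) (Z_module (regular_module R)) ?h"
      using P.Z_linear_map[OF tr(3)] by simp
    moreover have "bij_betw ?h (carrier (Z_module ?Q)) (carrier (Z_module (regular_module R)))"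
      using bij_betw_inv_into[OF bij] by simp
    ultimately have "free_resolution P.S (Z_module (regular_module R)) (syzygy_basis P.S (Z_module ?Q))
        (\<lambda>_. syzygy_boundary P.S) (\<lambda>b. ?h (the_gen b))"
      by (rule ZQ.res.transfer_iso)
    from acyclic_for_transfer[OF this reg.X.syzygy_resolution P.PY_module acyclic]
    show "\<forall>i\<ge>1. trivial_group (Ext P.S i (Z_module (regular_module R)) P.PY)"
      unfolding reg.Ext_all_trivial_iff .
  qed
qed

end
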